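(* Let $G$ be a finite group. Then $G$ has exactly $11$ cyclic subgroups if and only if $G$ is isomorphic to one of the following groups: $\mathbb{Z}_{p^{10}}$ for some prime $p$; $\mathbb{Z}_{27}\times\mathbb{Z}_3$; $\mathbb{Z}_{27}\rtimes\mathbb{Z}_3$; $Dic_7$; $\mathbb{Z}_7\rtimes\mathbb{Z}_9$; $\mathbb{Z}_3\times S_3$; $\mathbb{Z}_5\rtimes\mathbb{Z}_8$; $\mathbb{Z}_3\rtimes\mathbb{Z}_{16}$.
   Context: $\mathbb{Z}_n$ denotes the cyclic group of order $n$, and $S_3$ the symmetric group of degree $3$. $Dic_n$ denotes the dicyclic group of order $4n$, $\langle x,y \mid x^{2n}=1,\ y^2=x^n,\ yxy^{-1}=x^{-1}\rangle$; so $Dic_7$ has order $28$. A semidirect product $\mathbb{Z}_m\rtimes\mathbb{Z}_k$ denotes a non-abelian (nontrivial action) semidirect product with normal subgroup $\mathbb{Z}_m$: $\mathbb{Z}_{27}\rtimes\mathbb{Z}_3=\langle a,b\mid a^{27}=b^3=1,\ bab^{-1}=a^{10}\rangle$ (the modular group of order $81$); $\mathbb{Z}_7\rtimes\mathbb{Z}_9$ is the group of order $63$ in which a generator of $\mathbb{Z}_9$ acts on $\mathbb{Z}_7$ by an automorphism of order $3$; $\mathbb{Z}_3\rtimes\mathbb{Z}_{16}$ is the group of order $48$ in which a generator of $\mathbb{Z}_{16}$ inverts $\mathbb{Z}_3$; $\mathbb{Z}_5\rtimes\mathbb{Z}_8=\langle a,b\mid a^5=b^8=1,\ bab^{-1}=a^{-1}\rangle$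 (order $40$). *)

theory Defs
  imports "HOL-Algebra.Algebra"
begin

definition cyclic_subgroups :: "('a, 'b) monoid_scheme \<Rightarrow> 'a set set" where
  "cyclic_subgroups G = {H. subgroup H G \<and> cyclic_group (G\<lparr>carrier := H\<rparr>)}"


section \<open>Semidirect products\<close>

text \<open>
  For an action \<open>\<phi> \<in> hom H (AutoGroup N)\<close> this is the (outer) semidirect product
  of \<open>N\<close> (normal) and \<open>H\<close>, in which \<open>h n h\<inverse> = \<phi> h n\<close>.
\<close>

definition semidirect_product ::
  "('a, 'c) monoid_scheme \<Rightarrow> ('b, 'd) monoid_scheme \<Rightarrow> ('b \<Rightarrow> 'a \<Rightarrow> 'a) \<Rightarrow> ('a \<times> 'b) monoid" where
  "semidirect_product N H \<phi> =
    \<lparr>carrier = carrier N \<times> carrier H,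
     monoid.mult = (\<lambda>(n, h) (n', h'). (n \<otimes>\<^bsub>N\<^esub> \<phi> h n', h \<otimes>\<^bsub>H\<^esub> h')),
     one = (\<one>\<^bsub>N\<^esub>, \<one>\<^bsub>H\<^esub>)\<rparr>"

lemma group_semidirect_product:
  assumes N: "group N" and H: "group H" and \<phi>: "\<phi> \<in> hom H (AutoGroup N)"
  shows "group (semidirect_product N H \<phi>)"
proof -
  interpret N: group N by (rule N)
  interpret H: group H by (rule H)
  have auto: "\<phi> h \<in> auto N" if "h \<in> carrier H" for h
    using \<phi> that by (auto simp: hom_def AutoGroup_def)
  have cl [simp]: "\<phi> h n \<in> carrier N" if "h \<in> carrier H" "n \<in> carrier N" for h n
    using auto[OF that(1)] that(2) by (auto simp: auto_def hom_def)
  have mult: "\<phi> h (n \<otimes>\<^bsub>N\<^esub> n') = \<phi> h n \<otimes>\<^bsub>N\<^esub> \<phi> h n'"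
    if "h \<in> carrier H" "n \<in> carrier N" "n' \<in> carrier N" for h n n'
    using auto[OF that(1)] that(2,3) by (auto simp: auto_def hom_def)
  have comp: "\<phi> (h \<otimes>\<^bsub>H\<^esub> h') n = \<phi> h (\<phi> h' n)"
    if "h \<in> carrier H" "h' \<in> carrier H" "n \<in> carrier N" for h h' n
  proof -
    have "\<phi> (h \<otimes>\<^bsub>H\<^esub> h') = \<phi> h \<otimes>\<^bsub>AutoGroup N\<^esub> \<phi> h'"
      using \<phi> that by (auto simp: hom_def)
    also have "\<dots> = compose (carrier N) (\<phi> h) (\<phi> h')"
      using auto[OF that(1)] auto[OF that(2)]
      by (simp add: AutoGroup_def BijGroup_def auto_def)
    finally show ?thesis using that(3) by (simp add: compose_def)
  qed
  have one: "\<phi> \<one>\<^bsub>H\<^esub> n = n" if n: "n \<in> carrier N" for n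
  proof -
    have "\<phi> \<one>\<^bsub>H\<^esub> \<in> auto N" using auto by simp
    then have inj: "inj_on (\<phi> \<one>\<^bsub>H\<^esub>) (carrier N)"
      by (auto simp: auto_def Bij_def bij_betw_def)
    have "\<phi> \<one>\<^bsub>H\<^esub> (\<phi> \<one>\<^bsub>H\<^esub> n) = \<phi> \<one>\<^bsub>H\<^esub> n"
      using comp[of "\<one>\<^bsub>H\<^esub>" "\<one>\<^bsub>H\<^esub>" n] n by simp
    then show ?thesis using inj n by (auto dest: inj_onD)
  qed
  show ?thesis
  proof (rule groupI)
    fix x assume "x \<in> carrier (semidirect_product N H \<phi>)"
    then obtain n h where x: "x = (n, h)" "n \<in> carrier N" "h \<in> carrier H"
      by (auto simp: semidirect_product_def)
    let ?y = "(\<phi> (inv\<^bsub>H\<^esub> h) (inv\<^bsub>N\<^esub> n), inv\<^bsub>H\<^esub> h)"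
    have "\<phi> (inv\<^bsub>H\<^esub> h) \<one>\<^bsub>N\<^esub> = \<one>\<^bsub>N\<^esub>"
      using mult[of "inv\<^bsub>H\<^esub> h" "\<one>\<^bsub>N\<^esub>" "\<one>\<^bsub>N\<^esub>"] x
      by (metis H.inv_closed N.l_cancel_one N.one_closed N.r_one cl)
    then have "\<phi> (inv\<^bsub>H\<^esub> h) (inv\<^bsub>N\<^esub> n) \<otimes>\<^bsub>N\<^esub> \<phi> (inv\<^bsub>H\<^esub> h) n = \<one>\<^bsub>N\<^esub>"
      using x mult[of "inv\<^bsub>H\<^esub> h" "inv\<^bsub>N\<^esub> n" n] by simp
    then have "?y \<otimes>\<^bsub>semidirect_product N H \<phi>\<^esub> x = \<one>\<^bsub>semidirect_product N H \<phi>\<^esub>"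
      using x by (simp add: semidirect_product_def)
    moreover have "?y \<in> carrier (semidirect_product N H \<phi>)"
      using x by (simp add: semidirect_product_def)
    ultimately show "\<exists>y\<in>carrier (semidirect_product N H \<phi>).
        y \<otimes>\<^bsub>semidirect_product N H \<phi>\<^esub> x = \<one>\<^bsub>semidirect_product N H \<phi>\<^esub>" by blast
  qed (auto simp: semidirect_product_def comp mult one N.m_assoc H.m_assoc)
qed

text \<open>
  \<open>Z\<^sub>m \<rtimes> Z\<^sub>k\<close> in which the generator \<open>b = (0, 1)\<close> of \<open>Z\<^sub>k\<close> acts on the generator
  \<open>a = (1, 0)\<close> of \<open>Z\<^sub>m\<close> by \<open>b a b\<inverse> = a\<^sup>r\<close>. This is an action iff
  \<open>r\<^sup>k \<equiv> 1 (mod m)\<close>, and then the group is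
  \<open>\<langle>a, b | a\<^sup>m = b\<^sup>k = 1, b a b\<inverse> = a\<^sup>r\<rangle>\<close>.
\<close>

definition cyclic_action :: "nat \<Rightarrow> int \<Rightarrow> int \<Rightarrow> int \<Rightarrow> int" where
  "cyclic_action m r = (\<lambda>j. \<lambda>x\<in>carrier (integer_mod_group m). (r ^ nat j * x) mod int m)"

definition cyclic_semidirect :: "nat \<Rightarrow> nat \<Rightarrow> int \<Rightarrow> (int \<times> int) monoid" where
  "cyclic_semidirect m k r =
    semidirect_product (integer_mod_group m) (integer_mod_group k) (cyclic_action m r)"

lemma cyclic_action_hom:
  assumes m: "m > 0" and k: "k > 0" and r: "r ^ k mod int m = 1 mod int m"
  shows "cyclic_action m r \<in> hom (integer_mod_group k) (AutoGroup (integer_mod_group m))"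
proof -
  let ?M = "carrier (integer_mod_group m)"
  have M: "?M = {0..<int m}" using m by (simp add: carrier_integer_mod_group)
  have K: "carrier (integer_mod_group k) = {0..<int k}" using k by (simp add: carrier_integer_mod_group)
  have cl: "(r ^ i * x) mod int m \<in> ?M" for i x using m by (simp add: M)
  have pow: "(r ^ (i mod k) * x) mod int m = (r ^ i * x) mod int m" for i x
  proof -
    have "(r ^ i) mod int m = ((r ^ k) ^ (i div k) * r ^ (i mod k)) mod int m"
      by (simp flip: power_mult power_add)
    also have "\<dots> = (((r ^ k) mod int m) ^ (i div k) * r ^ (i mod k)) mod int m"
      by (metis mod_mult_left_eq power_mod)
    also have "\<dots> = r ^ (i mod k) mod int m"
      by (metis r mod_mult_left_eq power_mod mult_1 power_one)
    finally show ?thesis by (metis mod_mult_left_eq)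
  qed
  have fixp: "(r ^ (i * k) * x) mod int m = x" if "x \<in> ?M" for i x
    using pow[of "i * k" x] that by (simp add: M)
  have inv1: "(r ^ (i * (k - 1)) * ((r ^ i * x) mod int m)) mod int m = x"
    and inv2: "(r ^ i * ((r ^ (i * (k - 1)) * x) mod int m)) mod int m = x" if "x \<in> ?M" for i x
  proof -
    have e: "i + i * (k - 1) = i * k" using k by (cases k) auto
    have p: "r ^ (i * (k - 1)) * r ^ i = r ^ (i * k)"
      by (metis e add.commute power_add)
    have "(r ^ (i * (k - 1)) * (r ^ i * x)) mod int m = x"
      using fixp[OF that, of i] by (simp only: p mult.assoc[symmetric])
    then show "(r ^ (i * (k - 1)) * ((r ^ i * x) mod int m)) mod int m = x"
      and "(r ^ i * ((r ^ (i * (k - 1)) * x) mod int m)) mod int m = x"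
      by (simp_all add: mod_mult_right_eq mult.left_commute)
  qed
  have bij: "bij_betw (\<lambda>x. (r ^ i * x) mod int m) ?M ?M" for i
    by (rule bij_betwI[where g = "\<lambda>x. (r ^ (i * (k - 1)) * x) mod int m"])
       (use cl inv1 inv2 in auto)
  have aut: "cyclic_action m r j \<in> auto (integer_mod_group m)" for j
  proof -
    have "bij_betw (cyclic_action m r j) ?M ?M"
      using bij[of "nat j"] by (simp add: cyclic_action_def cong: bij_betw_cong)
    moreover have "(x + y) mod int m \<in> ?M" for x y using m by (simp add: M)
    ultimately show ?thesis
      using cl
      by (auto simp: auto_def Bij_def cyclic_action_def hom_def mod_simps distrib_left)
  qed
  have comp: "cyclic_action m r ((i + j) mod int k) =
      compose ?M (cyclic_action m r i) (cyclic_action m r j)"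
    if "i \<in> {0..<int k}" "j \<in> {0..<int k}" for i j
  proof
    fix x
    have n: "nat ((i + j) mod int k) = (nat i + nat j) mod k"
      using that by (simp add: nat_mod_distrib nat_add_distrib)
    show "cyclic_action m r ((i + j) mod int k) x =
        compose ?M (cyclic_action m r i) (cyclic_action m r j) x"
      by (cases "x \<in> ?M")
         (use cl in \<open>auto simp: cyclic_action_def compose_def n pow power_add mod_simps mult.assoc\<close>)
  qed
  show ?thesis
    using aut comp
    by (auto simp: hom_def AutoGroup_def BijGroup_def K auto_def)
qed

lemma group_cyclic_semidirect:
  assumes "m > 0" "k > 0" "r ^ k mod int m = 1 mod int m"
  shows "group (cyclic_semidirect m k r)"
  unfolding cyclic_semidirect_def
  using assms by (intro group_semidirect_product cyclic_action_hom) simp_all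


section \<open>Groups given by generators and relations\<close>

text \<open>
  Words over the type \<open>'g\<close> of generators; \<open>(x, True)\<close> stands for \<open>x\<close> and \<open>(x, False)\<close>
  for \<open>x\<inverse>\<close>. A relation \<open>l = r\<close> is a pair of words. The carrier of
  \<open>presented_group R\<close> consists of the classes of all words (every element of \<open>'g\<close> is a
  generator) modulo the congruence generated by \<open>R\<close> and \<open>x x\<inverse> = x\<inverse> x = 1\<close>.
\<close>

type_synonym 'g word = "('g \<times> bool) list"

inductive word_eq :: "('g word \<times> 'g word) set \<Rightarrow> 'g word \<Rightarrow> 'g word \<Rightarrow> bool"
  for R where
  word_eq_refl: "word_eq R w w"
| word_eq_sym: "word_eq R v w \<Longrightarrow> word_eq R w v"
| word_eq_trans: "word_eq R u v \<Longrightarrow> word_eq R v w \<Longrightarrow> word_eq R u w"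
| word_eq_cancel: "word_eq R (u @ [(x, b), (x, \<not> b)] @ v) (u @ v)"
| word_eq_rel: "(l, r) \<in> R \<Longrightarrow> word_eq R (u @ l @ v) (u @ r @ v)"

definition word_class :: "('g word \<times> 'g word) set \<Rightarrow> 'g word \<Rightarrow> 'g word set" where
  "word_class R w = {v. word_eq R w v}"

definition presented_group :: "('g word \<times> 'g word) set \<Rightarrow> 'g word set monoid" where
  "presented_group R =
    \<lparr>carrier = range (word_class R),
     monoid.mult = (\<lambda>A B. {w. \<exists>u\<in>A. \<exists>v\<in>B. word_eq R (u @ v) w}),
     one = word_class R []\<rparr>"

lemma word_eq_append_left: "word_eq R v w \<Longrightarrow> word_eq R (u @ v) (u @ w)"
proof (induction rule: word_eq.induct)
  case (word_eq_cancel u' x b v)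
  show ?case using word_eq.word_eq_cancel[of R "u @ u'" x b v] by simp
next
  case (word_eq_rel l r u' v)
  then show ?case using word_eq.word_eq_rel[of l r R "u @ u'" v] by simp
qed (blast intro: word_eq.intros)+

lemma word_eq_append_right: "word_eq R v w \<Longrightarrow> word_eq R (v @ u) (w @ u)"
proof (induction rule: word_eq.induct)
  case (word_eq_cancel u' x b v)
  show ?case using word_eq.word_eq_cancel[of R u' x b "v @ u"] by simp
next
  case (word_eq_rel l r u' v)
  then show ?case using word_eq.word_eq_rel[of l r R u' "v @ u"] by simp
qed (blast intro: word_eq.intros)+

lemma word_eq_append: "word_eq R u u' \<Longrightarrow> word_eq R v v' \<Longrightarrow> word_eq R (u @ v) (u' @ v')"
  by (blast intro: word_eq_append_left word_eq_append_right word_eq_trans)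

lemma word_class_eq_iff: "word_class R v = word_class R w \<longleftrightarrow> word_eq R v w"
  unfolding word_class_def by (blast intro: word_eq.intros)

lemma mult_presented_group:
  "word_class R u \<otimes>\<^bsub>presented_group R\<^esub> word_class R v = word_class R (u @ v)"
  unfolding presented_group_def word_class_def
  by (auto intro: word_eq_refl word_eq_trans word_eq_append)

lemma group_presented_group: "group (presented_group R)"
proof (rule groupI)
  have carr: "carrier (presented_group R) = range (word_class R)"
    and one: "\<one>\<^bsub>presented_group R\<^esub> = word_class R []"
    by (simp_all add: presented_group_def)
  {
    fix A B assume "A \<in> carrier (presented_group R)" "B \<in> carrier (presented_group R)"
    then show "A \<otimes>\<^bsub>presented_group R\<^esub> B \<in> carrier (presented_group R)"
      by (auto simp: carr mult_presented_group)
  next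
    show "\<one>\<^bsub>presented_group R\<^esub> \<in> carrier (presented_group R)"
      by (simp add: carr one)
  next
    fix A B C
    assume "A \<in> carrier (presented_group R)" "B \<in> carrier (presented_group R)"
      "C \<in> carrier (presented_group R)"
    then show "A \<otimes>\<^bsub>presented_group R\<^esub> B \<otimes>\<^bsub>presented_group R\<^esub> C =
        A \<otimes>\<^bsub>presented_group R\<^esub> (B \<otimes>\<^bsub>presented_group R\<^esub> C)"
      by (auto simp: carr mult_presented_group)
  next
    fix A assume "A \<in> carrier (presented_group R)"
    then show "\<one>\<^bsub>presented_group R\<^esub> \<otimes>\<^bsub>presented_group R\<^esub> A = A"
      by (auto simp: carr one mult_presented_group)
  next
    fix A assume "A \<in> carrier (presented_group R)"
    then obtain w where A: "A = word_class R w" by (auto simp: carr)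
    have "\<exists>v. word_eq R (v @ w) []"
    proof (induction w)
      case Nil
      show ?case using word_eq_refl[of R "[]"] by (intro exI[of _ "[]"]) simp
    next
      case (Cons a w)
      then obtain v where v: "word_eq R (v @ w) []" by blast
      obtain x b where a: "a = (x, b)" by (cases a)
      have "word_eq R ((v @ [(x, \<not> b)]) @ a # w) (v @ w)"
        using word_eq_cancel[of R v x "\<not> b" w] by (simp add: a)
      then show ?case using v by (blast intro: word_eq_trans)
    qed
    then show "\<exists>B\<in>carrier (presented_group R). B \<otimes>\<^bsub>presented_group R\<^esub> A = \<one>\<^bsub>presented_group R\<^esub>"
      by (auto simp: A carr one mult_presented_group word_class_eq_iff)
  }
qed

datatype dic_gen = dic_x | dic_y

definition dicyclic_group :: "nat \<Rightarrow> dic_gen word set monoid" where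
  "dicyclic_group n = presented_group
    {(replicate (2 * n) (dic_x, True), []),
     ([(dic_y, True), (dic_y, True)], replicate n (dic_x, True)),
     ([(dic_y, True), (dic_x, True), (dic_y, False)], [(dic_x, False)])}"

end

theory Submission
  imports Defs "HOL-Number_Theory.Residues"
begin

text \<open>
  Write \<open>c\<close> for the number of cyclic subgroups. For a Sylow subgroup \<open>P\<close> the cyclic
  \<open>p\<close>-subgroups outside \<open>P\<close> fall into orbits of length divisible by \<open>p\<close> under \<open>P\<close>, so a non-normal
  Sylow \<open>p\<close>-subgroup is expensive, and \<open>c(G) = 11\<close> leaves at most one prime \<open>p\<close> with
  non-normal Sylow subgroups. Hence \<open>G = N \<rtimes> P\<close> with \<open>N\<close> a normal \<open>p\<close>-complement and \<open>P\<close> a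
  \<open>p\<close>-group. Every cyclic subgroup is, up to conjugation by \<open>N\<close>, a product of some cyclic
  \<open>Y \<subseteq> P\<close> and a cyclic subgroup of the centralizer \<open>C\<^sub>N(Y)\<close>, whence
  \<open>c(G) = (\<Sum>Y. [N : C\<^sub>N(Y)] \<cdot> c(C\<^sub>N(Y)))\<close>. If \<open>P\<close> centralizes \<open>N\<close> then
  \<open>11 = c(P) \<cdot> c(N)\<close> forces \<open>G\<close> to be a \<open>p\<close>-group. Otherwise the index is at least \<open>p + 1\<close> for
  some \<open>Y\<close>, and the formula pins down \<open>N\<close>, \<open>P\<close> and the action: \<open>N\<close> is of order 3, 5 or 7
  with \<open>P\<close> cyclic, or \<open>N\<close> is elementary abelian of order 9 with \<open>P\<close> of order 2.

  For a non-cyclic \<open>p\<close>-group with \<open>c = 11\<close> and \<open>p\<close> odd, counting elements of given order modulo \<open>p\<close>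
  leaves \<open>p = 3\<close>, order 81 and an element of order 27. For \<open>p = 2\<close> the count is excluded by a
  parity argument when there is a normal Klein four-group, and by the structure of a maximal
  normal cyclic subgroup otherwise.

  All groups of the list other than \<open>Z\<^bsub>p^10\<^esub>\<close> are split metacyclic, which makes both recognizing
  them and counting their cyclic subgroups uniform.
\<close>

section \<open>Conjugation and cyclic subgroups\<close>

text \<open>Among p-groups the main device is an element \<open>w\<close> outside a normal cyclic
  \<open><a>\<close>, with w^p in \<open><a>\<close> and \<open>w\<close> central modulo
  \<open><a>\<close>. If \<open>w\<close> acts by a |-> a^r, then (a^i w)^p = a^(i (1 + r + ... +
  r^(p-1))) w^p, and a linear congruence for \<open>i\<close> decides whether \<open>w\<close> can
  be corrected to an element of order p. For odd p this always succeeds. For p = 2 it succeeds when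
  r = 1 (mod 4), which is why the residue 3 modulo 4 governs the 2-groups without a normal
  four-group. With a normal four-group, 11 is excluded only because it is odd: the cyclic subgroups
  other than 1 and one central involution are paired off by multiplication with suitable elements.
  Among the Sylow subgroups the obstacle is the pair of primes 2 and 3. Counting leaves a group that
  permutes four Sylow 3-subgroups and has a cyclic Sylow 2-subgroup transitive on them. It is
  excluded because in a transitive abelian group an element fixing one point fixes all of
  them.\<close>

lemma even_card_involution:
  assumes "finite A" "\<And>a. a \<in> A \<Longrightarrow> f a \<in> A" "\<And>a. a \<in> A \<Longrightarrow> f (f a) = a" "\<And>a. a \<in> A \<Longrightarrow> f a \<noteq> a"
  shows "even (card A)"
  using assms
proof (induction "card A" arbitrary: A rule: less_induct)
  case less
  show ?case
  proof (cases "A = {}")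
    case False
    then obtain a where a: "a \<in> A" by blast
    have sub: "{a, f a} \<subseteq> A" using a less.prems by auto
    have c: "card {a, f a} = 2" using less.prems(4)[OF a] by (simp add: eq_commute)
    have d: "card (A - {a, f a}) = card A - 2"
      using card_Diff_subset[OF _ sub] c by simp
    have le: "2 \<le> card A" using card_mono[OF less.prems(1) sub] c by simp
    have "even (card (A - {a, f a}))"
    proof (rule less.hyps)
      show "card (A - {a, f a}) < card A" using d le by simp
      show "f b \<in> A - {a, f a}" if "b \<in> A - {a, f a}" for b
        using that less.prems(2,3) a by (metis DiffD1 DiffD2 DiffI insertE insertI1 insertI2 singletonD)
    qed (use less.prems in auto)
    then show ?thesis using d le by (metis add_diff_inverse_nat even_add even_numeral not_less)
  qed simp
qed

context group
begin

lemma inv_mult_cancel: "x \<in> carrier G \<Longrightarrow> y \<in> carrier G \<Longrightarrow> inv x \<otimes> (x \<otimes> y) = y"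
  by (simp flip: m_assoc)

lemma mult_inv_cancel: "x \<in> carrier G \<Longrightarrow> y \<in> carrier G \<Longrightarrow> x \<otimes> (inv x \<otimes> y) = y"
  by (simp flip: m_assoc)

lemmas group_simps = m_assoc inv_mult_group inv_mult_cancel mult_inv_cancel

definition conjugate :: "'a \<Rightarrow> 'a \<Rightarrow> 'a" where
  "conjugate g x = g \<otimes> x \<otimes> inv g"

text \<open>\<open>H\<close> may be any subset. For a subgroup this is the set of its cyclic
  subgroups (\<open>mem_cyc_iff\<close>), but complements such as \<open>carrier G - A\<close> are
  used as well, so that disjoint pieces of the group can be counted separately.\<close>

definition cyc :: "'a set \<Rightarrow> 'a set set" where
  "cyc H = (\<lambda>x. generate G {x}) ` H"

lemma conjugate_closed [simp, intro]: "g \<in> carrier G \<Longrightarrow> x \<in> carrier G \<Longrightarrow> conjugate g x \<in> carrier G"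
  by (simp add: conjugate_def)

lemma conjugate_one [simp]: "g \<in> carrier G \<Longrightarrow> conjugate g \<one> = \<one>"
  "x \<in> carrier G \<Longrightarrow> conjugate \<one> x = x"
  by (simp_all add: conjugate_def)

lemma conjugate_mult:
  "g \<in> carrier G \<Longrightarrow> x \<in> carrier G \<Longrightarrow> y \<in> carrier G \<Longrightarrow>
    conjugate g (x \<otimes> y) = conjugate g x \<otimes> conjugate g y"
  by (simp add: conjugate_def group_simps)

lemma conjugate_conjugate:
  "g \<in> carrier G \<Longrightarrow> h \<in> carrier G \<Longrightarrow> x \<in> carrier G \<Longrightarrow>
    conjugate g (conjugate h x) = conjugate (g \<otimes> h) x"
  by (simp add: conjugate_def group_simps)

lemma conjugate_inv_cancel [simp]:
  "g \<in> carrier G \<Longrightarrow> x \<in> carrier G \<Longrightarrow> conjugate g (conjugate (inv g) x) = x"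
  "g \<in> carrier G \<Longrightarrow> x \<in> carrier G \<Longrightarrow> conjugate (inv g) (conjugate g x) = x"
  by (simp_all add: conjugate_def group_simps)

lemma conjugate_inv:
  "g \<in> carrier G \<Longrightarrow> x \<in> carrier G \<Longrightarrow> conjugate g (inv x) = inv (conjugate g x)"
  by (simp add: conjugate_def group_simps)

lemma conjugate_pow:
  "g \<in> carrier G \<Longrightarrow> x \<in> carrier G \<Longrightarrow> conjugate g (x [^] (n::nat)) = conjugate g x [^] n"
  by (induction n) (simp_all add: conjugate_mult)

lemma conjugate_eq_iff_commute:
  "g \<in> carrier G \<Longrightarrow> x \<in> carrier G \<Longrightarrow> conjugate g x = x \<longleftrightarrow> g \<otimes> x = x \<otimes> g"
  by (metis conjugate_def inv_closed inv_solve_right m_closed)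

lemma conjugate_eq_mult_iff:
  "g \<in> carrier G \<Longrightarrow> x \<in> carrier G \<Longrightarrow> y \<in> carrier G \<Longrightarrow> conjugate g x = y \<longleftrightarrow> g \<otimes> x = y \<otimes> g"
  by (metis conjugate_def inv_closed inv_solve_right m_closed)

lemma conjugate_inject [simp]:
  "g \<in> carrier G \<Longrightarrow> x \<in> carrier G \<Longrightarrow> y \<in> carrier G \<Longrightarrow> conjugate g x = conjugate g y \<longleftrightarrow> x = y"
  by (metis conjugate_inv_cancel(2))

lemma inj_on_conjugate: "g \<in> carrier G \<Longrightarrow> inj_on (conjugate g) (carrier G)"
  by (simp add: inj_on_def)

lemma conjugate_image_conjugate:
  "g \<in> carrier G \<Longrightarrow> h \<in> carrier G \<Longrightarrow> S \<subseteq> carrier G \<Longrightarrow>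
    conjugate g ` conjugate h ` S = conjugate (g \<otimes> h) ` S"
  by (auto simp: image_image conjugate_conjugate subset_iff intro!: image_cong)

lemma conjugate_image_one: "S \<subseteq> carrier G \<Longrightarrow> conjugate \<one> ` S = S"
  by (force simp: subset_iff)

lemma subgroup_conjugate_image:
  assumes "g \<in> carrier G" "subgroup H G"
  shows "subgroup (conjugate g ` H) G"
proof (rule subgroupI)
  interpret H: subgroup H G by fact
  show "conjugate g ` H \<subseteq> carrier G" "conjugate g ` H \<noteq> {}"
    using assms(1) H.subset H.one_closed by blast+
  fix a b assume "a \<in> conjugate g ` H" "b \<in> conjugate g ` H"
  then obtain x y where xy: "x \<in> H" "y \<in> H" "a = conjugate g x" "b = conjugate g y" by auto
  show "inv a \<in> conjugate g ` H"
    using xy assms(1) by (auto simp flip: conjugate_inv)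
  show "a \<otimes> b \<in> conjugate g ` H"
    using xy assms(1) by (auto simp flip: conjugate_mult)
qed

lemma card_conjugate_image:
  "g \<in> carrier G \<Longrightarrow> S \<subseteq> carrier G \<Longrightarrow> card (conjugate g ` S) = card S"
  by (meson card_image inj_on_conjugate inj_on_subset)

lemma subgroup_conjugate_closed:
  "subgroup H G \<Longrightarrow> g \<in> H \<Longrightarrow> x \<in> H \<Longrightarrow> conjugate g x \<in> H"
  by (simp add: conjugate_def subgroup.m_closed subgroup.m_inv_closed)

lemma normal_conjugate_closed: "N \<lhd> G \<Longrightarrow> g \<in> carrier G \<Longrightarrow> x \<in> N \<Longrightarrow> conjugate g x \<in> N"
  by (simp add: conjugate_def normal_inv_iff)

lemma normal_iff_conjugate:
  "N \<lhd> G \<longleftrightarrow> subgroup N G \<and> (\<forall>g\<in>carrier G. \<forall>x\<in>N. conjugate g x \<in> N)"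
  by (simp add: conjugate_def normal_inv_iff)

lemma normal_conjugate_image:
  assumes "N \<lhd> G" "g \<in> carrier G"
  shows "conjugate g ` N = N"
proof
  show "conjugate g ` N \<subseteq> N" using assms normal_conjugate_closed by auto
  show "N \<subseteq> conjugate g ` N"
  proof
    fix x assume x: "x \<in> N"
    then have "conjugate (inv g) x \<in> N" "x \<in> carrier G"
      using assms normal_conjugate_closed normal_imp_subgroup subgroup.mem_carrier by (fastforce)+
    then show "x \<in> conjugate g ` N" using assms(2) by (metis conjugate_inv_cancel(1) imageI)
  qed
qed

lemma subgroup_nat_pow_closed: "subgroup H G \<Longrightarrow> x \<in> H \<Longrightarrow> x [^] (n::nat) \<in> H"
  by (induction n) (simp_all add: subgroup.one_closed subgroup.m_closed)

lemma generate_singleton_self: "x \<in> generate G {x}"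
  by (simp add: generate.incl)

lemma generate_singleton_subgroup: "x \<in> carrier G \<Longrightarrow> subgroup (generate G {x}) G"
  by (simp add: generate_is_subgroup)

lemma generate_singleton_subset: "subgroup H G \<Longrightarrow> x \<in> H \<Longrightarrow> generate G {x} \<subseteq> H"
  by (simp add: generate_subgroup_incl)

lemma generate_singleton_in_carrier: "x \<in> carrier G \<Longrightarrow> y \<in> generate G {x} \<Longrightarrow> y \<in> carrier G"
  by (meson generate_singleton_subgroup subgroup.mem_carrier)

lemma generate_singleton_le_iff:
  "x \<in> carrier G \<Longrightarrow> y \<in> carrier G \<Longrightarrow> generate G {x} \<subseteq> generate G {y} \<longleftrightarrow> x \<in> generate G {y}"
  by (meson generate_singleton_self generate_singleton_subgroup generate_singleton_subset subsetD)

lemma generate_singleton_eq_iff: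
  "x \<in> carrier G \<Longrightarrow> y \<in> carrier G \<Longrightarrow>
    generate G {x} = generate G {y} \<longleftrightarrow> x \<in> generate G {y} \<and> y \<in> generate G {x}"
  by (metis equalityI generate_singleton_le_iff generate_singleton_self)

lemma card_generate_singleton: "x \<in> carrier G \<Longrightarrow> card (generate G {x}) = ord x"
  by (simp add: generate_pow_card)

lemma generate_conjugate:
  assumes "g \<in> carrier G" "x \<in> carrier G"
  shows "generate G {conjugate g x} = conjugate g ` generate G {x}"
proof
  show "generate G {conjugate g x} \<subseteq> conjugate g ` generate G {x}"
    by (rule generate_singleton_subset)
      (use assms in \<open>auto intro: subgroup_conjugate_image generate_singleton_subgroup generate_singleton_self\<close>)
  have "x \<in> conjugate (inv g) ` generate G {conjugate g x}"
    using assms generate_singleton_self[of "conjugate g x"] by (metis conjugate_inv_cancel(2) imageI)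
  then have "generate G {x} \<subseteq> conjugate (inv g) ` generate G {conjugate g x}"
    by (intro generate_singleton_subset subgroup_conjugate_image generate_singleton_subgroup)
      (use assms in auto)
  then have "conjugate g ` generate G {x} \<subseteq> conjugate g ` conjugate (inv g) ` generate G {conjugate g x}"
    by blast
  also have "\<dots> = generate G {conjugate g x}"
    using assms
    by (simp add: conjugate_image_conjugate conjugate_image_one subgroup.subset generate_singleton_subgroup)
  finally show "conjugate g ` generate G {x} \<subseteq> generate G {conjugate g x}" .
qed

lemma ord_conjugate: "g \<in> carrier G \<Longrightarrow> x \<in> carrier G \<Longrightarrow> ord (conjugate g x) = ord x"
  by (metis card_generate_singleton card_conjugate_image conjugate_closed generate_conjugate
      generate_singleton_subgroup subgroup.subset)

lemma cyclic_subgroups_eq_cyc: "cyclic_subgroups G = cyc (carrier G)"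
proof -
  have "subgroup H G \<and> cyclic_group (G\<lparr>carrier := H\<rparr>) \<longleftrightarrow> (\<exists>x\<in>carrier G. H = generate G {x})" for H
  proof
    assume H: "subgroup H G \<and> cyclic_group (G\<lparr>carrier := H\<rparr>)"
    then interpret H: group "G\<lparr>carrier := H\<rparr>" using subgroup_imp_group by blast
    obtain x where x: "x \<in> H" "H = range (\<lambda>n::int. x [^]\<^bsub>G\<lparr>carrier := H\<rparr>\<^esub> n)"
      using H H.cyclic_group by auto
    then have "H = range (\<lambda>n::int. x [^] n)"
      using int_pow_consistent[of H x] H by simp
    moreover have "x \<in> carrier G" using H x(1) subgroup.mem_carrier by metis
    ultimately show "\<exists>x\<in>carrier G. H = generate G {x}"
      using generate_pow[of x] by (auto simp: full_SetCompr_eq)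
  next
    assume "\<exists>x\<in>carrier G. H = generate G {x}"
    then obtain x where x: "x \<in> carrier G" "H = generate G {x}" by blast
    have "G\<lparr>carrier := H\<rparr> = subgroup_generated G {x}"
      using x by (simp add: subgroup_generated_def)
    then show "subgroup H G \<and> cyclic_group (G\<lparr>carrier := H\<rparr>)"
      using x generate_singleton_subgroup cyclic_group_generated by metis
  qed
  then show ?thesis by (auto simp: cyclic_subgroups_def cyc_def)
qed

lemma cyc_mono: "A \<subseteq> B \<Longrightarrow> cyc A \<subseteq> cyc B"
  by (auto simp: cyc_def)

lemma cyc_Un: "cyc (A \<union> B) = cyc A \<union> cyc B"
  by (auto simp: cyc_def)

lemma cycE:
  assumes "C \<in> cyc H"
  obtains x where "x \<in> H" "C = generate G {x}"
  using assms by (auto simp: cyc_def)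

lemma cyc_subgroup: "subgroup H G \<Longrightarrow> C \<in> cyc H \<Longrightarrow> subgroup C G \<and> C \<subseteq> H"
  by (metis cycE generate_singleton_subgroup generate_singleton_subset subgroup.mem_carrier)

lemma mem_cyc_iff:
  assumes "subgroup H G"
  shows "C \<in> cyc H \<longleftrightarrow> C \<in> cyc (carrier G) \<and> C \<subseteq> H"
proof
  show "C \<in> cyc (carrier G) \<and> C \<subseteq> H" if "C \<in> cyc H"
    using that cyc_subgroup[OF assms] cyc_mono[OF subgroup.subset[OF assms]] by blast
  show "C \<in> cyc H" if "C \<in> cyc (carrier G) \<and> C \<subseteq> H"
    using that generate_singleton_self by (auto simp: cyc_def)
qed

lemma generate_mem_cyc: "x \<in> H \<Longrightarrow> generate G {x} \<in> cyc H"
  by (simp add: cyc_def)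

lemma trivial_mem_cyc: "subgroup H G \<Longrightarrow> {\<one>} \<in> cyc H"
  by (metis generate_mem_cyc generate_one subgroup.one_closed)

lemma generate_mem_cyc_iff:
  "subgroup H G \<Longrightarrow> x \<in> carrier G \<Longrightarrow> generate G {x} \<in> cyc H \<longleftrightarrow> x \<in> H"
  using mem_cyc_iff generate_mem_cyc generate_singleton_self by blast

end

lemma card_cyclic_subgroups_iso:
  assumes "group G" "group H" "G \<cong> H"
  shows "card (cyclic_subgroups G) = card (cyclic_subgroups H)"
proof -
  interpret G: group G by fact
  interpret H: group H by fact
  obtain h where h: "h \<in> iso G H" using assms(3) by (auto simp: is_iso_def)
  then interpret h: group_hom G H h by unfold_locales (auto simp: iso_def)
  have inj: "inj_on h (carrier G)" and im: "h ` carrier G = carrier H"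
    using h by (auto simp: iso_def bij_betw_def)
  have gen: "h ` generate G {x} = generate H {h x}" if "x \<in> carrier G" for x
    using h.generate_img[of "{x}"] that by simp
  have "cyclic_subgroups H = (`) h ` cyclic_subgroups G"
    unfolding G.cyclic_subgroups_eq_cyc H.cyclic_subgroups_eq_cyc G.cyc_def H.cyc_def im[symmetric]
    by (simp add: image_image gen)
  moreover have "inj_on ((`) h) (cyclic_subgroups G)"
    using inj inj_on_image[of h "cyclic_subgroups G"]
    by (metis (no_types, lifting) Union_least cyclic_subgroups_def inj_on_subset mem_Collect_eq subgroup.subset)
  ultimately show ?thesis by (simp add: card_image)
qed

section \<open>Generators of cyclic subgroups of a finite group\<close>

locale finite_group = group G for G (structure) +
  assumes finite_carrier [simp, intro]: "finite (carrier G)"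
begin

lemma finite_subgroup: "subgroup H G \<Longrightarrow> finite H"
  by (meson finite_carrier finite_subset subgroup.subset)

lemma order_pos [simp]: "order G > 0"
  by (simp add: order_gt_0_iff_finite)

lemma ord_pos [simp]: "x \<in> carrier G \<Longrightarrow> ord x > 0"
  using ord_ge_1[of x] by simp

lemma card_subgroup_pos: "subgroup H G \<Longrightarrow> card H > 0"
  by (simp add: subgroup.finite_imp_card_positive)

lemma finite_cyc [simp]: "subgroup H G \<Longrightarrow> finite (cyc H)" "finite (cyc (carrier G))"
  by (simp_all add: cyc_def finite_subgroup)

lemma generate_singleton_iff:
  "x \<in> carrier G \<Longrightarrow> y \<in> generate G {x} \<longleftrightarrow> (\<exists>k::nat. y = x [^] k)"
  by (auto simp: generate_pow_on_finite_carrier)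

lemma ord_dvd_card_subgroup:
  assumes "subgroup H G" "x \<in> H"
  shows "ord x dvd card H"
proof -
  interpret H: group "G\<lparr>carrier := H\<rparr>" using assms subgroup_imp_group by blast
  have "H.ord x dvd card H" using H.ord_dvd_group_order[of x] assms by (simp add: order_def)
  moreover have "H.ord x = ord x"
    using assms H.ord_unique[of x "ord x"] pow_eq_id[of x] subgroup.mem_carrier[OF assms]
    by (simp flip: nat_pow_consistent)
  ultimately show ?thesis by simp
qed

lemma card_subgroup_dvd:
  assumes "subgroup H G" "subgroup K G" "H \<subseteq> K"
  shows "card H dvd card K"
proof -
  interpret K: group "G\<lparr>carrier := K\<rparr>" using assms subgroup_imp_group by blast
  have "subgroup H (G\<lparr>carrier := K\<rparr>)" using assms subgroup_incl by blast
  from K.lagrange[OF this] show ?thesis by (auto simp: order_def intro: dvdI[of _ _ "card _"] dest: sym)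
qed

lemma subgroup_eqI:
  assumes "subgroup H G" "subgroup K G" "H \<subseteq> K" "card K \<le> card H"
  shows "H = K"
  using assms card_seteq finite_subgroup by blast

lemma card_subgroup_dvd_order: "subgroup H G \<Longrightarrow> card H dvd order G"
  using card_subgroup_dvd[of H "carrier G"] by (simp add: order_def subgroup_self subgroup.subset)

lemma pow_eq_iff: "x \<in> carrier G \<Longrightarrow> x [^] (m::nat) = x [^] n \<longleftrightarrow> [m = n] (mod ord x)"
  using int_pow_eq[of x "int m" "int n"]
  by (simp add: int_pow_int cong_iff_dvd_diff cong_int_iff[symmetric] dvd_diff_commute)

lemma pow_mod_ord: "x \<in> carrier G \<Longrightarrow> x [^] (n mod ord x) = x [^] n"
  by (simp add: pow_eq_iff cong_def)

lemma generate_pow_eq_iff: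
  assumes "x \<in> carrier G"
  shows "generate G {x [^] (k::nat)} = generate G {x} \<longleftrightarrow> coprime k (ord x)"
proof -
  have sub: "generate G {x [^] k} \<subseteq> generate G {x}"
    by (rule generate_singleton_subset)
      (use assms in \<open>auto intro: generate_singleton_subgroup simp: generate_singleton_iff\<close>)
  have "generate G {x [^] k} = generate G {x} \<longleftrightarrow> ord (x [^] k) = ord x"
    using subgroup_eqI[OF _ _ sub] assms
    by (metis card_generate_singleton generate_singleton_subgroup nat_pow_closed order_refl)
  then show ?thesis using assms pow_ord_eq_ord_iff by simp
qed

lemma generate_eqE:
  assumes "x \<in> carrier G" "y \<in> carrier G" "generate G {x} = generate G {y}"
  obtains k :: nat where "y = x [^] k" "coprime k (ord x)"
  by (metis assms generate_pow_eq_iff generate_singleton_iff generate_singleton_self)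

lemma card_generators:
  assumes x: "x \<in> carrier G"
  shows "card {y \<in> carrier G. generate G {y} = generate G {x}} = totient (ord x)"
proof -
  have "{y \<in> carrier G. generate G {y} = generate G {x}} = (\<lambda>k. x [^] k) ` totatives (ord x)"
  proof (intro equalityI subsetI)
    fix y assume "y \<in> {y \<in> carrier G. generate G {y} = generate G {x}}"
    then have y: "y \<in> carrier G" "generate G {x} = generate G {y}" by auto
    obtain k :: nat where k: "y = x [^] k" "coprime k (ord x)" using generate_eqE[OF x y] by blast
    show "y \<in> (\<lambda>k. x [^] k) ` totatives (ord x)"
    \<comment> \<open>\<open>totatives 1 = {1}\<close>, whereas reduction modulo 1 gives 0, so order
      1 is treated separately.\<close>
    proof (cases "ord x = 1")
      case True
      then show ?thesis using k x ord_eq_1[OF x] by (auto simp: totatives_def)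
    next
      case False
      have "k mod ord x \<noteq> 0" using k(2) False by (metis coprime_mod_left_iff coprime_0_left_iff nat_dvd_1_iff_1 is_unit_right_imp_coprime less_numeral_extra(3) ord_pos x)
      then have "k mod ord x \<in> totatives (ord x)"
        using k(2) x by (auto simp: totatives_def less_imp_le)
      then show ?thesis using k x pow_mod_ord by (metis imageI)
    qed
  next
    fix y assume "y \<in> (\<lambda>k. x [^] k) ` totatives (ord x)"
    then obtain k where "y = x [^] k" "coprime k (ord x)" by (auto simp: totatives_def)
    then show "y \<in> {y \<in> carrier G. generate G {y} = generate G {x}}"
      using x by (metis (mono_tags, lifting) generate_pow_eq_iff mem_Collect_eq nat_pow_closed)
  qed
  moreover have "inj_on (\<lambda>k. x [^] k) (totatives (ord x))"
    by (rule inj_on_subset[OF ord_inj'[OF x]]) (auto simp: totatives_def)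
  ultimately show ?thesis by (simp add: card_image totient_def)
qed

text \<open>The fibres of x |-> <x> on \<open>S\<close> are full sets of generators,
  \<open>totient (card C)\<close> many for each \<open>C\<close>. This class equation turns the
  number of elements into information on the number of cyclic subgroups.\<close>

lemma card_eq_sum_totient:
  assumes "S \<subseteq> carrier G"
    and "\<And>x y. x \<in> S \<Longrightarrow> y \<in> carrier G \<Longrightarrow> generate G {y} = generate G {x} \<Longrightarrow> y \<in> S"
  shows "card S = (\<Sum>C\<in>cyc S. totient (card C))"
proof -
  have fin: "finite S" using assms(1) finite_subset by blast
  have "card S = (\<Sum>C\<in>cyc S. card {y \<in> S. generate G {y} = C})"
    using sum.image_gen[OF fin, of "\<lambda>_. 1::nat" "\<lambda>x. generate G {x}"] by (simp add: cyc_def)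
  also have "\<dots> = (\<Sum>C\<in>cyc S. totient (card C))"
  proof (rule sum.cong)
    fix C assume "C \<in> cyc S"
    then obtain x where x: "x \<in> S" "C = generate G {x}" by (rule cycE)
    then have xc: "x \<in> carrier G" using assms(1) by blast
    have "{y \<in> S. generate G {y} = C} = {y \<in> carrier G. generate G {y} = generate G {x}}"
      using assms x by auto
    then show "card {y \<in> S. generate G {y} = C} = totient (card C)"
      using card_generators[OF xc] card_generate_singleton[OF xc] x by simp
  qed simp
  finally show ?thesis .
qed

lemma card_subgroup_eq_sum_totient:
  assumes "subgroup H G"
  shows "card H = (\<Sum>C\<in>cyc H. totient (card C))"
  by (rule card_eq_sum_totient)
    (use assms subgroup.subset generate_singleton_self generate_singleton_subset in blast)+

text \<open>The pairing is given on elements. The third hypothesis lets it descend to cyclic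
  subgroups through an arbitrary choice \<open>g\<close> of generators, and \<open>f\<close> has to
  be an involution only up to generating the same subgroup.\<close>

lemma even_card_cyc:
  assumes "S \<subseteq> carrier G"
    and "\<And>x. x \<in> S \<Longrightarrow> f x \<in> S"
    and "\<And>x y. x \<in> S \<Longrightarrow> y \<in> S \<Longrightarrow> generate G {x} = generate G {y} \<Longrightarrow> generate G {f x} = generate G {f y}"
    and "\<And>x. x \<in> S \<Longrightarrow> generate G {f (f x)} = generate G {x}"
    and "\<And>x. x \<in> S \<Longrightarrow> generate G {f x} \<noteq> generate G {x}"
  shows "even (card (cyc S))"
proof -
  define g where "g C = (SOME x. x \<in> S \<and> generate G {x} = C)" for C
  have g: "g C \<in> S \<and> generate G {g C} = C" if "C \<in> cyc S" for C
    unfolding g_def by (rule someI_ex) (use that in \<open>auto simp: cyc_def\<close>)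
  show ?thesis
  proof (rule even_card_involution[where f = "\<lambda>C. generate G {f (g C)}"])
    show "finite (cyc S)" using assms(1) by (simp add: cyc_def finite_subset)
    fix C assume C: "C \<in> cyc S"
    show m: "generate G {f (g C)} \<in> cyc S" using g[OF C] assms(2) by (simp add: cyc_def)
    show "generate G {f (g C)} \<noteq> C" using g[OF C] assms(5) by metis
    show "generate G {f (g (generate G {f (g C)}))} = C"
      using g[OF C] g[OF m] assms(2,3,4) by metis
  qed
qed

end

section \<open>Group actions and Sylow subgroups\<close>

text \<open>Only the subgroup \<open>P\<close> acts. One set of lemmas thus covers conjugation of
  elements and of subsets and translation of cosets, whether the acting group is a p-subgroup, a
  normal subgroup or all of \<open>G\<close>.\<close>

locale subgroup_action = finite_group G + P: subgroup P G for G (structure) and P +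
  fixes S :: "'s set" and act :: "'a \<Rightarrow> 's \<Rightarrow> 's"
  assumes finite_S [simp]: "finite S"
    and act_closed: "g \<in> P \<Longrightarrow> x \<in> S \<Longrightarrow> act g x \<in> S"
    and act_one: "x \<in> S \<Longrightarrow> act \<one> x = x"
    and act_mult: "g \<in> P \<Longrightarrow> h \<in> P \<Longrightarrow> x \<in> S \<Longrightarrow> act (g \<otimes> h) x = act g (act h x)"
begin

lemma act_inv: "g \<in> P \<Longrightarrow> x \<in> S \<Longrightarrow> act (inv g) (act g x) = x"
  using act_mult[of "inv g" g x] by (simp add: act_one)

lemma orbit_stabilizer:
  assumes x: "x \<in> S"
  shows "card ((\<lambda>g. act g x) ` P) * card {g \<in> P. act g x = x} = card P"
proof -
  have fin: "finite P" by (simp add: finite_subgroup P.subgroup_axioms)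
  have "card {g \<in> P. act g x = y} = card {g \<in> P. act g x = x}" if y: "y \<in> (\<lambda>g. act g x) ` P" for y
  proof -
    obtain h where h: "h \<in> P" "y = act h x" using y by blast
    have "{g \<in> P. act g x = y} = (\<lambda>s. h \<otimes> s) ` {g \<in> P. act g x = x}"
    proof (intro equalityI subsetI)
      fix g assume g: "g \<in> {g \<in> P. act g x = y}"
      then have "act (inv h \<otimes> g) x = x" using h x act_mult act_inv by simp
      moreover have "g = h \<otimes> (inv h \<otimes> g)" using g h by (simp add: mult_inv_cancel)
      moreover have "inv h \<otimes> g \<in> P" using g h by simp
      ultimately show "g \<in> (\<lambda>s. h \<otimes> s) ` {g \<in> P. act g x = x}" by blast
    qed (use h x act_mult in auto)
    moreover have "inj_on (\<lambda>s. h \<otimes> s) {g \<in> P. act g x = x}"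
      by (rule inj_on_subset[OF inj_on_cmult[of h]]) (use h in auto)
    ultimately show ?thesis by (simp add: card_image)
  qed
  then have "(\<Sum>y\<in>(\<lambda>g. act g x) ` P. card {g \<in> P. act g x = y}) =
      (\<Sum>y\<in>(\<lambda>g. act g x) ` P. card {g \<in> P. act g x = x})"
    by (rule sum.cong[OF refl])
  then show ?thesis
    using sum.image_gen[OF fin, of "\<lambda>_. 1::nat" "\<lambda>g. act g x"] by simp
qed

text \<open>Orbits have p-power length, and those outside the fixed points have length divisible by
  \<open>p\<close>. This congruence drives Sylow's theorems, the coprime actions on \<open>N\<close>
  and the subgroup of index 3 in order 81.\<close>

lemma fixed_points_cong:
  assumes p: "Factorial_Ring.prime p" and card_P: "card P = p ^ a"
  shows "[card S = card {x \<in> S. \<forall>g\<in>P. act g x = x}] (mod p)"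
proof -
  define F where "F = {x \<in> S. \<forall>g\<in>P. act g x = x}"
  define orb where "orb x = (\<lambda>g. act g x) ` P" for x
  have orb_sub: "orb x \<subseteq> S" if "x \<in> S" for x
    using that act_closed by (auto simp: orb_def)
  have self: "x \<in> orb x" if "x \<in> S" for x
    using that act_one[of x] P.one_closed unfolding orb_def by (metis imageI)
  have eq: "orb y = orb x" if "x \<in> S" and y: "y \<in> orb x" for x y
  proof -
    obtain h where h: "h \<in> P" "y = act h x" using y by (auto simp: orb_def)
    have "act g y \<in> orb x" if "g \<in> P" for g
      using h that \<open>x \<in> S\<close> act_mult[of g h x] P.m_closed unfolding orb_def by (metis imageI)
    moreover have "act g x \<in> orb y" if "g \<in> P" for g
    proof -
      have "act (g \<otimes> inv h) y = act g x"
        using h that \<open>x \<in> S\<close> act_mult[of g "inv h" y] act_inv[of h x] act_closed by simp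
      moreover have "g \<otimes> inv h \<in> P" using h that by simp
      ultimately show ?thesis unfolding orb_def by (metis imageI)
    qed
    ultimately show ?thesis by (auto simp: orb_def)
  qed
  have "p dvd card (\<Union>(orb ` (S - F)))"
  proof (rule dvd_partition)
    show "\<forall>c\<in>orb ` (S - F). p dvd card c"
    proof
      fix c assume "c \<in> orb ` (S - F)"
      then obtain x where x: "x \<in> S" "x \<notin> F" "c = orb x" by blast
      have "card c dvd p ^ a" using orbit_stabilizer[OF x(1)] x(3) card_P by (metis orb_def dvd_triv_left)
      then obtain i where i: "card c = p ^ i" using p divides_primepow_nat by blast
      have "i \<noteq> 0"
      proof
        assume "i = 0"
        then have "card c = 1" using i by simp
        then obtain z where "c = {z}" by (auto simp: card_1_singleton_iff)
        then have "c = {x}" using self[OF x(1)] x(3) by simp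
        then have "x \<in> F" using x by (auto simp: F_def orb_def)
        then show False using x by blast
      qed
      then show "p dvd card c" using i by simp
    qed
    show "\<forall>c1\<in>orb ` (S - F). \<forall>c2\<in>orb ` (S - F). c1 \<noteq> c2 \<longrightarrow> c1 \<inter> c2 = {}"
      using eq by (metis (no_types, lifting) DiffD1 disjoint_iff image_iff)
    show "finite (\<Union>(orb ` (S - F)))"
      using orb_sub finite_S by (meson DiffD1 UN_least finite_subset)
  qed
  moreover have "\<Union>(orb ` (S - F)) = S - F"
  proof (intro equalityI subsetI)
    fix y assume "y \<in> \<Union>(orb ` (S - F))"
    then obtain x where x: "x \<in> S" "x \<notin> F" "y \<in> orb x" by blast
    have "y \<notin> F"
    proof
      assume "y \<in> F"
      then have "orb y \<subseteq> {y}" by (auto simp: F_def orb_def)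
      then have "x = y" using eq[OF x(1,3)] self[OF x(1)] by auto
      then show False using \<open>y \<in> F\<close> x by simp
    qed
    then show "y \<in> S - F" using x orb_sub by blast
  qed (use self in blast)
  moreover have "card S = card (S - F) + card F"
    using card_Diff_subset[of F S] card_mono[of S F] by (simp add: F_def finite_subset)
  ultimately show ?thesis unfolding F_def[symmetric] by (auto simp: cong_def)
qed

end

section \<open>Products of subgroups and Sylow's theorems\<close>

context group
begin

lemma subset_set_mult:
  assumes "subgroup K G" "subgroup H G"
  shows "K \<subseteq> K <#> H" "H \<subseteq> K <#> H"
proof -
  have "k = k \<otimes> \<one>" "h = \<one> \<otimes> h" if "k \<in> K" "h \<in> H" for h k
    using that assms subgroup.mem_carrier by fastforce+
  then show "K \<subseteq> K <#> H" "H \<subseteq> K <#> H"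
    using subgroup.one_closed[OF assms(1)] subgroup.one_closed[OF assms(2)] by (auto simp: set_mult_def)
qed

lemma set_multE:
  assumes "z \<in> H <#> K"
  obtains h k where "h \<in> H" "k \<in> K" "z = h \<otimes> k"
  using assms by (auto simp: set_mult_def)

lemma set_multI: "h \<in> H \<Longrightarrow> k \<in> K \<Longrightarrow> h \<otimes> k \<in> H <#> K"
  by (auto simp: set_mult_def)

lemma subgroup_set_mult_normalized:
  assumes "subgroup K G" "subgroup H G" "\<And>h k. h \<in> H \<Longrightarrow> k \<in> K \<Longrightarrow> conjugate h k \<in> K"
  shows "subgroup (K <#> H) G"
proof (rule subgroupI)
  interpret K: subgroup K G by fact
  interpret H: subgroup H G by fact
  show "K <#> H \<subseteq> carrier G" by (simp add: setmult_subset_G K.subset H.subset)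
  show "K <#> H \<noteq> {}" using set_multI[OF K.one_closed H.one_closed] by (metis empty_iff)
  fix a b assume "a \<in> K <#> H" "b \<in> K <#> H"
  then obtain k h k' h' where *: "k \<in> K" "h \<in> H" "a = k \<otimes> h" "k' \<in> K" "h' \<in> H" "b = k' \<otimes> h'"
    by (auto simp: set_mult_def)
  have "inv a = conjugate (inv h) (inv k) \<otimes> inv h"
    using * by (simp add: conjugate_def group_simps)
  then show "inv a \<in> K <#> H" using * assms(3)[of "inv h" "inv k"] by (auto simp: set_mult_def)
  have "a \<otimes> b = (k \<otimes> conjugate h k') \<otimes> (h \<otimes> h')"
    using * by (simp add: conjugate_def group_simps)
  then show "a \<otimes> b \<in> K <#> H" using * assms(3)[of h k'] by (auto simp: set_mult_def)
qed

end

context finite_group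
begin

text \<open>Every fibre of the multiplication map on pairs (h, k) is a copy of the intersection,
  through s |-> (h s, s^-1 k).\<close>

lemma card_set_mult:
  assumes "subgroup H G" "subgroup K G"
  shows "card (H <#> K) * card (H \<inter> K) = card H * card K"
proof -
  interpret H: subgroup H G by fact
  interpret K: subgroup K G by fact
  have fin: "finite (H \<times> K)" using assms finite_subgroup by blast
  have im: "(\<lambda>(h, k). h \<otimes> k) ` (H \<times> K) = H <#> K" by (auto simp: set_mult_def)
  have "card {x \<in> H \<times> K. (\<lambda>(h, k). h \<otimes> k) x = z} = card (H \<inter> K)" if z: "z \<in> H <#> K" for z
  proof -
    obtain h k where hk: "h \<in> H" "k \<in> K" "z = h \<otimes> k" using z by (rule set_multE)
    have "bij_betw (\<lambda>s. (h \<otimes> s, inv s \<otimes> k)) (H \<inter> K) {x \<in> H \<times> K. (\<lambda>(h, k). h \<otimes> k) x = z}"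
    proof (rule bij_betwI[where g = "\<lambda>(a, b). inv h \<otimes> a"])
      show "(\<lambda>s. (h \<otimes> s, inv s \<otimes> k)) \<in> H \<inter> K \<rightarrow> {x \<in> H \<times> K. (\<lambda>(h, k). h \<otimes> k) x = z}"
        using hk by (auto simp: group_simps)
      show "(\<lambda>(a, b). inv h \<otimes> a) \<in> {x \<in> H \<times> K. (\<lambda>(h, k). h \<otimes> k) x = z} \<rightarrow> H \<inter> K"
      proof (rule Pi_I)
        fix x assume "x \<in> {x \<in> H \<times> K. (\<lambda>(h, k). h \<otimes> k) x = z}"
        then obtain a b where ab: "x = (a, b)" "a \<in> H" "b \<in> K" "a \<otimes> b = z" by auto
        then have "inv h \<otimes> a = k \<otimes> inv b" using hk
          by (metis H.mem_carrier K.mem_carrier inv_closed inv_mult_cancel inv_solve_right m_assoc m_closed)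
        then show "(\<lambda>(a, b). inv h \<otimes> a) x \<in> H \<inter> K"
          using ab hk by (metis (no_types, lifting) H.m_closed H.m_inv_closed IntI K.m_closed K.m_inv_closed case_prod_conv)
      qed
      show "(\<lambda>(a, b). inv h \<otimes> a) (h \<otimes> s, inv s \<otimes> k) = s" if "s \<in> H \<inter> K" for s
        using that hk by (simp add: group_simps)
      show "(\<lambda>s. (h \<otimes> s, inv s \<otimes> k)) ((\<lambda>(a, b). inv h \<otimes> a) x) = x"
        if xin: "x \<in> {x \<in> H \<times> K. (\<lambda>(h, k). h \<otimes> k) x = z}" for x
      proof -
        obtain a b where x: "x = (a, b)" "a \<in> H" "b \<in> K" "a \<otimes> b = h \<otimes> k"
          using xin hk by auto
        have "inv a \<otimes> (h \<otimes> k) = b" using x by (metis H.mem_carrier K.mem_carrier inv_mult_cancel)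
        then show ?thesis using x hk by (simp add: group_simps)
      qed
    qed
    then show ?thesis by (simp add: bij_betw_same_card)
  qed
  then show ?thesis
    using sum.image_gen[OF fin, of "\<lambda>_. 1::nat" "\<lambda>(h, k). h \<otimes> k"] im
    by (simp add: card_cartesian_product)
qed

definition p_subgroup :: "nat \<Rightarrow> 'a set \<Rightarrow> bool" where
  "p_subgroup p H \<longleftrightarrow> subgroup H G \<and> (\<exists>k. card H = p ^ k)"

text \<open>If \<open>p\<close> does not divide the order, this is \<open>{{\<one>}}\<close>, so
  \<open>card (syl p) = 1\<close> expresses normality uniformly for all primes.\<close>

definition syl :: "nat \<Rightarrow> 'a set set" where
  "syl p = {P. subgroup P G \<and> card P = p ^ multiplicity p (order G)}"

lemma syl_subgroup: "P \<in> syl p \<Longrightarrow> subgroup P G"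
  by (simp add: syl_def)

lemma syl_p_subgroup: "P \<in> syl p \<Longrightarrow> p_subgroup p P"
  by (auto simp: syl_def p_subgroup_def)

lemma finite_syl [simp]: "finite (syl p)"
  by (rule finite_subset[of _ "Pow (carrier G)"]) (auto simp: syl_def dest: subgroup.mem_carrier)

lemma syl_nonempty:
  assumes "Factorial_Ring.prime p"
  shows "syl p \<noteq> {}"
proof -
  obtain m where "order G = p ^ multiplicity p (order G) * m"
    by (meson dvdE multiplicity_dvd)
  from sylow_thm[OF assms group_axioms this finite_carrier] show ?thesis by (auto simp: syl_def)
qed

lemma p_subgroup_card_le:
  assumes "Factorial_Ring.prime p" "p_subgroup p H" "P \<in> syl p"
  shows "card H dvd card P"
proof -
  obtain k where k: "card H = p ^ k" using assms by (auto simp: p_subgroup_def)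
  have "p ^ k dvd order G" using assms(2) k card_subgroup_dvd_order by (metis p_subgroup_def)
  then have "k \<le> multiplicity p (order G)"
    using assms(1) by (metis multiplicity_geI order_pos not_prime_unit less_numeral_extra(3))
  then show ?thesis using assms(3) k by (simp add: syl_def le_imp_power_dvd)
qed

lemma cauchy:
  assumes "Factorial_Ring.prime p" "subgroup H G" "p dvd card H"
  shows "\<exists>x\<in>H. ord x = p"
proof -
  interpret H: group "G\<lparr>carrier := H\<rparr>" using assms subgroup_imp_group by blast
  obtain m where "order (G\<lparr>carrier := H\<rparr>) = p ^ 1 * m"
    using assms(3) by (auto simp: order_def)
  from sylow_thm[OF assms(1) H.group_axioms this] obtain K where
    K: "subgroup K (G\<lparr>carrier := H\<rparr>)" "card K = p"
    using finite_subgroup[OF assms(2)] by auto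
  have sub: "subgroup K G" "K \<subseteq> H" using K(1) incl_subgroup[OF assms(2)] subgroup.subset by fastforce+
  have "K \<noteq> {\<one>}" using K(2) assms(1) by (metis card.empty card.insert empty_iff finite.emptyI not_prime_1 One_nat_def)
  then obtain x where x: "x \<in> K" "x \<noteq> \<one>" using subgroup.one_closed[OF sub(1)] by blast
  have xc: "x \<in> carrier G" using subgroup.mem_carrier[OF sub(1) x(1)] .
  have "ord x dvd p" using ord_dvd_card_subgroup[OF sub(1) x(1)] K(2) by simp
  moreover have "ord x \<noteq> 1" using ord_eq_1[OF xc] x by simp
  ultimately have "ord x = p" using assms(1) by (metis One_nat_def prime_nat_iff)
  then show ?thesis using x sub by blast
qed

lemma prime_power_ord:
  assumes "p_subgroup p H" "Factorial_Ring.prime p" "x \<in> H"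
  shows "\<exists>k. ord x = p ^ k"
  using ord_dvd_card_subgroup[of H x] assms divides_primepow_nat[of p] by (auto simp: p_subgroup_def)

text \<open>Right multiplication by the inverse turns the right cosets of \<open>P\<close> into a
  left \<open>H\<close>-set.\<close>

lemma rcosets_subgroup_action:
  assumes H: "subgroup H G" and P: "subgroup P G"
  shows "subgroup_action G H (rcosets P) (\<lambda>h C. C #> inv h)"
proof -
  interpret P: subgroup P G by fact
  interpret H: subgroup H G by fact
  show ?thesis
  proof
    show "finite (rcosets P)" by (auto simp: RCOSETS_def)
    fix C assume "C \<in> rcosets P"
    then obtain g where C: "g \<in> carrier G" "C = P #> g" by (auto simp: RCOSETS_def)
    then have act: "C #> inv h = P #> (g \<otimes> inv h)" if "h \<in> H" for h
      using that by (simp add: coset_mult_assoc P.subset)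
    show "C #> inv h \<in> rcosets P" if "h \<in> H" for h
      using act[OF that] C that by (simp add: rcosetsI P.subset)
    show "C #> inv \<one> = C" using act[OF H.one_closed] C by simp
    show "C #> inv (h \<otimes> h') = C #> inv h' #> inv h" if "h \<in> H" "h' \<in> H" for h h'
      using that C act[of h'] act[of "h \<otimes> h'"] by (simp add: coset_mult_assoc P.subset group_simps)
  qed
qed

lemma fixed_rcoset_conjugate:
  assumes P: "subgroup P G" and g: "g \<in> carrier G" and h: "h \<in> carrier G" and fixed: "P #> g #> inv h = P #> g"
  shows "conjugate g h \<in> P"
proof -
  interpret P: subgroup P G by fact
  have "P #> g = P #> g #> inv h #> h" using g h by (simp add: coset_mult_assoc P.subset m_assoc)
  then have "P #> (g \<otimes> h) = P #> g" using fixed g h by (simp add: coset_mult_assoc P.subset)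
  then have "g \<otimes> h \<in> P #> g" using g h rcos_self[of "g \<otimes> h" P] P.subgroup_axioms by simp
  then obtain x where x: "x \<in> P" "g \<otimes> h = x \<otimes> g" by (auto simp: r_coset_def)
  then have "conjugate g h = x" using g h conjugate_eq_mult_iff[of g h x] by simp
  then show ?thesis using x(1) by simp
qed

text \<open>The number of cosets is prime to \<open>p\<close>, so \<open>H\<close> fixes some coset
  P g, and then g H g^-1 lies in \<open>P\<close>. \<open>P\<close> is any subgroup of index prime
  to \<open>p\<close>, because the result is applied to Sylow subgroups and to the complement in
  \<open>p_complement\<close>.\<close>

lemma p_subgroup_subset_conjugate:
  assumes p: "Factorial_Ring.prime p" and H: "p_subgroup p H" and P: "subgroup P G"
    and ndvd: "\<not> p dvd card (rcosets P)"
  shows "\<exists>g\<in>carrier G. H \<subseteq> conjugate g ` P"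
proof -
  obtain k where k: "card H = p ^ k" and sH: "subgroup H G" using H by (auto simp: p_subgroup_def)
  interpret A: subgroup_action G H "rcosets P" "\<lambda>h C. C #> inv h" by (rule rcosets_subgroup_action[OF sH P])
  have "{C \<in> rcosets P. \<forall>h\<in>H. C #> inv h = C} \<noteq> {}"
  proof
    assume e: "{C \<in> rcosets P. \<forall>h\<in>H. C #> inv h = C} = {}"
    have "[card (rcosets P) = 0] (mod p)" using A.fixed_points_cong[OF p k] unfolding e by simp
    then show False using ndvd by (simp add: cong_0_iff)
  qed
  then obtain g where g: "g \<in> carrier G" "\<And>h. h \<in> H \<Longrightarrow> P #> g #> inv h = P #> g"
    by (auto simp: RCOSETS_def)
  have "h \<in> conjugate (inv g) ` P" if h: "h \<in> H" for h
  proof -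
    have hc: "h \<in> carrier G" using h sH subgroup.mem_carrier by metis
    have "conjugate g h \<in> P" using fixed_rcoset_conjugate[OF P g(1) hc g(2)[OF h]] .
    then show ?thesis using g(1) hc by (metis conjugate_inv_cancel(2) image_eqI)
  qed
  then show ?thesis using g(1) by blast
qed

lemma card_rcosets_syl:
  assumes p: "Factorial_Ring.prime p" and P: "P \<in> syl p"
  shows "\<not> p dvd card (rcosets P)"
proof
  assume "p dvd card (rcosets P)"
  then have "p * card P dvd order G"
    using lagrange[OF syl_subgroup[OF P]] by (metis dvd_refl mult_dvd_mono)
  then have "p ^ Suc (multiplicity p (order G)) dvd order G" using P by (simp add: syl_def)
  then show False
    using p multiplicity_geI[of "order G" p "Suc (multiplicity p (order G))"] order_pos
    by (metis Suc_n_not_le_n less_numeral_extra(3) not_prime_unit)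
qed

lemma p_subgroup_subset_syl_conjugate:
  assumes "Factorial_Ring.prime p" "p_subgroup p H" "P \<in> syl p"
  shows "\<exists>g\<in>carrier G. H \<subseteq> conjugate g ` P"
  using p_subgroup_subset_conjugate[OF assms(1,2) syl_subgroup[OF assms(3)] card_rcosets_syl[OF assms(1,3)]] .

lemma conjugate_syl: "g \<in> carrier G \<Longrightarrow> P \<in> syl p \<Longrightarrow> conjugate g ` P \<in> syl p"
  by (simp add: syl_def subgroup_conjugate_image card_conjugate_image subgroup.subset)

lemma syl_conjugate:
  assumes "Factorial_Ring.prime p" "P \<in> syl p" "Q \<in> syl p"
  shows "\<exists>g\<in>carrier G. Q = conjugate g ` P"
proof -
  obtain g where g: "g \<in> carrier G" "Q \<subseteq> conjugate g ` P"
    using p_subgroup_subset_syl_conjugate[OF assms(1) syl_p_subgroup[OF assms(3)] assms(2)] by blast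
  then have "Q = conjugate g ` P"
    using conjugate_syl[OF g(1) assms(2)] assms(3) by (intro subgroup_eqI) (auto simp: syl_def)
  then show ?thesis using g by blast
qed

text \<open>As \<open>P\<close> normalizes \<open>H\<close>, the product H P is a p-subgroup
  containing the Sylow subgroup \<open>P\<close>, hence equal to it.\<close>

lemma normalized_p_subgroup_subset_syl:
  assumes p: "Factorial_Ring.prime p" and P: "P \<in> syl p" and H: "p_subgroup p H"
    and "\<And>g h. g \<in> P \<Longrightarrow> h \<in> H \<Longrightarrow> conjugate g h \<in> H"
  shows "H \<subseteq> P"
proof -
  have sH: "subgroup H G" and sP: "subgroup P G" using H P by (auto simp: p_subgroup_def syl_def)
  have sK: "subgroup (H <#> P) G" using subgroup_set_mult_normalized[OF sH sP] assms(4) by blast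
  obtain k where "card H = p ^ k" using H by (auto simp: p_subgroup_def)
  then have "card (H <#> P) dvd p ^ (k + multiplicity p (order G))"
    using card_set_mult[OF sH sP] P by (metis (mono_tags, lifting) dvd_triv_left mem_Collect_eq power_add syl_def)
  then have "p_subgroup p (H <#> P)"
    using sK p divides_primepow_nat by (auto simp: p_subgroup_def)
  then have "card (H <#> P) dvd card P" using p_subgroup_card_le[OF p _ P] by blast
  then have "P = H <#> P"
    using subgroup_eqI[OF sP sK subset_set_mult(2)[OF sH sP]] card_subgroup_pos[OF sP] dvd_imp_le by blast
  then show ?thesis using subset_set_mult(1)[OF sH sP] by blast
qed

text \<open>\<open>P\<close> acts on the Sylow p-subgroups by conjugation, and by
  \<open>normalized_p_subgroup_subset_syl\<close> its only fixed point is \<open>P\<close>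
  itself.\<close>

lemma card_syl_cong:
  assumes p: "Factorial_Ring.prime p"
  shows "[card (syl p) = 1] (mod p)"
proof -
  obtain P where P: "P \<in> syl p" using syl_nonempty[OF p] by blast
  interpret P: subgroup P G by (rule syl_subgroup[OF P])
  interpret A: subgroup_action G P "syl p" "\<lambda>g Q. conjugate g ` Q"
  proof
    fix Q assume Q: "Q \<in> syl p"
    then have sub: "Q \<subseteq> carrier G" using syl_subgroup subgroup.subset by blast
    show "conjugate g ` Q \<in> syl p" if "g \<in> P" for g using that Q conjugate_syl by simp
    show "conjugate \<one> ` Q = Q" using sub by (rule conjugate_image_one)
    show "conjugate (g \<otimes> h) ` Q = conjugate g ` conjugate h ` Q" if "g \<in> P" "h \<in> P" for g h
      using that sub by (simp add: conjugate_image_conjugate)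
  qed simp
  have "{Q \<in> syl p. \<forall>g\<in>P. conjugate g ` Q = Q} = {P}"
  proof (intro equalityI subsetI)
    fix Q assume Q: "Q \<in> {Q \<in> syl p. \<forall>g\<in>P. conjugate g ` Q = Q}"
    then have "Q \<subseteq> P" using normalized_p_subgroup_subset_syl[OF p P, of Q] syl_p_subgroup by blast
    then have "Q = P" using Q P by (intro subgroup_eqI) (auto simp: syl_def)
    then show "Q \<in> {P}" by simp
  next
    fix Q assume "Q \<in> {P}"
    moreover have "conjugate g ` P = P" if "g \<in> P" for g
    proof (rule card_seteq)
      show "conjugate g ` P \<subseteq> P" using that subgroup_conjugate_closed[OF P.subgroup_axioms] by blast
    qed (use that in \<open>simp_all add: card_conjugate_image P.subset finite_subgroup P.subgroup_axioms\<close>)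
    ultimately show "Q \<in> {Q \<in> syl p. \<forall>g\<in>P. conjugate g ` Q = Q}" using P by auto
  qed
  then show ?thesis using A.fixed_points_cong[OF p] P by (simp add: syl_def)
qed

lemma card_syl_index:
  assumes p: "Factorial_Ring.prime p" and P: "P \<in> syl p"
  shows "card (syl p) * card {g \<in> carrier G. conjugate g ` P = P} = order G"
    and "card P dvd card {g \<in> carrier G. conjugate g ` P = P}"
proof -
  interpret P: subgroup P G by (rule syl_subgroup[OF P])
  interpret C: subgroup "carrier G" G by (rule subgroup_self)
  interpret A: subgroup_action G "carrier G" "syl p" "\<lambda>g Q. conjugate g ` Q"
  proof
    fix Q assume Q: "Q \<in> syl p"
    then have sub: "Q \<subseteq> carrier G" using syl_subgroup subgroup.subset by blast
    show "conjugate g ` Q \<in> syl p" if "g \<in> carrier G" for g using that Q conjugate_syl by simp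
    show "conjugate \<one> ` Q = Q" using sub by (rule conjugate_image_one)
    show "conjugate (g \<otimes> h) ` Q = conjugate g ` conjugate h ` Q" if "g \<in> carrier G" "h \<in> carrier G" for g h
      using that sub by (simp add: conjugate_image_conjugate)
  qed simp
  have "(\<lambda>g. conjugate g ` P) ` carrier G = syl p"
    using syl_conjugate[OF p P] conjugate_syl[OF _ P] by blast
  then show "card (syl p) * card {g \<in> carrier G. conjugate g ` P = P} = order G"
    using A.orbit_stabilizer[OF P] by (simp add: order_def)
  show "card P dvd card {g \<in> carrier G. conjugate g ` P = P}"
  proof (rule card_subgroup_dvd)
    show "subgroup {g \<in> carrier G. conjugate g ` P = P} G"
    proof (rule subgroupI)
      fix g h assume gh: "g \<in> {g \<in> carrier G. conjugate g ` P = P}" "h \<in> {g \<in> carrier G. conjugate g ` P = P}"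
      then have "conjugate (inv g) ` conjugate g ` P = P"
        using conjugate_image_conjugate[of "inv g" g P] conjugate_image_one[OF P.subset] P.subset by simp
      then show "inv g \<in> {g \<in> carrier G. conjugate g ` P = P}" using gh by simp
      have "conjugate (g \<otimes> h) ` P = conjugate g ` conjugate h ` P"
        using gh conjugate_image_conjugate[of g h P] P.subset by simp
      then show "g \<otimes> h \<in> {g \<in> carrier G. conjugate g ` P = P}" using gh by simp
    qed (use conjugate_image_one[OF P.subset] in auto)
    show "P \<subseteq> {g \<in> carrier G. conjugate g ` P = P}"
    proof
      fix g assume g: "g \<in> P"
      have "conjugate g ` P = P"
      proof (rule card_seteq)
        show "conjugate g ` P \<subseteq> P" using g subgroup_conjugate_closed[OF P.subgroup_axioms] by blast
      qed (use g in \<open>simp_all add: card_conjugate_image P.subset finite_subgroup P.subgroup_axioms\<close>)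
      then show "g \<in> {g \<in> carrier G. conjugate g ` P = P}" using g by simp
    qed
  qed (rule P.subgroup_axioms)
qed

lemma card_syl_dvd:
  assumes "Factorial_Ring.prime p" "P \<in> syl p"
  shows "card (syl p) * card P dvd order G"
  using mult_dvd_mono[OF dvd_refl card_syl_index(2)[OF assms], of "card (syl p)"] card_syl_index(1)[OF assms]
  by simp

lemma syl_normal:
  assumes "Factorial_Ring.prime p" "card (syl p) \<le> 1" "P \<in> syl p"
  shows "P \<lhd> G"
proof -
  have "Q = P" if "Q \<in> syl p" for Q
    using assms that by (metis card_le_Suc0_iff_eq One_nat_def finite_syl)
  then have "conjugate g ` P = P" if "g \<in> carrier G" for g using conjugate_syl[OF that assms(3)] by blast
  then show ?thesis
    unfolding normal_iff_conjugate using syl_subgroup[OF assms(3)] by (metis imageI)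
qed

text \<open>Provides a central subgroup of order \<open>p\<close> of G/N inside M/N, phrased through
  a representative \<open>w\<close>. Conjugation permutes the cosets of \<open>N\<close> in
  \<open>M\<close>. Their number is divisible by \<open>p\<close>, hence so is the number of fixed
  ones, and since \<open>N\<close> is fixed there is another.\<close>

lemma p_group_chief_step:
  assumes p: "Factorial_Ring.prime p" and G: "order G = p ^ n"
    and N: "N \<lhd> G" and M: "M \<lhd> G" and "N \<subset> M"
  shows "\<exists>w\<in>M - N. w [^] p \<in> N \<and> (\<forall>g\<in>carrier G. \<exists>c\<in>N. conjugate g w = c \<otimes> w)"
proof -
  interpret N: normal N G by fact
  interpret M: normal M G by fact
  interpret C: subgroup "carrier G" G by (rule subgroup_self)
  interpret K: group "G\<lparr>carrier := M\<rparr>" by (simp add: subgroup_imp_group M.subgroup_axioms)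
  define S where "S = (\<lambda>m. N #> m) ` M"
  have sN: "subgroup N (G\<lparr>carrier := M\<rparr>)"
    using subgroup_incl[OF N.subgroup_axioms M.subgroup_axioms] \<open>N \<subset> M\<close> by blast
  have "rcosets\<^bsub>G\<lparr>carrier := M\<rparr>\<^esub> N = S"
    by (auto simp: RCOSETS_def S_def)
  with K.lagrange[OF sN] have lag: "card S * card N = card M" by (simp add: order_def)
  have act: "conjugate g ` (N #> m) = N #> conjugate g m" if "g \<in> carrier G" "m \<in> carrier G" for g m
  proof -
    have "conjugate g ` (N #> m) = (\<lambda>c. conjugate g c \<otimes> conjugate g m) ` N"
      using that by (auto simp: r_coset_def image_iff conjugate_mult)
    also have "\<dots> = (\<lambda>c. c \<otimes> conjugate g m) ` conjugate g ` N" by (simp add: image_image)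
    also have "\<dots> = N #> conjugate g m"
      using normal_conjugate_image[OF N that(1)] by (auto simp: r_coset_def)
    finally show ?thesis .
  qed
  interpret A: subgroup_action G "carrier G" S "\<lambda>g C. conjugate g ` C"
  proof
    show "finite S" using finite_subgroup[OF M.subgroup_axioms] by (simp add: S_def)
    fix C assume "C \<in> S"
    then obtain m where m: "m \<in> M" "C = N #> m" by (auto simp: S_def)
    show "conjugate g ` C \<in> S" if "g \<in> carrier G" for g
      using m that act normal_conjugate_closed[OF M] by (auto simp: S_def)
    have "C \<subseteq> carrier G" using m by (simp add: r_coset_subset_G N.subset)
    then show "conjugate \<one> ` C = C"
      and "\<And>g h. g \<in> carrier G \<Longrightarrow> h \<in> carrier G \<Longrightarrow> conjugate (g \<otimes> h) ` C = conjugate g ` conjugate h ` C"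
      by (simp_all add: conjugate_image_one conjugate_image_conjugate)
  qed
  have "card S dvd p ^ n"
    using lag card_subgroup_dvd_order[OF M.subgroup_axioms] G by (metis dvd_mult_left)
  then obtain i where i: "card S = p ^ i" using p divides_primepow_nat by blast
  have "i \<noteq> 0"
  proof
    assume "i = 0"
    then have "card N = card M" using lag i by simp
    then show False using \<open>N \<subset> M\<close> psubset_card_mono[OF finite_subgroup[OF M.subgroup_axioms]] by (metis less_irrefl)
  qed
  then have "p dvd card S" using i by simp
  define F where "F = {C \<in> S. \<forall>g\<in>carrier G. conjugate g ` C = C}"
  have "p dvd card F"
    using A.fixed_points_cong[OF p, of n] G \<open>p dvd card S\<close> by (simp add: F_def order_def cong_dvd_iff)
  moreover have NF: "N \<in> F"
    using normal_conjugate_image[OF N] imageI[OF M.one_closed, of "\<lambda>m. N #> m"]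
    by (simp add: F_def S_def coset_mult_one[OF N.subset])
  ultimately have "F \<noteq> {N}" using p by auto
  then have "\<exists>C\<in>F. C \<noteq> N" using NF by (metis empty_iff insertE insert_iff subsetI subset_antisym)
  then obtain C where C: "C \<in> S" "\<And>g. g \<in> carrier G \<Longrightarrow> conjugate g ` C = C" "C \<noteq> N"
    by (auto simp: F_def)
  then obtain m where m: "m \<in> M" "C = N #> m" by (auto simp: S_def)
  have mN: "m \<notin> N" using C(3) m coset_join2[of m N] N.subgroup_axioms by auto
  have mc: "\<exists>c\<in>N. conjugate g m = c \<otimes> m" if "g \<in> carrier G" for g
  proof -
    have "N #> conjugate g m = N #> m" using C(2)[OF that] act[OF that, of m] m by simp
    then have "conjugate g m \<in> N #> m"
      using rcos_self[of "conjugate g m"] that m N.subgroup_axioms by auto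
    then show ?thesis by (auto simp: r_coset_def)
  qed
  \<comment> \<open>Being fixed modulo \<open>N\<close> passes to powers of \<open>m\<close>, so
    \<open>w\<close> may be taken among them.\<close>
  have pow: "\<exists>c'\<in>N. (c \<otimes> m) [^] k = c' \<otimes> m [^] k" if "c \<in> N" for c and k :: nat
  proof (induction k)
    case (Suc k)
    then obtain c' where c': "c' \<in> N" "(c \<otimes> m) [^] k = c' \<otimes> m [^] k" by blast
    have "(c \<otimes> m) [^] Suc k = c' \<otimes> conjugate (m [^] k) c \<otimes> m [^] Suc k"
      using c' that m by (simp add: conjugate_def group_simps)
    moreover have "c' \<otimes> conjugate (m [^] k) c \<in> N"
      using c' that m normal_conjugate_closed[OF N] by simp
    ultimately show ?case by blast
  qed (use N.one_closed in auto)
  \<comment> \<open>\<open>m\<close> has p-power order modulo \<open>N\<close>; the last p-power of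
    \<open>m\<close> before entering \<open>N\<close> is the witness.\<close>
  define j where "j = (LEAST j. m [^] (p ^ j) \<in> N)"
  have "m [^] (p ^ n) \<in> N" using G m pow_order_eq_1[of m] by (simp flip: G)
  then have j: "m [^] (p ^ j) \<in> N" unfolding j_def by (rule LeastI)
  have "j \<noteq> 0" using j mN m by (metis M.mem_carrier nat_pow_eone power_0)
  then obtain j' where j': "j = Suc j'" using not0_implies_Suc by blast
  define w where "w = m [^] (p ^ j')"
  have "w \<notin> N" using not_less_Least[of j' "\<lambda>j. m [^] (p ^ j) \<in> N"] j' by (auto simp: w_def j_def)
  moreover have "w \<in> M" using m subgroup_nat_pow_closed[OF M.subgroup_axioms] by (simp add: w_def)
  moreover have "w [^] p \<in> N" using j j' m by (simp add: w_def nat_pow_pow mult.commute)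
  moreover have "\<exists>c\<in>N. conjugate g w = c \<otimes> w" if "g \<in> carrier G" for g
    using mc[OF that] pow[of _ "p ^ j'"] that m by (auto simp: w_def conjugate_pow)
  ultimately show ?thesis by blast
qed

end

section \<open>Groups of prime power order\<close>

lemma power_one_plus_cong: "[(1 + p * t) ^ j = 1 + j * (p * t)] (mod p\<^sup>2)" for p :: nat
proof (induction j)
  case (Suc j)
  have "(1 + p * t) * (1 + j * (p * t)) = 1 + Suc j * (p * t) + p\<^sup>2 * (j * t * t)"
    by (simp add: algebra_simps power2_eq_square)
  then have "[(1 + p * t) * (1 + j * (p * t)) = 1 + Suc j * (p * t)] (mod p\<^sup>2)"
    by (simp only: cong_def mod_mult_self2)
  moreover have "[(1 + p * t) ^ Suc j = (1 + p * t) * (1 + j * (p * t))] (mod p\<^sup>2)"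
    unfolding power_Suc by (rule cong_scalar_left[OF Suc])
  ultimately show ?case by (rule cong_trans[rotated])
qed simp

text \<open>This sum is the exponent that \<open>mult_power_conjugate\<close> gives for a p-th
  power. With r = 1 + p t it is p + (p (p - 1) / 2) p t modulo p^2, and for odd \<open>p\<close> the
  second term vanishes, so exactly one factor \<open>p\<close> divides it.\<close>

lemma sum_powers_odd_prime:
  fixes p r :: nat
  assumes "odd p" "p > 1" "[r = 1] (mod p)"
  obtains v where "(\<Sum>j<p. r ^ j) = p * v" "coprime v p"
proof -
  have "r \<noteq> 0" using assms by (metis cong_0_1_nat not_less_iff_gr_or_eq cong_def mod_0 mod_less zero_neq_one)
  then obtain t where t: "r = 1 + p * t"
    using assms(3) by (metis cong_to_1'_nat mult.commute)
  have "[(\<Sum>j<p. r ^ j) = (\<Sum>j<p. 1 + j * (p * t))] (mod p\<^sup>2)"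
    unfolding t by (intro cong_sum power_one_plus_cong)
  also have "(\<Sum>j<p. 1 + j * (p * t)) = p + (\<Sum>j<p. j) * (p * t)"
    by (simp only: sum.distrib sum_distrib_right) simp
  also have "(\<Sum>j<p. j) = p * ((p - 1) div 2)"
  proof -
    obtain q where q: "p = Suc (2 * q)" using assms(1) by (metis oddE Suc_eq_plus1)
    have "(\<Sum>j<n. j) * 2 = n * (n - 1)" for n :: nat
      by (induction n) (auto simp: algebra_simps nat_distrib split: nat_diff_split)
    from this[of p] show ?thesis by (simp add: q)
  qed
  also have "p + p * ((p - 1) div 2) * (p * t) = p + p\<^sup>2 * ((p - 1) div 2 * t)"
    by (simp add: algebra_simps power2_eq_square)
  also have "[\<dots> = p] (mod p\<^sup>2)" by (simp add: cong_def)
  finally have c: "[(\<Sum>j<p. r ^ j) = p] (mod p\<^sup>2)" .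
  have "p \<le> (\<Sum>j<p. r ^ j)"
    using sum_mono[of "{..<p}" "\<lambda>_. 1" "\<lambda>j. r ^ j"] \<open>r \<noteq> 0\<close> by simp
  then obtain u where u: "(\<Sum>j<p. r ^ j) = p + p\<^sup>2 * u"
    using c by (metis cong_le_nat mult.commute cong_sym_eq add.commute)
  then have "(\<Sum>j<p. r ^ j) = p * (1 + p * u)" by (simp add: algebra_simps power2_eq_square)
  moreover have "coprime (1 + p * u) p"
    by (metis coprime_1_left coprime_iff_gcd_eq_1 gcd.commute gcd_add_mult mult.commute add.commute)
  ultimately show ?thesis using that by blast
qed

lemma coprime_linear_cong_0:
  fixes v s n :: nat
  assumes "coprime v n" "n > 0"
  obtains i where "n dvd i * v + s"
proof -
  obtain x where x: "[v * x = 1] (mod n)" using cong_solve_coprime_nat[OF assms(1)] by auto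
  have "[x * (s * (n - 1)) * v + s = 1 * (s * (n - 1)) + s] (mod n)"
    using x cong_scalar_right[of "v * x" 1 n "s * (n - 1)"] by (metis cong_add_rcancel_nat mult.assoc mult.commute)
  also have "1 * (s * (n - 1)) + s = s * n" using assms(2) by (cases n) (simp_all add: algebra_simps)
  also have "[s * n = 0] (mod n)" by (simp add: cong_0_iff)
  finally show ?thesis using that by (simp add: cong_0_iff)
qed

context group
begin

lemma generate_singleton_normalI:
  assumes "x \<in> carrier G" "\<And>g. g \<in> carrier G \<Longrightarrow> conjugate g x \<in> generate G {x}"
  shows "generate G {x} \<lhd> G"
proof -
  have "conjugate g h \<in> generate G {x}" if "g \<in> carrier G" "h \<in> generate G {x}" for g h
  proof -
    have "conjugate g h \<in> generate G {conjugate g x}"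
      using that assms(1) by (simp add: generate_conjugate)
    then show ?thesis using assms that(1) generate_singleton_le_iff[of "conjugate g x" x] by auto
  qed
  then show ?thesis using assms(1) by (simp add: normal_iff_conjugate generate_singleton_subgroup)
qed

text \<open>Moving all factors \<open>a\<close> to the left past w^j turns a^i into a^(i r^j). Used
  to correct \<open>w\<close> by a power of \<open>a\<close> and to compute orders in metacyclic
  groups.\<close>

lemma mult_power_conjugate:
  assumes a: "a \<in> carrier G" and w: "w \<in> carrier G" and r: "conjugate w a = a [^] (r::nat)"
  shows "(a [^] (i::nat) \<otimes> w) [^] (n::nat) = a [^] (i * (\<Sum>j<n. r ^ j)) \<otimes> w [^] n"
proof (induction n)
  case (Suc n)
  have "conjugate w (a [^] k) = a [^] (r * k)" for k :: nat
    using a w r by (simp add: conjugate_pow nat_pow_pow)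
  then have *: "w \<otimes> a [^] k = a [^] (r * k) \<otimes> w" for k :: nat
    using a w conjugate_eq_mult_iff by simp
  let ?s = "\<Sum>j<n. r ^ j"
  have "(a [^] i \<otimes> w) [^] Suc n = (a [^] i \<otimes> w) \<otimes> (a [^] (i * ?s) \<otimes> w [^] n)"
    using a w Suc nat_pow_Suc2[of "a [^] i \<otimes> w" n] by simp
  also have "\<dots> = a [^] i \<otimes> (w \<otimes> a [^] (i * ?s)) \<otimes> w [^] n" using a w by (simp add: m_assoc)
  also have "\<dots> = (a [^] i \<otimes> a [^] (r * (i * ?s))) \<otimes> (w \<otimes> w [^] n)" using a w by (simp add: * m_assoc)
  also have "a [^] i \<otimes> a [^] (r * (i * ?s)) = a [^] (i * (\<Sum>j<Suc n. r ^ j))"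
    using a by (simp only: nat_pow_mult sum.lessThan_Suc_shift sum_distrib_left)
      (simp add: algebra_simps sum_distrib_left)
  finally show ?case using w nat_pow_Suc2[of w n] by simp
qed (use a w in auto)

end

context finite_group
begin

lemma ord_le_imp_generate_eq:
  "x \<in> carrier G \<Longrightarrow> y \<in> carrier G \<Longrightarrow> x \<in> generate G {y} \<Longrightarrow> ord y \<le> ord x \<Longrightarrow> generate G {x} = generate G {y}"
  by (rule subgroup_eqI) (simp_all add: generate_singleton_subgroup generate_singleton_le_iff card_generate_singleton)

text \<open>x^j generates the same subgroup as x^(p^i), where p^i is the gcd of \<open>j\<close> and
  p^k, and different \<open>i\<close> give different orders.\<close>

lemma card_cyc_prime_power:
  assumes p: "Factorial_Ring.prime p" and x: "x \<in> carrier G" and ord: "ord x = p ^ k"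
  shows "card (cyc (generate G {x})) = k + 1"
proof -
  have ordi: "ord (x [^] (p ^ i)) = p ^ (k - i)" if "i \<le> k" for i
    using that ord_pow[OF x, of "p ^ i"] p ord
    by (simp add: le_imp_power_dvd power_diff prime_gt_0_nat)
  have "cyc (generate G {x}) = (\<lambda>i. generate G {x [^] (p ^ i)}) ` {..k}"
  proof (intro equalityI subsetI)
    fix C assume "C \<in> cyc (generate G {x})"
    then obtain y where y: "y \<in> generate G {x}" "C = generate G {y}" by (rule cycE)
    then obtain j :: nat where j: "y = x [^] j" using x by (auto simp: generate_singleton_iff)
    obtain i where i: "i \<le> k" "gcd j (p ^ k) = p ^ i"
      using divides_primepow_nat[OF p, of "gcd j (p ^ k)" k] by auto
    have "coprime (j div p ^ i) (p ^ k div p ^ i)"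
      using div_gcd_coprime[of j "p ^ k"] p i by (auto simp: prime_gt_0_nat)
    then have "coprime (j div p ^ i) (ord (x [^] (p ^ i)))"
      using i ordi p by (simp add: power_diff prime_gt_0_nat)
    moreover have "(x [^] (p ^ i)) [^] (j div p ^ i) = y"
      using j x i by (metis dvd_mult_div_cancel gcd_dvd1 nat_pow_pow)
    ultimately have "C = generate G {x [^] (p ^ i)}"
      using generate_pow_eq_iff[of "x [^] (p ^ i)" "j div p ^ i"] x y by simp
    then show "C \<in> (\<lambda>i. generate G {x [^] (p ^ i)}) ` {..k}" using i by blast
  next
    fix C assume "C \<in> (\<lambda>i. generate G {x [^] (p ^ i)}) ` {..k}"
    then obtain i where "C = generate G {x [^] (p ^ i)}" by blast
    moreover have "x [^] (p ^ i) \<in> generate G {x}" using x by (auto simp: generate_singleton_iff)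
    ultimately show "C \<in> cyc (generate G {x})" using generate_mem_cyc by metis
  qed
  moreover have "inj_on (\<lambda>i. generate G {x [^] (p ^ i)}) {..k}"
  proof (rule inj_onI)
    fix i j assume ij: "i \<in> {..k}" "j \<in> {..k}" "generate G {x [^] (p ^ i)} = generate G {x [^] (p ^ j)}"
    then have "p ^ (k - i) = p ^ (k - j)" using ordi x by (metis atMost_iff card_generate_singleton nat_pow_closed)
    then show "i = j" using ij p by (metis atMost_iff diff_diff_cancel prime_gt_1_nat power_inject_exp)
  qed
  ultimately show ?thesis by (simp add: card_image)
qed

text \<open>Maximality is by order, which makes existence immediate. It is applied only to a cyclic
  subgroup containing \<open><a>\<close>, where it excludes proper containment.\<close>

definition maximal_normal_cyclic :: "'a \<Rightarrow> bool" where
  "maximal_normal_cyclic a \<longleftrightarrow> a \<in> carrier G \<and> generate G {a} \<lhd> G \<and>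
    (\<forall>b\<in>carrier G. generate G {b} \<lhd> G \<longrightarrow> ord b \<le> ord a)"

lemma maximal_normal_cyclic_exists: "\<exists>a. maximal_normal_cyclic a"
proof -
  have "\<exists>a. (a \<in> carrier G \<and> generate G {a} \<lhd> G) \<and>
      (\<forall>b. b \<in> carrier G \<and> generate G {b} \<lhd> G \<longrightarrow> ord b \<le> ord a)"
  proof (rule ex_has_greatest_nat)
    show "\<one> \<in> carrier G \<and> generate G {\<one>} \<lhd> G"
      using generate_one one_is_normal by simp
    show "\<forall>b. b \<in> carrier G \<and> generate G {b} \<lhd> G \<longrightarrow> ord b < Suc (order G)"
      by (simp add: ord_le_group_order less_Suc_eq_le)
  qed
  then show ?thesis by (auto simp: maximal_normal_cyclic_def)
qed

text \<open>If w^p generated \<open><a>\<close>, then \<open><w>\<close> would contain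
  \<open><a>\<close>, be normal because conjugation changes \<open>w\<close> only by factors in
  \<open><a>\<close>, and be larger. So the exponent of w^p is a multiple of \<open>p\<close>. The
  same argument shows that \<open><a>\<close> is not trivial.\<close>

lemma maximal_normal_cyclic_step:
  assumes p: "Factorial_Ring.prime p" and G: "order G = p ^ n"
    and a: "maximal_normal_cyclic a" and w: "w \<in> carrier G" "w \<notin> generate G {a}"
    and wp: "w [^] p \<in> generate G {a}"
    and comm: "\<And>g. g \<in> carrier G \<Longrightarrow> \<exists>c\<in>generate G {a}. conjugate g w = c \<otimes> w"
  obtains m s where "ord a = p ^ Suc m" "w [^] p = a [^] (p * s)"
proof -
  have ac: "a \<in> carrier G" using a by (simp add: maximal_normal_cyclic_def)
  obtain k where k: "ord a = p ^ k"
    using ord_dvd_group_order[OF ac] G divides_primepow_nat[OF p] by auto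
  obtain s :: nat where s: "w [^] p = a [^] s" using wp ac by (auto simp: generate_singleton_iff)
  have nc: "\<not> coprime s (ord a)"
  proof
    assume "coprime s (ord a)"
    then have "generate G {w [^] p} = generate G {a}" using generate_pow_eq_iff[OF ac] s by simp
    then have aw: "a \<in> generate G {w}"
      using generate_singleton_self[of a] w(1) generate_singleton_le_iff[of "w [^] p" w]
      by (auto simp: generate_singleton_iff)
    then have sub: "generate G {a} \<subseteq> generate G {w}" using ac w by (simp add: generate_singleton_le_iff)
    have "conjugate g w \<in> generate G {w}" if "g \<in> carrier G" for g
    proof -
      obtain c where "c \<in> generate G {a}" "conjugate g w = c \<otimes> w" using comm \<open>g \<in> carrier G\<close> by metis
      then show ?thesis using sub subgroup.m_closed[OF generate_singleton_subgroup[OF w(1)]] generate_singleton_self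
        by (metis subsetD)
    qed
    then have "generate G {w} \<lhd> G" using w(1) generate_singleton_normalI by blast
    then have "ord w \<le> ord a" using a w(1) by (simp add: maximal_normal_cyclic_def)
    then have "generate G {a} = generate G {w}" using ord_le_imp_generate_eq ac w aw by metis
    then show False using w(2) generate_singleton_self by metis
  qed
  then obtain m where m: "k = Suc m" using k by (cases k) auto
  have "p dvd s" using nc k p by (metis coprime_commute coprime_power_left_iff prime_imp_coprime_nat)
  then obtain s' where "s = p * s'" by blast
  then show ?thesis using that k m s by blast
qed

text \<open>Since w^p commutes with \<open>a\<close>, the exponent \<open>r\<close> of the action
  satisfies r^p = 1 and, by Fermat, r = 1 modulo \<open>p\<close>. Then (a^i w)^p = a^(p (i v + s))
  with \<open>v\<close> prime to \<open>p\<close>, and \<open>i\<close> is chosen so that p^m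
  divides i v + s.\<close>

lemma odd_prime_order_complement:
  assumes p: "Factorial_Ring.prime p" "odd p" and a: "a \<in> carrier G" and w: "w \<in> carrier G"
    and ord: "ord a = p ^ Suc m" and conj: "conjugate w a \<in> generate G {a}" and wp: "w [^] p = a [^] (p * s)"
  obtains i :: nat where "(a [^] i \<otimes> w) [^] p = \<one>"
proof -
  obtain r :: nat where r: "conjugate w a = a [^] r" using conj a by (auto simp: generate_singleton_iff)
  have "conjugate (w [^] j) a = a [^] (r ^ j)" for j :: nat
  proof (induction j)
    case (Suc j)
    have "conjugate (w [^] Suc j) a = conjugate (w [^] j) (a [^] r)"
      using a w r by (simp flip: conjugate_conjugate)
    also have "\<dots> = a [^] (r ^ Suc j)"
      using a w Suc by (simp add: conjugate_pow nat_pow_pow mult.commute)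
    finally show ?case .
  qed (use a in simp)
  then have "conjugate (w [^] p) a = a [^] (r ^ p)" .
  moreover have "conjugate (w [^] p) a = a"
    using a w nat_pow_comm[OF a, of "p * s" 1] by (simp add: wp conjugate_eq_iff_commute)
  ultimately have "a [^] (r ^ p) = a [^] (1::nat)" using a by simp
  then have "[r ^ p = 1] (mod p ^ Suc m)" using pow_eq_iff[OF a] ord by metis
  then have rp: "[r ^ p = 1] (mod p)" by (rule cong_dvd_modulus_nat) simp
  have "\<not> p dvd r"
  proof
    assume "p dvd r"
    then have "p dvd r ^ p" using p(1) prime_gt_0_nat by (simp add: dvd_power_same prime_dvd_power_iff)
    then have "p dvd 1" using rp cong_dvd_iff by blast
    then show False using p(1) by simp
  qed
  then have "[r ^ (p - 1) = 1] (mod p)"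
    using p(1) by (intro fermat_theorem)
  then have "[r ^ (p - 1) * r = 1 * r] (mod p)" by (rule cong_scalar_right)
  then have "[r = 1] (mod p)"
    using rp p(1) prime_gt_0_nat[of p] by (metis cong_sym cong_trans mult_1 power_minus_mult)
  then obtain v where v: "(\<Sum>j<p. r ^ j) = p * v" "coprime v p"
    using sum_powers_odd_prime p(2) prime_gt_1_nat[OF p(1)] by metis
  obtain i where i: "p ^ m dvd i * v + s"
    using coprime_linear_cong_0[of v "p ^ m" s] v(2) p(1) prime_gt_0_nat by auto
  have "(a [^] i \<otimes> w) [^] p = a [^] (i * (p * v)) \<otimes> a [^] (p * s)"
    using mult_power_conjugate[OF a w r, of i p] v wp by simp
  also have "\<dots> = a [^] (p * (i * v + s))" using a by (simp add: nat_pow_mult algebra_simps)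
  also have "\<dots> = \<one>" using a i ord by (simp add: pow_eq_id)
  finally show ?thesis using that by blast
qed

text \<open>One subgroup of order \<open>p\<close> lies in a maximal normal cyclic
  \<open><a>\<close>; the corrected element a^i w generates another one outside. Oddness matters:
  generalized quaternion groups have only one involution.\<close>

lemma odd_noncyclic_two_prime_subgroups:
  assumes p: "Factorial_Ring.prime p" "odd p" and G: "order G = p ^ n"
    and nc: "\<And>x. x \<in> carrier G \<Longrightarrow> generate G {x} \<noteq> carrier G"
  obtains x y where "x \<in> carrier G" "y \<in> carrier G" "ord x = p" "ord y = p" "generate G {x} \<noteq> generate G {y}"
proof -
  obtain a where a: "maximal_normal_cyclic a" using maximal_normal_cyclic_exists by blast
  then have ac: "a \<in> carrier G" and an: "generate G {a} \<lhd> G" by (simp_all add: maximal_normal_cyclic_def)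
  have "generate G {a} \<subset> carrier G"
    using nc[OF ac] subgroup.subset[OF generate_singleton_subgroup[OF ac]] by blast
  then obtain w where w: "w \<in> carrier G" "w \<notin> generate G {a}" "w [^] p \<in> generate G {a}"
      "\<And>g. g \<in> carrier G \<Longrightarrow> \<exists>c\<in>generate G {a}. conjugate g w = c \<otimes> w"
    using p_group_chief_step[OF p(1) G an normal_self] by auto
  obtain m s where ms: "ord a = p ^ Suc m" "w [^] p = a [^] (p * s)"
    using maximal_normal_cyclic_step[OF p(1) G a w] by blast
  have "conjugate w a \<in> generate G {a}"
    using normal_conjugate_closed[OF an w(1)] generate_singleton_self by blast
  then obtain i :: nat where i: "(a [^] i \<otimes> w) [^] p = \<one>"
    using odd_prime_order_complement[OF p ac w(1) ms(1) _ ms(2)] by blast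
  define y where "y = a [^] i \<otimes> w"
  have yc: "y \<in> carrier G" using ac w by (simp add: y_def)
  have ain: "a [^] i \<in> generate G {a}" using ac by (auto simp: generate_singleton_iff)
  have yn: "y \<notin> generate G {a}"
  proof
    assume "y \<in> generate G {a}"
    then have "inv (a [^] i) \<otimes> y \<in> generate G {a}"
      using ain generate_singleton_subgroup[OF ac] subgroup.m_closed subgroup.m_inv_closed by metis
    then show False using w ac by (simp add: y_def inv_mult_cancel)
  qed
  have "ord y dvd p" using i yc by (simp add: y_def flip: pow_eq_id)
  moreover have "y \<noteq> \<one>" using yn subgroup.one_closed[OF generate_singleton_subgroup[OF ac]] by blast
  ultimately have oy: "ord y = p" using p(1) ord_eq_1[OF yc] prime_nat_iff by blast
  define x where "x = a [^] (p ^ m)"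
  have xc: "x \<in> carrier G" using ac by (simp add: x_def)
  have ox: "ord x = p" using ord_pow[OF ac, of "p ^ m"] ms(1) p(1) prime_gt_0_nat by (simp add: x_def)
  have "x \<in> generate G {a}" using ac by (auto simp: generate_singleton_iff x_def)
  then have "generate G {x} \<subseteq> generate G {a}" using xc ac by (simp add: generate_singleton_le_iff)
  then have "generate G {x} \<noteq> generate G {y}" using yn generate_singleton_self by blast
  then show ?thesis using that xc yc ox oy by blast
qed

end

section \<open>2-groups without a normal four-group\<close>

context group
begin

lemma pow_2: "x \<in> carrier G \<Longrightarrow> x [^] (2::nat) = x \<otimes> x"
  by (simp add: numeral_2_eq_2)

lemma involution_pow:
  assumes "z \<in> carrier G" "z \<otimes> z = \<one>"
  shows "z [^] (j::nat) = (if even j then \<one> else z)"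
  by (induction j) (use assms in auto)

lemma cyc_subgroup_disjoint:
  assumes "subgroup H G" "S \<subseteq> carrier G" "H \<inter> S = {}"
  shows "cyc H \<inter> cyc S = {}"
proof -
  have False if "C \<in> cyc H" "C \<in> cyc S" for C
    using that generate_mem_cyc_iff[OF assms(1)] assms(2,3) by (metis cycE disjoint_iff subsetD)
  then show ?thesis by blast
qed

text \<open>Then {1, z, t, t z} is a normal four-group with \<open>z\<close> central in
  \<open>G\<close>; conjugation moves \<open>t\<close> at most to t z. In a 2-group every normal
  four-group contains such a \<open>z\<close>.\<close>

definition klein_pair :: "'a \<Rightarrow> 'a \<Rightarrow> bool" where
  "klein_pair z t \<longleftrightarrow> z \<in> carrier G \<and> t \<in> carrier G \<and> z \<noteq> \<one> \<and> t \<noteq> \<one> \<and> t \<noteq> z \<and>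
    z \<otimes> z = \<one> \<and> t \<otimes> t = \<one> \<and> (\<forall>g\<in>carrier G. conjugate g z = z \<and> conjugate g t \<in> {t, t \<otimes> z})"

end

context finite_group
begin

text \<open>If \<open>w\<close> acts by an exponent that is 1 modulo 4, then 1 + r is twice an odd
  number and \<open>w\<close> can be corrected to an involution a^i w, just as for odd primes. This
  involution would form a \<open>klein_pair\<close> with the involution of \<open><a>\<close>, so
  only exponents that are 3 modulo 4 survive.\<close>

lemma no_klein_pair_action:
  assumes G: "order G = 2 ^ n" and a: "maximal_normal_cyclic a"
    and nk: "\<And>z t. \<not> klein_pair z t"
    and w: "w \<in> carrier G" "w \<notin> generate G {a}" "w [^] (2::nat) \<in> generate G {a}"
    and comm: "\<And>g. g \<in> carrier G \<Longrightarrow> \<exists>c\<in>generate G {a}. conjugate g w = c \<otimes> w"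
    and r: "conjugate w a = a [^] (r::nat)"
  shows "\<exists>m. ord a = 2 ^ Suc m \<and> 1 \<le> m \<and> r mod 4 = 3 \<and> w [^] (2::nat) \<in> {\<one>, a [^] (2 ^ m :: nat)}"
proof -
  have p2: "Factorial_Ring.prime (2::nat)" by simp
  have ac: "a \<in> carrier G" and an: "generate G {a} \<lhd> G"
    using a by (simp_all add: maximal_normal_cyclic_def)
  obtain m s where ms: "ord a = 2 ^ Suc m" "w [^] (2::nat) = a [^] (2 * s :: nat)"
    by (rule maximal_normal_cyclic_step[OF p2 G a w comm])
  define z where "z = a [^] (2 ^ m :: nat)"
  have zc: "z \<in> carrier G" using ac by (simp add: z_def)
  have oz: "ord z = 2" using ord_pow[OF ac, of "2 ^ m"] ms(1) by (simp add: z_def)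
  have z1: "z \<noteq> \<one>" using oz ord_eq_1[OF zc] by auto
  have zz: "z \<otimes> z = \<one>" using pow_ord_eq_1[OF zc] oz pow_2[OF zc] by simp
  have zA: "a [^] j \<in> {\<one>, z}" if j: "2 ^ m dvd j" for j :: nat
  proof -
    obtain q where q: "j = 2 ^ m * q" using j by blast
    then have "a [^] j = z [^] q" using ac by (simp add: z_def nat_pow_pow)
    then show ?thesis using involution_pow[OF zc zz, of q] by simp
  qed
  have act: "\<exists>k::nat. conjugate g a = a [^] k \<and> odd k" if g: "g \<in> carrier G" for g
  proof -
    have "conjugate g a \<in> generate G {a}"
      using normal_conjugate_closed[OF an g] generate_singleton_self by blast
    then obtain k :: nat where k: "conjugate g a = a [^] k" using ac by (auto simp: generate_singleton_iff)
    then have "ord (a [^] k) = ord a" using ord_conjugate[OF g ac] by simp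
    then have "coprime k (ord a)" using ac pow_ord_eq_ord_iff by simp
    then show ?thesis using k ms(1) by auto
  qed
  have zcen: "conjugate g z = z" if g: "g \<in> carrier G" for g
  proof -
    obtain k :: nat where k: "conjugate g a = a [^] k" "odd k" using act[OF g] by blast
    then have "conjugate g z = z [^] k"
      using g ac by (simp add: z_def conjugate_pow nat_pow_pow mult.commute)
    then show ?thesis using involution_pow[OF zc zz, of k] k by simp
  qed
  have odd_r: "odd r"
  proof -
    obtain k :: nat where k: "conjugate w a = a [^] k" "odd k" using act[OF w(1)] by blast
    then have "[r = k] (mod 2 ^ Suc m)" using r ms(1) pow_eq_iff[OF ac] by metis
    then have "[r = k] (mod 2)" by (rule cong_dvd_modulus_nat) simp
    then show ?thesis using k(2) by (simp add: cong_def odd_iff_mod_2_eq_one)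
  qed
  \<comment> \<open>Stated for every exponent describing the action, since exponents count only
    modulo \<open>ord a\<close>: it is applied to \<open>r\<close> and, when
    \<open>ord a = 2\<close>, to 1.\<close>
  have no1: False if r': "conjugate w a = a [^] r'" "r' mod 4 = 1" for r' :: nat
  proof -
    obtain q where q: "r' = 4 * q + 1" using r'(2) by (metis mod_mult_div_eq add.commute)
    define v where "v = 2 * q + 1"
    have v: "1 + r' = 2 * v" "odd v" using q by (simp_all add: v_def)
    obtain i where i: "2 ^ m dvd i * v + s"
      using coprime_linear_cong_0[of v "2 ^ m" s] v(2) by auto
    define y where "y = a [^] i \<otimes> w"
    have yc: "y \<in> carrier G" using ac w by (simp add: y_def)
    have sum2: "(\<Sum>j<2. r' ^ j) = 2 * v" using v(1) by (simp add: numeral_2_eq_2)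
    have "y [^] (2::nat) = a [^] (i * (2 * v)) \<otimes> a [^] (2 * s)"
      using mult_power_conjugate[OF ac w(1) r'(1), of i 2] ms(2) sum2 by (simp add: y_def)
    also have "\<dots> = a [^] (2 * (i * v + s))" using ac by (simp add: nat_pow_mult algebra_simps)
    also have "\<dots> = \<one>"
      using pow_eq_id[OF ac, of "2 * (i * v + s)"] ms(1) mult_dvd_mono[OF dvd_refl i, of 2] by simp
    finally have y2: "y [^] (2::nat) = \<one>" .
    have ain: "a [^] j \<in> generate G {a}" for j :: nat using ac by (auto simp: generate_singleton_iff)
    note sub = generate_singleton_subgroup[OF ac]
    have yn: "y \<notin> generate G {a}"
    proof
      assume "y \<in> generate G {a}"
      then have "inv (a [^] i) \<otimes> y \<in> generate G {a}"
        using ain sub subgroup.m_closed subgroup.m_inv_closed by metis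
      then show False using w ac by (simp add: y_def inv_mult_cancel)
    qed
    have ya: "conjugate y a = a [^] r'"
    proof -
      have "conjugate y a = conjugate (a [^] i) (a [^] r')"
        using ac w r' by (simp add: y_def flip: conjugate_conjugate)
      also have "\<dots> = a [^] r'" using ac by (simp add: conjugate_eq_iff_commute nat_pow_comm)
      finally show ?thesis .
    qed
    \<comment> \<open>A conjugate of \<open>y\<close> has the form a^j y and squares to 1. This
      forces a^(2 v j) = 1 with \<open>v\<close> odd, so a^j is 1 or \<open>z\<close>.\<close>
    have conj: "conjugate g y \<in> {y, y \<otimes> z}" if g: "g \<in> carrier G" for g
    proof -
      obtain c where c: "c \<in> generate G {a}" "conjugate g w = c \<otimes> w" using comm[OF g] by blast
      have cc: "c \<in> carrier G" using c(1) ac generate_singleton_in_carrier by blast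
      have d: "conjugate g (a [^] i) \<in> generate G {a}" using normal_conjugate_closed[OF an g ain] .
      have "conjugate g (a [^] i) \<otimes> c \<otimes> inv (a [^] i) \<in> generate G {a}"
        using d c(1) ain sub subgroup.m_closed subgroup.m_inv_closed by metis
      then obtain j :: nat where j: "conjugate g (a [^] i) \<otimes> c \<otimes> inv (a [^] i) = a [^] j"
        using ac by (auto simp: generate_singleton_iff)
      have "conjugate g y = conjugate g (a [^] i) \<otimes> c \<otimes> w"
        using g ac w c cc by (simp add: y_def conjugate_mult m_assoc)
      also have "\<dots> = (conjugate g (a [^] i) \<otimes> c \<otimes> inv (a [^] i)) \<otimes> y"
        using g ac w cc by (simp add: y_def group_simps)
      finally have gy: "conjugate g y = a [^] j \<otimes> y" using j by simp
      have "(a [^] j \<otimes> y) [^] (2::nat) = \<one>"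
        using g yc y2 by (simp flip: gy conjugate_pow)
      then have "a [^] (j * (2 * v)) = \<one>"
        using mult_power_conjugate[OF ac yc ya, of j 2] y2 sum2 ac by simp
      then have "2 ^ m dvd j * v" using ac ms(1) by (simp add: pow_eq_id)
      then have "2 ^ m dvd j" using v(2) by (simp add: coprime_dvd_mult_left_iff)
      then have "a [^] j \<in> {\<one>, z}" by (rule zA)
      moreover have "z \<otimes> y = y \<otimes> z" using zcen[OF yc] conjugate_eq_iff_commute[OF yc zc] by simp
      ultimately show ?thesis using gy yc by auto
    qed
    have "z \<in> generate G {a}" using ain by (simp add: z_def)
    then have "klein_pair z y"
      using zc yc z1 zz zcen conj yn y2 subgroup.one_closed[OF sub] pow_2[OF yc]
      unfolding klein_pair_def by metis
    then show False using nk by blast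
  qed
  have m1: "1 \<le> m"
  proof (rule ccontr)
    assume "\<not> 1 \<le> m"
    then have "ord a = 2" using ms(1) by simp
    then have "a [^] r = a [^] (1::nat)" using odd_r pow_eq_iff[OF ac, of r 1] by (simp add: cong_def odd_iff_mod_2_eq_one)
    then show False using no1[of 1] r by simp
  qed
  have "r mod 4 \<noteq> 1" using no1[OF r] by blast
  then have r3: "r mod 4 = 3" using odd_r by presburger
  obtain q where q: "r = 4 * q + 3" using r3 by (metis mod_mult_div_eq add.commute)
  \<comment> \<open>\<open>w\<close> commutes with its square a^(2 s). As r - 1 is twice an odd
    number, \<open>ord a\<close> divides 4 s, so w^2 is 1 or \<open>z\<close>.\<close>
  have "conjugate w (a [^] (2 * s)) = a [^] (2 * s)"
    using w(1) nat_pow_comm[of w 1 2] by (simp add: conjugate_eq_iff_commute flip: ms(2))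
  then have "a [^] (r * (2 * s)) = a [^] (2 * s)"
    using w(1) ac r by (simp add: conjugate_pow nat_pow_pow)
  then have "[2 * s + 4 * (s * (2 * q + 1)) = 2 * s] (mod 2 ^ Suc m)"
    using pow_eq_iff[OF ac] ms(1) q by (simp add: algebra_simps)
  then have "2 * 2 ^ m dvd 4 * (s * (2 * q + 1))"
    by (simp only: cong_add_lcancel_0_nat cong_0_iff power_Suc)
  also have "4 * (s * (2 * q + 1)) = 2 * (2 * s * (2 * q + 1))" by simp
  finally have "2 * 2 ^ m dvd 2 * (2 * s * (2 * q + 1))" .
  then have "2 ^ m dvd 2 * s * (2 * q + 1)" by (simp only: nat_mult_dvd_cancel_disj) simp
  then have "2 ^ m dvd 2 * s" by (simp add: coprime_dvd_mult_left_iff del: mult_Suc_right)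
  then have "w [^] (2::nat) \<in> {\<one>, z}" using zA ms(2) by simp
  then show ?thesis using ms(1) m1 r3 by (auto simp: z_def)
qed

text \<open>The elements acting on \<open><a>\<close> by an exponent 1 modulo 4 form a normal
  subgroup \<open>D\<close>, and \<open>no_klein_pair_action\<close> reduces it to
  \<open>A = <a>\<close>. Two elements outside \<open>A\<close> have their product in
  \<open>D\<close>, so \<open>A\<close> has index 2 and the elements outside have order 2 or 4, as
  in dihedral, semidihedral and generalized quaternion groups. Counting leaves a single
  configuration to exclude.\<close>

lemma two_group_no_klein_pair:
  assumes G: "order G = 2 ^ n" and nk: "\<And>z t. \<not> klein_pair z t"
    and nc: "\<And>x. x \<in> carrier G \<Longrightarrow> generate G {x} \<noteq> carrier G"
  shows "card (cyc (carrier G)) \<noteq> 11"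
proof -
  have p2: "Factorial_Ring.prime (2::nat)" by simp
  obtain a where a: "maximal_normal_cyclic a" using maximal_normal_cyclic_exists by blast
  define A where "A = generate G {a}"
  have ac: "a \<in> carrier G" and an: "A \<lhd> G"
    using a by (simp_all add: maximal_normal_cyclic_def A_def)
  have sA: "subgroup A G" using ac by (simp add: A_def generate_singleton_subgroup)
  interpret A: subgroup A G by (rule sA)
  have ain: "a [^] j \<in> A" for j :: nat using ac by (auto simp: generate_singleton_iff A_def)
  have aE: "\<exists>k::nat. x = a [^] k" if "x \<in> A" for x using that ac by (simp add: A_def generate_singleton_iff)
  have act: "\<exists>k::nat. conjugate g a = a [^] k" if g: "g \<in> carrier G" for g
    using normal_conjugate_closed[OF an g] generate_singleton_self aE unfolding A_def by blast
  have "A \<noteq> carrier G" using nc[OF ac] by (simp add: A_def)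
  then have AG: "A \<subset> carrier G" using A.subset by blast
  define D where "D = {g \<in> carrier G. \<exists>k. conjugate g a = a [^] (4 * k + 1 :: nat)}"
  have comp: "conjugate (g \<otimes> h) a = a [^] (k * l)"
    if "g \<in> carrier G" "h \<in> carrier G" "conjugate g a = a [^] k" "conjugate h a = a [^] l" for g h and k l :: nat
    using that ac by (simp add: conjugate_pow nat_pow_pow flip: conjugate_conjugate)
  have D_mult: "g \<otimes> h \<in> D" if gh: "g \<in> D" "h \<in> D" for g h
  proof -
    obtain k l where kl: "conjugate g a = a [^] (4 * k + 1 :: nat)" "conjugate h a = a [^] (4 * l + 1 :: nat)"
      using gh unfolding D_def by blast
    have "conjugate (g \<otimes> h) a = a [^] ((4 * k + 1) * (4 * l + 1))"
      by (rule comp[OF _ _ kl]) (use gh in \<open>simp_all add: D_def\<close>)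
    also have "(4 * k + 1) * (4 * l + 1) = 4 * (4 * k * l + k + l) + 1" by (simp add: algebra_simps)
    finally show ?thesis using gh unfolding D_def by blast
  qed
  have AD: "A \<subseteq> D"
  proof
    fix g assume g: "g \<in> A"
    then obtain k :: nat where "g = a [^] k" using aE by blast
    then have "conjugate g a = a [^] (4 * 0 + 1 :: nat)"
      using ac nat_pow_comm[OF ac, of k 1] by (simp add: conjugate_eq_iff_commute)
    then show "g \<in> D" using A.subset g unfolding D_def by blast
  qed
  have D_pow: "g [^] k \<in> D" if "g \<in> D" for g and k :: nat
    by (induction k) (use that D_mult AD A.one_closed in auto)
  \<comment> \<open>Inverses are powers, so closure of \<open>D\<close> under products is
    enough.\<close>
  have inv_pow: "inv g = g [^] (order G - 1)" if "g \<in> carrier G" for g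
  proof -
    have "g [^] (order G - 1) \<otimes> g = \<one>"
      using pow_order_eq_1[OF that] order_pos by (metis Suc_diff_1 nat_pow_Suc)
    then show ?thesis using that inv_equality by simp
  qed
  have sD: "subgroup D G"
  proof (rule subgroupI)
    show "D \<subseteq> carrier G" by (auto simp: D_def)
    then show "inv g \<in> D" if "g \<in> D" for g using inv_pow D_pow that by auto
    show "D \<noteq> {}" using AD A.one_closed by blast
  qed (rule D_mult)
  have nD: "D \<lhd> G"
    unfolding normal_iff_conjugate
  proof (intro conjI ballI sD)
    fix g x assume g: "g \<in> carrier G" and x: "x \<in> D"
    have xc: "x \<in> carrier G" using x by (simp add: D_def)
    obtain k l where k: "conjugate x a = a [^] l" and l: "l = (4 * k + 1 :: nat)"
      using x unfolding D_def by blast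
    obtain e :: nat where e: "conjugate (inv g) a = a [^] e" using act[of "inv g"] g by auto
    have ge: "conjugate g (a [^] e) = a" using g ac by (simp flip: e)
    have "conjugate (conjugate g x) a = conjugate g (conjugate x (conjugate (inv g) a))"
      using g xc ac by (simp add: conjugate_conjugate m_assoc) (simp add: conjugate_def[of g x] m_assoc)
    also have "\<dots> = conjugate g ((a [^] e) [^] l)"
      using e k ac xc by (simp add: conjugate_pow nat_pow_pow mult.commute)
    also have "\<dots> = a [^] l" using ge g ac by (simp only: conjugate_pow nat_pow_closed)
    finally show "conjugate g x \<in> D" using g xc unfolding D_def l by blast
  qed
  \<comment> \<open>Otherwise a chief step from \<open>A\<close> into \<open>D\<close> gives an
    element whose exponent would be both 1 and 3 modulo 4.\<close>
  have DA: "D = A"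
  proof (rule ccontr)
    assume "D \<noteq> A"
    then have "A \<subset> D" using AD by blast
    then obtain w where w: "w \<in> D" "w \<notin> A" "w [^] (2::nat) \<in> A"
      "\<And>g. g \<in> carrier G \<Longrightarrow> \<exists>c\<in>A. conjugate g w = c \<otimes> w"
      using p_group_chief_step[OF p2 G an nD] by auto
    obtain k where k: "w \<in> carrier G" "conjugate w a = a [^] (4 * k + 1 :: nat)" using w(1) unfolding D_def by blast
    have "(4 * k + 1) mod 4 = 3"
      using no_klein_pair_action[OF G a nk k(1) w(2,3,4)[unfolded A_def] k(2)] by auto
    then show False by simp
  qed
  obtain w0 where w0: "w0 \<in> carrier G" "w0 \<notin> A" using AG by blast
  have odd_act: "\<exists>k. conjugate g a = a [^] (4 * k + 3 :: nat)" if g: "g \<in> carrier G" "g \<notin> A" for g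
  proof -
    obtain k :: nat where k: "conjugate g a = a [^] k" using act[OF g(1)] by blast
    have oa: "\<exists>i. ord a = 2 ^ i" using ord_dvd_group_order[OF ac] G divides_primepow_nat[OF p2] by auto
    have "ord (a [^] k) = ord a" using ord_conjugate[OF g(1) ac] k by simp
    then have "coprime k (ord a)" using ac pow_ord_eq_ord_iff by simp
    show ?thesis
    proof (cases "ord a = 1")
      case True
      then have "a = \<one>" using ord_eq_1[OF ac] by simp
      then show ?thesis using k by simp
    next
      case False
      then have "odd k" using \<open>coprime k (ord a)\<close> oa by (metis coprime_power_right_iff coprime_right_2_iff_odd power_0 gr0I)
      moreover have "k mod 4 \<noteq> 1"
      proof
        assume "k mod 4 = 1"
        then obtain j where "k = 4 * j + 1" by (metis mod_mult_div_eq add.commute)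
        then have "g \<in> D" using g k unfolding D_def by blast
        then show False using DA g by blast
      qed
      ultimately have "k = 4 * (k div 4) + 3" by presburger
      then show ?thesis using k by metis
    qed
  qed
  have quot: "g \<otimes> h \<in> A" if gh: "g \<in> carrier G" "g \<notin> A" "h \<in> carrier G" "h \<notin> A" for g h
  proof -
    obtain k l where kl: "conjugate g a = a [^] (4 * k + 3 :: nat)" "conjugate h a = a [^] (4 * l + 3 :: nat)"
      using odd_act gh by metis
    have "conjugate (g \<otimes> h) a = a [^] ((4 * k + 3) * (4 * l + 3))"
      by (rule comp[OF _ _ kl]) (use gh in simp_all)
    also have "(4 * k + 3) * (4 * l + 3) = 4 * (4 * k * l + 3 * k + 3 * l + 2) + 1" by (simp add: algebra_simps)
    finally have "g \<otimes> h \<in> D" using that unfolding D_def by blast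
    then show ?thesis using DA by simp
  qed
  have inv_notin: "inv g \<notin> A" if "g \<in> carrier G" "g \<notin> A" for g
    using that A.m_inv_closed[of "inv g"] by auto
  have main: "\<exists>m. ord a = 2 ^ Suc m \<and> 1 \<le> m \<and> w [^] (2::nat) \<in> {\<one>, a [^] (2 ^ m :: nat)}"
    and r3: "conjugate w a = a [^] (r::nat) \<Longrightarrow> r mod 4 = 3"
    if w: "w \<in> carrier G" "w \<notin> A" for w r
  proof -
    have w2: "w [^] (2::nat) \<in> A" using quot[OF w w] w pow_2 by simp
    have cm: "\<exists>c\<in>A. conjugate g w = c \<otimes> w" if g: "g \<in> carrier G" for g
    proof -
      have "conjugate g w \<notin> A"
        using normal_conjugate_closed[OF an, of "inv g" "conjugate g w"] g w by auto
      then have "conjugate g w \<otimes> inv w \<in> A" using quot inv_notin g w by simp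
      moreover have "conjugate g w = (conjugate g w \<otimes> inv w) \<otimes> w" using g w by (simp add: group_simps)
      ultimately show ?thesis by blast
    qed
    have act': "\<exists>m. ord a = 2 ^ Suc m \<and> 1 \<le> m \<and> r mod 4 = 3 \<and> w [^] (2::nat) \<in> {\<one>, a [^] (2 ^ m :: nat)}"
      if "conjugate w a = a [^] r" for r :: nat
      by (rule no_klein_pair_action[OF G a nk w(1) w(2)[unfolded A_def] w2[unfolded A_def]])
        (use cm that in \<open>simp_all add: A_def\<close>)
    obtain r' :: nat where "conjugate w a = a [^] r'" using act w by blast
    from act'[OF this] show "\<exists>m. ord a = 2 ^ Suc m \<and> 1 \<le> m \<and> w [^] (2::nat) \<in> {\<one>, a [^] (2 ^ m :: nat)}"
      by blast
    show "conjugate w a = a [^] (r::nat) \<Longrightarrow> r mod 4 = 3" using act' by blast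
  qed
  obtain m where m: "ord a = 2 ^ Suc m" "1 \<le> m" using main[OF w0] by blast
  define z where "z = a [^] (2 ^ m :: nat)"
  have zc: "z \<in> carrier G" using ac by (simp add: z_def)
  have oz: "ord z = 2" using ord_pow[OF ac, of "2 ^ m"] m(1) by (simp add: z_def)
  define S where "S = carrier G - A"
  have sq: "w [^] (2::nat) \<in> {\<one>, z}" if "w \<in> S" for w
    using main[of w] that m(1) unfolding S_def z_def by (metis Diff_iff Suc_inject one_less_numeral_iff power_inject_exp semiring_norm(76))
  have ordS: "ord w = (if w [^] (2::nat) = \<one> then 2 else 4)" if w: "w \<in> S" for w
  proof -
    have wc: "w \<in> carrier G" and w1: "w \<noteq> \<one>" using w A.one_closed by (auto simp: S_def)
    then have o1: "ord w \<noteq> 1" using ord_eq_1 by blast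
    show ?thesis
    proof (cases "w [^] (2::nat) = \<one>")
      case True
      then have "ord w dvd 2" using pow_eq_id[OF wc] by blast
      then have "ord w = 2" using o1 p2 by (metis prime_nat_iff)
      then show ?thesis using True by simp
    next
      case False
      then have "w [^] (2::nat) = z" using sq[OF w] by simp
      then have "w [^] (2 * 2 :: nat) = \<one>" using pow_ord_eq_1[OF zc] oz nat_pow_pow[OF wc, of 2 2] by simp
      then have "ord w dvd 2 ^ 2" using pow_eq_id[OF wc, of 4] by simp
      then obtain i where i: "i \<le> 2" "ord w = 2 ^ i" using divides_primepow_nat[OF p2] by blast
      have "\<not> ord w dvd 2 ^ 1" using False pow_eq_id[OF wc, of 2] by simp
      then have "\<not> i \<le> 1" using i(2) le_imp_power_dvd by metis
      then have "i = 2" using i by simp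
      then show ?thesis using i False by simp
    qed
  qed
  have Ssub: "S \<subseteq> carrier G" by (auto simp: S_def)
  have SW: "S = (\<lambda>x. x \<otimes> w0) ` A"
  proof (intro equalityI subsetI)
    fix x assume x: "x \<in> S"
    then have "x \<otimes> inv w0 \<in> A" using quot[of x "inv w0"] inv_notin w0 by (simp add: S_def)
    moreover have "x = (x \<otimes> inv w0) \<otimes> w0" using x w0 by (simp add: S_def group_simps)
    ultimately show "x \<in> (\<lambda>x. x \<otimes> w0) ` A" by blast
  next
    fix x assume "x \<in> (\<lambda>x. x \<otimes> w0) ` A"
    then obtain c where c: "c \<in> A" "x = c \<otimes> w0" by blast
    have "x \<notin> A"
    proof
      assume "x \<in> A"
      then have "inv c \<otimes> x \<in> A" using c by simp
      then show False using c w0 by (simp add: inv_mult_cancel)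
    qed
    then show "x \<in> S" using c w0 by (simp add: S_def)
  qed
  have cardS: "card S = 2 ^ Suc m"
  proof -
    have "card S = card A"
      unfolding SW by (rule card_image) (use inj_on_multc[OF w0(1)] A.subset in \<open>auto simp: inj_on_def\<close>)
    then show ?thesis using m(1) card_generate_singleton[OF ac] by (simp add: A_def)
  qed
  define C2 where "C2 = {C \<in> cyc S. card C = 2}"
  define C4 where "C4 = {C \<in> cyc S. card C = 4}"
  have fin: "finite (cyc S)" using Ssub by (simp add: cyc_def finite_subset)
  have split: "cyc S = C2 \<union> C4"
  proof (intro equalityI subsetI)
    fix C assume C: "C \<in> cyc S"
    then obtain x where x: "x \<in> S" "C = generate G {x}" by (rule cycE)
    then have "card C = ord x" using card_generate_singleton Ssub by blast
    then have "card C \<in> {2, 4}" using ordS[OF x(1)] by simp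
    then show "C \<in> C2 \<union> C4" using C by (auto simp: C2_def C4_def)
  qed (auto simp: C2_def C4_def)
  have disj: "C2 \<inter> C4 = {}" by (auto simp: C2_def C4_def)
  have finC: "finite C2" "finite C4" using fin by (simp_all add: C2_def C4_def)
  have tot4: "totient 4 = 2" using totient_prime_power[OF p2, of 2] by simp
  have closed: "y \<in> S" if "x \<in> S" "y \<in> carrier G" "generate G {y} = generate G {x}" for x y
  proof -
    have "x \<in> generate G {y}" using that generate_singleton_self by metis
    then show ?thesis using that generate_singleton_subset[OF sA, of y] by (auto simp: S_def)
  qed
  have "card S = (\<Sum>C\<in>C2. totient (card C)) + (\<Sum>C\<in>C4. totient (card C))"
    using card_eq_sum_totient[OF Ssub closed] by (simp add: split sum.union_disjoint disj finC)
  also have "(\<Sum>C\<in>C2. totient (card C)) = card C2" by (simp add: C2_def totient_prime[OF p2])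
  also have "(\<Sum>C\<in>C4. totient (card C)) = 2 * card C4" by (simp add: C4_def tot4)
  finally have eq1: "2 ^ Suc m = card C2 + 2 * card C4" using cardS by simp
  have "carrier G = A \<union> S" using A.subset by (auto simp: S_def)
  then have "cyc (carrier G) = cyc A \<union> cyc S" using cyc_Un by metis
  moreover have "cyc A \<inter> cyc S = {}"
    by (rule cyc_subgroup_disjoint[OF sA Ssub]) (auto simp: S_def)
  ultimately have eq2: "card (cyc (carrier G)) = Suc m + 1 + (card C2 + card C4)"
    using card_cyc_prime_power[OF p2 ac m(1), folded A_def] finite_cyc(1)[OF sA]
    by (simp add: card_Un_disjoint split disj finC)
  show ?thesis
  proof
    \<comment> \<open>With c2 and c4 the sizes of \<open>C2\<close> and \<open>C4\<close>, the
      equations are 2^(m+1) = c2 + 2 c4 and c2 + c4 + m = 9. Only m = 2 is possible, with c2 = 6 and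
      c4 = 1.\<close>
    assume "card (cyc (carrier G)) = 11"
    then have e: "card C2 + card C4 + m = 9" using eq2 by simp
    have "m = 2"
    proof -
      have "m \<le> 2"
      proof (rule ccontr)
        assume "\<not> m \<le> 2"
        then have "(2::nat) ^ Suc 3 \<le> 2 ^ Suc m" by (intro power_increasing) auto
        then show False using eq1 e \<open>\<not> m \<le> 2\<close> by simp
      qed
      moreover have "m \<noteq> 1"
        using eq1 e by auto
      ultimately show ?thesis using m(2) by simp
    qed
    then have "card C4 = 1" using eq1 e by simp
    then obtain C where C: "C4 = {C}" by (auto simp: card_1_singleton_iff)
    then have "C \<in> cyc S" "card C = 4" by (auto simp: C4_def)
    then obtain x where x: "x \<in> S" "C = generate G {x}" by (auto simp: cyc_def)
    have xc: "x \<in> carrier G" "x \<notin> A" using x by (auto simp: S_def)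
    have ox: "ord x = 4" using \<open>card C = 4\<close> x xc card_generate_singleton by simp
    then have x2: "x [^] (2::nat) \<noteq> \<one>" using ordS[OF x(1)] by auto
    \<comment> \<open>Another element of order 4 outside \<open>A\<close>: its square is x^2 because
      2 (1 + r) is a multiple of 8 = \<open>ord a\<close>. By uniqueness it generates
      \<open><x>\<close>, which puts a^2 into \<open><x>\<close> and then \<open>x\<close> into
      \<open>A\<close>.\<close>
    define y where "y = a [^] (2::nat) \<otimes> x"
    have yS: "y \<in> S"
    proof -
      have "y \<notin> A"
      proof
        assume "y \<in> A"
        then have "inv (a [^] (2::nat)) \<otimes> y \<in> A" using ain by simp
        then show False using xc ac by (simp add: y_def inv_mult_cancel)
      qed
      then show ?thesis using ac xc by (simp add: S_def y_def)
    qed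
    obtain r :: nat where r: "conjugate x a = a [^] r" using act xc by blast
    then have "r mod 4 = 3" using r3 xc by blast
    then obtain q where q: "r = 4 * q + 3" by (metis mod_mult_div_eq add.commute)
    have "y [^] (2::nat) = a [^] (2 * (\<Sum>j<2. r ^ j)) \<otimes> x [^] (2::nat)"
      using mult_power_conjugate[OF ac xc(1) r, of 2 2] by (simp add: y_def)
    also have "2 * (\<Sum>j<2. r ^ j) = 8 * (q + 1)" by (simp add: numeral_2_eq_2 q)
    also have "a [^] (8 * (q + 1)) = \<one>" using pow_eq_id[OF ac] m(1) \<open>m = 2\<close> by simp
    finally have "y [^] (2::nat) = x [^] (2::nat)" using xc by simp
    then have "ord y = 4" using ordS[OF yS] x2 by simp
    then have "generate G {y} \<in> C4"
      using yS Ssub card_generate_singleton generate_mem_cyc by (auto simp: C4_def)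
    then have "y \<in> generate G {x}" using C x generate_singleton_self by auto
    then have "y \<otimes> inv x \<in> generate G {x}"
      using xc generate_singleton_subgroup generate_singleton_self subgroup.m_closed subgroup.m_inv_closed by metis
    then have a2: "a [^] (2::nat) \<in> generate G {x}" using xc ac by (simp add: y_def group_simps)
    have "ord (a [^] (2::nat)) = 4" using ord_pow[OF ac, of 2] m(1) \<open>m = 2\<close> by simp
    then have "generate G {a [^] (2::nat)} = generate G {x}"
      using ord_le_imp_generate_eq[OF _ xc(1) a2] ox ac by simp
    then have "x \<in> generate G {a [^] (2::nat)}" using generate_singleton_self by metis
    then have "x \<in> A" using generate_singleton_subset[OF sA ain] by blast
    then show False using xc by blast
  qed
qed

end

section \<open>2-groups with a normal four-group\<close>

lemma (in group) pow_4: "x \<in> carrier G \<Longrightarrow> x [^] (4::nat) = (x \<otimes> x) \<otimes> (x \<otimes> x)"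
  by (simp add: numeral_eq_Suc m_assoc)

context finite_group
begin

lemma cyclic_involution_unique:
  assumes x: "x \<in> carrier G" and y: "y \<in> generate G {x}" "y \<otimes> y = \<one>" "y \<noteq> \<one>"
    and y': "y' \<in> generate G {x}" "y' \<otimes> y' = \<one>" "y' \<noteq> \<one>"
  shows "y = y'"
proof -
  have *: "\<exists>i a. u = x [^] (i::nat) \<and> 2 * i = ord x * (2 * a + 1)"
    if u: "u \<in> generate G {x}" "u \<otimes> u = \<one>" "u \<noteq> \<one>" for u
  proof -
    obtain i :: nat where i: "u = x [^] i" using u x by (auto simp: generate_singleton_iff)
    have "x [^] (2 * i) = \<one>" using u(2) x by (simp add: i nat_pow_mult mult_2)
    then obtain b where b: "2 * i = ord x * b" using pow_eq_id[OF x] by blast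
    have "odd b"
    proof
      assume "even b"
      then obtain c where "b = 2 * c" by blast
      then have "ord x dvd i" using b by simp
      then show False using u(3) i pow_eq_id[OF x] by blast
    qed
    then obtain a where "b = 2 * a + 1" by (auto elim: oddE)
    then show ?thesis using i b by blast
  qed
  obtain i a where i: "y = x [^] (i::nat)" "2 * i = ord x * (2 * a + 1)" using *[OF y] by blast
  obtain j b where j: "y' = x [^] (j::nat)" "2 * j = ord x * (2 * b + 1)" using *[OF y'] by blast
  have "2 * (i + ord x * b) = 2 * (j + ord x * a)" using i(2) j(2) by (simp add: algebra_simps)
  then have "i + ord x * b = j + ord x * a" by simp
  then have "[i = j] (mod ord x)" by (metis cong_def mod_mult_self2)
  then show ?thesis using i j x pow_eq_iff by simp
qed

text \<open>The cyclic subgroups other than {1} and <z> are paired off. The partner of <x> comes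
  from multiplying \<open>x\<close> by \<open>z\<close>, by \<open>t\<close>, or by \<open>w\<close>
  or w t. In each case the new element must fall under the same case, and the rule must not depend
  on the generator. The bound on the order is needed: the dihedral group of order 8 has 7 cyclic
  subgroups.\<close>

lemma klein_pair_even_cyc:
  assumes G: "order G = 2 ^ n" "8 < order G" and kp: "klein_pair z t"
  shows "even (card (cyc (carrier G)))"
proof -
  have p2: "Factorial_Ring.prime (2::nat)" by simp
  have zc: "z \<in> carrier G" and tc: "t \<in> carrier G" and z1: "z \<noteq> \<one>" and t1: "t \<noteq> \<one>" and tz: "t \<noteq> z"
    and zz: "z \<otimes> z = \<one>" and tt: "t \<otimes> t = \<one>"
    and tconj: "\<And>g. g \<in> carrier G \<Longrightarrow> conjugate g t \<in> {t, t \<otimes> z}"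
    and zcom: "\<And>g. g \<in> carrier G \<Longrightarrow> g \<otimes> z = z \<otimes> g"
    using kp conjugate_eq_iff_commute unfolding klein_pair_def by auto
  have zlcom: "g \<otimes> (z \<otimes> h) = z \<otimes> (g \<otimes> h)" if "g \<in> carrier G" "h \<in> carrier G" for g h
    using that zcom[of g] zc by (simp flip: m_assoc)
  have zzl: "z \<otimes> (z \<otimes> h) = h" and ttl: "t \<otimes> (t \<otimes> h) = h" if "h \<in> carrier G" for h
    using that zc tc zz tt by (simp_all flip: m_assoc)
  have zlt: "t \<otimes> z = z \<otimes> t" "t \<otimes> (z \<otimes> h) = z \<otimes> (t \<otimes> h)" if "h \<in> carrier G" for h
    using that zcom[OF tc] zlcom[OF tc] by simp_all
  note zs = m_assoc zlt zzl ttl zz tt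
  have zsq: "(u \<otimes> z) \<otimes> (u \<otimes> z) = u \<otimes> u" "(z \<otimes> u) \<otimes> (z \<otimes> u) = u \<otimes> u" if u: "u \<in> carrier G" for u
  proof -
    have "(u \<otimes> z) \<otimes> (z \<otimes> u) = u \<otimes> u" using u zc by (simp add: m_assoc zzl)
    then show "(u \<otimes> z) \<otimes> (u \<otimes> z) = u \<otimes> u" "(z \<otimes> u) \<otimes> (z \<otimes> u) = u \<otimes> u" using zcom[OF u] by simp_all
  qed
  \<comment> \<open>\<open>A\<close> is the centralizer of \<open>t\<close> and \<open>E\<close> is
    the four-group.\<close>
  define A where "A = {g \<in> carrier G. conjugate g t = t}"
  define E where "E = {\<one>, z, t, t \<otimes> z}"
  have Ad: "g \<in> A \<longleftrightarrow> g \<in> carrier G \<and> conjugate g t = t" for g by (simp add: A_def)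
  have AI: "g \<in> A \<longleftrightarrow> g \<in> carrier G \<and> g \<otimes> t = t \<otimes> g" for g
    using tc conjugate_eq_iff_commute by (auto simp: A_def)
  have notA: "g \<otimes> t = t \<otimes> (g \<otimes> z)" if g: "g \<in> carrier G" "g \<notin> A" for g
  proof -
    have "conjugate g t = t \<otimes> z" using tconj[OF g(1)] g by (simp add: A_def)
    then show ?thesis using g(1) tc zc conjugate_eq_mult_iff zcom[of g] by (simp add: m_assoc)
  qed
  have sA: "subgroup A G"
  proof (rule subgroupI)
    fix g h assume "g \<in> A" "h \<in> A"
    then show "g \<otimes> h \<in> A" using tc by (simp add: A_def flip: conjugate_conjugate)
    have "conjugate (inv g) (conjugate g t) = t"
      by (rule conjugate_inv_cancel(2)) (use \<open>g \<in> A\<close> tc in \<open>simp_all add: A_def\<close>)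
    then show "inv g \<in> A" using \<open>g \<in> A\<close> by (simp add: A_def)
  qed (use tc in \<open>auto simp: A_def\<close>)
  interpret A: subgroup A G by (rule sA)
  have zA: "z \<in> A" and tA: "t \<in> A" using zc tc zcom[OF tc] by (simp_all add: AI)
  have EA: "E \<subseteq> A" using zA tA by (simp add: E_def)
  have sE: "subgroup E G"
  proof (rule subgroupI)
    show "E \<subseteq> carrier G" using zc tc by (auto simp: E_def)
    have "inv z = z" "inv t = t" "inv (t \<otimes> z) = t \<otimes> z"
      using zc tc by (auto intro!: inv_equality simp: zs)
    then show "inv g \<in> E" if "g \<in> E" for g using that by (auto simp: E_def)
    show "g \<otimes> h \<in> E" if "g \<in> E" "h \<in> E" for g h
      using that zc tc by (auto simp: E_def zs)
  qed (simp add: E_def)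
  have nE: "E \<lhd> G"
    unfolding normal_iff_conjugate
  proof (intro conjI ballI sE)
    fix g x assume g: "g \<in> carrier G" and x: "x \<in> E"
    have "conjugate g z = z" using g zc zcom conjugate_eq_iff_commute by simp
    then have "conjugate g (t \<otimes> z) = conjugate g t \<otimes> z" using g tc zc by (simp add: conjugate_mult)
    then show "conjugate g x \<in> E"
      using x tconj[OF g] \<open>conjugate g z = z\<close> g zc tc by (auto simp: E_def zs)
  qed
  have nA: "A \<lhd> G"
    unfolding normal_iff_conjugate
  proof (intro conjI ballI sA)
    fix g x assume g: "g \<in> carrier G" and x: "x \<in> A"
    have xc: "x \<in> carrier G" and xt: "conjugate x t = t" using x by (simp_all only: Ad)
    have "conjugate x z = z" using xc zc zcom conjugate_eq_iff_commute by simp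
    then have "conjugate x (t \<otimes> z) = t \<otimes> z" using conjugate_mult[OF xc tc zc] xt by simp
    then have xe: "conjugate x e = e" if "e \<in> {t, t \<otimes> z}" for e using that xt by blast
    have "conjugate (conjugate g x) t = conjugate g (conjugate x (conjugate (inv g) t))"
      using g xc tc by (simp add: conjugate_conjugate m_assoc) (simp add: conjugate_def[of g x] m_assoc)
    also have "\<dots> = t" using xe[OF tconj[of "inv g"]] g tc by simp
    finally show "conjugate g x \<in> A" using g xc by (simp only: Ad conjugate_closed)
  qed
  \<comment> \<open>\<open>t\<close> has at most two conjugates, so \<open>A\<close> has index at
    most 2. As the order exceeds 8, \<open>A\<close> is larger than \<open>E\<close>, and a chief
    step between them supplies \<open>w\<close>.\<close>
  have "E \<noteq> A"
  proof -
    interpret C: subgroup "carrier G" G by (rule subgroup_self)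
    interpret act: subgroup_action G "carrier G" "carrier G" conjugate
      by unfold_locales (simp_all add: conjugate_conjugate)
    have "card ((\<lambda>g. conjugate g t) ` carrier G) * card A = order G"
      using act.orbit_stabilizer[OF tc] by (simp only: A_def order_def)
    moreover have "card ((\<lambda>g. conjugate g t) ` carrier G) \<le> card {t, t \<otimes> z}"
      by (rule card_mono) (use tconj in auto)
    moreover have "card {t, t \<otimes> z} \<le> 2" by (simp add: card_insert_if)
    ultimately have "order G \<le> 2 * card A" by (metis le_trans mult_le_mono1)
    moreover have "card E \<le> 4" unfolding E_def by (rule card_insert_le_m1, simp)+ simp
    ultimately show ?thesis using G(2) by auto
  qed
  then have "E \<subset> A" using EA by blast
  then obtain w where w: "w \<in> A" "w \<notin> E" "w [^] (2::nat) \<in> E"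
      "\<And>g. g \<in> carrier G \<Longrightarrow> \<exists>c\<in>E. conjugate g w = c \<otimes> w"
    using p_group_chief_step[OF p2 G(1) nE nA] by auto
  have wc: "w \<in> carrier G" and wt: "w \<otimes> t = t \<otimes> w" using w(1) by (auto simp: AI)
  have Ec: "e \<in> carrier G" if "e \<in> E" for e using that zc tc by (auto simp: E_def)
  have pow2: "\<exists>k. ord x = 2 ^ k" if "x \<in> carrier G" for x
    using ord_dvd_group_order[OF that] G(1) divides_primepow_nat[OF p2] by auto
  define S where "S = carrier G - {\<one>, z}"
  have genz: "y = z" if "x \<in> carrier G" "z \<in> generate G {x}" "y \<in> generate G {x}" "y \<otimes> y = \<one>" "y \<noteq> \<one>" for x y
    by (rule cyclic_involution_unique[OF that(1) that(3,4,5) that(2) zz z1])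
  have even_ord: "even (ord x)" if x: "x \<in> S" for x
  proof -
    obtain k where k: "ord x = 2 ^ k" using pow2 x by (auto simp: S_def)
    have "ord x \<noteq> 1" using x ord_eq_1 by (auto simp: S_def)
    then show ?thesis using k by (cases k) auto
  qed
  have genE: "\<exists>k. y = x [^] (2 * k + 1 :: nat)"
    if xy: "x \<in> S" "y \<in> S" "generate G {x} = generate G {y}" for x y
  proof -
    obtain k :: nat where k: "y = x [^] k" "coprime k (ord x)"
      using generate_eqE[of x y] xy by (auto simp: S_def)
    then have "odd k" using even_ord[OF xy(1)] by auto
    then obtain j where "k = 2 * j + 1" by (auto elim: oddE)
    then show ?thesis using k by blast
  qed
  have sq1: "x \<otimes> x \<noteq> \<one>" if "x \<in> S" "z \<in> generate G {x}" for x
    using genz[of x x] that generate_singleton_self[of x] by (auto simp: S_def)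
  have ord4: "ord x = 4 \<and> x \<otimes> x = z" if x: "x \<in> S" "z \<in> generate G {x}" "ord x < 8" for x
  proof -
    have xc: "x \<in> carrier G" using x by (simp add: S_def)
    obtain k where k: "ord x = 2 ^ k" using pow2[OF xc] by blast
    have "(2::nat) ^ k < 2 ^ 3" using k x(3) by simp
    then have "k < 3" by (rule power_less_imp_less_exp[rotated]) simp
    moreover have "\<not> 2 ^ k dvd (2::nat) ^ 1" using sq1[OF x(1,2)] pow_eq_id[OF xc, of 2] k pow_2[OF xc] by simp
    then have "\<not> k \<le> 1" using le_imp_power_dvd by blast
    ultimately have k2: "k = 2" by simp
    then have "x [^] (4 :: nat) = \<one>" using k pow_eq_id[OF xc, of 4] by simp
    then have "(x \<otimes> x) \<otimes> (x \<otimes> x) = \<one>" by (simp only: pow_4[OF xc])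
    moreover have "x \<otimes> x \<in> generate G {x}"
      using generate_singleton_subgroup[OF xc] generate_singleton_self subgroup.m_closed by metis
    ultimately have "x \<otimes> x = z" using genz[OF xc x(2)] sq1[OF x(1,2)] by simp
    then show ?thesis using k k2 by simp
  qed
  \<comment> \<open>Both \<open>b x\<close> and membership of \<open>z\<close> in <x> depend only on
    <x>, so they separate the cases. If \<open>z\<close> is in <x> and \<open>b x\<close> fails,
    then x^2 = z and \<open>x\<close> does not centralize \<open>t\<close>.\<close>
  define b where "b x \<longleftrightarrow> 8 \<le> ord x \<or> x \<in> A" for x
  define f where "f x = (if z \<notin> generate G {x} then x \<otimes> z else if b x then x \<otimes> t
    else if (x \<otimes> w) \<otimes> (x \<otimes> w) = z then x \<otimes> w else x \<otimes> w \<otimes> t)" for x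
  have b_gen: "b x \<longleftrightarrow> b y" if "x \<in> S" "y \<in> S" "generate G {x} = generate G {y}" for x y
  proof -
    have "ord x = ord y" using that card_generate_singleton by (metis DiffD1 S_def)
    moreover have "x \<in> A \<longleftrightarrow> y \<in> A"
      using that(3) generate_singleton_subset[OF sA] generate_singleton_self by blast
    ultimately show ?thesis by (simp add: b_def)
  qed

  \<comment> \<open>If z = (x z)^j, then \<open>z\<close> is a power of \<open>x\<close> for even
    \<open>j\<close>, and x^j = 1 for odd \<open>j\<close>, although \<open>x\<close> has even
    order.\<close>
  have case0: "x \<otimes> z \<in> S \<and> z \<notin> generate G {x \<otimes> z} \<and> generate G {x \<otimes> z} \<noteq> generate G {x}"
    if x: "x \<in> S" "z \<notin> generate G {x}" for x
  proof -
    have xc: "x \<in> carrier G" using x by (simp add: S_def)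
    have "z \<notin> generate G {x \<otimes> z}"
    proof
      assume "z \<in> generate G {x \<otimes> z}"
      then obtain j :: nat where "z = (x \<otimes> z) [^] j" using xc zc by (auto simp: generate_singleton_iff)
      then have j: "z = x [^] j \<otimes> z [^] j" using pow_mult_distrib[OF zcom[OF xc] xc zc] by simp
      show False
      proof (cases "even j")
        case True
        then have "z = x [^] j" using j involution_pow[OF zc zz, of j] xc by simp
        then show False using x(2) xc by (auto simp: generate_singleton_iff)
      next
        case False
        then have "z = x [^] j \<otimes> z" using j involution_pow[OF zc zz, of j] by simp
        then have "x [^] j = \<one>" using xc zc by simp
        then show False using pow_eq_id[OF xc] even_ord[OF x(1)] False dvd_trans by blast
      qed
    qed
    moreover have "x \<otimes> z \<noteq> \<one>"
    proof
      assume "x \<otimes> z = \<one>"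
      then have "x \<otimes> z \<otimes> z = z" using zc by simp
      then have "x = z" using xc zc by (simp add: m_assoc zz)
      then show False using x by (simp add: S_def)
    qed
    moreover have "generate G {x \<otimes> z} \<noteq> generate G {x}"
    proof
      assume "generate G {x \<otimes> z} = generate G {x}"
      then have "inv x \<otimes> (x \<otimes> z) \<in> generate G {x}"
        using generate_singleton_subgroup[OF xc] generate_singleton_self subgroup.m_closed subgroup.m_inv_closed by metis
      then show False using x(2) xc zc by (simp add: inv_mult_cancel)
    qed
    moreover have "x \<otimes> z \<noteq> z" using x xc zc by (simp add: S_def)
    ultimately show ?thesis using xc zc by (simp add: S_def)
  qed

  \<comment> \<open>\<open>x\<close> and \<open>t\<close> commute up to \<open>z\<close>, so the
    squares of x t and \<open>x\<close> agree up to \<open>z\<close>, and their fourth powers are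
    equal. This carries \<open>z\<close> from <x> to <x t> when the order is at least 8.\<close>
  have sq_xt: "\<exists>e\<in>{\<one>, z}. (x \<otimes> t) \<otimes> (x \<otimes> t) = (x \<otimes> x) \<otimes> e" if xc: "x \<in> carrier G" for x
  proof (cases "x \<in> A")
    case True
    then have "(x \<otimes> t) \<otimes> (x \<otimes> t) = x \<otimes> x" using xc tc AI[of x] by (metis m_assoc m_closed r_one tt)
    then show ?thesis using xc by simp
  next
    case False
    have "(x \<otimes> t) \<otimes> (x \<otimes> t) = (x \<otimes> t) \<otimes> (t \<otimes> (x \<otimes> z))" using notA[OF xc False] by simp
    also have "\<dots> = (x \<otimes> x) \<otimes> z" using xc tc zc by (simp add: m_assoc ttl)
    finally show ?thesis by simp
  qed
  have case1: "x \<otimes> t \<in> S \<and> z \<in> generate G {x \<otimes> t} \<and> b (x \<otimes> t) \<and> generate G {x \<otimes> t} \<noteq> generate G {x}"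
    if x: "x \<in> S" "z \<in> generate G {x}" "b x" for x
  proof -
    have xc: "x \<in> carrier G" using x by (simp add: S_def)
    have zb: "z \<in> generate G {x \<otimes> t} \<and> b (x \<otimes> t)"
    proof (cases "8 \<le> ord x")
      case True
      obtain k where k: "ord x = 2 ^ k" using pow2[OF xc] by blast
      have "(2::nat) ^ 3 \<le> 2 ^ k" using k True by simp
      then have "3 \<le> k" by (rule power_le_imp_le_exp[rotated]) simp
      then obtain j where j: "k = j + 3" by (metis add.commute le_Suc_ex)
      obtain e where e: "e \<in> {\<one>, z}" "(x \<otimes> t) \<otimes> (x \<otimes> t) = (x \<otimes> x) \<otimes> e" using sq_xt[OF xc] by blast
      have "(x \<otimes> t) [^] (4::nat) = ((x \<otimes> x) \<otimes> e) \<otimes> ((x \<otimes> x) \<otimes> e)"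
        using xc tc e by (simp only: pow_4 m_closed)
      also have "\<dots> = x [^] (4::nat)"
        using e(1) xc zsq(1)[of "x \<otimes> x"] by (auto simp: pow_4)
      finally have q4: "(x \<otimes> t) [^] (4::nat) = x [^] (4::nat)" .
      have "(x \<otimes> t) [^] (4 * 2 ^ j :: nat) = x [^] (4 * 2 ^ j :: nat)"
        using q4 xc tc by (simp flip: nat_pow_pow)
      moreover have "x [^] (4 * 2 ^ j :: nat) = z"
      proof (rule genz[OF xc x(2)])
        show "x [^] (4 * 2 ^ j :: nat) \<in> generate G {x}" using xc by (auto simp: generate_singleton_iff)
        have "x [^] (4 * 2 ^ j + 4 * 2 ^ j :: nat) = \<one>"
          using k j pow_eq_id[OF xc] by (simp add: power_add)
        then show "x [^] (4 * 2 ^ j :: nat) \<otimes> x [^] (4 * 2 ^ j :: nat) = \<one>" using xc by (simp add: nat_pow_mult)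
        have "\<not> ord x dvd 4 * 2 ^ j" using k j by (auto simp: power_add dest!: dvd_imp_le)
        then show "x [^] (4 * 2 ^ j :: nat) \<noteq> \<one>" using pow_eq_id[OF xc] by blast
      qed
      ultimately have xz: "(x \<otimes> t) [^] (4 * 2 ^ j :: nat) = z" by simp
      have xtc: "x \<otimes> t \<in> carrier G" using xc tc by simp
      obtain i where i: "ord (x \<otimes> t) = 2 ^ i" using pow2[OF xtc] by blast
      have "\<not> 2 ^ i dvd (2::nat) ^ (j + 2)" using xz z1 pow_eq_id[OF xtc, of "4 * 2 ^ j"] i by (simp add: power_add mult.commute)
      then have "3 \<le> i" using le_imp_power_dvd[of i "j + 2" "2::nat"] by linarith
      then have "(2::nat) ^ 3 \<le> 2 ^ i" by (intro power_increasing) simp_all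
      then show ?thesis using xz i xtc by (auto simp: b_def generate_singleton_iff)
    next
      case False
      then have xA: "x \<in> A" using x(3) by (simp add: b_def)
      have "x \<otimes> x = z" using ord4[OF x(1,2)] False by simp
      moreover have "(x \<otimes> t) \<otimes> (x \<otimes> t) = x \<otimes> x" using xA tc AI[of x] by (metis m_assoc m_closed r_one tt)
      ultimately have "(x \<otimes> t) \<otimes> (x \<otimes> t) = z" by simp
      then have "z \<in> generate G {x \<otimes> t}"
        using xc tc generate_singleton_subgroup[of "x \<otimes> t"] generate_singleton_self subgroup.m_closed
        by (metis m_closed)
      then show ?thesis using xA tA by (simp add: b_def)
    qed
    have "x \<otimes> t \<noteq> \<one>"
      using zb z1 generate_one by (metis singletonD)
    moreover have "x \<otimes> t \<noteq> z"
    proof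
      assume "x \<otimes> t = z"
      then have "x \<otimes> t \<otimes> t = z \<otimes> t" by simp
      then have "x = z \<otimes> t" using xc tc by (simp add: m_assoc tt)
      then have "x \<otimes> x = \<one>" using zc tc by (simp add: zs)
      then show False using sq1[OF x(1,2)] by simp
    qed
    moreover have "generate G {x \<otimes> t} \<noteq> generate G {x}"
    proof
      assume "generate G {x \<otimes> t} = generate G {x}"
      then have "inv x \<otimes> (x \<otimes> t) \<in> generate G {x}"
        using generate_singleton_subgroup[OF xc] generate_singleton_self subgroup.m_closed subgroup.m_inv_closed by metis
      then have "t \<in> generate G {x}" using xc tc by (simp add: inv_mult_cancel)
      then show False using genz[OF xc x(2)] tt t1 tz by blast
    qed
    ultimately show ?thesis using zb xc tc by (simp add: S_def)
  qed
  \<comment> \<open>Independence of the generator: (x t)^(2 k + 1) and x^(2 k + 1) t differ at most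
    by \<open>z\<close>, which lies in <x t>.\<close>
  have case1_pow: "x [^] (2 * k + 1 :: nat) \<otimes> t \<in> generate G {x \<otimes> t}"
    if x: "x \<in> carrier G" "z \<in> generate G {x \<otimes> t}" for x and k :: nat
  proof -
    obtain e where e: "e \<in> {\<one>, z}" "(x \<otimes> t) \<otimes> (x \<otimes> t) = (x \<otimes> x) \<otimes> e" using sq_xt[OF x(1)] by blast
    have ec: "e \<in> carrier G" "x \<otimes> x \<otimes> e = e \<otimes> (x \<otimes> x)" using e x zc zcom by auto
    have ek: "e [^] k \<in> {\<one>, z}" using e(1) involution_pow[OF zc zz, of k] by auto
    have "(x \<otimes> t) [^] (2 * k + 1) = ((x \<otimes> t) \<otimes> (x \<otimes> t)) [^] k \<otimes> (x \<otimes> t)"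
      using x tc by (simp add: pow_2 flip: nat_pow_pow)
    also have "\<dots> = ((x \<otimes> x) [^] k \<otimes> e [^] k) \<otimes> (x \<otimes> t)"
      using pow_mult_distrib[OF ec(2) _ ec(1), of k] x by (simp add: e(2))
    also have "(x \<otimes> x) [^] k = x [^] (2 * k)" using x by (simp add: pow_2 flip: nat_pow_pow)
    also have "(x [^] (2 * k) \<otimes> e [^] k) \<otimes> (x \<otimes> t) = (x [^] (2 * k + 1) \<otimes> t) \<otimes> e [^] k"
    proof -
      have "e [^] k \<otimes> (x \<otimes> t) = (x \<otimes> t) \<otimes> e [^] k" using ek zcom[of "x \<otimes> t"] x tc by auto
      then show ?thesis using x tc ec by (simp add: m_assoc)
    qed
    finally have eq: "(x \<otimes> t) [^] (2 * k + 1) = (x [^] (2 * k + 1) \<otimes> t) \<otimes> e [^] k" .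
    have ee: "e [^] k \<otimes> e [^] k = \<one>" using ek zz by auto
    have "x [^] (2 * k + 1) \<otimes> t = (x \<otimes> t) [^] (2 * k + 1) \<otimes> e [^] k"
      unfolding eq using x tc ec ee by (simp add: m_assoc del: nat_pow_Suc)
    moreover have xtc: "x \<otimes> t \<in> carrier G" using x tc by simp
    moreover have "(x \<otimes> t) [^] (2 * k + 1) \<in> generate G {x \<otimes> t}" using xtc generate_singleton_iff by blast
    moreover have "e [^] k \<in> generate G {x \<otimes> t}"
      using ek x(2) subgroup.one_closed[OF generate_singleton_subgroup[OF xtc]] by auto
    ultimately show ?thesis using subgroup.m_closed[OF generate_singleton_subgroup[OF xtc]] by simp
  qed

  \<comment> \<open>Here x^2 = z and \<open>x\<close> is outside \<open>A\<close>. The square of x w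
    lies in \<open>E\<close> and commutes with x w, which does not centralize \<open>t\<close>; so
    it is 1 or \<open>z\<close>, and if it is 1, the extra factor \<open>t\<close> makes it
    \<open>z\<close>. Applying \<open>f\<close> twice multiplies \<open>x\<close> by an element of
    \<open>E\<close>, and comparing squares leaves only 1 and \<open>z\<close>.\<close>
  have case2: "f x \<in> S \<and> z \<in> generate G {f x} \<and> \<not> b (f x) \<and> generate G {f x} \<noteq> generate G {x}
      \<and> generate G {f (f x)} = generate G {x}"
    and case2_eq: "y \<in> S \<Longrightarrow> generate G {x} = generate G {y} \<Longrightarrow> f y \<in> generate G {f x}"
    if x: "x \<in> S" "z \<in> generate G {x}" "\<not> b x" for x y
  proof -
    have props: "u \<in> carrier G \<and> u \<notin> A \<and> u \<otimes> u = z" if "u \<in> S" "z \<in> generate G {u}" "\<not> b u" for u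
      using that ord4[OF that(1,2)] by (auto simp: b_def S_def)
    have propsI: "u \<in> S \<and> z \<in> generate G {u} \<and> \<not> b u" if u: "u \<in> carrier G" "u \<notin> A" "u \<otimes> u = z" for u
    proof -
      have "u \<in> S" using u zA by (auto simp: S_def)
      moreover have zg: "z \<in> generate G {u}"
        using u generate_singleton_subgroup[OF u(1)] generate_singleton_self subgroup.m_closed by metis
      moreover have "u [^] (4::nat) = \<one>" using u zz by (simp add: pow_4)
      then have "ord u dvd 4" using pow_eq_id[OF u(1)] by blast
      then have "ord u \<le> 4" by (rule dvd_imp_le) simp
      ultimately show ?thesis using u by (auto simp: b_def)
    qed
    have main: "f u \<in> carrier G \<and> f u \<notin> A \<and> f u \<otimes> f u = z \<and> (\<exists>e\<in>{\<one>, t}. f u = u \<otimes> w \<otimes> e)"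
      if "u \<in> S" "z \<in> generate G {u}" "\<not> b u" for u
    proof -
      have u: "u \<in> carrier G" "u \<notin> A" "u \<otimes> u = z" using props[OF that] by auto
      have uw: "u \<otimes> w \<in> carrier G" "u \<otimes> w \<notin> A"
      proof -
        show "u \<otimes> w \<in> carrier G" using u wc by simp
        show "u \<otimes> w \<notin> A"
        proof
          assume "u \<otimes> w \<in> A"
          then have "u \<otimes> w \<otimes> inv w \<in> A" using w(1) by simp
          then show False using u wc by (simp add: m_assoc)
        qed
      qed
      obtain c where c: "c \<in> E" "conjugate (inv u) w = c \<otimes> w" using w(4)[of "inv u"] u by auto
      have "(u \<otimes> w) \<otimes> (u \<otimes> w) = (u \<otimes> u) \<otimes> (conjugate (inv u) w \<otimes> w)"
        using u(1) wc by (simp add: conjugate_def group_simps)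
      also have "\<dots> = z \<otimes> (c \<otimes> w [^] (2::nat))" using c u wc Ec pow_2 by (simp add: m_assoc)
      finally have sqE: "(u \<otimes> w) \<otimes> (u \<otimes> w) \<in> E"
        using c(1) w(3) sE subgroup.m_closed[OF sE] by (simp add: E_def)
      have nt: "(u \<otimes> w) \<otimes> (u \<otimes> w) \<notin> {t, t \<otimes> z}"
      proof
        assume *: "(u \<otimes> w) \<otimes> (u \<otimes> w) \<in> {t, t \<otimes> z}"
        have "(u \<otimes> w) \<otimes> ((u \<otimes> w) \<otimes> (u \<otimes> w)) = ((u \<otimes> w) \<otimes> (u \<otimes> w)) \<otimes> (u \<otimes> w)"
          using uw(1) by (simp only: m_assoc m_closed)
        then have "(u \<otimes> w) \<otimes> t = t \<otimes> (u \<otimes> w)"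
        proof -
          assume e: "(u \<otimes> w) \<otimes> ((u \<otimes> w) \<otimes> (u \<otimes> w)) = ((u \<otimes> w) \<otimes> (u \<otimes> w)) \<otimes> (u \<otimes> w)"
          from * consider "(u \<otimes> w) \<otimes> (u \<otimes> w) = t" | "(u \<otimes> w) \<otimes> (u \<otimes> w) = t \<otimes> z" by blast
          then show ?thesis
          proof cases
            case 1
            then show ?thesis using e by simp
          next
            case 2
            have "((u \<otimes> w) \<otimes> t) \<otimes> z = (t \<otimes> (u \<otimes> w)) \<otimes> z"
              using e[unfolded 2] uw(1) tc zc zcom[OF uw(1)] by (simp add: m_assoc[of _ t z] m_assoc[of t _ z] m_assoc[of t z _])
            then show ?thesis using uw(1) tc zc by simp
          qed
        qed
        then show False using uw AI by blast
      qed
      have sq: "(u \<otimes> w) \<otimes> (u \<otimes> w) \<in> {\<one>, z}" using sqE nt by (auto simp: E_def)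
      show ?thesis
      proof (cases "(u \<otimes> w) \<otimes> (u \<otimes> w) = z")
        case True
        then show ?thesis using that uw by (auto simp: f_def)
      next
        case False
        then have one: "(u \<otimes> w) \<otimes> (u \<otimes> w) = \<one>" using sq by simp
        have fu: "f u = u \<otimes> w \<otimes> t" using False that by (simp add: f_def)
        have "f u \<notin> A"
        proof
          assume "f u \<in> A"
          then have "f u \<otimes> t \<in> A" using tA by simp
          then show False using uw fu tc by (simp add: m_assoc[of "u \<otimes> w"] tt)
        qed
        moreover have "f u \<otimes> f u = z"
        proof -
          have "f u \<otimes> f u = (u \<otimes> w \<otimes> t) \<otimes> (t \<otimes> (u \<otimes> w \<otimes> z))" using fu notA[OF uw] by simp
          also have "\<dots> = ((u \<otimes> w) \<otimes> (u \<otimes> w)) \<otimes> z" using u(1) wc tc zc by (simp add: m_assoc ttl)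
          finally show ?thesis using one zc by simp
        qed
        ultimately show ?thesis using fu uw tc by auto
      qed
    qed
    have xx: "x \<in> carrier G" "x \<notin> A" "x \<otimes> x = z" using props[OF x] by auto
    have fx: "f x \<in> carrier G" "f x \<notin> A" "f x \<otimes> f x = z" using main[OF x] by auto
    obtain e where e: "e \<in> {\<one>, t}" "f x = x \<otimes> w \<otimes> e" using main[OF x] by blast
    have ec: "e \<in> carrier G" "w \<otimes> e = e \<otimes> w" using e(1) tc wt wc by auto
    have fS: "f x \<in> S" "z \<in> generate G {f x}" "\<not> b (f x)" using propsI[OF fx] by auto
    obtain e' where e': "e' \<in> {\<one>, t}" "f (f x) = f x \<otimes> w \<otimes> e'" using main[OF fS] by blast
    have e'c: "e' \<in> carrier G" using e'(1) tc by auto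
    have ffx: "f (f x) \<in> carrier G" "f (f x) \<notin> A" "f (f x) \<otimes> f (f x) = z" using main[OF fS] by auto
    have "f (f x) = x \<otimes> (w [^] (2::nat) \<otimes> (e \<otimes> e'))"
    proof -
      have "f (f x) = x \<otimes> (w \<otimes> ((e \<otimes> w) \<otimes> e'))"
        using e(2) e'(2) xx(1) wc ec(1) e'c by (simp add: m_assoc)
      also have "\<dots> = x \<otimes> (w \<otimes> ((w \<otimes> e) \<otimes> e'))" using ec by simp
      also have "\<dots> = x \<otimes> (w [^] (2::nat) \<otimes> (e \<otimes> e'))" using wc ec(1) e'c by (simp add: pow_2 m_assoc)
      finally show ?thesis .
    qed
    moreover have "w [^] (2::nat) \<otimes> (e \<otimes> e') \<in> E"
      using w(3) e(1) e'(1) subgroup.m_closed[OF sE] by (auto simp: E_def)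
    ultimately obtain d where d: "d \<in> E" "f (f x) = x \<otimes> d" by blast
    have "d \<in> {\<one>, z}"
    proof (rule ccontr)
      assume "d \<notin> {\<one>, z}"
      then have "d = t \<or> d = t \<otimes> z" using d(1) by (auto simp: E_def)
      then have "(x \<otimes> d) \<otimes> (x \<otimes> d) = (x \<otimes> t) \<otimes> (x \<otimes> t)"
        using xx(1) tc zc zsq(1)[of "x \<otimes> t"] by (auto simp: m_assoc)
      also have "\<dots> = (x \<otimes> t) \<otimes> (t \<otimes> (x \<otimes> z))" using notA[OF xx(1,2)] by simp
      also have "\<dots> = (x \<otimes> x) \<otimes> z" using xx(1) tc zc by (simp add: m_assoc ttl)
      also have "\<dots> = \<one>" using xx(3) zz by simp
      finally show False using ffx(3) d(2) z1 by simp
    qed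
    then have ff: "f (f x) \<in> {x, x \<otimes> z}" using d xx(1) by auto
    have "generate G {f (f x)} = generate G {x}"
    proof -
      note sg = generate_singleton_subgroup[OF xx(1)]
      have mem: "f (f x) \<in> generate G {x}"
        using ff x(2) generate_singleton_self[of x] subgroup.m_closed[OF sg] by auto
      show ?thesis
        using ord_le_imp_generate_eq[OF ffx(1) xx(1) mem] ord4[OF x(1,2)] x(3)
          ord4[of "f (f x)"] propsI[OF ffx] by (auto simp: b_def)
    qed
    moreover have "generate G {f x} \<noteq> generate G {x}"
    proof
      assume "generate G {f x} = generate G {x}"
      then obtain k where k: "f x = x [^] (2 * k + 1 :: nat)" using genE[OF x(1) fS(1)] by auto
      have "x [^] (2 * k) = z [^] k" using xx by (simp add: pow_2 flip: nat_pow_pow)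
      then have "f x = z [^] k \<otimes> x" using k by simp
      then have "f x \<in> {x, z \<otimes> x}" using involution_pow[OF zc zz, of k] xx(1) by auto
      then have "x \<otimes> (w \<otimes> e) \<in> {x \<otimes> \<one>, x \<otimes> z}" using e(2) xx(1) wc ec(1) zcom[OF xx(1)] by (auto simp: m_assoc)
      then have we: "w \<otimes> e \<in> {\<one>, z}" using xx(1) wc ec(1) zc by auto
      have "w \<otimes> e \<otimes> e \<in> E"
        using we e(1) subgroup.m_closed[OF sE, of "w \<otimes> e" e] by (auto simp: E_def)
      then show False using e(1) w(2) wc tc by (auto simp: m_assoc tt)
    qed
    ultimately show "f x \<in> S \<and> z \<in> generate G {f x} \<and> \<not> b (f x) \<and> generate G {f x} \<noteq> generate G {x}
      \<and> generate G {f (f x)} = generate G {x}" using fS by blast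
    show "f y \<in> generate G {f x}" if y: "y \<in> S" and xy: "generate G {x} = generate G {y}"
    proof -
      obtain k where k: "y = x [^] (2 * k + 1 :: nat)" using genE[OF x(1) y xy] by blast
      have "x [^] (2 * k) = z [^] k" using xx by (simp add: pow_2 flip: nat_pow_pow)
      then have "y = z [^] k \<otimes> x" using k by simp
      then have "y \<in> {x, z \<otimes> x}" using involution_pow[OF zc zz, of k] xx(1) by auto
      moreover have "f (z \<otimes> x) = z \<otimes> f x" if "y = z \<otimes> x"
      proof -
        have "\<not> b (z \<otimes> x)" "z \<in> generate G {z \<otimes> x}" using b_gen[OF x(1) y xy] x xy that by auto
        moreover have "((z \<otimes> x) \<otimes> w) \<otimes> ((z \<otimes> x) \<otimes> w) = (x \<otimes> w) \<otimes> (x \<otimes> w)"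
          using xx(1) wc zc zsq(2)[of "x \<otimes> w"] by (simp add: m_assoc)
        ultimately show ?thesis using x xx(1) wc zc tc by (simp add: f_def m_assoc)
      qed
      ultimately show ?thesis
        using fS(2) generate_singleton_self[of "f x"] subgroup.m_closed[OF generate_singleton_subgroup[OF fx(1)]]
        by auto
    qed
  qed

  have mem_gen: "f y \<in> generate G {f x}" if xy: "x \<in> S" "y \<in> S" "generate G {x} = generate G {y}" for x y
  proof -
    have xc: "x \<in> carrier G" using xy by (simp add: S_def)
    obtain k where k: "y = x [^] (2 * k + 1 :: nat)" using genE[OF xy] by blast
    consider "z \<notin> generate G {x}" | "z \<in> generate G {x}" "b x" | "z \<in> generate G {x}" "\<not> b x" by blast
    then show ?thesis
    proof cases
      case 1
      have "(x \<otimes> z) [^] (2 * k + 1) = y \<otimes> z"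
        using pow_mult_distrib[OF zcom[OF xc] xc zc, of "2 * k + 1"] involution_pow[OF zc zz, of "2 * k + 1"] k by simp
      then have "y \<otimes> z \<in> generate G {x \<otimes> z}" using xc zc generate_singleton_iff by (metis m_closed)
      then show ?thesis using 1 xy(3) by (simp add: f_def)
    next
      case 2
      then show ?thesis using case1_pow[OF xc, of k] case1[OF xy(1) 2] k xy b_gen[OF xy] by (simp add: f_def)
    next
      case 3
      then show ?thesis using case2_eq[OF xy(1) 3 xy(2,3)] by blast
    qed
  qed
  have fS: "f x \<in> S" if "x \<in> S" for x
    using case0[OF that] case1[OF that] case2[OF that] by (cases "z \<in> generate G {x}"; cases "b x") (auto simp: f_def)
  have "even (card (cyc S))"
  proof (rule even_card_cyc[of S f])
    show "S \<subseteq> carrier G" by (auto simp: S_def)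
    show "f x \<in> S" if "x \<in> S" for x using fS[OF that] .
    show "generate G {f x} = generate G {f y}" if "x \<in> S" "y \<in> S" "generate G {x} = generate G {y}" for x y
      using generate_singleton_eq_iff[of "f x" "f y"] mem_gen[OF that] mem_gen[OF that(2,1)] that fS
      by (simp add: S_def)
    fix x assume x: "x \<in> S"
    then have xc: "x \<in> carrier G" by (simp add: S_def)
    consider "z \<notin> generate G {x}" | "z \<in> generate G {x}" "b x" | "z \<in> generate G {x}" "\<not> b x" by blast
    then have "generate G {f (f x)} = generate G {x} \<and> generate G {f x} \<noteq> generate G {x}"
    proof cases
      case 1
      then show ?thesis using case0[OF x 1] xc zc by (simp add: f_def m_assoc zz)
    next
      case 2
      then show ?thesis using case1[OF x 2] xc tc by (simp add: f_def m_assoc tt)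
    next
      case 3
      then show ?thesis using case2[OF x 3] by blast
    qed
    then show "generate G {f (f x)} = generate G {x}" "generate G {f x} \<noteq> generate G {x}" by auto
  qed
  moreover have "cyc (carrier G) = insert (generate G {\<one>}) (insert (generate G {z}) (cyc S))"
    using zc by (auto simp: cyc_def S_def)
  moreover have "generate G {\<one>} \<noteq> generate G {z}"
    using generate_one generate_singleton_self[of z] z1 by auto
  moreover have "generate G {\<one>} \<notin> cyc S"
    using generate_one generate_singleton_self by (auto simp: cyc_def S_def)
  moreover have "generate G {z} \<notin> cyc S"
  proof
    assume "generate G {z} \<in> cyc S"
    then obtain x where x: "x \<in> S" "generate G {z} = generate G {x}" by (auto simp: cyc_def)
    then have "x \<in> generate G {z}" using generate_singleton_self by metis
    then obtain k :: nat where "x = z [^] k" using zc by (auto simp: generate_singleton_iff)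
    then show False using x involution_pow[OF zc zz, of k] by (auto simp: S_def split: if_splits)
  qed
  moreover have "finite (cyc S)" by (simp add: cyc_def S_def)
  ultimately show ?thesis by simp
qed

end

section \<open>The class equation of a p-group with eleven cyclic subgroups\<close>

context finite_group
begin

lemma card_cyc_le: "card (cyc (carrier G)) \<le> order G"
  unfolding cyc_def order_def by (rule card_image_le) simp

text \<open>\<open>s1\<close>, \<open>s2\<close>, \<open>s3\<close> count the cyclic subgroups of
  order p, p^2, p^3, and \<open>s4\<close> all larger ones. These are lumped together, since it is
  enough that their generators contribute a multiple of p^3. A cyclic p-group has subgroups of all
  smaller orders, which gives the vanishing conditions.\<close>

lemma p_group_class_equation:
  assumes p: "Factorial_Ring.prime p" and G: "order G = p ^ n"
  obtains s1 s2 s3 s4 x where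
    "s1 = card {C \<in> cyc (carrier G). card C = p}"
    "card (cyc (carrier G)) = 1 + s1 + s2 + s3 + s4"
    "order G = 1 + (p - 1) * s1 + p * (p - 1) * s2 + p\<^sup>2 * (p - 1) * s3 + p ^ 3 * x"
    "s2 = 0 \<longrightarrow> s3 = 0" "s3 = 0 \<longrightarrow> s4 = 0" "s4 = 0 \<longrightarrow> x = 0"
    "s3 \<noteq> 0 \<longrightarrow> (\<exists>a\<in>carrier G. ord a = p ^ 3)"
proof -
  define K where "K = cyc (carrier G)"
  define N where "N j = {C \<in> K. card C = p ^ j}" for j
  define T where "T = {C \<in> K. \<exists>k\<ge>4. card C = p ^ k}"
  have p1: "p > 1" using prime_gt_1_nat[OF p] .
  have fin: "finite K" by (simp add: K_def)
  have finN: "finite (N j)" "finite T" for j using fin by (simp_all add: N_def T_def)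
  have K_card: "\<exists>k. card C = p ^ k" if C: "C \<in> K" for C
  proof -
    obtain y where y: "y \<in> carrier G" "C = generate G {y}" using C unfolding K_def by (rule cycE)
    then show ?thesis using ord_dvd_group_order[OF y(1)] card_generate_singleton[OF y(1)] G divides_primepow_nat[OF p] by auto
  qed
  have split: "K = N 0 \<union> N 1 \<union> N 2 \<union> N 3 \<union> T"
  proof (intro equalityI subsetI)
    fix C assume C: "C \<in> K"
    then obtain k where k: "card C = p ^ k" using K_card by blast
    consider "k = 0" | "k = 1" | "k = 2" | "k = 3" | "4 \<le> k" by linarith
    then show "C \<in> N 0 \<union> N 1 \<union> N 2 \<union> N 3 \<union> T"
      using C k by cases (auto simp: N_def T_def)
  qed (auto simp: N_def T_def)
  have ne: "N i \<inter> N j = {}" if "i \<noteq> j" for i j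
    using that power_inject_exp[OF p1] by (auto simp: N_def)
  have neT: "N j \<inter> T = {}" if "j < 4" for j
    using that power_inject_exp[OF p1] by (auto simp: N_def T_def)
  have disj: "N 0 \<inter> N 1 = {}" "(N 0 \<union> N 1) \<inter> N 2 = {}" "(N 0 \<union> N 1 \<union> N 2) \<inter> N 3 = {}"
    "(N 0 \<union> N 1 \<union> N 2 \<union> N 3) \<inter> T = {}"
    by (simp_all only: Int_Un_distrib2 ne neT) simp_all
  have N0: "N 0 = {{\<one>}}"
  proof (intro equalityI subsetI)
    fix C assume "C \<in> N 0"
    then have C: "C \<in> cyc (carrier G)" "card C = 1" by (auto simp: N_def K_def)
    obtain y where y: "y \<in> carrier G" "C = generate G {y}" using C(1) by (rule cycE)
    then have "\<one> \<in> C" using generate.one by blast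
    then show "C \<in> {{\<one>}}" using C(2) by (auto simp: card_1_singleton_iff)
  qed (use trivial_mem_cyc[OF subgroup_self] in \<open>auto simp: N_def K_def\<close>)
  have sub: "N j \<noteq> {}" if C: "C \<in> K" "card C = p ^ k" "j \<le> k" for C j k
  proof -
    obtain y where y: "y \<in> carrier G" "C = generate G {y}" using C(1) unfolding K_def by (rule cycE)
    have "ord (y [^] (p ^ (k - j))) = p ^ j"
      using ord_pow[OF y(1), of "p ^ (k - j)"] C y card_generate_singleton[OF y(1)] p1
      by (simp add: le_imp_power_dvd power_diff[symmetric])
    then have "generate G {y [^] (p ^ (k - j))} \<in> N j"
      using y by (simp add: N_def K_def generate_mem_cyc card_generate_singleton)
    then show ?thesis by blast
  qed
  have sumN: "(\<Sum>C\<in>N (Suc j). totient (card C)) = p ^ j * (p - 1) * card (N (Suc j))" for j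
    by (simp add: N_def totient_prime_power_Suc[OF p] del: power_Suc)
  have "p ^ 3 dvd (\<Sum>C\<in>T. totient (card C))"
  proof (rule dvd_sum)
    fix C assume "C \<in> T"
    then obtain k where k: "4 \<le> k" "card C = p ^ k" by (auto simp: T_def)
    then obtain j where "k = Suc j" "3 \<le> j" by (cases k) auto
    then have "card C = p ^ Suc j" "3 \<le> j" using k by simp_all
    then show "p ^ 3 dvd totient (card C)"
      by (simp add: totient_prime_power_Suc[OF p] le_imp_power_dvd dvd_mult2 del: power_Suc)
  qed
  then obtain x where x: "(\<Sum>C\<in>T. totient (card C)) = p ^ 3 * x" by blast
  show ?thesis
  proof (rule that[of "card (N 1)" "card (N 2)" "card (N 3)" "card T" x])
    show "card (N 1) = card {C \<in> cyc (carrier G). card C = p}" by (simp add: N_def K_def)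
    have "card K = card (N 0) + card (N 1) + card (N 2) + card (N 3) + card T"
      by (subst split) (simp only: card_Un_disjoint disj finN finite_Un)
    then show "card (cyc (carrier G)) = 1 + card (N 1) + card (N 2) + card (N 3) + card T"
      by (simp add: N0 K_def)
    have "order G = (\<Sum>C\<in>K. totient (card C))"
      using card_subgroup_eq_sum_totient[OF subgroup_self] by (simp add: order_def K_def)
    also have "\<dots> = (\<Sum>C\<in>N 0. totient (card C)) + (\<Sum>C\<in>N 1. totient (card C)) + (\<Sum>C\<in>N 2. totient (card C))
        + (\<Sum>C\<in>N 3. totient (card C)) + (\<Sum>C\<in>T. totient (card C))"
      by (subst split) (simp only: sum.union_disjoint disj finN finite_Un)
    finally show "order G = 1 + (p - 1) * card (N 1) + p * (p - 1) * card (N 2) + p\<^sup>2 * (p - 1) * card (N 3) + p ^ 3 * x"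
      using sumN[of 0] sumN[of 1] sumN[of 2] by (simp add: N0 x numeral_2_eq_2 numeral_3_eq_3)
    show "card (N 2) = 0 \<longrightarrow> card (N 3) = 0"
      using sub[of _ 3 2] finN by (auto simp: N_def)
    show "card (N 3) = 0 \<longrightarrow> card T = 0"
    proof
      assume "card (N 3) = 0"
      then have N3: "N 3 = {}" using finN by simp
      have "C \<notin> T" for C
      proof
        assume "C \<in> T"
        then obtain k where "C \<in> K" "card C = p ^ k" "3 \<le> k" by (auto simp: T_def)
        then show False using sub N3 by blast
      qed
      then have "T = {}" by blast
      then show "card T = 0" by simp
    qed
    show "card T = 0 \<longrightarrow> x = 0"
      using x finN p1 by auto
    show "card (N 3) \<noteq> 0 \<longrightarrow> (\<exists>a\<in>carrier G. ord a = p ^ 3)"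
    proof
      assume "card (N 3) \<noteq> 0"
      then obtain C where "C \<in> N 3" by (metis card.empty equals0I)
      then obtain y where "y \<in> carrier G" "card (generate G {y}) = p ^ 3"
        by (auto simp: N_def K_def elim: cycE)
      then show "\<exists>a\<in>carrier G. ord a = p ^ 3" using card_generate_singleton by auto
    qed
  qed
qed

text \<open>Modulo \<open>p\<close> the class equation gives s1 = 1, and there are at least two
  subgroups of order \<open>p\<close>, so s1 is at least p + 1; this leaves p = 3, 5, 7. Reduction
  modulo p^2 fixes \<open>s2\<close> modulo \<open>p\<close>. For 5 and 7 this contradicts the total
  of 10, and for 3 only s1 = 4, s2 = 3, s3 = 3 yields a power of 3.\<close>

lemma odd_p_group_11:
  assumes p: "Factorial_Ring.prime p" "odd p" and G: "order G = p ^ n"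
    and nc: "\<And>x. x \<in> carrier G \<Longrightarrow> generate G {x} \<noteq> carrier G"
    and c: "card (cyc (carrier G)) = 11"
  shows "order G = 81 \<and> (\<exists>a\<in>carrier G. ord a = 27)"
proof -
  obtain s1 s2 s3 s4 x where s:
    "s1 = card {C \<in> cyc (carrier G). card C = p}"
    "card (cyc (carrier G)) = 1 + s1 + s2 + s3 + s4"
    "order G = 1 + (p - 1) * s1 + p * (p - 1) * s2 + p\<^sup>2 * (p - 1) * s3 + p ^ 3 * x"
    "s2 = 0 \<longrightarrow> s3 = 0" "s3 = 0 \<longrightarrow> s4 = 0" "s4 = 0 \<longrightarrow> x = 0"
    "s3 \<noteq> 0 \<longrightarrow> (\<exists>a\<in>carrier G. ord a = p ^ 3)"
    by (rule p_group_class_equation[OF p(1) G])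
  obtain u v where uv: "u \<in> carrier G" "v \<in> carrier G" "ord u = p" "ord v = p" "generate G {u} \<noteq> generate G {v}"
    using odd_noncyclic_two_prime_subgroups[OF p G nc] by metis
  have "card {generate G {u}, generate G {v}} \<le> s1"
    unfolding s(1) by (rule card_mono) (use uv in \<open>auto simp: generate_mem_cyc card_generate_singleton\<close>)
  then have s1: "2 \<le> s1" using uv(5) by simp
  have total: "s1 + s2 + s3 + s4 = 10" using s(2) c by simp
  have p3: "3 \<le> p" using p prime_ge_2_nat[OF p(1)] by (cases "p = 2") auto
  have "order G \<noteq> 1" using s(3) s1 p3 by auto
  then have n1: "p dvd order G" using G by (cases n) auto
  define M where "M = s1 + (p - 1) * s2 + p * (p - 1) * s3 + p\<^sup>2 * x"
  obtain q where q: "p = Suc q" using p3 by (cases p) auto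
  \<comment> \<open>Adding \<open>s1\<close> avoids subtraction: (p - 1) s1 + s1 = p s1.\<close>
  have "order G + s1 = 1 + p * M"
    unfolding s(3) M_def q by (simp add: algebra_simps power2_eq_square power3_eq_cube)
  moreover obtain D where "order G = p * D" using n1 by blast
  ultimately have "s1 - 1 = p * (M - D)" using s1 by (simp add: right_diff_distrib')
  then obtain k where k: "s1 - 1 = p * k" by blast
  have k': "s1 = p * k + 1" using k s1 by simp
  moreover have "k \<noteq> 0" using k s1 by (cases "k = 0") simp_all
  ultimately have k1: "k \<ge> 1" by simp
  then have "p * 1 \<le> p * k" by (intro mult_le_mono) simp_all
  then have ps1: "p + 1 \<le> s1" using k' by simp
  then have "p \<le> 9" using total by simp
  then have "p \<in> {3, 5, 7, 9}" using p3 p(2) by simp presburger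
  moreover have "\<not> Factorial_Ring.prime (9::nat)"
  proof
    assume "Factorial_Ring.prime (9::nat)"
    moreover have "(3::nat) dvd 9" by simp
    ultimately show False by (metis numeral_eq_iff num.distinct(1) num.distinct(3) num.inject(2) one_eq_numeral_iff prime_nat_iff semiring_norm(85))
  qed
  ultimately consider "p = 3" | "p = 5" | "p = 7" using p(1) by auto
  moreover have "p\<^sup>2 dvd order G"
  proof -
    have "n \<noteq> 0" using \<open>order G \<noteq> 1\<close> G by auto
    moreover have "n \<noteq> 1"
    proof
      assume "n = 1"
      then have "order G = p" using G by simp
      moreover have "2 * s1 \<le> (p - 1) * s1" using p3 by (intro mult_le_mono) simp_all
      then have "2 * s1 < order G" using s(3) by linarith
      ultimately show False using ps1 by linarith
    qed
    ultimately have "2 \<le> n" by simp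
    then show ?thesis using G by (simp add: le_imp_power_dvd)
  qed
  then obtain d where d: "order G = p\<^sup>2 * d" by blast
  have dvdL: "q dvd y" if "y + q * u = q * v" for q y u v :: nat
    using that by (metis dvd_add_left_iff dvd_triv_left)
  \<comment> \<open>21 and 45 are the orders that the excluded solutions for p = 3 would
    have.\<close>
  have pow3: "3 ^ m \<notin> {21, 45::nat}" for m :: nat
  proof -
    consider "m = 0" | "m = 1" | "m = 2" | "m = 3" | "4 \<le> m" by linarith
    then show ?thesis
    proof cases
      case 5
      then have "(3::nat) ^ 4 \<le> 3 ^ m" by (rule power_increasing) simp
      then show ?thesis by auto
    qed simp_all
  qed
  ultimately show ?thesis
  proof cases
    case 1
    have eq: "order G = 1 + 2 * s1 + 6 * s2 + 18 * s3 + 27 * x" using s(3) 1 by simp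
    have od: "order G = 9 * d" using d 1 by simp
    have "s1 = 3 * k + 1" using k' 1 by simp
    then consider "s1 = 4" | "s1 = 7" | "s1 = 10" using total k' k1 by (cases "k = 1"; cases "k = 2"; cases "k = 3") auto
    then show ?thesis
    proof cases
      case A: 1
      have "9 * d = 9 + 6 * s2 + 18 * s3 + 27 * x" using eq od A by simp
      then have "2 * s2 + 3 * (1 + 2 * s3 + 3 * x) = 3 * d" by simp
      then have "3 dvd 2 * s2" by (rule dvdL)
      then have "3 dvd s2" by presburger
      moreover have "s2 \<le> 6" "s2 \<noteq> 0" using total A s by auto
      ultimately have "s2 = 3 \<or> s2 = 6" by presburger
      then show ?thesis
      proof
        assume s2: "s2 = 6"
        then have "order G = 45" using eq total A s by simp
        then show ?thesis using pow3[of n] G 1 by simp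
      next
        assume s2: "s2 = 3"
        then have e27: "order G = 27 + 18 * s3 + 27 * x" using eq A by simp
        have "s3 \<noteq> 0" using total A s2 s by auto
        then have "(3::nat) ^ 3 < 3 ^ n" using e27 G 1 by simp
        then have "3 < n" by (rule power_less_imp_less_exp[rotated]) simp
        then have "(3::nat) ^ 4 dvd order G" using G 1 le_imp_power_dvd[of 4 n "3::nat"] by simp
        then obtain e where "27 + 18 * s3 + 27 * x = 81 * e" using e27 by (auto elim: dvdE)
        then have "2 * s3 + 3 * (1 + x) = 3 * (3 * e)" by simp
        then have "3 dvd 2 * s3" by (rule dvdL)
        then have "3 dvd s3" by presburger
        moreover have "s3 + s4 = 3" using total A s2 by simp
        ultimately have s3: "s3 = 3" "s4 = 0" using \<open>s3 \<noteq> 0\<close> by presburger+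
        then have "order G = 81" using e27 s by simp
        then show ?thesis using s(7) s3 1 by simp
      qed
    next
      case A: 2
      have "9 * d = 15 + 6 * s2 + 18 * s3 + 27 * x" using eq od A by simp
      then have "(5 + 2 * s2) + 3 * (2 * s3 + 3 * x) = 3 * d" by simp
      then have "3 dvd 5 + 2 * s2" by (rule dvdL)
      then have "s2 mod 3 = 2" by presburger
      moreover have "s2 \<le> 3" using total A by simp
      ultimately have s2: "s2 = 2" by presburger
      then have "s3 = 1" "s4 = 0" using total A s by auto
      then have "order G = 45" using eq A s s2 by simp
      then show ?thesis using pow3[of n] G 1 by simp
    next
      case A: 3
      then have "order G = 21" using eq total s by simp
      then show ?thesis using pow3[of n] G 1 by simp
    qed
  next
    case 2
    have "s1 = 6" using k' k1 2 total by (cases "k = 1") auto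
    moreover have "25 * d = 1 + 4 * s1 + 20 * s2 + 100 * s3 + 125 * x" using s(3) d 2 by simp
    ultimately have "4 * s2 + 5 * (1 + 4 * s3 + 5 * x) = 5 * d" by simp
    then have "5 dvd 4 * s2" by (rule dvdL)
    then have "5 dvd s2" by presburger
    moreover have "s2 \<le> 4" "s2 \<noteq> 0" using total \<open>s1 = 6\<close> s by auto
    ultimately show ?thesis by presburger
  next
    case 3
    have "s1 = 8" using k' k1 3 total by (cases "k = 1") auto
    moreover have "49 * d = 1 + 6 * s1 + 42 * s2 + 294 * s3 + 343 * x" using s(3) d 3 by simp
    ultimately have "6 * s2 + 7 * (1 + 6 * s3 + 7 * x) = 7 * d" by simp
    then have "7 dvd 6 * s2" by (rule dvdL)
    then have "7 dvd s2" by presburger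
    moreover have "s2 \<le> 2" "s2 \<noteq> 0" using total \<open>s1 = 8\<close> s by auto
    ultimately show ?thesis by presburger
  qed
qed

lemma p_group_11:
  assumes p: "Factorial_Ring.prime p" and G: "order G = p ^ n"
    and c: "card (cyc (carrier G)) = 11"
  shows "(\<exists>x\<in>carrier G. generate G {x} = carrier G \<and> ord x = p ^ 10) \<or>
    (order G = 81 \<and> (\<exists>a\<in>carrier G. ord a = 27) \<and> (\<forall>x\<in>carrier G. generate G {x} \<noteq> carrier G))"
proof (cases "\<exists>x\<in>carrier G. generate G {x} = carrier G")
  case True
  then obtain x where x: "x \<in> carrier G" "generate G {x} = carrier G" by blast
  then have "ord x = p ^ n" using card_generate_singleton[OF x(1)] G by (simp add: order_def)
  moreover from this have "n = 10" using card_cyc_prime_power[OF p x(1), of n] x(2) c by simp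
  ultimately show ?thesis using x by blast
next
  case False
  then have nc: "\<And>x. x \<in> carrier G \<Longrightarrow> generate G {x} \<noteq> carrier G" by blast
  have "odd p"
  proof
    assume "even p"
    then have p2: "p = 2" using p primes_dvd_imp_eq two_is_prime_nat by blast
    show False
    proof (cases "\<exists>z t. klein_pair z t")
      case True
      moreover have "8 < order G" using card_cyc_le c by simp
      ultimately have "even (card (cyc (carrier G)))" using klein_pair_even_cyc G p2 by blast
      then show False using c by simp
    next
      case False
      then show False using two_group_no_klein_pair[of n] G p2 nc c by blast
    qed
  qed
  then show ?thesis using odd_p_group_11[OF p _ G nc c] nc by blast
qed

end

section \<open>Normal p-complements\<close>

context group
begin

lemma cyc_conjugate_image:
  assumes "g \<in> carrier G" "H \<subseteq> carrier G"
  shows "cyc (conjugate g ` H) = (\<lambda>C. conjugate g ` C) ` cyc H"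
proof -
  have "generate G {conjugate g x} = conjugate g ` generate G {x}" if "x \<in> H" for x
    using generate_conjugate[OF assms(1)] that assms(2) by blast
  then show ?thesis by (simp add: cyc_def image_image)
qed

lemma inj_on_conjugate_image:
  assumes "g \<in> carrier G"
  shows "inj_on (\<lambda>C. conjugate g ` C) (Pow (carrier G))"
  using inj_on_image_Pow[OF inj_on_conjugate[OF assms]] .

lemma card_cyc_conjugate_image:
  assumes "g \<in> carrier G" "H \<subseteq> carrier G"
  shows "card (cyc (conjugate g ` H)) = card (cyc H)"
proof -
  have "cyc H \<subseteq> Pow (carrier G)"
    using assms(2) generate_singleton_in_carrier by (auto simp: cyc_def)
  then show ?thesis
    unfolding cyc_conjugate_image[OF assms]
    by (intro card_image inj_on_subset[OF inj_on_conjugate_image[OF assms(1)]])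
qed

lemma normal_pow_index:
  assumes N: "N \<lhd> G" and g: "g \<in> carrier G"
  shows "g [^] card (rcosets N) \<in> N"
proof -
  interpret N: normal N G by fact
  interpret Q: group "G Mod N" by (rule N.factorgroup_is_group)
  have "N #> g \<in> carrier (G Mod N)" using g by (simp add: carrier_FactGroup)
  from Q.pow_order_eq_1[OF this] have "(N #> g) [^]\<^bsub>G Mod N\<^esub> card (rcosets N) = N"
    by (simp add: order_def FactGroup_def)
  then have "N #> g [^] card (rcosets N) = N" using N.FactGroup_pow[OF g] by simp
  then show ?thesis using coset_join1[of N] N.subset N.subgroup_axioms g by simp
qed

end

text \<open>The orders of \<open>N\<close> and \<open>P\<close> are coprime with product
  \<open>order G\<close>, so \<open>G\<close> is the semidirect product of \<open>N\<close> and
  \<open>P\<close>. Nothing is assumed about the action of \<open>P\<close> on \<open>N\<close>; the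
  count has to determine it.\<close>

locale p_complement = finite_group G for G (structure) +
  fixes p :: nat and N P :: "'a set"
  assumes prime_p: "Factorial_Ring.prime p" and normal_N: "N \<lhd> G" and subgroup_P: "subgroup P G"
    and card_P: "\<exists>k. card P = p ^ k" and not_dvd: "\<not> p dvd card N"
    and order_eq: "order G = card N * card P"
begin

sublocale N: normal N G by (rule normal_N)
sublocale P: subgroup P G by (rule subgroup_P)

lemma coprime_N_P: "coprime (card N) (card P)"
  using card_P not_dvd prime_p by (metis coprime_commute coprime_power_right_iff prime_imp_coprime_nat)

lemma N_torsion: "x \<in> N \<Longrightarrow> x [^] card P = \<one> \<Longrightarrow> x = \<one>"
proof -
  assume x: "x \<in> N" "x [^] card P = \<one>"
  then have "ord x dvd card N" "ord x dvd card P"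
    using ord_dvd_card_subgroup[OF N.subgroup_axioms] pow_eq_id[OF N.mem_carrier] by blast+
  then have "ord x = 1" using coprime_N_P by (metis coprime_common_divisor_nat)
  then show "x = \<one>" using ord_eq_1[OF N.mem_carrier[OF x(1)]] by simp
qed

lemma pow_card_P: "x \<in> P \<Longrightarrow> x [^] card P = \<one>"
  using ord_dvd_card_subgroup[OF subgroup_P] pow_eq_id[OF P.mem_carrier] by blast

lemma pow_card_N: "x \<in> N \<Longrightarrow> x [^] card N = \<one>"
  using ord_dvd_card_subgroup[OF N.subgroup_axioms] pow_eq_id[OF N.mem_carrier] by blast

lemma Int_trivial: "x \<in> N \<Longrightarrow> x \<in> P \<Longrightarrow> x = \<one>"
  using N_torsion pow_card_P by blast

lemma N_mult_P: "N <#> P = carrier G"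
proof -
  have "N \<inter> P = {\<one>}" using Int_trivial N.one_closed P.one_closed by blast
  then have "card (N <#> P) = order G"
    using card_set_mult[OF N.subgroup_axioms subgroup_P] order_eq by simp
  then show ?thesis
    by (intro card_seteq) (simp_all add: setmult_subset_G N.subset P.subset order_def)
qed

lemma decompose:
  assumes "g \<in> carrier G"
  obtains n x where "n \<in> N" "x \<in> P" "g = n \<otimes> x"
  using assms N_mult_P by (metis set_multE)

lemma card_rcosets_N: "card (rcosets N) = card P"
  using lagrange[OF N.subgroup_axioms] order_eq card_subgroup_pos[OF N.subgroup_axioms] by simp

lemma card_rcosets_P: "card (rcosets P) = card N"
  using lagrange[OF subgroup_P] order_eq card_subgroup_pos[OF subgroup_P] by simp

text \<open>If the order of \<open>u\<close> divides \<open>card N\<close>, then \<open>u\<close> is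
  a power of u^(card P), and the latter lies in \<open>N\<close> because the index of
  \<open>N\<close> is \<open>card P\<close>.\<close>

lemma mem_N_iff:
  assumes "u \<in> carrier G"
  shows "u \<in> N \<longleftrightarrow> u [^] card N = \<one>"
proof
  assume u: "u [^] card N = \<one>"
  obtain x where x: "[card P * x = 1] (mod card N)"
    using cong_solve_coprime_nat[of "card P" "card N"] coprime_N_P by (auto simp: coprime_commute)
  have "ord u dvd card N" using u pow_eq_id[OF assms] by blast
  then have "[card P * x = 1] (mod ord u)" using x cong_dvd_modulus_nat by blast
  then have "(u [^] card P) [^] x = u" using assms pow_eq_iff[OF assms, of "card P * x" 1] by (simp add: nat_pow_pow)
  moreover have "u [^] card P \<in> N" using normal_pow_index[OF normal_N assms] card_rcosets_N by simp
  ultimately show "u \<in> N" using subgroup_nat_pow_closed[OF N.subgroup_axioms] by metis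
qed (rule pow_card_N)

definition cent :: "'a set \<Rightarrow> 'a set" where
  "cent Y = {n \<in> N. \<forall>y\<in>Y. conjugate y n = n}"

text \<open>Conjugation by \<open>N\<close> alone: distinct members of \<open>cyc P\<close> have
  disjoint \<open>N\<close>-classes, so nothing is counted twice.\<close>

definition conjs :: "'a set \<Rightarrow> 'a set set" where
  "conjs Y = (\<lambda>n. conjugate n ` Y) ` N"

lemma cent_generate:
  assumes "y \<in> carrier G"
  shows "cent (generate G {y}) = {n \<in> N. conjugate y n = n}"
proof -
  have "conjugate (y [^] k) n = n" if "n \<in> N" "conjugate y n = n" for n and k :: nat
    by (induction k) (use that assms in \<open>simp_all flip: conjugate_conjugate\<close>)
  then show ?thesis
    using assms generate_singleton_self by (auto simp: cent_def generate_singleton_iff)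
qed

lemma subgroup_cent:
  assumes "Y \<subseteq> carrier G"
  shows "subgroup (cent Y) G"
proof (rule subgroupI)
  show "cent Y \<subseteq> carrier G" by (auto simp: cent_def)
  have "\<one> \<in> cent Y" using assms by (auto simp: cent_def subset_iff)
  then show "cent Y \<noteq> {}" by blast
  show "inv a \<in> cent Y" if "a \<in> cent Y" for a
    using that assms by (auto simp: cent_def subset_iff conjugate_inv)
  show "a \<otimes> b \<in> cent Y" if "a \<in> cent Y" "b \<in> cent Y" for a b
    using that assms by (auto simp: cent_def subset_iff conjugate_mult)
qed

lemma cent_conjugate:
  assumes "g \<in> carrier G" "Y \<subseteq> carrier G"
  shows "cent (conjugate g ` Y) = conjugate g ` cent Y"
proof -
  have *: "conjugate g n \<in> cent (conjugate g ` Y)"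
    if g: "g \<in> carrier G" and n: "n \<in> cent Y" and Y: "Y \<subseteq> carrier G" for g n Y
  proof -
    have "conjugate (conjugate g y) (conjugate g n) = conjugate g n" if "y \<in> Y" for y
    proof -
      have c: "y \<in> carrier G" "n \<in> carrier G" "conjugate y n = n" using that n Y by (auto simp: cent_def)
      then have "y \<otimes> n = n \<otimes> y" using conjugate_eq_iff_commute by simp
      then have "conjugate g y \<otimes> conjugate g n = conjugate g n \<otimes> conjugate g y"
        using c g by (simp flip: conjugate_mult)
      then show ?thesis using c g by (simp add: conjugate_eq_iff_commute)
    qed
    then show ?thesis using n g normal_conjugate_closed[OF normal_N] by (auto simp: cent_def)
  qed
  show ?thesis
  proof (intro equalityI subsetI)
    fix n assume n: "n \<in> cent (conjugate g ` Y)"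
    have "conjugate (inv g) n \<in> cent (conjugate (inv g) ` conjugate g ` Y)"
      by (rule *) (use assms n in auto)
    also have "conjugate (inv g) ` conjugate g ` Y = Y"
      using assms by (simp add: conjugate_image_conjugate conjugate_image_one)
    finally have "conjugate (inv g) n \<in> cent Y" .
    moreover have "n = conjugate g (conjugate (inv g) n)"
      using n assms(1) by (auto simp: cent_def)
    ultimately show "n \<in> conjugate g ` cent Y" by blast
  qed (use * assms in auto)
qed

text \<open>The commutator of \<open>n\<close> and \<open>y\<close> lies in \<open>N\<close> by
  normality and in \<open>P\<close> by hypothesis, hence is trivial.\<close>

lemma conjugate_fix:
  assumes "n \<in> N" "y \<in> P" "conjugate n y \<in> P"
  shows "conjugate n y = y" "conjugate y n = n"
proof -
  have c: "n \<in> carrier G" "y \<in> carrier G" using assms by auto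
  have "conjugate n y \<otimes> inv y = n \<otimes> conjugate y (inv n)" using c by (simp add: conjugate_def group_simps)
  moreover have "n \<otimes> conjugate y (inv n) \<in> N"
    using assms c normal_conjugate_closed[OF normal_N] by simp
  moreover have "conjugate n y \<otimes> inv y \<in> P" using assms by simp
  ultimately have "conjugate n y \<otimes> inv y = \<one>" using Int_trivial by simp
  then show "conjugate n y = y"
    using c by (metis conjugate_closed inv_closed inv_equality inv_inv)
  then show "conjugate y n = n" using c by (simp add: conjugate_eq_iff_commute)
qed

lemma cyc_P_subset: "Y \<in> cyc P \<Longrightarrow> Y \<subseteq> P" "Y \<in> cyc P \<Longrightarrow> Y \<subseteq> carrier G"
  using cyc_subgroup[OF subgroup_P] P.subset by blast+

text \<open>By \<open>conjugate_fix\<close>, an element of \<open>N\<close> that normalizes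
  \<open>Y\<close> centralizes it, so the stabilizer in this orbit count is
  \<open>cent Y\<close>.\<close>

lemma card_conjs:
  assumes Y: "Y \<in> cyc P"
  shows "card (conjs Y) * card (cent Y) = card N"
proof -
  have sub: "Y \<subseteq> P" "Y \<subseteq> carrier G" using cyc_P_subset[OF Y] by auto
  interpret act: subgroup_action G N "Pow (carrier G)" "\<lambda>n Z. conjugate n ` Z"
  proof
    fix g h Z assume "g \<in> N" "h \<in> N" "Z \<in> Pow (carrier G)"
    then show "conjugate (g \<otimes> h) ` Z = conjugate g ` conjugate h ` Z"
      by (simp add: conjugate_image_conjugate)
  qed (auto simp: conjugate_image_one)
  have "{n \<in> N. conjugate n ` Y = Y} = cent Y"
  proof (intro equalityI subsetI)
    fix n assume n: "n \<in> {n \<in> N. conjugate n ` Y = Y}"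
    have "conjugate y n = n" if "y \<in> Y" for y
    proof -
      have "conjugate n y \<in> P" using n that sub(1) by blast
      then show ?thesis using conjugate_fix[of n y] n that sub(1) by blast
    qed
    then show "n \<in> cent Y" using n by (auto simp: cent_def)
  next
    fix n assume n: "n \<in> cent Y"
    have "conjugate n y = y" if "y \<in> Y" for y
    proof -
      have "n \<in> carrier G" "y \<in> carrier G" "conjugate y n = n" using n that sub by (auto simp: cent_def)
      then show ?thesis by (simp add: conjugate_eq_iff_commute)
    qed
    then show "n \<in> {n \<in> N. conjugate n ` Y = Y}" using n by (auto simp: cent_def)
  qed
  then show ?thesis using act.orbit_stabilizer[of Y] sub(2) by (simp add: conjs_def)
qed

text \<open>A cyclic subgroup is the product of its p-part \<open>Y\<close> and its part
  \<open>M\<close> of order prime to \<open>p\<close>, and (Y, M) |-> Y M is a bijection.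
  \<open>Y\<close> runs through the \<open>N\<close>-conjugates of cyclic subgroups of
  \<open>P\<close>, and \<open>M\<close> through the cyclic subgroups of
  \<open>cent Y\<close>.\<close>

lemma card_cyc_eq_sum:
  "card (cyc (carrier G)) = (\<Sum>Y\<in>cyc P. card (conjs Y) * card (cyc (cent Y)))"
proof -
  define U where "U = (\<Union>Y\<in>cyc P. conjs Y)"
  define T where "T = Sigma U (\<lambda>Y. cyc (cent Y))"
  define f where "f = (\<lambda>(Y, M). Y <#> M)"
  have finc: "finite (cyc P)" using subgroup_P by simp
  have finU: "finite U" using finc finite_subgroup[OF N.subgroup_axioms] by (auto simp: U_def conjs_def)
  have UE: "\<exists>y\<in>carrier G. Y = generate G {y} \<and> y [^] card P = \<one>" if Y: "Y \<in> U" for Y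
  proof -
    obtain n Y0 where n: "n \<in> N" "Y0 \<in> cyc P" "Y = conjugate n ` Y0"
      using Y by (auto simp: U_def conjs_def)
    then obtain y where y: "y \<in> P" "Y0 = generate G {y}" by (auto simp: cyc_def)
    have nc: "n \<in> carrier G" "y \<in> carrier G" using n y by auto
    have "Y = generate G {conjugate n y}" using n y nc by (simp add: generate_conjugate)
    moreover have "conjugate n y [^] card P = \<one>"
      using pow_card_P[OF y(1)] nc by (simp flip: conjugate_pow)
    ultimately show ?thesis using nc by blast
  qed
  \<comment> \<open>Chinese remainder exponents: g^e1 is the p-part of \<open>g\<close>, and g^e2,
    with \<open>e2\<close> below, is the part of order prime to \<open>p\<close>.\<close>
  obtain e1 where e1: "[e1 = 1] (mod card P)" "[e1 = 0] (mod card N)"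
    using binary_chinese_remainder_nat[of "card P" "card N" 1 0] coprime_N_P by (auto simp: coprime_commute)
  obtain e2 where e2: "[e2 = 0] (mod card P)" "[e2 = 1] (mod card N)"
    using binary_chinese_remainder_nat[of "card P" "card N" 0 1] coprime_N_P by (auto simp: coprime_commute)
  have gen: "generate G {y \<otimes> v} = generate G {y} <#> generate G {v}"
    if y: "y \<in> carrier G" "y [^] card P = \<one>" and v: "v \<in> N" and com: "y \<otimes> v = v \<otimes> y" for y v
  proof
    have vc: "v \<in> carrier G" using v by simp
    have oy: "ord y dvd card P" using y pow_eq_id by blast
    have ov: "ord v dvd card N" using ord_dvd_card_subgroup[OF N.subgroup_axioms v] .
    have sy: "subgroup (generate G {y}) G" and sv: "subgroup (generate G {v}) G"
      and syv: "subgroup (generate G {y \<otimes> v}) G"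
      using y vc by (simp_all add: generate_singleton_subgroup)
    have pow: "(y \<otimes> v) [^] k = y [^] k \<otimes> v [^] k" for k :: nat
      using pow_mult_distrib[OF com y(1) vc] .
    have "subgroup (generate G {y} <#> generate G {v}) G"
    proof (rule subgroup_set_mult_normalized[OF sy sv])
      fix h k assume h: "h \<in> generate G {v}" and k: "k \<in> generate G {y}"
      obtain i j :: nat where ij: "h = v [^] i" "k = y [^] j"
        using h k y vc by (auto simp: generate_singleton_iff)
      have "y [^] j \<otimes> v [^] i = v [^] i \<otimes> y [^] j"
        using com y(1) vc by (metis group_commutes_pow nat_pow_closed)
      then have "conjugate h k = k" using ij y vc by (simp add: conjugate_eq_iff_commute)
      then show "conjugate h k \<in> generate G {y}" using k by simp
    qed
    then show "generate G {y \<otimes> v} \<subseteq> generate G {y} <#> generate G {v}"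
      by (rule generate_singleton_subset) (intro set_multI generate_singleton_self)
    have "(y \<otimes> v) [^] e1 = y"
    proof -
      have "y [^] e1 = y" using y oy e1(1) pow_eq_iff[OF y(1), of e1 1] cong_dvd_modulus_nat by simp
      moreover have "v [^] e1 = \<one>" using pow_eq_id[OF vc] e1(2) ov by (metis cong_0_iff dvd_trans)
      ultimately show ?thesis using y by (simp add: pow)
    qed
    then have ym: "y \<in> generate G {y \<otimes> v}" using y vc generate_singleton_iff[of "y \<otimes> v" y] by (metis m_closed)
    have "(y \<otimes> v) [^] e2 = v"
    proof -
      have "v [^] e2 = v" using vc ov e2(2) pow_eq_iff[OF vc, of e2 1] cong_dvd_modulus_nat by simp
      moreover have "y [^] e2 = \<one>" using pow_eq_id[OF y(1)] e2(1) oy by (metis cong_0_iff dvd_trans)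
      ultimately show ?thesis using vc by (simp add: pow)
    qed
    then have vm: "v \<in> generate G {y \<otimes> v}" using y vc generate_singleton_iff[of "y \<otimes> v" v] by (metis m_closed)
    have "generate G {y} \<subseteq> generate G {y \<otimes> v}" "generate G {v} \<subseteq> generate G {y \<otimes> v}"
      using ym vm syv by (simp_all add: generate_singleton_subset)
    then show "generate G {y} <#> generate G {v} \<subseteq> generate G {y \<otimes> v}"
      using subgroup.m_closed[OF syv] by (auto elim!: set_multE)
  qed
  have TE: "\<exists>y v. y \<in> carrier G \<and> v \<in> N \<and> y [^] card P = \<one> \<and> y \<otimes> v = v \<otimes> y \<and>
      Y = generate G {y} \<and> M = generate G {v}" if YM: "(Y, M) \<in> T" for Y M
  proof -
    have "Y \<in> U" "M \<in> cyc (cent Y)" using YM by (auto simp: T_def)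
    obtain y where y: "y \<in> carrier G" "Y = generate G {y}" "y [^] card P = \<one>"
      using UE[OF \<open>Y \<in> U\<close>] by blast
    obtain v where v: "v \<in> cent Y" "M = generate G {v}" using \<open>M \<in> cyc (cent Y)\<close> by (rule cycE)
    then have "v \<in> N" "conjugate y v = v" using y by (auto simp: cent_generate)
    then show ?thesis using y v conjugate_eq_iff_commute[OF y(1) N.mem_carrier[OF \<open>v \<in> N\<close>]] by metis
  qed
  \<comment> \<open>Both factors are recovered from the product, which gives injectivity.\<close>
  have rec: "(Y <#> M) \<inter> N = M \<and> {z \<in> Y <#> M. z [^] card P = \<one>} = Y" if YM: "(Y, M) \<in> T" for Y M
  proof -
    obtain y v where yv: "y \<in> carrier G" "v \<in> N" "y [^] card P = \<one>" "y \<otimes> v = v \<otimes> y"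
      "Y = generate G {y}" "M = generate G {v}" using TE[OF YM] by blast
    have vc: "v \<in> carrier G" using yv by simp
    have sY: "subgroup Y G" and sM: "subgroup M G" and MN: "M \<subseteq> N"
      using yv vc by (simp_all add: generate_singleton_subgroup generate_singleton_subset[OF N.subgroup_axioms])
    have Yt: "z [^] card P = \<one>" if z: "z \<in> Y" for z
    proof -
      obtain i :: nat where "z = y [^] i" using z yv by (auto simp: generate_singleton_iff)
      then have "z [^] card P = (y [^] card P) [^] i" using yv(1) by (simp only: nat_pow_pow mult.commute)
      then show ?thesis using yv(3) by simp
    qed
    have com: "s \<otimes> t = t \<otimes> s" if s: "s \<in> Y" and t: "t \<in> M" for s t
    proof -
      obtain i j :: nat where "s = y [^] i" "t = v [^] j" using s t yv vc by (auto simp: generate_singleton_iff)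
      then show ?thesis using yv(1,4) vc by (metis group_commutes_pow nat_pow_closed)
    qed
    have 1: "s \<otimes> t \<in> M" if s: "s \<in> Y" and t: "t \<in> M" and "s \<otimes> t \<in> N" for s t
    proof -
      have sc: "s \<in> carrier G" "t \<in> carrier G" using s t sY sM subgroup.mem_carrier by metis+
      have "(s \<otimes> t) \<otimes> inv t \<in> N" using that MN by blast
      then have "s \<in> N" using sc by (simp add: m_assoc)
      then have "s = \<one>" using N_torsion Yt[OF s] by blast
      then show ?thesis using t sc by simp
    qed
    have 2: "s \<otimes> t \<in> Y" if s: "s \<in> Y" and t: "t \<in> M" and e: "(s \<otimes> t) [^] card P = \<one>" for s t
    proof -
      have sc: "s \<in> carrier G" "t \<in> carrier G" using s t sY sM subgroup.mem_carrier by metis+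
      have "s [^] card P \<otimes> t [^] card P = \<one>" using e pow_mult_distrib[OF com[OF s t] sc] by simp
      then have "t [^] card P = \<one>" using Yt[OF s] sc by simp
      then have "t = \<one>" using N_torsion t MN by blast
      then show ?thesis using s sc by simp
    qed
    have 3: "M \<subseteq> Y <#> M" "Y \<subseteq> Y <#> M" using subset_set_mult[OF sY sM] by auto
    show ?thesis
    proof (intro conjI equalityI subsetI)
      show "z \<in> M" if "z \<in> (Y <#> M) \<inter> N" for z using that 1 by (auto elim!: set_multE)
      show "z \<in> Y" if "z \<in> {z \<in> Y <#> M. z [^] card P = \<one>}" for z using that 2 by (auto elim!: set_multE)
    qed (use 3 MN Yt in auto)
  qed
  have "bij_betw f T (cyc (carrier G))"
  proof (rule bij_betwI')
    fix a b assume a: "a \<in> T" and b: "b \<in> T"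
    obtain Y M Y' M' where ab: "a = (Y, M)" "b = (Y', M')" by (cases a, cases b)
    show "(f a = f b) = (a = b)"
      using rec[of Y M] rec[of Y' M'] a b ab by (auto simp: f_def)
  next
    fix a assume a: "a \<in> T"
    obtain Y M where YM: "a = (Y, M)" by (cases a)
    obtain y v where yv: "y \<in> carrier G" "v \<in> N" "y [^] card P = \<one>" "y \<otimes> v = v \<otimes> y"
      "Y = generate G {y}" "M = generate G {v}" using TE a YM by blast
    then have "f a = generate G {y \<otimes> v}" using gen YM by (simp add: f_def)
    then show "f a \<in> cyc (carrier G)" using yv by (simp add: generate_mem_cyc)
  next
    fix C assume "C \<in> cyc (carrier G)"
    then obtain g where g: "g \<in> carrier G" "C = generate G {g}" by (rule cycE)
    define y u where "y = g [^] e1" and "u = g [^] e2"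
    have yuc: "y \<in> carrier G" "u \<in> carrier G" using g by (simp_all add: y_def u_def)
    have og: "ord g dvd card N * card P" using ord_dvd_group_order[OF g(1)] order_eq by simp
    have "[e1 + e2 = 1 + 0] (mod card P)" "[e1 + e2 = 0 + 1] (mod card N)"
      using e1 e2 by (intro cong_add; simp)+
    then have "[e1 + e2 = 1] (mod card N * card P)"
      using coprime_cong_mult_nat[OF _ _ coprime_N_P] by simp
    then have "[e1 + e2 = 1] (mod ord g)" using og cong_dvd_modulus_nat by blast
    then have gyu: "g = y \<otimes> u" using g pow_eq_iff[OF g(1), of "e1 + e2" 1] by (simp add: y_def u_def nat_pow_mult)
    have com: "y \<otimes> u = u \<otimes> y" using g by (simp add: y_def u_def nat_pow_mult add.commute)
    have "card N * card P dvd e1 * card P" using e1(2) by (simp add: cong_0_iff)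
    then have yP: "y [^] card P = \<one>" using g og pow_eq_id[OF g(1)] dvd_trans
      by (metis nat_pow_pow y_def)
    have "card N * card P dvd e2 * card N" using e2(1) by (simp add: cong_0_iff mult.commute)
    then have "u [^] card N = \<one>" using g og pow_eq_id[OF g(1)] dvd_trans
      by (metis nat_pow_pow u_def)
    then have uN: "u \<in> N" using mem_N_iff[OF yuc(2)] by simp
    have "p_subgroup p (generate G {y})"
    proof -
      have "ord y dvd card P" using yP pow_eq_id[OF yuc(1)] by blast
      then show ?thesis
        using yuc card_P prime_p divides_primepow_nat
        by (auto simp: p_subgroup_def generate_singleton_subgroup card_generate_singleton)
    qed
    \<comment> \<open>The p-part lies in a conjugate of \<open>P\<close>. As G = N P, the
      conjugating element can be taken in \<open>N\<close>.\<close>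
    then obtain h where h: "h \<in> carrier G" "generate G {y} \<subseteq> conjugate h ` P"
      using p_subgroup_subset_conjugate[OF prime_p _ subgroup_P] not_dvd card_rcosets_P by metis
    obtain n x where nx: "n \<in> N" "x \<in> P" "h = n \<otimes> x" using decompose[OF h(1)] by blast
    have nc: "n \<in> carrier G" using nx by simp
    have "conjugate h ` P = conjugate n ` conjugate x ` P"
      using nx by (simp add: conjugate_image_conjugate P.subset)
    also have "\<dots> \<subseteq> conjugate n ` P"
      using nx subgroup_conjugate_closed[OF subgroup_P nx(2)] by auto
    finally have "y \<in> conjugate n ` P" using h(2) generate_singleton_self by blast
    then obtain y0 where y0: "y0 \<in> P" "y = conjugate n y0" by blast
    then have "generate G {y} = conjugate n ` generate G {y0}" using nc by (simp add: generate_conjugate)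
    then have "generate G {y} \<in> U"
      using y0 nx generate_mem_cyc[OF y0(1)] by (auto simp: U_def conjs_def)
    moreover have "u \<in> cent (generate G {y})"
      using yuc uN com by (simp add: cent_generate conjugate_eq_iff_commute)
    ultimately have "(generate G {y}, generate G {u}) \<in> T"
      by (simp add: T_def generate_mem_cyc)
    moreover have "C = f (generate G {y}, generate G {u})"
      using gen[OF yuc(1) yP uN com] g gyu by (simp add: f_def)
    ultimately show "\<exists>a\<in>T. C = f a" by blast
  qed
  then have "card (cyc (carrier G)) = card T" by (simp add: bij_betw_same_card)
  also have "\<dots> = (\<Sum>Y\<in>U. card (cyc (cent Y)))"
  proof -
    have "finite (cyc (cent Y))" for Y
      using finite_subgroup[OF N.subgroup_axioms] by (simp add: cyc_def cent_def)
    then show ?thesis using finU by (simp add: T_def card_SigmaI)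
  qed
  also have "\<dots> = (\<Sum>Y\<in>cyc P. \<Sum>Y'\<in>conjs Y. card (cyc (cent Y')))"
    unfolding U_def
  proof (rule sum.UNION_disjoint)
    show "\<forall>Y\<in>cyc P. finite (conjs Y)" using finite_subgroup[OF N.subgroup_axioms] by (simp add: conjs_def)
    \<comment> \<open>If \<open>N\<close>-conjugates of \<open>Y\<close> and \<open>Z\<close>
      coincide, some element of \<open>N\<close> carries \<open>Y\<close> onto \<open>Z\<close>
      inside \<open>P\<close>; by \<open>conjugate_fix\<close> it fixes \<open>Y\<close>
      pointwise.\<close>
    show "\<forall>Y\<in>cyc P. \<forall>Z\<in>cyc P. Y \<noteq> Z \<longrightarrow> conjs Y \<inter> conjs Z = {}"
    proof (intro ballI impI)
      fix Y Z assume YZ: "Y \<in> cyc P" "Z \<in> cyc P" "Y \<noteq> Z"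
      have "Y = Z" if eq: "conjugate n ` Y = conjugate m ` Z" and nm: "n \<in> N" "m \<in> N" for n m
      proof -
        have sub: "Y \<subseteq> P" "Z \<subseteq> P" "Y \<subseteq> carrier G" "Z \<subseteq> carrier G" using cyc_P_subset YZ by auto
        define l where "l = inv m \<otimes> n"
        have l: "l \<in> N" "l \<in> carrier G" using nm by (simp_all add: l_def)
        have "conjugate (inv m) ` conjugate n ` Y = conjugate (inv m) ` conjugate m ` Z" using eq by simp
        then have lY: "conjugate l ` Y = Z"
          using nm sub by (simp add: conjugate_image_conjugate conjugate_image_one l_def)
        have "conjugate l y = y" if "y \<in> Y" for y
          using conjugate_fix(1)[OF l(1), of y] that lY sub by blast
        then have "conjugate l ` Y = Y" by simp
        then show ?thesis using lY by simp
      qed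
      then show "conjs Y \<inter> conjs Z = {}" using YZ(3) by (auto simp: conjs_def)
    qed
  qed (rule finc)
  also have "\<dots> = (\<Sum>Y\<in>cyc P. card (conjs Y) * card (cyc (cent Y)))"
  proof (rule sum.cong[OF refl])
    fix Y assume Y: "Y \<in> cyc P"
    have "card (cyc (cent Y')) = card (cyc (cent Y))" if Y': "Y' \<in> conjs Y" for Y'
    proof -
      obtain n where n: "n \<in> N" "Y' = conjugate n ` Y" using Y' by (auto simp: conjs_def)
      have sub: "Y \<subseteq> carrier G" using cyc_P_subset[OF Y] by simp
      have "cent Y' = conjugate n ` cent Y" using n sub cent_conjugate by simp
      then show ?thesis
        using card_cyc_conjugate_image n subgroup.subset[OF subgroup_cent[OF sub]] by simp
    qed
    then have "(\<Sum>Y'\<in>conjs Y. card (cyc (cent Y'))) = (\<Sum>Y'\<in>conjs Y. card (cyc (cent Y)))"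
      by (rule sum.cong[OF refl])
    then show "(\<Sum>Y'\<in>conjs Y. card (cyc (cent Y'))) = card (conjs Y) * card (cyc (cent Y))" by simp
  qed
  finally show ?thesis .
qed

text \<open>The p-group \<open>Y\<close> acts on \<open>N\<close> with fixed points
  \<open>cent Y\<close>, so the two orders agree modulo \<open>p\<close>, and
  \<open>card (cent Y)\<close> can be cancelled.\<close>

lemma card_conjs_cong:
  assumes Y: "Y \<in> cyc P"
  shows "[card (conjs Y) = 1] (mod p)"
proof -
  obtain y where y: "y \<in> P" "Y = generate G {y}" using Y by (rule cycE)
  have yc: "y \<in> carrier G" using y by simp
  interpret Y: subgroup Y G using y by (simp add: generate_singleton_subgroup)
  interpret act: subgroup_action G Y N conjugate
    by unfold_locales
      (use normal_conjugate_closed[OF normal_N] finite_subgroup[OF N.subgroup_axioms] in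
        \<open>auto simp: conjugate_conjugate\<close>)
  obtain k where k: "card Y = p ^ k"
    using ord_dvd_card_subgroup[OF subgroup_P y(1)] card_P divides_primepow_nat[OF prime_p]
      card_generate_singleton[OF yc] y(2) by auto
  have "[card N = card (cent Y)] (mod p)"
    using act.fixed_points_cong[OF prime_p k] by (simp add: cent_def)
  then have "[card (conjs Y) * card (cent Y) = 1 * card (cent Y)] (mod p)"
    using card_conjs[OF Y] by simp
  moreover have "coprime (card (cent Y)) p"
  proof -
    have "card (cent Y) dvd card N" using card_conjs[OF Y] by (metis dvd_triv_right)
    then have "\<not> p dvd card (cent Y)" using not_dvd dvd_trans by blast
    then show ?thesis using prime_p prime_imp_coprime_nat coprime_commute by blast
  qed
  ultimately show ?thesis using cong_mult_rcancel_nat by blast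
qed

text \<open>The kernel of the action of \<open>P\<close> on \<open>N\<close>. Its cyclic subgroups
  are the \<open>Y\<close> with \<open>cent Y = N\<close> (\<open>cent_eq_N_iff\<close>).\<close>

definition core :: "'a set" where
  "core = {x \<in> P. \<forall>n\<in>N. conjugate x n = n}"

lemma subgroup_core: "subgroup core G"
proof (rule subgroupI)
  have "\<one> \<in> core" using P.one_closed by (simp add: core_def)
  then show "core \<noteq> {}" by blast
  show "core \<subseteq> carrier G" by (auto simp: core_def)
  fix x y assume x: "x \<in> core" and y: "y \<in> core"
  show "x \<otimes> y \<in> core" using x y by (auto simp: core_def simp flip: conjugate_conjugate)
  have "conjugate (inv x) n = n" if n: "n \<in> N" for n
    using x n conjugate_inv_cancel(2)[of x n] by (auto simp: core_def)
  then show "inv x \<in> core" using x by (auto simp: core_def)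
qed

lemma core_subset: "core \<subseteq> P"
  by (auto simp: core_def)

lemma cent_eq_N_iff:
  assumes "Y \<in> cyc P"
  shows "cent Y = N \<longleftrightarrow> Y \<in> cyc core"
proof -
  have "cent Y = N \<longleftrightarrow> Y \<subseteq> core" using cyc_P_subset(1)[OF assms] by (auto simp: cent_def core_def)
  also have "\<dots> \<longleftrightarrow> Y \<in> cyc core"
    using mem_cyc_iff[OF subgroup_core] mem_cyc_iff[OF subgroup_P] assms by blast
  finally show ?thesis .
qed

text \<open>Each cyclic subgroup of \<open>core\<close> contributes \<open>card (cyc N)\<close>.
  Splitting these off leaves a sum in which every index is at least p + 1
  (\<open>not_core_cent\<close>).\<close>

lemma card_cyc_eq:
  "card (cyc (carrier G)) = card (cyc core) * card (cyc N) +
    (\<Sum>Y\<in>cyc P - cyc core. card (conjs Y) * card (cyc (cent Y)))"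
proof -
  have sub: "cyc core \<subseteq> cyc P" by (rule cyc_mono[OF core_subset])
  have fin: "finite (cyc P)" using subgroup_P by simp
  have "card (conjs Y) * card (cyc (cent Y)) = card (cyc N)" if Y: "Y \<in> cyc core" for Y
  proof -
    have "cent Y = N" using cent_eq_N_iff Y sub by blast
    moreover from this have "card (conjs Y) = 1"
      using card_conjs[of Y] Y sub card_subgroup_pos[OF N.subgroup_axioms] by auto
    ultimately show ?thesis by simp
  qed
  then have "(\<Sum>Y\<in>cyc core. card (conjs Y) * card (cyc (cent Y))) = card (cyc core) * card (cyc N)" by simp
  then show ?thesis
    unfolding card_cyc_eq_sum
    using sum.subset_diff[OF sub fin, of "\<lambda>Y. card (conjs Y) * card (cyc (cent Y))"] by (simp only: add.commute)
qed

end

section \<open>Sylow subgroups of a group with 11 cyclic subgroups\<close>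

context group
begin

text \<open>If a is in \<open>H\<close> but not in \<open>A\<close>, and b is in \<open>H\<close>
  but not in \<open>B\<close>, then a b can lie in neither.\<close>

lemma subgroup_subset_Un:
  assumes "subgroup H G" "subgroup A G" "subgroup B G" "H \<subseteq> A \<union> B"
  shows "H \<subseteq> A \<or> H \<subseteq> B"
proof (rule ccontr)
  assume "\<not> (H \<subseteq> A \<or> H \<subseteq> B)"
  then obtain a b where ab: "a \<in> H" "a \<notin> A" "b \<in> H" "b \<notin> B" by blast
  then have "a \<in> B" "b \<in> A" using assms(4) by auto
  have c: "a \<in> carrier G" "b \<in> carrier G" using ab assms(1) subgroup.mem_carrier by metis+
  have "a \<otimes> b \<in> A \<or> a \<otimes> b \<in> B" using subgroup.m_closed[OF assms(1) ab(1,3)] assms(4) by blast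
  then show False
  proof
    assume "a \<otimes> b \<in> A"
    then have "(a \<otimes> b) \<otimes> inv b \<in> A" using \<open>b \<in> A\<close> assms(2) subgroup.m_closed subgroup.m_inv_closed by metis
    then show False using ab c by (simp add: m_assoc)
  next
    assume "a \<otimes> b \<in> B"
    then have "inv a \<otimes> (a \<otimes> b) \<in> B" using \<open>a \<in> B\<close> assms(3) subgroup.m_closed subgroup.m_inv_closed by metis
    then show False using ab c by (simp add: inv_mult_cancel)
  qed
qed

end

context finite_group
begin

lemma card_1_subgroup: "subgroup H G \<Longrightarrow> card H = 1 \<Longrightarrow> H = {\<one>}"
  using subgroup.one_closed by (metis card_1_singletonE singletonD)

text \<open>Every cyclic subgroup is proper and covers at most p^(k-1) - 1 nontrivial elements, so
  \<open>p\<close> of them cannot cover all p^k - 1. The trivial subgroup adds one more.\<close>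

lemma noncyclic_p_subgroup_card_cyc:
  assumes p: "Factorial_Ring.prime p" and H: "subgroup H G" and cH: "card H = p ^ k"
    and nc: "\<And>x. x \<in> H \<Longrightarrow> generate G {x} \<noteq> H"
  shows "p + 2 \<le> card (cyc H)"
proof -
  interpret H: subgroup H G by fact
  have p1: "p > 1" using prime_gt_1_nat[OF p] .
  have k0: "k \<noteq> 0"
  proof
    assume "k = 0"
    then have "card H = 1" using cH by simp
    then have "H = {\<one>}" using card_1_subgroup[OF H] by simp
    then show False using nc[of \<one>] generate_one by simp
  qed
  then obtain j where j: "k = Suc j" by (cases k) auto
  define K where "K = cyc H - {{\<one>}}"
  have fin: "finite (cyc H)" using H by simp
  have cK: "card (cyc H) = card K + 1"
    using card_Suc_Diff1[OF fin trivial_mem_cyc[OF H]] by (simp add: K_def)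
  have le: "card (C - {\<one>}) \<le> p ^ j - 1" if C: "C \<in> K" for C
  proof -
    obtain x where x: "x \<in> H" "C = generate G {x}" using C unfolding K_def by (auto elim: cycE)
    have sC: "subgroup C G" "C \<subseteq> H" using cyc_subgroup[OF H] C by (auto simp: K_def)
    have "card C dvd p ^ k" using card_subgroup_dvd[OF sC(1) H sC(2)] cH by simp
    then obtain i where i: "i \<le> k" "card C = p ^ i" using divides_primepow_nat[OF p] by blast
    have "i \<noteq> k"
    proof
      assume "i = k"
      then have "C = H" using i cH subgroup_eqI[OF sC(1) H sC(2)] by simp
      then show False using nc x by blast
    qed
    then have "card C \<le> p ^ j" using i j p1 by (simp add: power_increasing)
    moreover have "card (C - {\<one>}) = card C - 1"
      using subgroup.one_closed[OF sC(1)] finite_subgroup[OF sC(1)] by simp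
    ultimately show ?thesis by simp
  qed
  have "card (H - {\<one>}) \<le> card (\<Union>C\<in>K. C - {\<one>})"
  proof (rule card_mono)
    show "finite (\<Union>C\<in>K. C - {\<one>})"
      using fin cyc_subgroup[OF H] finite_subgroup by (auto simp: K_def)
    show "H - {\<one>} \<subseteq> (\<Union>C\<in>K. C - {\<one>})"
    proof
      fix x assume x: "x \<in> H - {\<one>}"
      then have "generate G {x} \<in> K" using generate_singleton_self[of x] by (auto simp: K_def generate_mem_cyc)
      then show "x \<in> (\<Union>C\<in>K. C - {\<one>})" using x generate_singleton_self by blast
    qed
  qed
  also have "\<dots> \<le> (\<Sum>C\<in>K. card (C - {\<one>}))" by (rule card_UN_le) (use fin in \<open>simp add: K_def\<close>)
  also have "\<dots> \<le> card K * (p ^ j - 1)" using sum_bounded_above[of K "\<lambda>C. card (C - {\<one>})" "p ^ j - 1"] le by simp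
  finally have *: "p ^ k - 1 \<le> card K * (p ^ j - 1)"
    using cH H.one_closed finite_subgroup[OF H] by simp
  have "p + 1 \<le> card K"
  proof (rule ccontr)
    assume "\<not> p + 1 \<le> card K"
    then have "card K * (p ^ j - 1) \<le> p * (p ^ j - 1)" by (intro mult_le_mono1) simp
    then have "p ^ k - 1 \<le> p ^ k - p" using * j by (simp add: diff_mult_distrib2)
    moreover have "p \<le> p ^ k" using j p1 by simp
    ultimately show False using p1 by linarith
  qed
  then show ?thesis using cK by simp
qed

lemma card_cyc_ge_2:
  assumes H: "subgroup H G" "card H \<noteq> 1"
  shows "2 \<le> card (cyc H)"
proof -
  have "H \<noteq> {\<one>}" using H(2) by auto
  then obtain x where x: "x \<in> H" "x \<noteq> \<one>" using subgroup.one_closed[OF H(1)] by blast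
  have "card {{\<one>}, generate G {x}} \<le> card (cyc H)"
    by (rule card_mono) (use H x trivial_mem_cyc generate_mem_cyc in auto)
  moreover have "generate G {x} \<noteq> {\<one>}" using x generate_singleton_self[of x] by auto
  ultimately show ?thesis by (simp add: eq_commute)
qed

lemma p_subgroup_card_cyc_2:
  assumes p: "Factorial_Ring.prime p" and H: "subgroup H G" and cH: "card H = p ^ k"
    and c: "card (cyc H) = 2"
  shows "card H = p"
proof -
  obtain x where x: "x \<in> H" "generate G {x} = H"
    using noncyclic_p_subgroup_card_cyc[OF p H cH] c prime_gt_1_nat[OF p] by force
  have xc: "x \<in> carrier G" using x H subgroup.mem_carrier by metis
  then have "ord x = p ^ k" using card_generate_singleton[OF xc] x cH by simp
  then have "k + 1 = 2" using card_cyc_prime_power[OF p xc, of k] x(2) c by simp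
  then show ?thesis using cH by simp
qed

text \<open>The trivial subgroup is left out, so that the sets for different primes are
  disjoint.\<close>

definition p_cyc :: "nat \<Rightarrow> 'a set set" where
  "p_cyc p = {C \<in> cyc (carrier G). \<exists>k\<ge>1. card C = p ^ k}"

lemma finite_p_cyc [simp]: "finite (p_cyc p)"
  by (simp add: p_cyc_def)

lemma p_cyc_disjoint:
  assumes "Factorial_Ring.prime p" "Factorial_Ring.prime q" "p \<noteq> q"
  shows "p_cyc p \<inter> p_cyc q = {}"
proof -
  have False if k: "p ^ k = q ^ l" "1 \<le> k" for k l
  proof -
    have "p dvd p ^ k" using k(2) by simp
    then have "p dvd q ^ l" by (simp only: k(1))
    then have "p dvd q" using assms(1) prime_dvd_power by blast
    then show False using assms primes_dvd_imp_eq by blast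
  qed
  then have False if "C \<in> p_cyc p" "C \<in> p_cyc q" for C
    using that unfolding p_cyc_def by (smt (verit, best) mem_Collect_eq)
  then show ?thesis by blast
qed

lemma p_cyc_subset: "Factorial_Ring.prime p \<Longrightarrow> p_cyc p \<subseteq> cyc (carrier G) - {{\<one>}}"
proof
  fix C assume p: "Factorial_Ring.prime p" and C: "C \<in> p_cyc p"
  then obtain k where k: "C \<in> cyc (carrier G)" "1 \<le> k" "card C = p ^ k" unfolding p_cyc_def by blast
  then have "card C \<noteq> 1" using prime_gt_1_nat[OF p] by simp
  then show "C \<in> cyc (carrier G) - {{\<one>}}" using k(1) by auto
qed

lemma p_cyc_nonempty:
  assumes "Factorial_Ring.prime p" "p dvd order G"
  shows "p_cyc p \<noteq> {}" "1 \<le> card (p_cyc p)"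
proof -
  obtain x where x: "x \<in> carrier G" "ord x = p"
    using cauchy[OF assms(1) subgroup_self] assms(2) by (auto simp: order_def)
  then have "generate G {x} \<in> p_cyc p"
    using card_generate_singleton generate_mem_cyc by (auto simp: p_cyc_def intro!: exI[of _ 1])
  then show "p_cyc p \<noteq> {}" by blast
  then show "1 \<le> card (p_cyc p)" by (simp add: Suc_le_eq card_gt_0_iff)
qed

text \<open>The second summand collects the nontrivial cyclic subgroups not seen by any prime in
  \<open>A\<close>, for instance those whose order has two prime factors. \<open>nonnormal_5\<close>
  uses that it vanishes.\<close>

lemma sum_p_cyc_le:
  assumes "finite A" "\<And>p. p \<in> A \<Longrightarrow> Factorial_Ring.prime p"
  shows "(\<Sum>p\<in>A. card (p_cyc p)) + card (cyc (carrier G) - {{\<one>}} - (\<Union>p\<in>A. p_cyc p)) + 1 = card (cyc (carrier G))"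
proof -
  let ?B = "\<Union>p\<in>A. p_cyc p"
  have "(\<Sum>p\<in>A. card (p_cyc p)) = card ?B"
    using card_UN_disjoint[OF assms(1), of p_cyc] p_cyc_disjoint assms(2) by auto
  moreover have B: "?B \<subseteq> cyc (carrier G) - {{\<one>}}" using p_cyc_subset assms(2) by blast
  moreover have "card (cyc (carrier G) - {{\<one>}} - ?B) = card (cyc (carrier G) - {{\<one>}}) - card ?B"
    by (rule card_Diff_subset) (use B assms(1) in auto)
  moreover have "card ?B \<le> card (cyc (carrier G) - {{\<one>}})" using B by (intro card_mono) simp_all
  moreover have "card (cyc (carrier G)) = card (cyc (carrier G) - {{\<one>}}) + 1"
    using card_Suc_Diff1[of "cyc (carrier G)" "{\<one>}"] trivial_mem_cyc[OF subgroup_self] by simp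
  ultimately show ?thesis by simp
qed

lemma multiplicity_pos_if_syl_ne_1:
  assumes "card (syl p) \<noteq> 1"
  shows "p dvd order G"
proof (rule ccontr)
  assume "\<not> p dvd order G"
  then have "multiplicity p (order G) = 0" by (rule not_dvd_imp_multiplicity_0)
  then have "syl p = {{\<one>}}"
    using triv_subgroup subgroup.one_closed by (fastforce simp: syl_def card_1_singleton_iff)
  then show False using assms by simp
qed

lemma syl_card_ne_1:
  assumes p: "Factorial_Ring.prime p" and P: "P \<in> syl p" and d: "p dvd order G"
  shows "p dvd card P" "card P \<noteq> 1"
proof -
  have "multiplicity p (order G) > 0"
    using d p prime_multiplicity_gt_zero_iff[of p "order G"] order_pos by simp
  then show "p dvd card P" using P by (simp add: syl_def)
  then show "card P \<noteq> 1" using p by auto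
qed

text \<open>\<open>P\<close> permutes the cyclic p-subgroups not contained in it. A fixed one would
  be normalized by \<open>P\<close> and hence lie in \<open>P\<close>, so \<open>p\<close> divides
  their number.\<close>

lemma p_cyc_syl_split:
  assumes p: "Factorial_Ring.prime p" and P: "P \<in> syl p"
  shows "card (p_cyc p) = (card (cyc P) - 1) + card (p_cyc p - cyc P)"
    and "p dvd card (p_cyc p - cyc P)"
    and "card (syl p) \<noteq> 1 \<Longrightarrow> p \<le> card (p_cyc p - cyc P)"
    and "C \<in> p_cyc p \<Longrightarrow> C \<in> cyc P \<longleftrightarrow> C \<subseteq> P"
proof -
  have sP: "subgroup P G" using P by (rule syl_subgroup)
  obtain a where a: "card P = p ^ a" using P by (auto simp: syl_def)
  have mem: "C \<in> cyc P \<longleftrightarrow> C \<subseteq> P" if "C \<in> p_cyc p" for C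
    using that mem_cyc_iff[OF sP] by (auto simp: p_cyc_def)
  then show "C \<in> p_cyc p \<Longrightarrow> C \<in> cyc P \<longleftrightarrow> C \<subseteq> P" .
  have "p_cyc p \<inter> cyc P = cyc P - {{\<one>}}"
  proof (intro equalityI subsetI)
    fix C assume C: "C \<in> cyc P - {{\<one>}}"
    then have sC: "subgroup C G" "C \<subseteq> P" using cyc_subgroup[OF sP] by auto
    obtain k where k: "card C = p ^ k"
      using card_subgroup_dvd[OF sC(1) sP sC(2)] a divides_primepow_nat[OF p] by auto
    have "k \<noteq> 0"
    proof
      assume "k = 0"
      then have "C = {\<one>}" using k card_1_subgroup[OF sC(1)] by simp
      then show False using C by simp
    qed
    then have "\<exists>k\<ge>1. card C = p ^ k" using k by (intro exI[of _ k]) simp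
    then show "C \<in> p_cyc p \<inter> cyc P" using C mem_cyc_iff[OF sP] unfolding p_cyc_def by blast
  qed (use p_cyc_subset[OF p] in auto)
  then have "card (p_cyc p \<inter> cyc P) = card (cyc P) - 1"
    using trivial_mem_cyc[OF sP] by simp
  then show "card (p_cyc p) = (card (cyc P) - 1) + card (p_cyc p - cyc P)"
    using card_Int_Diff[of "p_cyc p" "cyc P"] by simp
  interpret P: subgroup P G by (rule sP)
  have pC: "p_subgroup p C \<and> C \<subseteq> carrier G" if "C \<in> p_cyc p" for C
    using that cyc_subgroup[OF subgroup_self] by (auto simp: p_cyc_def p_subgroup_def)
  have cyc_conj: "conjugate g ` C \<in> p_cyc p" if g: "g \<in> carrier G" and C: "C \<in> p_cyc p" for g C
  proof -
    obtain x where x: "x \<in> carrier G" "C = generate G {x}" using C by (auto simp: p_cyc_def elim: cycE)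
    then have "conjugate g ` C = generate G {conjugate g x}" using g by (simp add: generate_conjugate)
    then have "conjugate g ` C \<in> cyc (carrier G)" using g x by (simp add: generate_mem_cyc)
    moreover have "card (conjugate g ` C) = card C" using g pC[OF C] by (simp add: card_conjugate_image)
    ultimately show ?thesis using C by (simp add: p_cyc_def)
  qed
  interpret act: subgroup_action G P "p_cyc p - cyc P" "\<lambda>g C. conjugate g ` C"
  proof
    fix C assume C: "C \<in> p_cyc p - cyc P"
    then have sub: "C \<subseteq> carrier G" using pC by blast
    show "conjugate \<one> ` C = C" using sub by (rule conjugate_image_one)
    show "conjugate (g \<otimes> h) ` C = conjugate g ` conjugate h ` C" if "g \<in> P" "h \<in> P" for g h
      using that sub by (simp add: conjugate_image_conjugate)
    show "conjugate g ` C \<in> p_cyc p - cyc P" if g: "g \<in> P" for g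
    proof -
      have "\<not> conjugate g ` C \<subseteq> P"
      proof
        assume "conjugate g ` C \<subseteq> P"
        then have "conjugate (inv g) ` conjugate g ` C \<subseteq> P"
          using g subgroup_conjugate_closed[OF sP] by blast
        then have "C \<subseteq> P" using g sub by (simp add: conjugate_image_conjugate conjugate_image_one)
        then show False using C mem by blast
      qed
      then show ?thesis using cyc_conj[of g C] mem[of "conjugate g ` C"] C g by auto
    qed
  qed simp
  have no_fixed: "{C \<in> p_cyc p - cyc P. \<forall>g\<in>P. conjugate g ` C = C} = {}"
  proof -
    have False if C: "C \<in> p_cyc p - cyc P" and fixed: "\<forall>g\<in>P. conjugate g ` C = C" for C
    proof -
      have "C \<subseteq> P" using normalized_p_subgroup_subset_syl[OF p P, of C] pC C fixed by blast
      then show False using C mem by blast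
    qed
    then show ?thesis by blast
  qed
  show dvd: "p dvd card (p_cyc p - cyc P)"
    using act.fixed_points_cong[OF p a] unfolding no_fixed by (simp add: cong_0_iff)
  show "p \<le> card (p_cyc p - cyc P)" if ne: "card (syl p) \<noteq> 1"
  proof -
    have "syl p \<noteq> {P}" using ne by auto
    then obtain Q where Q: "Q \<in> syl p" "Q \<noteq> P" using P by blast
    then have "\<not> Q \<subseteq> P"
      using subgroup_eqI[OF syl_subgroup[OF Q(1)] sP] P by (auto simp: syl_def)
    then obtain x where x: "x \<in> Q" "x \<notin> P" by blast
    have xc: "x \<in> carrier G" using x syl_subgroup[OF Q(1)] subgroup.mem_carrier by metis
    obtain k where k: "ord x = p ^ k" using prime_power_ord[OF syl_p_subgroup[OF Q(1)] p x(1)] by blast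
    have "k \<noteq> 0"
    proof
      assume "k = 0"
      then have "x = \<one>" using k ord_eq_1[OF xc] by simp
      then show False using x P.one_closed by simp
    qed
    then have "\<exists>k\<ge>1. ord x = p ^ k" using k by (intro exI[of _ k]) simp
    then have "generate G {x} \<in> p_cyc p"
      using xc by (simp add: p_cyc_def generate_mem_cyc card_generate_singleton)
    moreover have "generate G {x} \<notin> cyc P" using generate_mem_cyc_iff[OF sP xc] x by simp
    ultimately have "p_cyc p - cyc P \<noteq> {}" by blast
    then have "0 < card (p_cyc p - cyc P)" by (simp add: card_gt_0_iff)
    then show ?thesis using dvd dvd_imp_le by blast
  qed
qed

text \<open>The Sylow p-subgroups, all conjugate to the cyclic \<open>P\<close>, are themselves
  members of \<open>p_cyc p\<close>.\<close>

lemma syl_cyclic_card_le: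
  assumes p: "Factorial_Ring.prime p" and P: "P \<in> syl p" and d: "p dvd order G"
    and x: "x \<in> carrier G" "P = generate G {x}"
  shows "card (syl p) \<le> card (p_cyc p)"
proof (rule card_mono)
  show "syl p \<subseteq> p_cyc p"
  proof
    fix Q assume Q: "Q \<in> syl p"
    obtain g where g: "g \<in> carrier G" "Q = conjugate g ` P" using syl_conjugate[OF p P Q] by blast
    then have "Q = generate G {conjugate g x}" using x by (simp add: generate_conjugate)
    moreover have "multiplicity p (order G) \<ge> 1"
      using d p prime_multiplicity_gt_zero_iff[of p "order G"] order_pos by simp
    ultimately show "Q \<in> p_cyc p" using Q g x by (auto simp: p_cyc_def generate_mem_cyc syl_def)
  qed
qed simp

text \<open>On the four Sylow 3-subgroups the cyclic group \<open>P\<close> is transitive, so an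
  element of \<open>P\<close> fixing one of them fixes all. But the 4-cycle given by
  \<open>x\<close>, composed with a 3-cycle given by \<open>r\<close> or its inverse, exchanges two
  of them and fixes a third, and it leads to a 2-element with this behaviour, conjugate to an
  element of \<open>P\<close>.\<close>

lemma no_abelian_transitive_S4:
  assumes R: "R \<in> syl 3" "R = generate G {r}" and r: "r \<in> carrier G"
    and P: "P \<in> syl 2" "P = generate G {x}" and x: "x \<in> carrier G"
    and card4: "card (syl 3) = 4"
  shows False
proof -
  have p2: "Factorial_Ring.prime (2::nat)" and p3: "Factorial_Ring.prime (3::nat)" by simp_all
  define act where "act g S = conjugate g ` S" for g :: 'a and S
  have sub: "S \<subseteq> carrier G" if "S \<in> syl 3" for S using that syl_subgroup subgroup.subset by blast
  have act_closed: "act g S \<in> syl 3" if "g \<in> carrier G" "S \<in> syl 3" for g S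
    using that conjugate_syl by (simp add: act_def)
  have act_mult: "act (g \<otimes> h) S = act g (act h S)" if "g \<in> carrier G" "h \<in> carrier G" "S \<in> syl 3" for g h S
    using that sub by (simp add: act_def conjugate_image_conjugate)
  have act_one: "act \<one> S = S" if "S \<in> syl 3" for S
    using that sub by (simp add: act_def conjugate_image_one)
  have act_inj: "act g S = act g T \<longleftrightarrow> S = T" if "g \<in> carrier G" "S \<in> syl 3" "T \<in> syl 3" for g S T
  proof
    assume "act g S = act g T"
    then have "act (inv g) (act g S) = act (inv g) (act g T)" by simp
    then show "S = T" using that by (simp add: act_one flip: act_mult)
  qed simp
  have sP: "subgroup P G" using P(1) by (rule syl_subgroup)
  interpret P: subgroup P G by (rule sP)
  interpret A: subgroup_action G P "syl 3" act
    by unfold_locales (simp_all add: act_closed act_mult act_one)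
  define st where "st = {g \<in> P. act g R = R}"
  define NR where "NR = {g \<in> carrier G. conjugate g ` R = R}"
  have orb: "card ((\<lambda>g. act g R) ` P) * card st = card P"
    using A.orbit_stabilizer[OF R(1)] by (simp add: st_def)
  have NRc: "4 * card NR = order G" using card_syl_index(1)[OF p3 R(1)] card4 by (simp add: NR_def)
  have st_sub: "subgroup st G" "subgroup NR G" "st \<subseteq> NR"
  proof -
    have inv_fix: "act (inv g) R = R" if "g \<in> carrier G" "act g R = R" for g
      using act_mult[of "inv g" g R] that R(1) act_one by simp
    have "\<one> \<in> st" using act_one[OF R(1)] by (simp add: st_def)
    then have "st \<noteq> {}" by blast
    show "subgroup st G"
      by (rule subgroupI) (use \<open>st \<noteq> {}\<close> P.one_closed act_one[OF R(1)] inv_fix act_mult R(1) in \<open>auto simp: st_def\<close>)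
    show "subgroup NR G"
      unfolding NR_def act_def[symmetric]
      by (rule subgroupI) (use act_one[OF R(1)] inv_fix act_mult R(1) in auto)
    show "st \<subseteq> NR" by (auto simp: st_def NR_def act_def)
  qed
  \<comment> \<open>The stabilizer of \<open>R\<close> in \<open>P\<close> lies in the normalizer of
    \<open>R\<close>, which has index 4. Comparing powers of 2, the \<open>P\<close>-orbit of
    \<open>R\<close> has length divisible by 4.\<close>
  have "4 * card st dvd order G" using card_subgroup_dvd[OF st_sub] NRc by (metis dvd_refl mult_dvd_mono)
  have "card st dvd 2 ^ multiplicity 2 (order G)" using orb P(1) by (metis (mono_tags, lifting) dvd_triv_right mem_Collect_eq syl_def)
  then obtain i where i: "card st = 2 ^ i" using divides_primepow_nat[OF p2] by blast
  then have "2 ^ (i + 2) dvd order G" using \<open>4 * card st dvd order G\<close> by (simp add: power_add mult.commute)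
  then have "i + 2 \<le> multiplicity 2 (order G)"
    by (intro multiplicity_geI) simp_all
  then have "(2::nat) ^ (i + 2) dvd card P"
    using P(1) le_imp_power_dvd[of "i + 2" _ "2::nat"] by (simp add: syl_def)
  then have "4 * card st dvd card ((\<lambda>g. act g R) ` P) * card st" using orb i by (simp add: power_add mult.commute)
  then have "4 dvd card ((\<lambda>g. act g R) ` P)" using i by simp
  moreover have "card ((\<lambda>g. act g R) ` P) \<noteq> 0"
    using imageI[OF P.one_closed, of "\<lambda>g. act g R"] finite_imageI[OF finite_subgroup[OF sP]]
    by (metis card_0_eq empty_iff)
  ultimately have "4 \<le> card ((\<lambda>g. act g R) ` P)" by (simp add: dvd_imp_le)
  then have trans: "(\<lambda>g. act g R) ` P = syl 3"
    using R(1) act_closed card4 by (intro card_seteq) auto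
  \<comment> \<open>Some element of \<open>P\<close> moves \<open>S\<close> to \<open>T\<close>, and
    it commutes with \<open>h\<close>.\<close>
  have semireg: "act h T = T" if h: "h \<in> P" "act h S = S" and S: "S \<in> syl 3" "T \<in> syl 3" for h S T
  proof -
    obtain u v where uv: "u \<in> P" "S = act u R" "v \<in> P" "T = act v R" using S trans by (metis imageE)
    have com: "a \<otimes> b = b \<otimes> a" if "a \<in> P" "b \<in> P" for a b
      using that P(2) x by (auto simp: generate_singleton_iff nat_pow_mult add.commute)
    define w where "w = v \<otimes> inv u"
    have w: "w \<in> P" "T = act w S" using uv R(1) by (simp_all add: w_def m_assoc flip: act_mult)
    have "act h T = act (h \<otimes> w) S" using w h S act_mult[of h w S] by simp
    also have "\<dots> = act w (act h S)" using w h S com[of h w] act_mult[of w h S] by simp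
    finally have "act h T = act w (act h S)" .
    then show ?thesis using h w by simp
  qed
  define S1 S2 S3 where "S1 = act x R" and "S2 = act x S1" and "S3 = act x S2"
  have S: "S1 \<in> syl 3" "S2 \<in> syl 3" "S3 \<in> syl 3"
    using R(1) x act_closed by (simp_all add: S1_def S2_def S3_def)
  have actpow: "act (x [^] (Suc k)) R = act x (act (x [^] k) R)" for k :: nat
    using x R(1) nat_pow_Suc2[OF x, of k] by (simp add: act_mult del: nat_pow_Suc)
  have x4: "act x S3 = R" and distinct: "R \<noteq> S1" "R \<noteq> S2" "R \<noteq> S3" "S1 \<noteq> S2" "S1 \<noteq> S3" "S2 \<noteq> S3"
  proof -
    have pw: "act (x [^] k) R \<in> Q" if Q: "R \<in> Q" "\<And>T. T \<in> Q \<Longrightarrow> act x T \<in> Q" for k :: nat and Q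
      by (induction k) (use Q actpow x R(1) act_one in \<open>auto simp del: nat_pow_Suc\<close>)
    \<comment> \<open>As <x> is transitive, a set that contains \<open>R\<close> and is closed under
      \<open>x\<close> has all four points. This makes R, S1, S2, S3 a 4-cycle of
      \<open>x\<close>.\<close>
    have big: "4 \<le> card Q" if Q: "R \<in> Q" "\<And>T. T \<in> Q \<Longrightarrow> act x T \<in> Q" "finite Q" for Q
    proof -
      have "syl 3 \<subseteq> Q" using pw[OF Q(1,2)] x P(2) unfolding trans[symmetric] by (auto simp: generate_singleton_iff)
      then show ?thesis using card4 card_mono[OF Q(3)] by metis
    qed
    have step: "act x R = S1" "act x S1 = S2" "act x S2 = S3" by (simp_all add: S1_def S2_def S3_def)
    have 1: "R \<noteq> S1"
    proof
      assume "R = S1"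
      then have "4 \<le> card {R}" by (intro big) (use step \<open>R = S1\<close> in auto)
      then show False by simp
    qed
    have 2: "R \<noteq> S2"
    proof
      assume "R = S2"
      then have "4 \<le> card {R, S1}" by (intro big) (use step \<open>R = S2\<close> in auto)
      then show False by (simp add: card_insert_if split: if_splits)
    qed
    have 3: "R \<noteq> S3"
    proof
      assume "R = S3"
      then have "4 \<le> card {R, S1, S2}" by (intro big) (use step \<open>R = S3\<close> in auto)
      then show False by (simp add: card_insert_if split: if_splits)
    qed
    show "R \<noteq> S1" "R \<noteq> S2" "R \<noteq> S3" using 1 2 3 by auto
    show 4: "S1 \<noteq> S2" "S1 \<noteq> S3" using 1 2 act_inj x S R(1) S1_def S2_def S3_def by metis+
    show "S2 \<noteq> S3" using 4 act_inj x S S2_def S3_def by metis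
    then have "card {R, S1, S2, S3} = 4" using 1 2 3 4 by simp
    then have "{R, S1, S2, S3} = syl 3" using card4 S R(1) by (intro card_seteq) auto
    then have "act x S3 \<in> {R, S1, S2, S3}" using act_closed[OF x S(3)] by simp
    moreover have "act x S3 \<noteq> S1" "act x S3 \<noteq> S2" "act x S3 \<noteq> S3"
      using 3 4 \<open>S2 \<noteq> S3\<close> act_inj x S R(1) S1_def S2_def S3_def by metis+
    ultimately show "act x S3 = R" by blast
  qed
  have all: "syl 3 = {R, S1, S2, S3}"
    by (rule card_seteq[symmetric]) (use S R(1) distinct card4 in auto)
  have rR: "act r R = R"
  proof -
    have "conjugate r ` R \<subseteq> R" using R r syl_subgroup[OF R(1)] subgroup_conjugate_closed generate_singleton_self by blast
    then show ?thesis unfolding act_def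
      by (rule card_seteq[rotated]) (use r sub[OF R(1)] finite_subgroup[OF syl_subgroup[OF R(1)]] in \<open>simp_all add: card_conjugate_image\<close>)
  qed
  \<comment> \<open>Otherwise \<open>R\<close> would normalize the Sylow subgroup \<open>T\<close>
    and so be equal to it.\<close>
  have rfree: "act r T \<noteq> T" if T: "T \<in> syl 3" "T \<noteq> R" for T
  proof
    assume fixed: "act r T = T"
    have fixp: "act (r [^] k) T = T" for k :: nat
      by (induction k) (use r T fixed in \<open>simp_all add: act_one act_mult\<close>)
    have "T \<subseteq> carrier G" using sub T by simp
    have "R \<subseteq> T"
    proof (rule normalized_p_subgroup_subset_syl[OF p3 T(1) syl_p_subgroup[OF R(1)]])
      have "T \<subseteq> R"
      proof (rule normalized_p_subgroup_subset_syl[OF p3 R(1) syl_p_subgroup[OF T(1)]])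
        fix g h assume "g \<in> R" "h \<in> T"
        then obtain k :: nat where "g = r [^] k" using R(2) r by (auto simp: generate_singleton_iff)
        then show "conjugate g h \<in> T" using fixp[of k] \<open>h \<in> T\<close> by (auto simp: act_def)
      qed
      then have "T = R" using T(1) R(1) by (intro subgroup_eqI) (auto simp: syl_def)
      then show "conjugate g h \<in> R" if "g \<in> T" "h \<in> R" for g h using T by simp
    qed
    then have "R = T" using T(1) R(1) by (intro subgroup_eqI) (auto simp: syl_def)
    then show False using T by simp
  qed
  have r_in: "act r T \<in> {S1, S2, S3}" if "T \<in> {S1, S2, S3}" for T
  proof -
    have T: "T \<in> syl 3" "T \<noteq> R" using that S distinct by auto
    have "act r T \<noteq> act r R" using act_inj[OF r T(1) R(1)] T by simp
    then show ?thesis using act_closed[OF r T(1)] all rR by auto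
  qed
  \<comment> \<open>\<open>r\<close> permutes the three points other than \<open>R\<close>
    cyclically. \<rho> is \<open>r\<close> or its inverse, chosen so that x \<rho> exchanges
    \<open>R\<close> and \<open>S1\<close> and fixes \<open>S2\<close>.\<close>
  obtain \<rho> where \<rho>: "\<rho> \<in> carrier G" "act \<rho> R = R" "act \<rho> S1 = S3" "act \<rho> S2 = S1"
  proof -
    have ne: "act r S1 \<noteq> S1" "act r S2 \<noteq> S2" "act r S3 \<noteq> S3" using rfree S distinct by auto
    have inj: "act r S1 \<noteq> act r S2" "act r S1 \<noteq> act r S3" "act r S2 \<noteq> act r S3"
      using act_inj[OF r] S distinct by auto
    have inn: "act r S1 \<in> {S1, S2, S3}" "act r S2 \<in> {S1, S2, S3}" "act r S3 \<in> {S1, S2, S3}"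
      using r_in by auto
    consider "act r S1 = S2" | "act r S1 = S3" using ne inn by blast
    then show ?thesis
    proof cases
      case 1
      have 2: "act r S2 = S3" "act r S3 = S1" using 1 ne inj inn by auto
      have inv: "act (inv r) (act r T) = T" if "T \<in> syl 3" for T
        using that r act_one by (simp flip: act_mult)
      have "act (inv r) R = R" using inv[OF R(1)] rR by simp
      moreover have "act (inv r) S1 = S3" using inv[OF S(3)] 2 by simp
      moreover have "act (inv r) S2 = S1" using inv[OF S(1)] 1 by simp
      ultimately show ?thesis using that[of "inv r"] r by simp
    next
      case 2
      have "act r S2 = S1" using 2 ne inj inn by auto
      then show ?thesis using that[of r] r rR 2 by simp
    qed
  qed
  define g where "g = x \<otimes> \<rho>"
  have gc: "g \<in> carrier G" using x \<rho> by (simp add: g_def)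
  have gR: "act g R = S1" "act g S1 = R" "act g S2 = S2"
    using x \<rho> R(1) S x4 by (simp_all add: g_def act_mult flip: S1_def S2_def)
  \<comment> \<open>The odd power g^j is a 2-element with the same effect on \<open>R\<close> and
    \<open>S2\<close>, because g^2 fixes \<open>R\<close> and \<open>g\<close> fixes
    \<open>S2\<close>.\<close>
  obtain i j where ij: "ord g = 2 ^ i * j" "odd j"
    using multiplicity_decompose'[of "ord g" "2::nat"] ord_pos[OF gc] by (metis less_numeral_extra(3) not_prime_unit p2)
  define h where "h = g [^] j"
  have hc: "h \<in> carrier G" using gc by (simp add: h_def)
  have gpow: "act (g [^] (k + k)) R = R \<and> act (g [^] k) S2 = S2" for k :: nat
  proof (induction k)
    case (Suc k)
    have "g [^] (Suc k + Suc k) = g [^] (k + k) \<otimes> g \<otimes> g" using gc by simp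
    then show ?case using Suc gc R(1) S gR by (simp add: act_mult)
  qed (use act_one R(1) S in simp)
  obtain k where k: "j = Suc (k + k)" using ij(2) by (metis oddE mult_2 Suc_eq_plus1)
  have "act h R = act (g [^] (k + k)) (act g R)" using gc R(1) by (simp add: h_def k act_mult)
  have "act h R = S1"
  proof -
    have "act h R = act g (act (g [^] (k + k)) R)"
      using gc R(1) nat_pow_Suc2[OF gc, of "k + k"] by (simp add: h_def k act_mult del: nat_pow_Suc)
    then show ?thesis using gpow gR by simp
  qed
  moreover have hS2: "act h S2 = S2" using gpow[of j] by (simp add: h_def)
  have "p_subgroup 2 (generate G {h})"
  proof -
    have "j > 0" using ij(2) by (cases j) auto
    then have "ord h = 2 ^ i" using ord_pow[OF gc, of j] ij by (simp add: h_def)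
    then show ?thesis using hc by (auto simp: p_subgroup_def generate_singleton_subgroup card_generate_singleton)
  qed
  then obtain q where q: "q \<in> carrier G" "generate G {h} \<subseteq> conjugate q ` P"
    using p_subgroup_subset_syl_conjugate[OF p2 _ P(1)] by blast
  then obtain u where u: "u \<in> P" "h = conjugate q u" using generate_singleton_self by blast
  have qinv: "act (inv q) T \<in> syl 3" "act q (act (inv q) T) = T" if "T \<in> syl 3" for T
    using that q(1) act_closed act_one by (simp_all flip: act_mult)
  have hq: "act h T = act q (act u (act (inv q) T))" if "T \<in> syl 3" for T
    using that q(1) u act_closed by (simp add: conjugate_def act_mult)
  have "act q (act u (act (inv q) S2)) = act q (act (inv q) S2)" using hq[OF S(2)] hS2 qinv(2)[OF S(2)] by simp
  then have "act u (act (inv q) S2) = act (inv q) S2"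
    using act_inj[OF q(1)] qinv(1)[OF S(2)] u act_closed by simp
  then have "act u (act (inv q) R) = act (inv q) R"
    using semireg[OF u(1)] qinv(1)[OF S(2)] qinv(1)[OF R(1)] by blast
  then have "act h R = R" using hq[OF R(1)] qinv(2)[OF R(1)] by simp
  ultimately show False using distinct by simp
qed

end

section \<open>At most one prime with non-normal Sylow subgroups\<close>

context finite_group
begin

lemma card_syl_prime_dvd:
  assumes "Factorial_Ring.prime p" "q dvd card (syl p)"
  shows "q dvd order G"
proof -
  obtain P where "P \<in> syl p" using syl_nonempty[OF assms(1)] by blast
  then show ?thesis using card_syl_dvd[OF assms(1)] assms(2) by (meson dvd_mult_left dvd_trans)
qed

lemma p_cyc_sum_le:
  assumes "finite A" "\<forall>p\<in>A. Factorial_Ring.prime p"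
  shows "(\<Sum>p\<in>A. card (p_cyc p)) + 1 \<le> card (cyc (carrier G))"
  using sum_p_cyc_le[OF assms(1) assms(2)[rule_format]] by linarith

lemma nonnormal_syl_p_cyc:
  assumes p: "Factorial_Ring.prime p" and ne: "card (syl p) \<noteq> 1" and P: "P \<in> syl p"
  shows "card (cyc P) - 1 + p \<le> card (p_cyc p)" "1 \<le> card (cyc P) - 1"
    and "\<exists>k. card (p_cyc p) = card (cyc P) - 1 + p * k"
proof -
  show "card (cyc P) - 1 + p \<le> card (p_cyc p)"
    using p_cyc_syl_split(1,3)[OF p P] ne by linarith
  show "\<exists>k. card (p_cyc p) = card (cyc P) - 1 + p * k"
    using p_cyc_syl_split(1,2)[OF p P] by (metis dvdE)
  have "card P \<noteq> 1" using syl_card_ne_1[OF p P multiplicity_pos_if_syl_ne_1[OF ne]] by simp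
  then show "1 \<le> card (cyc P) - 1" using card_cyc_ge_2[OF syl_subgroup[OF P]] by simp
qed

lemma syl_cyclic_or_large:
  assumes p: "Factorial_Ring.prime p" and P: "P \<in> syl p"
  shows "(\<exists>x\<in>carrier G. P = generate G {x}) \<or> p + 1 \<le> card (cyc P) - 1"
proof (cases "\<exists>x\<in>P. generate G {x} = P")
  case True
  then show ?thesis using subgroup.mem_carrier[OF syl_subgroup[OF P]] by blast
next
  case False
  then have "p + 2 \<le> card (cyc P)"
    using noncyclic_p_subgroup_card_cyc[OF p syl_subgroup[OF P]] P by (auto simp: syl_def)
  then have "p + 1 \<le> card (cyc P) - 1" by linarith
  then show ?thesis by simp
qed

text \<open>Counting leaves four cyclic Sylow 3-subgroups, and 4 divides the order. A non-cyclic
  Sylow 2-subgroup is ruled out by the structure of the few cyclic 2-subgroups outside it, a cyclic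
  one by \<open>no_abelian_transitive_S4\<close>.\<close>

lemma nonnormal_2_3:
  assumes c: "card (cyc (carrier G)) = 11"
    and n2: "card (syl 2) \<noteq> 1" and n3: "card (syl 3) \<noteq> 1"
  shows False
proof -
  have p2: "Factorial_Ring.prime (2::nat)" and p3: "Factorial_Ring.prime (3::nat)" by simp_all
  obtain P where P: "P \<in> syl 2" using syl_nonempty[OF p2] by blast
  obtain R where R: "R \<in> syl 3" using syl_nonempty[OF p3] by blast
  have sum2: "card (p_cyc 2) + card (p_cyc 3) \<le> 10"
    using p_cyc_sum_le[of "{2, 3}"] c by auto
  have sum3: "card (p_cyc 2) + card (p_cyc 3) + 1 \<le> 10"
    if r: "Factorial_Ring.prime r" "r dvd order G" "r \<noteq> 2" "r \<noteq> 3" for r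
    using p_cyc_sum_le[of "{2, 3, r}"] c p_cyc_nonempty(2)[OF r(1,2)] r by auto
  note t2 = nonnormal_syl_p_cyc[OF p2 n2 P] and t3 = nonnormal_syl_p_cyc[OF p3 n3 R]
  have n3mod: "card (syl 3) mod 3 = 1" using card_syl_cong[OF p3] by (simp add: cong_def)
  have P4: "3 \<le> card (cyc P)" if "4 dvd order G"
  proof (rule ccontr)
    assume "\<not> 3 \<le> card (cyc P)"
    then have "card (cyc P) = 2" using t2(2) by simp
    then have "card P = 2" using p_subgroup_card_cyc_2[OF p2 syl_subgroup[OF P]] P by (auto simp: syl_def)
    moreover have "2 \<le> multiplicity 2 (order G)" using that by (intro multiplicity_geI) simp_all
    then have "(2::nat) ^ 2 dvd card P" using P le_imp_power_dvd[of 2 _ "2::nat"] by (simp add: syl_def)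
    ultimately show False by simp
  qed
  \<comment> \<open>A non-cyclic \<open>R\<close> forces 7 + 3 = 10 nontrivial cyclic subgroups of
    3- and 2-power order, so no prime beyond 2 and 3 divides the order. The number of Sylow
    3-subgroups is then a power of 2 other than 1 and 2, so 4 divides the order, and this requires
    one more cyclic 2-subgroup.\<close>
  have "\<exists>r\<in>carrier G. R = generate G {r}"
  proof (rule ccontr)
    assume "\<not> (\<exists>r\<in>carrier G. R = generate G {r})"
    then have "4 \<le> card (cyc R) - 1" using syl_cyclic_or_large[OF p3 R] by simp
    then have t: "card (p_cyc 3) = 7" "card (p_cyc 2) = 3" using t3(1) t2(1,2) sum2 by linarith+
    have only2: "r = 2" if r: "Factorial_Ring.prime r" "r dvd card (syl 3)" for r
    proof (rule ccontr)
      assume "r \<noteq> 2"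
      have "r \<noteq> 3" using r(2) n3mod by auto
      then show False using sum3[OF r(1) card_syl_prime_dvd[OF p3 r(2)] \<open>r \<noteq> 2\<close>] t by simp
    qed
    then have "2 dvd card (syl 3)" using prime_factor_nat[OF n3] by blast
    then obtain j where j: "card (syl 3) = 2 * j" by blast
    have "j \<noteq> 1" using j n3mod by auto
    then obtain r where r: "Factorial_Ring.prime r" "r dvd j" using prime_factor_nat by blast
    then have "r = 2" using only2[of r] j by simp
    then have "4 dvd card (syl 3)" using r(2) j by auto
    then have "4 dvd order G" by (rule card_syl_prime_dvd[OF p3])
    then show False using P4 t2(1) t by simp
  qed
  then obtain r where r: "r \<in> carrier G" "R = generate G {r}" by blast
  have d3: "3 dvd order G" using multiplicity_pos_if_syl_ne_1[OF n3] .
  have le7: "card (syl 3) \<le> card (p_cyc 3)" using syl_cyclic_card_le[OF p3 R d3 r] .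
  then have "card (syl 3) \<le> 7" using sum2 t2(1,2) by linarith
  then have "card (syl 3) = 4 \<or> card (syl 3) = 7" using n3 n3mod by presburger
  moreover have "card (syl 3) \<noteq> 7"
  proof
    assume 7: "card (syl 3) = 7"
    then have "7 dvd order G" using card_syl_prime_dvd[OF p3, of 7] by simp
    then have "card (p_cyc 2) + card (p_cyc 3) + 1 \<le> 10" by (intro sum3[of 7]) simp_all
    then show False using le7 7 t2(1,2) by linarith
  qed
  ultimately have c4: "card (syl 3) = 4" by simp
  then have P3: "3 \<le> card (cyc P)" using P4 card_syl_prime_dvd[OF p3, of 4] by simp
  have t2le: "card (p_cyc 2) \<le> 6" using sum2 le7 c4 by linarith
  have "\<exists>x\<in>carrier G. P = generate G {x}"
  proof (rule ccontr)
    assume nc: "\<not> (\<exists>x\<in>carrier G. P = generate G {x})"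
    have sP: "subgroup P G" using syl_subgroup[OF P] .
    have big: "3 \<le> card (cyc P) - 1" using syl_cyclic_or_large[OF p2 P] nc by simp
    \<comment> \<open>The part of another Sylow subgroup \<open>Q\<close> outside \<open>P\<close>
      is covered by the two members of \<open>V\<close>, and \<open>Q\<close>, not being cyclic,
      contains both. Hence two such \<open>Q\<close> coincide, and there are at most two Sylow
      2-subgroups, although their number is odd.\<close>
    define V where "V = p_cyc 2 - cyc P"
    have V: "card V = 2"
    proof -
      have "card (p_cyc 2) = card (cyc P) - 1 + card V" "2 dvd card V" "2 \<le> card V"
        using p_cyc_syl_split(1,2,3)[OF p2 P] n2 by (auto simp: V_def)
      then have "card V \<le> 3" "even (card V)" using big t2le by linarith+
      then show ?thesis using \<open>2 \<le> card V\<close> by presburger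
    qed
    have main: "\<Union>V \<subseteq> Q \<and> Q - P \<subseteq> \<Union>V" if Q: "Q \<in> syl 2" "Q \<noteq> P" for Q
    proof -
      have sQ: "subgroup Q G" using syl_subgroup[OF Q(1)] .
      have out: "generate G {x} \<in> V" if x: "x \<in> Q" "x \<notin> P" for x
      proof -
        have xc: "x \<in> carrier G" using x sQ subgroup.mem_carrier by metis
        have "generate G {x} \<in> cyc Q" using x by (simp add: generate_mem_cyc)
        have "x \<noteq> \<one>" using x subgroup.one_closed[OF sP] by blast
        then have o1: "ord x \<noteq> 1" using ord_eq_1[OF xc] by simp
        obtain k where k: "ord x = 2 ^ k" using prime_power_ord[OF syl_p_subgroup[OF Q(1)] p2 x(1)] by blast
        then have "k \<noteq> 0" using o1 by (cases k) auto
        then have "\<exists>k\<ge>1. ord x = 2 ^ k" using k by (intro exI[of _ k]) simp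
        then have "generate G {x} \<in> p_cyc 2"
          using xc by (simp add: p_cyc_def generate_mem_cyc card_generate_singleton)
        then show ?thesis using generate_mem_cyc_iff[OF sP xc] x by (simp add: V_def)
      qed
      then have QV: "Q - P \<subseteq> \<Union>V" using generate_singleton_self by fastforce
      have ncQ: "Q \<noteq> generate G {x}" if "x \<in> carrier G" for x
      proof
        assume e: "Q = generate G {x}"
        obtain g where g: "g \<in> carrier G" "P = conjugate g ` Q" using syl_conjugate[OF p2 Q(1) P] by blast
        then have "P = generate G {conjugate g x}" using e that by (simp add: generate_conjugate)
        then show False using nc g that by blast
      qed
      have nsub: "\<not> Q \<subseteq> P" using subgroup_eqI[OF sQ sP] P Q by (auto simp: syl_def)
      then obtain x where x: "x \<in> Q" "x \<notin> P" by blast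
      define U1 where "U1 = generate G {x}"
      have U1: "U1 \<in> V" "U1 \<subseteq> Q" "subgroup U1 G" "U1 \<noteq> Q"
        using out[OF x] generate_singleton_subset[OF sQ x(1)] ncQ[of x] generate_singleton_subgroup[of x]
          subgroup.mem_carrier[OF sQ x(1)] by (auto simp: U1_def)
      have "\<not> Q \<subseteq> P \<union> U1" using subgroup_subset_Un[OF sQ sP U1(3)] nsub U1 by blast
      then obtain y where y: "y \<in> Q" "y \<notin> P" "y \<notin> U1" by blast
      define U2 where "U2 = generate G {y}"
      have U2: "U2 \<in> V" "U2 \<subseteq> Q" "U1 \<noteq> U2"
        using out[OF y(1,2)] generate_singleton_subset[OF sQ y(1)] y(3) generate_singleton_self[of y]
        by (auto simp: U2_def)
      have "{U1, U2} = V"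
      proof (rule card_seteq)
        show "finite V" by (simp add: V_def)
        show "{U1, U2} \<subseteq> V" using U1(1) U2(1) by simp
        show "card V \<le> card {U1, U2}" using V U2(3) by simp
      qed
      from this[symmetric] have "\<Union>V \<subseteq> Q" using U1(2) U2(2) by simp
      then show ?thesis using QV by blast
    qed
    have "Q = Q'" if Q: "Q \<in> syl 2" "Q \<noteq> P" and Q': "Q' \<in> syl 2" "Q' \<noteq> P" for Q Q'
    proof -
      have s: "subgroup Q G" "subgroup Q' G" using Q Q' syl_subgroup by blast+
      have "Q \<subseteq> P \<union> Q'" using main[OF Q] main[OF Q'] by blast
      moreover have "\<not> Q \<subseteq> P" using subgroup_eqI[OF s(1) sP] P Q by (auto simp: syl_def)
      ultimately have "Q \<subseteq> Q'" using subgroup_subset_Un[OF s(1) sP s(2)] by blast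
      then show ?thesis using Q Q' s by (intro subgroup_eqI) (auto simp: syl_def)
    qed
    then have le: "card (syl 2 - {P}) \<le> 1" by (simp add: card_le_Suc0_iff_eq)
    have "card (syl 2) = card (syl 2 - {P}) + 1" using card_Suc_Diff1[OF finite_syl P] by simp
    moreover have "card (syl 2) mod 2 = 1" using card_syl_cong[OF p2] by (simp add: cong_def)
    ultimately have "card (syl 2) = 1" using le by presburger
    then show False using n2 by simp
  qed
  then obtain x where "x \<in> carrier G" "P = generate G {x}" by blast
  then show False using no_abelian_transitive_S4[OF R r(2,1) P] c4 by blast
qed

text \<open>The count forces six Sylow 5-subgroups, so 2 and 3 divide the order, and then exactly 3
  + 1 + 6 cyclic subgroups belong to 2, 3 and 5. The single subgroup of order 3 is centralized by an
  element of order 5, which gives a cyclic subgroup that is not accounted for.\<close>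

lemma nonnormal_5:
  assumes c: "card (cyc (carrier G)) = 11" and p: "p = 2 \<or> p = 3"
    and np: "card (syl p) \<noteq> 1" and n5: "card (syl 5) \<noteq> 1"
  shows False
proof -
  have p5: "Factorial_Ring.prime (5::nat)" by simp
  have p2: "Factorial_Ring.prime (2::nat)" and p3: "Factorial_Ring.prime (3::nat)" by simp_all
  have pp: "Factorial_Ring.prime p" using p p2 p3 by auto
  obtain P where P: "P \<in> syl p" using syl_nonempty[OF pp] by blast
  obtain R where R: "R \<in> syl 5" using syl_nonempty[OF p5] by blast
  note tp = nonnormal_syl_p_cyc[OF pp np P] and t5 = nonnormal_syl_p_cyc[OF p5 n5 R]
  have "card (p_cyc p) + card (p_cyc 5) \<le> 10"
    using p_cyc_sum_le[of "{p, 5}"] c p pp by auto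
  then have le7: "card (p_cyc 5) \<le> 7" using tp p by auto
  have "\<exists>x\<in>carrier G. R = generate G {x}"
    using syl_cyclic_or_large[OF p5 R] t5(1) le7 by linarith
  then have "card (syl 5) \<le> 7"
    using syl_cyclic_card_le[OF p5 R multiplicity_pos_if_syl_ne_1[OF n5]] le7 by force
  moreover have "card (syl 5) mod 5 = 1" using card_syl_cong[OF p5] by (simp add: cong_def)
  ultimately have "card (syl 5) = 6" using n5 by presburger
  then have d: "2 dvd order G" "3 dvd order G"
    using card_syl_prime_dvd[OF p5] by simp_all
  have sum: "card (p_cyc 2) + card (p_cyc 3) + card (p_cyc 5) \<le> 10"
    using p_cyc_sum_le[of "{2, 3, 5}"] c by auto
  have ge: "1 \<le> card (p_cyc 2)" "1 \<le> card (p_cyc 3)" "6 \<le> card (p_cyc 5)"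
    using p_cyc_nonempty(2)[OF p2 d(1)] p_cyc_nonempty(2)[OF p3 d(2)] t5(1,2) by linarith+
  have "p \<noteq> 3" using tp(1,2) sum ge by auto
  then have [simp]: "p = 2" using p by simp
  have exact: "card (p_cyc 2) = 3" "card (p_cyc 3) = 1" "card (p_cyc 5) = 6"
    using tp(1,2) sum ge by auto
  have pr: "Factorial_Ring.prime p" if "p \<in> {2, 3, 5}" for p :: nat using that p2 p3 p5 by blast
  have all: "cyc (carrier G) - {{\<one>}} - (p_cyc 2 \<union> p_cyc 3 \<union> p_cyc 5) = {}"
  proof -
    have "card (cyc (carrier G) - {{\<one>}} - (\<Union>p\<in>{2, 3, 5}. p_cyc p)) = 0"
      using sum_p_cyc_le[of "{2, 3, 5}", OF _ pr] c exact by simp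
    then show ?thesis by (simp add: Un_assoc)
  qed
  obtain u where u: "u \<in> carrier G" "ord u = 3" using cauchy[OF p3 subgroup_self] d(2) by (auto simp: order_def)
  obtain y where y: "y \<in> carrier G" "ord y = 5"
    using cauchy[OF p5 subgroup_self] multiplicity_pos_if_syl_ne_1[OF n5] by (auto simp: order_def)
  obtain C where C: "p_cyc 3 = {C}" using exact(2) by (auto simp: card_1_singleton_iff)
  have gen3: "generate G {v} = C" if "v \<in> carrier G" "ord v = 3" for v
  proof -
    have "generate G {v} \<in> p_cyc 3"
      using that by (auto simp: p_cyc_def generate_mem_cyc card_generate_singleton intro!: exI[of _ 1])
    then show ?thesis using C by blast
  qed
  have "generate G {u} = generate G {conjugate y u}"
    using gen3[OF u] gen3[of "conjugate y u"] u y by (simp add: ord_conjugate)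
  then obtain k :: nat where k: "conjugate y u = u [^] k" "coprime k (ord u)"
    using generate_eqE[OF u(1), of "conjugate y u"] u y by auto
  have iter: "conjugate (y [^] j) u = u [^] (k ^ j)" for j :: nat
  proof (induction j)
    case (Suc j)
    have "conjugate (y [^] Suc j) u = conjugate (y [^] j) (u [^] k)"
      using u y k(1) by (simp flip: conjugate_conjugate)
    also have "\<dots> = u [^] (k ^ Suc j)" using u y Suc by (simp add: conjugate_pow nat_pow_pow mult.commute)
    finally show ?case .
  qed (use u in simp)
  have "y [^] (5::nat) = \<one>" using pow_ord_eq_1[OF y(1)] y(2) by simp
  then have "u [^] (k ^ 5) = u [^] (1::nat)" using iter[of 5] u by simp
  \<comment> \<open>Automorphisms of a group of order 3 have order at most 2, so one whose fifth
    power is trivial is itself trivial.\<close>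
  then have "[k ^ 5 = 1] (mod 3)" using pow_eq_iff[OF u(1)] u(2) by metis
  then have "(k mod 3) ^ 5 mod 3 = 1" by (simp add: cong_def power_mod)
  moreover have "k mod 3 = 0 \<or> k mod 3 = 1 \<or> k mod 3 = 2" by linarith
  ultimately have "k mod 3 = 1" by auto
  then have "conjugate y u = u" using k(1) pow_eq_iff[OF u(1), of k 1] u by (simp add: cong_def)
  then have com: "u \<otimes> y = y \<otimes> u" using conjugate_eq_iff_commute u y by simp
  define g where "g = u \<otimes> y"
  have gc: "g \<in> carrier G" using u y by (simp add: g_def)
  have gp: "g [^] j = u [^] j \<otimes> y [^] j" for j :: nat
    unfolding g_def using pow_mult_distrib[OF com u(1) y(1)] .
  have "\<not> ord y dvd 3" "\<not> ord u dvd 5" using u y by simp_all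
  then have g3: "g [^] (3::nat) \<noteq> \<one>" and g5: "g [^] (5::nat) \<noteq> \<one>"
    using gp[of 3] gp[of 5] u y pow_eq_id[OF u(1), of 3] pow_eq_id[OF y(1), of 3]
      pow_eq_id[OF u(1), of 5] pow_eq_id[OF y(1), of 5] by simp_all
  have g15: "g [^] (15::nat) = \<one>"
    using gp[of 15] u y pow_eq_id[OF u(1), of 15] pow_eq_id[OF y(1), of 15] by simp
  then have o15: "ord g dvd 15" using pow_eq_id[OF gc] by blast
  have "\<not> ord g dvd 3" "\<not> ord g dvd 5" using g3 g5 pow_eq_id[OF gc] by blast+
  have "generate G {g} \<noteq> {\<one>}"
  proof
    assume "generate G {g} = {\<one>}"
    then have "g = \<one>" using generate_singleton_self[of g] by auto
    then show False using g3 by simp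
  qed
  then have "generate G {g} \<in> p_cyc 2 \<union> p_cyc 3 \<union> p_cyc 5"
    using all generate_mem_cyc[OF gc] by blast
  then obtain q l where ql: "q \<in> {2, 3, 5::nat}" "1 \<le> l" "ord g = q ^ l"
    using card_generate_singleton[OF gc] by (auto simp: p_cyc_def)
  have qd: "q dvd q ^ l" using ql(2) by simp
  have q15: "q ^ l dvd 15" using o15 ql(3) by simp
  have "q \<noteq> 2" using dvd_trans[OF qd q15] by auto
  moreover have "l < 2"
  proof (rule ccontr)
    assume "\<not> l < 2"
    then have "q ^ 2 dvd q ^ l" by (intro le_imp_power_dvd) simp
    then have "q ^ 2 dvd 15" using q15 dvd_trans by blast
    then show False using ql(1) by auto
  qed
  then have "l = 1" using ql(2) by simp
  ultimately have "ord g = 3 \<or> ord g = 5" using ql by auto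
  then show False using \<open>\<not> ord g dvd 3\<close> \<open>\<not> ord g dvd 5\<close> by auto
qed

text \<open>A prime p with non-normal Sylow subgroups accounts for at least p + 1 nontrivial cyclic
  subgroups, so two such primes have sum at most 8.\<close>

lemma at_most_one_nonnormal_syl:
  assumes c: "card (cyc (carrier G)) = 11"
    and p: "Factorial_Ring.prime p" "card (syl p) \<noteq> 1"
    and q: "Factorial_Ring.prime q" "card (syl q) \<noteq> 1"
  shows "p = q"
proof -
  have False if "p < q" and p: "Factorial_Ring.prime p" "card (syl p) \<noteq> 1"
    and q: "Factorial_Ring.prime q" "card (syl q) \<noteq> 1" for p q
  proof -
    obtain P where P: "P \<in> syl p" using syl_nonempty[OF p(1)] by blast
    obtain Q where Q: "Q \<in> syl q" using syl_nonempty[OF q(1)] by blast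
    have "card (p_cyc p) + card (p_cyc q) \<le> 10"
      using p_cyc_sum_le[of "{p, q}"] c p q \<open>p < q\<close> by auto
    then have le: "p + q \<le> 8"
      using nonnormal_syl_p_cyc(1,2)[OF p P] nonnormal_syl_p_cyc(1,2)[OF q Q] by linarith
    then have "p < 4" using \<open>p < q\<close> by simp
    then have "p = 2 \<or> p = 3" using prime_ge_2_nat[OF p(1)] by linarith
    moreover have "q \<noteq> 4" "q \<noteq> 6"
      using q(1) prime_nat_iff[of q] by (auto dest: spec[of _ 2])
    ultimately consider "p = 2" "q = 3" | "q = 5"
      using le \<open>p < q\<close> by linarith
    then show False
    proof cases
      case 1
      then show ?thesis using nonnormal_2_3[OF c] p q by simp
    next
      case 2
      then show ?thesis using nonnormal_5[OF c \<open>p = 2 \<or> p = 3\<close> p(2)] q by simp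
    qed
  qed
  then show ?thesis using p q by (metis linorder_neqE_nat)
qed

text \<open>Take a normal \<open>N\<close> of largest order prime to \<open>p\<close>. For any other
  prime q the Sylow subgroup \<open>Q\<close> is normal, and N Q is again such a subgroup, so
  \<open>Q\<close> lies in \<open>N\<close>. Thus \<open>N\<close> has the full part of the order
  prime to \<open>p\<close>.\<close>

lemma p_complement_exists:
  assumes p: "Factorial_Ring.prime p"
    and nrm: "\<And>q. Factorial_Ring.prime q \<Longrightarrow> q \<noteq> p \<Longrightarrow> card (syl q) = 1"
  obtains N P where "p_complement G p N P"
proof -
  define good where "good N \<longleftrightarrow> N \<lhd> G \<and> \<not> p dvd card N" for N
  have "\<exists>N. good N \<and> (\<forall>M. good M \<longrightarrow> card M \<le> card N)"
  proof (rule ex_has_greatest_nat)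
    show "good {\<one>}" using one_is_normal p by (auto simp: good_def)
    show "\<forall>M. good M \<longrightarrow> card M < Suc (order G)"
      using card_subgroup_dvd_order dvd_imp_le[OF _ order_pos] normal_imp_subgroup
      by (auto simp: good_def less_Suc_eq_le)
  qed
  then obtain N where N: "good N" "\<And>M. good M \<Longrightarrow> card M \<le> card N" by blast
  have nN: "N \<lhd> G" and pN: "\<not> p dvd card N" and sN: "subgroup N G"
    using N(1) normal_imp_subgroup by (auto simp: good_def)
  obtain P where P: "P \<in> syl p" using syl_nonempty[OF p] by blast
  obtain a where a: "card P = p ^ a" using P by (auto simp: syl_def)
  have full: "Q \<subseteq> N" if q: "Factorial_Ring.prime q" "q \<noteq> p" and Q: "Q \<in> syl q" for q Q
  proof -
    have nQ: "Q \<lhd> G" using syl_normal[OF q(1) _ Q] nrm[OF q] by simp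
    have sQ: "subgroup Q G" using syl_subgroup[OF Q] .
    have sNQ: "subgroup (N <#> Q) G"
      by (rule subgroup_set_mult_normalized[OF sN sQ])
        (use normal_conjugate_closed[OF nN] subgroup.mem_carrier[OF sQ] in blast)
    have "N <#> Q \<lhd> G"
      unfolding normal_iff_conjugate
    proof (intro conjI ballI sNQ)
      fix g x assume g: "g \<in> carrier G" and "x \<in> N <#> Q"
      then obtain n y where ny: "n \<in> N" "y \<in> Q" "x = n \<otimes> y" by (auto elim: set_multE)
      then have "n \<in> carrier G" "y \<in> carrier G" using sN sQ subgroup.mem_carrier by metis+
      then have "conjugate g x = conjugate g n \<otimes> conjugate g y" using g ny by (simp add: conjugate_mult)
      then show "conjugate g x \<in> N <#> Q"
        using normal_conjugate_closed[OF nN g ny(1)] normal_conjugate_closed[OF nQ g ny(2)]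
        by (simp add: set_multI)
    qed
    moreover have "\<not> p dvd card (N <#> Q)"
    proof
      assume "p dvd card (N <#> Q)"
      then have "p dvd card N * card Q" using card_set_mult[OF sN sQ] by (metis dvd_mult2)
      then have "p dvd card Q" using pN p prime_dvd_mult_iff by blast
      then have "p dvd q ^ multiplicity q (order G)" using Q by (simp add: syl_def)
      then have "p dvd q" using p prime_dvd_power by blast
      then show False using p q primes_dvd_imp_eq by blast
    qed
    ultimately have "card (N <#> Q) \<le> card N" using N(2) by (simp add: good_def)
    then have "N = N <#> Q"
      using subgroup_eqI[OF sN sNQ subset_set_mult(1)[OF sN sQ]] by simp
    then show ?thesis using subset_set_mult(2)[OF sN sQ] by simp
  qed
  have cop: "coprime (card N) (card P)"
    using pN p a by (metis coprime_commute coprime_power_right_iff prime_imp_coprime_nat)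
  have "card N * card P dvd order G"
    using card_subgroup_dvd_order[OF sN] card_subgroup_dvd_order[OF syl_subgroup[OF P]] cop
    by (rule divides_mult)
  moreover have "order G dvd card N * card P"
  proof (rule multiplicity_le_imp_dvd)
    show "order G \<noteq> 0" using order_pos by simp
    fix q :: nat assume q: "Factorial_Ring.prime q"
    have nz: "card N * card P \<noteq> 0" using card_subgroup_pos sN syl_subgroup[OF P] by simp
    have "q ^ multiplicity q (order G) dvd card N * card P"
    proof (cases "q = p")
      case True
      then show ?thesis using P by (simp add: syl_def)
    next
      case False
      obtain Q where Q: "Q \<in> syl q" using syl_nonempty[OF q] by blast
      have "card Q dvd card N" using card_subgroup_dvd[OF syl_subgroup[OF Q] sN full[OF q False Q]] .
      then show ?thesis using Q by (simp add: syl_def)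
    qed
    then show "multiplicity q (order G) \<le> multiplicity q (card N * card P)"
      using nz q by (intro multiplicity_geI) auto
  qed
  ultimately have "order G = card N * card P" by (simp add: dvd_antisym)
  then have "p_complement G p N P"
    by (intro p_complement.intro finite_group_axioms p_complement_axioms.intro p nN syl_subgroup[OF P] pN exI[of _ a] a)
  then show ?thesis by (rule that)
qed

end

section \<open>Split metacyclic groups\<close>

context group
begin

text \<open>The internal form of \<open>cyclic_semidirect\<close>. The congruence r^k = 1 (mod m)
  follows from b^k = 1. The exponent is an integer so that inversion can be written as r =
  -1.\<close>

definition split_metacyclic :: "nat \<Rightarrow> nat \<Rightarrow> int \<Rightarrow> bool" where
  "split_metacyclic m k r \<longleftrightarrow> (\<exists>a\<in>carrier G. \<exists>b\<in>carrier G. ord a = m \<and> ord b = k \<and>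
    conjugate b a = a [^] r \<and> generate G {a} \<inter> generate G {b} = {\<one>} \<and> order G = m * k)"

lemma int_pow_cong: "x \<in> carrier G \<Longrightarrow> [i = j] (mod int (ord x)) \<Longrightarrow> x [^] i = x [^] j" for i j :: int
  by (simp add: int_pow_eq cong_iff_dvd_diff dvd_diff_commute)

lemma conjugate_int_pow:
  "g \<in> carrier G \<Longrightarrow> x \<in> carrier G \<Longrightarrow> conjugate g (x [^] (i::int)) = conjugate g x [^] i"
  by (cases i rule: int_cases2) (simp_all add: int_pow_int int_pow_neg conjugate_pow conjugate_inv)

lemma conjugate_pow_int_pow:
  assumes "a \<in> carrier G" "b \<in> carrier G" "conjugate b a = a [^] (r::int)"
  shows "conjugate (b [^] (n::nat)) (a [^] (i::int)) = a [^] (r ^ n * i)"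
proof (induction n)
  case (Suc n)
  have "conjugate (b [^] Suc n) (a [^] i) = conjugate (b [^] n) (conjugate b (a [^] i))"
    using assms by (simp add: conjugate_conjugate)
  also have "conjugate b (a [^] i) = (a [^] i) [^] r"
    using assms by (simp add: conjugate_int_pow int_pow_pow mult.commute)
  also have "conjugate (b [^] n) ((a [^] i) [^] r) = (a [^] (r ^ n * i)) [^] r"
    using assms(1,2) by (subst conjugate_int_pow) (simp_all add: Suc)
  also have "\<dots> = a [^] (r ^ Suc n * i)" using assms(1) by (simp add: int_pow_pow mult_ac)
  finally show ?case .
qed (use assms in simp)

lemma int_pow_mem_generate: "a \<in> carrier G \<Longrightarrow> a [^] (i::int) \<in> generate G {a}"
  by (auto simp: generate_pow)

end

context finite_group
begin

lemma metacyclic_product_eq: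
  assumes ab: "a \<in> carrier G" "b \<in> carrier G" "generate G {a} \<inter> generate G {b} = {\<one>}"
    and eq: "a [^] (i::int) \<otimes> b [^] (j::int) = a [^] i' \<otimes> b [^] j'"
  shows "[i = i'] (mod int (ord a))" "[j = j'] (mod int (ord b))"
proof -
  have "a [^] (i - i') = inv (a [^] i') \<otimes> (a [^] i \<otimes> b [^] j) \<otimes> inv (b [^] j)"
    using ab by (simp add: int_pow_diff group_simps) (metis add.commute diff_conv_add_uminus int_pow_mult int_pow_neg)
  also have "\<dots> = b [^] (j' - j)"
    unfolding eq using ab by (simp add: int_pow_diff group_simps)
  finally have e: "a [^] (i - i') = b [^] (j' - j)" .
  then have "a [^] (i - i') \<in> generate G {a} \<inter> generate G {b}"
    using ab int_pow_mem_generate by (metis IntI)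
  then have "a [^] (i - i') = \<one>" using ab(3) by blast
  then show "[i = i'] (mod int (ord a))" using ab int_pow_eq_id by (simp add: cong_iff_dvd_diff)
  have "b [^] (j' - j) = \<one>" using e \<open>a [^] (i - i') = \<one>\<close> by simp
  then show "[j = j'] (mod int (ord b))" using ab int_pow_eq_id by (simp add: cong_iff_dvd_diff dvd_diff_commute)
qed

lemma split_metacyclic_iso:
  assumes "split_metacyclic m k r"
  shows "G \<cong> cyclic_semidirect m k r"
proof -
  obtain a b where ab: "a \<in> carrier G" "b \<in> carrier G" "ord a = m" "ord b = k"
    "conjugate b a = a [^] r" "generate G {a} \<inter> generate G {b} = {\<one>}" "order G = m * k"
    using assms by (auto simp: split_metacyclic_def)
  have m: "m > 0" and k: "k > 0" using ord_pos ab by blast+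
  have "a [^] (r ^ k * 1) = conjugate (b [^] k) (a [^] (1::int))"
    using conjugate_pow_int_pow[OF ab(1,2,5), of k 1] by simp
  also have "\<dots> = a [^] (1::int)" using pow_ord_eq_1[OF ab(2)] ab by simp
  finally have "[r ^ k = 1] (mod int m)"
    using int_pow_eq[OF ab(1), of "r ^ k * 1" 1] ab(3) by (simp add: cong_iff_dvd_diff dvd_diff_commute)
  then have rk: "r ^ k mod int m = 1 mod int m" by (simp add: cong_def)
  interpret S: group "cyclic_semidirect m k r" using group_cyclic_semidirect[OF m k rk] .
  have carr: "carrier (cyclic_semidirect m k r) = {0..<int m} \<times> {0..<int k}"
    using m k by (simp add: cyclic_semidirect_def semidirect_product_def carrier_integer_mod_group)
  define f where "f = (\<lambda>(i, j). a [^] (i::int) \<otimes> b [^] (j::int))"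
  have "f \<in> iso (cyclic_semidirect m k r) G"
  proof (rule isoI)
    show "f \<in> hom (cyclic_semidirect m k r) G"
    proof (rule homI)
      fix u v assume u: "u \<in> carrier (cyclic_semidirect m k r)" and v: "v \<in> carrier (cyclic_semidirect m k r)"
      obtain i j i' j' where uv: "u = (i, j)" "v = (i', j')" by (cases u, cases v)
      have rng: "0 \<le> j" "0 \<le> i'" "i' < int m" using u v uv carr by auto
      have "u \<otimes>\<^bsub>cyclic_semidirect m k r\<^esub> v = ((i + (r ^ nat j * i') mod int m) mod int m, (j + j') mod int k)"
        using rng uv m by (simp add: cyclic_semidirect_def semidirect_product_def cyclic_action_def carrier_integer_mod_group)
      then have "f (u \<otimes>\<^bsub>cyclic_semidirect m k r\<^esub> v) =
          a [^] ((i + (r ^ nat j * i') mod int m) mod int m) \<otimes> b [^] ((j + j') mod int k)"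
        by (simp add: f_def)
      also have "a [^] ((i + (r ^ nat j * i') mod int m) mod int m) = a [^] (i + r ^ nat j * i')"
        by (rule int_pow_cong) (use ab in \<open>simp_all add: cong_def mod_simps\<close>)
      also have "b [^] ((j + j') mod int k) = b [^] (j + j')"
        by (rule int_pow_cong) (use ab in \<open>simp_all add: cong_def\<close>)
      also have "a [^] (i + r ^ nat j * i') \<otimes> b [^] (j + j') = f u \<otimes> f v"
      proof -
        have "conjugate (b [^] nat j) (a [^] i') = a [^] (r ^ nat j * i')"
          using conjugate_pow_int_pow[OF ab(1,2,5)] .
        moreover have "b [^] nat j = b [^] j" using rng(1) by (metis int_pow_int nat_0_le)
        ultimately have "b [^] j \<otimes> a [^] i' = a [^] (r ^ nat j * i') \<otimes> b [^] j"
          using ab(1,2) conjugate_eq_mult_iff[of "b [^] j" "a [^] i'"] by simp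
        then have "f u \<otimes> f v = a [^] i \<otimes> (a [^] (r ^ nat j * i') \<otimes> b [^] j) \<otimes> b [^] j'"
          using ab(1,2) uv m_assoc[of "b [^] j" "a [^] i'" "b [^] j'"] by (simp add: f_def m_assoc)
        also have "\<dots> = (a [^] i \<otimes> a [^] (r ^ nat j * i')) \<otimes> (b [^] j \<otimes> b [^] j')"
          using ab by (simp add: m_assoc)
        finally show ?thesis using ab by (simp add: int_pow_mult)
      qed
      finally show "f (u \<otimes>\<^bsub>cyclic_semidirect m k r\<^esub> v) = f u \<otimes> f v" .
    qed (use ab in \<open>auto simp: f_def\<close>)
    have inj: "inj_on f (carrier (cyclic_semidirect m k r))"
    proof (rule inj_onI)
      fix u v assume u: "u \<in> carrier (cyclic_semidirect m k r)" and v: "v \<in> carrier (cyclic_semidirect m k r)"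
        and eq: "f u = f v"
      obtain i j i' j' where uv: "u = (i, j)" "v = (i', j')" by (cases u, cases v)
      have "[i = i'] (mod int m)" "[j = j'] (mod int k)"
        using metacyclic_product_eq[OF ab(1,2,6), of i j i' j'] eq uv ab(3,4) by (auto simp: f_def)
      then show "u = v" using u v uv carr by (simp add: cong_def)
    qed
    have sub: "f ` carrier (cyclic_semidirect m k r) \<subseteq> carrier G" using ab by (auto simp: f_def)
    have "card (f ` carrier (cyclic_semidirect m k r)) = card (carrier G)"
      using card_image[OF inj] ab(7) by (simp add: carr order_def)
    then have "f ` carrier (cyclic_semidirect m k r) = carrier G"
      by (intro card_seteq sub) simp_all
    then show "bij_betw f (carrier (cyclic_semidirect m k r)) (carrier G)" using inj by (simp add: bij_betw_def)
  qed
  then have "cyclic_semidirect m k r \<cong> G" by (rule is_isoI)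
  then show ?thesis by (rule S.iso_sym)
qed

lemma prime_ord_Int_trivial:
  assumes "a \<in> carrier G" "Factorial_Ring.prime (ord a)" "subgroup H G" "a \<notin> H"
  shows "generate G {a} \<inter> H = {\<one>}"
proof -
  have s: "subgroup (generate G {a}) G" using assms by (simp add: generate_singleton_subgroup)
  have "x = \<one>" if x: "x \<in> generate G {a}" "x \<in> H" for x
  proof (rule ccontr)
    assume "x \<noteq> \<one>"
    have xc: "x \<in> carrier G" using x(1) s subgroup.mem_carrier by metis
    have "ord x dvd ord a" using ord_dvd_card_subgroup[OF s x(1)] card_generate_singleton assms(1) by simp
    moreover have "ord x \<noteq> 1" using \<open>x \<noteq> \<one>\<close> ord_eq_1[OF xc] by simp
    ultimately have "ord x = ord a" using assms(2) prime_nat_iff by metis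
    then have "generate G {x} = generate G {a}" using ord_le_imp_generate_eq[OF xc assms(1) x(1)] by simp
    then show False using generate_singleton_subset[OF assms(3) x(2)] generate_singleton_self assms(4) by blast
  qed
  then show ?thesis using subgroup.one_closed[OF s] subgroup.one_closed[OF assms(3)] by blast
qed

lemma prime_metacyclic_Int_trivial:
  assumes "a \<in> carrier G" "b \<in> carrier G" "Factorial_Ring.prime (ord a)" "conjugate b a \<noteq> a"
  shows "generate G {a} \<inter> generate G {b} = {\<one>}"
proof (rule prime_ord_Int_trivial)
  show "a \<notin> generate G {b}"
  proof
    assume "a \<in> generate G {b}"
    then obtain j :: nat where "a = b [^] j" using assms by (auto simp: generate_singleton_iff)
    then have "conjugate b a = a"
      using assms(2) nat_pow_comm[of b 1 j] by (simp add: conjugate_eq_iff_commute)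
    then show False using assms(4) by simp
  qed
qed (use assms in \<open>simp_all add: generate_singleton_subgroup\<close>)

section \<open>Counting cyclic subgroups in split metacyclic groups\<close>

lemma card_elements_of_order:
  assumes "subgroup H G"
  shows "card {x \<in> H. ord x = d} = totient d * card {C \<in> cyc H. card C = d}"
proof -
  let ?S = "{x \<in> H. ord x = d}"
  have H: "H \<subseteq> carrier G" using assms by (rule subgroup.subset)
  have "card ?S = (\<Sum>C\<in>cyc ?S. totient (card C))"
  proof (rule card_eq_sum_totient)
    fix x y assume x: "x \<in> ?S" and y: "y \<in> carrier G" "generate G {y} = generate G {x}"
    have "y \<in> H" using generate_singleton_subset[OF assms, of x] x y(2) generate_singleton_self[of y] by blast
    moreover have "ord y = ord x" using card_generate_singleton x y H by (metis (mono_tags, lifting) mem_Collect_eq subset_iff)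
    ultimately show "y \<in> ?S" using x by simp
  qed (use H in auto)
  moreover have "cyc ?S = {C \<in> cyc H. card C = d}"
    using H by (auto simp: cyc_def card_generate_singleton subset_iff)
  ultimately show ?thesis by simp
qed

lemma card_cyc_by_order:
  assumes "finite D" "\<And>x. x \<in> carrier G \<Longrightarrow> ord x \<in> D"
  shows "card (cyc (carrier G)) = (\<Sum>d\<in>D. card {x \<in> carrier G. ord x = d} div totient d)"
proof -
  have "cyc (carrier G) = (\<Union>d\<in>D. {C \<in> cyc (carrier G). card C = d})"
    using assms(2) by (auto simp: cyc_def card_generate_singleton)
  then have "card (cyc (carrier G)) = (\<Sum>d\<in>D. card {C \<in> cyc (carrier G). card C = d})"
    using card_UN_disjoint[OF assms(1), of "\<lambda>d. {C \<in> cyc (carrier G). card C = d}"] by auto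
  also have "\<dots> = (\<Sum>d\<in>D. card {x \<in> carrier G. ord x = d} div totient d)"
  proof (rule sum.cong[OF refl])
    fix d
    show "card {C \<in> cyc (carrier G). card C = d} = card {x \<in> carrier G. ord x = d} div totient d"
    \<comment> \<open>No element has order 0, and \<open>totient 0 = 0\<close> could not be
      cancelled in the division.\<close>
    proof (cases "d = 0")
      case True
      then show ?thesis by (auto simp: cyc_def card_generate_singleton)
    qed (simp add: card_elements_of_order[OF subgroup_self])
  qed
  finally show ?thesis .
qed

text \<open>The coordinates (i, j) of a^i b^j turn the number of solutions of an equation in the
  group into a number of index pairs.\<close>

lemma card_metacyclic_solutions:
  assumes ab: "a \<in> carrier G" "b \<in> carrier G" "ord a = m" "ord b = k"
    "generate G {a} \<inter> generate G {b} = {\<one>}" "order G = m * k"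
    and Q: "\<And>i j :: nat. i < m \<Longrightarrow> j < k \<Longrightarrow> R (a [^] i \<otimes> b [^] j) \<longleftrightarrow> Q i j"
  shows "card {x \<in> carrier G. R x} = card {(i, j). i < m \<and> j < k \<and> Q i j}"
proof -
  define f where "f = (\<lambda>(i, j). a [^] (i::nat) \<otimes> b [^] (j::nat))"
  have inj: "inj_on f ({..<m} \<times> {..<k})"
  proof (rule inj_onI)
    fix u v assume u: "u \<in> {..<m} \<times> {..<k}" and v: "v \<in> {..<m} \<times> {..<k}" and eq: "f u = f v"
    obtain i j i' j' where uv: "u = (i, j)" "v = (i', j')" by (cases u, cases v)
    have "[int i = int i'] (mod int m)" "[int j = int j'] (mod int k)"
      using metacyclic_product_eq[OF ab(1,2,5), of "int i" "int j" "int i'" "int j'"] eq uv ab(3,4)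
      by (auto simp: f_def int_pow_int)
    then show "u = v" using u v uv by (simp add: cong_int_iff cong_def)
  qed
  have "f ` ({..<m} \<times> {..<k}) \<subseteq> carrier G" using ab(1,2) by (auto simp: f_def)
  moreover have "card (f ` ({..<m} \<times> {..<k})) = card (carrier G)"
    using card_image[OF inj] ab(6) by (simp add: order_def)
  ultimately have im: "f ` ({..<m} \<times> {..<k}) = carrier G" by (intro card_seteq) simp_all
  have "{x \<in> carrier G. R x} = f ` {u \<in> {..<m} \<times> {..<k}. R (f u)}"
    unfolding im[symmetric] by blast
  also have "{u \<in> {..<m} \<times> {..<k}. R (f u)} = {(i, j). i < m \<and> j < k \<and> Q i j}"
    using Q by (auto simp: f_def)
  finally have "{x \<in> carrier G. R x} = f ` {(i, j). i < m \<and> j < k \<and> Q i j}" .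
  moreover have "inj_on f {(i, j). i < m \<and> j < k \<and> Q i j}"
    by (rule inj_on_subset[OF inj]) auto
  ultimately show ?thesis by (simp add: card_image)
qed

text \<open>As b^p acts trivially and \<open>b\<close> does not, \<open>core\<close> is the maximal
  subgroup of \<open>P\<close>. Its \<open>k\<close> cyclic subgroups contribute 2 each, and
  \<open>P\<close>, whose centralizer in \<open>N\<close> is trivial, contributes
  \<open>q\<close>.\<close>

lemma metacyclic_prime_card:
  assumes sm: "split_metacyclic q (p ^ k) r" and q: "Factorial_Ring.prime q" and p: "Factorial_Ring.prime p"
    and ne: "p \<noteq> q" and k: "k > 0" and r1: "\<not> [r = 1] (mod int q)" and rp: "[r ^ p = 1] (mod int q)"
  shows "card (cyc (carrier G)) = 2 * k + q"
proof -
  obtain a b where ab: "a \<in> carrier G" "b \<in> carrier G" "ord a = q" "ord b = p ^ k"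
    "conjugate b a = a [^] r" "generate G {a} \<inter> generate G {b} = {\<one>}" "order G = q * p ^ k"
    using sm by (auto simp: split_metacyclic_def)
  define N where "N = generate G {a}"
  define P where "P = generate G {b}"
  have sN: "subgroup N G" and sP: "subgroup P G" using ab by (simp_all add: N_def P_def generate_singleton_subgroup)
  have cN: "card N = q" and cP: "card P = p ^ k" using ab by (simp_all add: N_def P_def card_generate_singleton)
  have ndvd: "\<not> p dvd q" using p q ne primes_dvd_imp_eq by blast
  have NP: "N <#> P = carrier G"
  proof -
    have "card (N <#> P) = order G" using card_set_mult[OF sN sP] ab(6,7) cN cP by (simp add: N_def P_def)
    then show ?thesis
      by (intro card_seteq) (simp_all add: setmult_subset_G sN sP subgroup.subset order_def)
  qed
  have "N \<lhd> G"
    unfolding N_def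
  proof (rule generate_singleton_normalI[OF ab(1)])
    fix g assume "g \<in> carrier G"
    then obtain n x where nx: "n \<in> N" "x \<in> P" "g = n \<otimes> x" using NP by (metis set_multE)
    obtain i j :: nat where ij: "n = a [^] i" "x = b [^] j"
      using nx ab by (auto simp: N_def P_def generate_singleton_iff)
    have "conjugate g a = conjugate (a [^] i) (conjugate (b [^] j) (a [^] (1::int)))"
      using ij nx ab by (simp add: conjugate_conjugate)
    also have "\<dots> = conjugate (a [^] i) (a [^] (r ^ j))" using conjugate_pow_int_pow[OF ab(1,2,5), of j 1] by simp
    also have "\<dots> = a [^] (r ^ j)"
    proof -
      have "a [^] int i \<otimes> a [^] (r ^ j) = a [^] (r ^ j) \<otimes> a [^] int i"
        using ab(1) by (simp flip: int_pow_mult add: add.commute)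
      then show ?thesis using ab(1) by (simp add: conjugate_eq_iff_commute int_pow_int)
    qed
    finally show "conjugate g a \<in> generate G {a}" using int_pow_mem_generate ab(1) by simp
  qed
  then interpret p_complement G p N P
    by (intro p_complement.intro finite_group_axioms p_complement_axioms.intro p sP exI[of _ k])
      (use ndvd cN cP ab(7) in simp_all)
  have nfix: "n = \<one>" if n: "n \<in> N" "conjugate b n = n" for n
  proof -
    obtain i :: nat where i: "n = a [^] i" using n ab by (auto simp: N_def generate_singleton_iff)
    have "conjugate b n = a [^] (r * int i)"
      using ab i by (simp add: conjugate_int_pow int_pow_pow flip: int_pow_int)
    then have "a [^] (r * int i) = a [^] int i" using n i by (simp add: int_pow_int)
    then have "int q dvd int i - r * int i" using int_pow_eq[OF ab(1)] ab(3) by simp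
    then have "int q dvd int i * (1 - r)" by (simp add: algebra_simps)
    moreover have "\<not> int q dvd 1 - r" using r1 by (simp add: cong_iff_dvd_diff dvd_diff_commute)
    ultimately have "int q dvd int i" using q prime_dvd_mult_iff[of "int q"] by simp
    then show ?thesis using i pow_eq_id[OF ab(1)] ab(3) by simp
  qed
  have bcore: "b \<notin> core"
  proof
    assume "b \<in> core"
    moreover have "a \<in> N" using generate_singleton_self by (simp add: N_def)
    ultimately have "conjugate b a = a" unfolding core_def by blast
    then have "a = \<one>" using nfix[of a] generate_singleton_self by (simp add: N_def)
    then show False using ab(3) q by auto
  qed
  have bp: "b [^] p \<in> core"
  proof -
    have "conjugate (b [^] p) n = n" if n: "n \<in> N" for n
    proof -
      obtain i :: nat where i: "n = a [^] i" using n ab by (auto simp: N_def generate_singleton_iff)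
      have "conjugate (b [^] p) n = a [^] (r ^ p * int i)"
        using conjugate_pow_int_pow[OF ab(1,2,5), of p "int i"] i by (simp add: int_pow_int)
      also have "\<dots> = a [^] (1 * int i)"
        by (rule int_pow_cong[OF ab(1)]) (use rp ab(3) cong_scalar_right in blast)
      finally show ?thesis using i by (simp add: int_pow_int)
    qed
    moreover have "b [^] p \<in> P" using ab(2) by (auto simp: P_def generate_singleton_iff)
    ultimately show ?thesis by (simp add: core_def)
  qed
  have "cyc core = cyc P - {P}"
  proof (intro equalityI subsetI)
    fix C assume C: "C \<in> cyc core"
    have "P \<notin> cyc core" using cyc_subgroup[OF subgroup_core, of P] bcore generate_singleton_self[of b] by (auto simp: P_def)
    then show "C \<in> cyc P - {P}" using C cyc_mono[OF core_subset] by blast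
  next
    fix C assume C: "C \<in> cyc P - {P}"
    then obtain x where x: "x \<in> P" "C = generate G {x}" by (auto simp: cyc_def)
    then obtain j :: nat where j: "x = b [^] j" using ab by (auto simp: P_def generate_singleton_iff)
    have "\<not> coprime j (ord b)" using C x j generate_pow_eq_iff[OF ab(2), of j] by (auto simp: P_def)
    then have "p dvd j" using ab(4) p by (metis coprime_commute coprime_power_left_iff prime_imp_coprime_nat)
    then obtain l where "j = p * l" by blast
    then have "x = (b [^] p) [^] l" using j ab(2) by (simp add: nat_pow_pow)
    then have "x \<in> core" using subgroup_nat_pow_closed[OF subgroup_core bp] by simp
    then show "C \<in> cyc core" using x(2) by (simp add: generate_mem_cyc)
  qed
  moreover have Pin: "P \<in> cyc P" using generate_mem_cyc[OF generate_singleton_self[of b]] by (simp add: P_def)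
  moreover have "card (cyc P) = k + 1" using card_cyc_prime_power[OF p ab(2,4)] by (simp add: P_def)
  ultimately have cc: "card (cyc core) = k" "cyc P - cyc core = {P}" by auto
  have "cent P = {\<one>}"
    using nfix N.one_closed ab(2) unfolding P_def cent_generate[OF ab(2)] by auto
  moreover from this have "card (conjs P) = q" using card_conjs[OF Pin] cN by simp
  moreover have "card (cyc {\<one>}) = 1" by (simp add: cyc_def)
  moreover have "card (cyc N) = 2" using card_cyc_prime_power[OF q ab(1), of 1] ab(3) by (simp add: N_def)
  ultimately show ?thesis using card_cyc_eq cc by simp
qed

text \<open>The hypothesis covers the direct product (r = 1) and the modular group (r = 10). In
  both, (a^i b^j)^3 = a^(3 v i) with \<open>v\<close> prime to 3, so whether the third, ninth and
  27th powers vanish depends on \<open>i\<close> alone. There are 1, 8, 18, 54 elements of orders 1,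
  3, 9, 27.\<close>

lemma metacyclic_27_3_card:
  assumes sm: "split_metacyclic 27 3 r" and r: "[r = 1] (mod 9)"
  shows "card (cyc (carrier G)) = 11"
proof -
  obtain a b where ab: "a \<in> carrier G" "b \<in> carrier G" "ord a = 27" "ord b = 3"
    "conjugate b a = a [^] r" "generate G {a} \<inter> generate G {b} = {\<one>}" "order G = 27 * 3"
    using sm by (auto simp: split_metacyclic_def)
  have cube: "\<exists>v. (a [^] i \<otimes> b [^] j) [^] (3::nat) = a [^] (3 * (v * i)) \<and> \<not> 3 dvd v" for i j :: nat
  proof -
    define s where "s = nat (r ^ j mod 27)"
    have s: "int s = r ^ j mod 27" by (simp add: s_def)
    have "conjugate (b [^] j) a = a [^] (r ^ j)"
      using conjugate_pow_int_pow[OF ab(1,2,5), of j 1] ab(1) by simp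
    also have "\<dots> = a [^] int s" by (rule int_pow_cong) (use ab s in \<open>simp_all add: cong_def\<close>)
    finally have cj: "conjugate (b [^] j) a = a [^] s" by (simp add: int_pow_int)
    have "[r ^ j = 1 ^ j] (mod 9)" using r by (rule cong_pow)
    then have "int s mod 9 = 1" unfolding s by (simp add: cong_def mod_mod_cancel)
    then have "s mod 9 = 1" by (metis numeral_One of_nat_eq_iff of_nat_numeral zmod_int)
    then obtain t where t: "s = 9 * t + 1" by (metis mod_mult_div_eq add.commute)
    have sum: "(\<Sum>l<3. s ^ l) = 3 * (27 * t * t + 9 * t + 1)"
      by (simp add: t numeral_3_eq_3 algebra_simps)
    have "(b [^] j) [^] (3::nat) = \<one>"
      using ab pow_eq_id[OF ab(2), of "j * 3"] by (simp add: nat_pow_pow)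
    then have "(a [^] i \<otimes> b [^] j) [^] (3::nat) = a [^] (i * (3 * (27 * t * t + 9 * t + 1)))"
      using mult_power_conjugate[OF ab(1) _ cj, of i 3] ab sum by simp
    moreover have "\<not> 3 dvd 27 * t * t + 9 * t + 1"
    proof -
      have "27 * t * t + 9 * t + 1 = 3 * (9 * t * t + 3 * t) + 1" by simp
      moreover have "\<not> 3 dvd 3 * u + 1" for u :: nat by presburger
      ultimately show ?thesis by metis
    qed
    ultimately show ?thesis by (metis mult.commute mult.left_commute)
  qed
  have c3: "(a [^] i \<otimes> b [^] j) [^] (3::nat) = \<one> \<longleftrightarrow> 9 dvd i"
    and c9: "(a [^] i \<otimes> b [^] j) [^] (9::nat) = \<one> \<longleftrightarrow> 3 dvd i"
    and c27: "(a [^] i \<otimes> b [^] j) [^] (27::nat) = \<one>" for i j :: nat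
  proof -
    obtain v where v: "(a [^] i \<otimes> b [^] j) [^] (3::nat) = a [^] (3 * (v * i))" "\<not> 3 dvd v" using cube by blast
    have xc: "a [^] i \<otimes> b [^] j \<in> carrier G" using ab by simp
    have v': "coprime 3 v" using v(2) by (simp add: prime_imp_coprime)
    then have v9: "coprime 9 v" using coprime_power_left_iff[of 3 2 v] by simp
    have "(a [^] i \<otimes> b [^] j) [^] (3::nat) = \<one> \<longleftrightarrow> 3 * 9 dvd 3 * (v * i)"
      using v(1) pow_eq_id[OF ab(1)] ab(3) by simp
    also have "\<dots> \<longleftrightarrow> 9 dvd i" using v9 by (simp only: nat_mult_dvd_cancel_disj) (simp add: coprime_dvd_mult_right_iff)
    finally show "(a [^] i \<otimes> b [^] j) [^] (3::nat) = \<one> \<longleftrightarrow> 9 dvd i" .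
    have x9: "(a [^] i \<otimes> b [^] j) [^] (9::nat) = a [^] (9 * (v * i))"
      using nat_pow_pow[OF xc, of 3 3] v(1) ab(1) by (simp add: nat_pow_pow mult.commute)
    then have "(a [^] i \<otimes> b [^] j) [^] (9::nat) = \<one> \<longleftrightarrow> 9 * 3 dvd 9 * (v * i)"
      using pow_eq_id[OF ab(1)] ab(3) by simp
    also have "\<dots> \<longleftrightarrow> 3 dvd i" using v' by (simp only: nat_mult_dvd_cancel_disj) (simp add: coprime_dvd_mult_right_iff)
    finally show "(a [^] i \<otimes> b [^] j) [^] (9::nat) = \<one> \<longleftrightarrow> 3 dvd i" .
    have "(a [^] i \<otimes> b [^] j) [^] (27::nat) = a [^] (27 * (v * i))"
      using nat_pow_pow[OF xc, of 9 3] x9 ab(1) by (simp add: nat_pow_pow mult.commute)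
    then show "(a [^] i \<otimes> b [^] j) [^] (27::nat) = \<one>" using pow_eq_id[OF ab(1)] ab(3) by simp
  qed
  have n3: "card {x \<in> carrier G. x [^] (3::nat) = \<one>} = 9"
  proof -
    have "card {x \<in> carrier G. x [^] (3::nat) = \<one>} = card {(i, j :: nat). i < 27 \<and> j < 3 \<and> (9::nat) dvd i}"
      by (rule card_metacyclic_solutions[OF ab(1-4,6,7)]) (rule c3)
    also have "{(i, j :: nat). i < 27 \<and> j < 3 \<and> (9::nat) dvd i} = {0, 9, 18} \<times> {..<3}"
    proof -
      have "i < 27 \<Longrightarrow> 9 dvd i \<Longrightarrow> i = 0 \<or> i = 9 \<or> i = 18" for i :: nat
        by (elim dvdE) auto
      then show ?thesis by auto
    qed
    finally show ?thesis by simp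
  qed
  have n9: "card {x \<in> carrier G. x [^] (9::nat) = \<one>} = 27"
  proof -
    have "card {x \<in> carrier G. x [^] (9::nat) = \<one>} = card {(i, j :: nat). i < 27 \<and> j < 3 \<and> (3::nat) dvd i}"
      by (rule card_metacyclic_solutions[OF ab(1-4,6,7)]) (rule c9)
    also have "{(i, j :: nat). i < 27 \<and> j < 3 \<and> (3::nat) dvd i} = ((\<lambda>l. 3 * l) ` {..<9}) \<times> {..<3}"
      by (auto simp: image_iff)
    also have "card \<dots> = 27" by (simp add: card_cartesian_product card_image inj_on_def)
    finally show ?thesis .
  qed
  have n27: "card {x \<in> carrier G. x [^] (27::nat) = \<one>} = 81"
  proof -
    have "card {x \<in> carrier G. x [^] (27::nat) = \<one>} = card {(i :: nat, j :: nat). i < 27 \<and> j < 3 \<and> True}"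
      by (rule card_metacyclic_solutions[OF ab(1-4,6,7)]) (simp add: c27)
    also have "{(i :: nat, j :: nat). i < 27 \<and> j < 3 \<and> True} = {..<27} \<times> {..<3}" by auto
    finally show ?thesis by simp
  qed
  have all: "x [^] (27::nat) = \<one>" if x: "x \<in> carrier G" for x
  proof -
    have "{x \<in> carrier G. x [^] (27::nat) = \<one>} = carrier G"
      by (rule card_seteq) (use n27 ab(7) in \<open>auto simp: order_def\<close>)
    then show ?thesis using x by blast
  qed
  have p3: "Factorial_Ring.prime (3::nat)" by simp
  have ord: "ord x \<in> {1, 3, 9, 27}" if x: "x \<in> carrier G" for x
  proof -
    have "ord x dvd 3 ^ 3" using all[OF x] pow_eq_id[OF x] by simp
    then obtain i where "i \<le> 3" "ord x = 3 ^ i" using divides_primepow_nat[OF p3] by blast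
    moreover from this have "i = 0 \<or> i = 1 \<or> i = 2 \<or> i = 3" by linarith
    ultimately show ?thesis by auto
  qed
  have dv: "ord x dvd d \<longleftrightarrow> x [^] d = \<one>" if "x \<in> carrier G" for x d using pow_eq_id[OF that] by simp
  have i1: "{x \<in> carrier G. ord x = 1} = {\<one>}" using ord_eq_1 by auto
  have i3: "{x \<in> carrier G. ord x = 3} = {x \<in> carrier G. x [^] (3::nat) = \<one>} - {\<one>}"
    using ord ord_eq_1 by (fastforce simp flip: dv)
  have i9: "{x \<in> carrier G. ord x = 9} = {x \<in> carrier G. x [^] (9::nat) = \<one>} - {x \<in> carrier G. x [^] (3::nat) = \<one>}"
    using ord by (fastforce simp flip: dv)
  have i27: "{x \<in> carrier G. ord x = 27} = carrier G - {x \<in> carrier G. x [^] (9::nat) = \<one>}"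
    using ord by (fastforce simp flip: dv)
  have sub: "{x \<in> carrier G. x [^] (3::nat) = \<one>} \<subseteq> {x \<in> carrier G. x [^] (9::nat) = \<one>}"
  proof
    fix x assume "x \<in> {x \<in> carrier G. x [^] (3::nat) = \<one>}"
    then have "x \<in> carrier G" "ord x dvd 3" using dv by auto
    then show "x \<in> {x \<in> carrier G. x [^] (9::nat) = \<one>}" using dvd_trans[of "ord x" 3 9] dv by simp
  qed
  have "card {x \<in> carrier G. ord x = 3} = 8" unfolding i3 using n3 by simp
  moreover have "card {x \<in> carrier G. ord x = 9} = 18"
    unfolding i9 using card_Diff_subset[OF _ sub] n3 n9 by simp
  moreover have "card {x \<in> carrier G. ord x = 27} = 54"
    unfolding i27 using card_Diff_subset[of "{x \<in> carrier G. x [^] (9::nat) = \<one>}" "carrier G"] n9 ab(7)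
    by (simp add: order_def)
  moreover have "card {x \<in> carrier G. ord x = 1} = 1" unfolding i1 by simp
  moreover have "totient 3 = 2" "totient 9 = 6" "totient 27 = 18"
    using totient_prime[OF p3] totient_prime_power[OF p3, of 2] totient_prime_power[OF p3, of 3] by simp_all
  moreover have "card (cyc (carrier G)) = (\<Sum>d\<in>{1, 3, 9, 27}. card {x \<in> carrier G. ord x = d} div totient d)"
    by (rule card_cyc_by_order) (use ord in auto)
  ultimately show ?thesis by simp
qed

text \<open>Since b^2 commutes with \<open>a\<close>, powers of a^i b^j are componentwise for even
  \<open>j\<close>; for odd \<open>j\<close> the square loses its \<open>a\<close>-part. The 1, 3,
  8, 6 elements of orders 1, 2, 3, 6 give 1 + 3 + 4 + 3 cyclic subgroups.\<close>

lemma metacyclic_3_6_card: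
  assumes sm: "split_metacyclic 3 6 (- 1)"
  shows "card (cyc (carrier G)) = 11"
proof -
  obtain a b where ab: "a \<in> carrier G" "b \<in> carrier G" "ord a = 3" "ord b = 6"
    "conjugate b a = a [^] (- 1 :: int)" "generate G {a} \<inter> generate G {b} = {\<one>}" "order G = 3 * 6"
    using sm by (auto simp: split_metacyclic_def)
  have even: "(a [^] i \<otimes> b [^] j) [^] n = a [^] (i * n) \<otimes> b [^] (j * n)" if "even j" for i j n :: nat
  proof -
    have "conjugate (b [^] j) a = a [^] (1::nat)"
      using conjugate_pow_int_pow[OF ab(1,2,5), of j 1] that ab(1) by simp
    then show ?thesis using mult_power_conjugate[OF ab(1), of "b [^] j" 1 i n] ab(2) by (simp add: nat_pow_pow)
  qed
  have odd: "(a [^] i \<otimes> b [^] j) [^] (2::nat) = b [^] (2 * j)" if "odd j" for i j :: nat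
  proof -
    have "conjugate (b [^] j) a = a [^] (- 1 :: int)"
      using conjugate_pow_int_pow[OF ab(1,2,5), of j 1] that ab(1) by simp
    also have "\<dots> = a [^] int 2" by (rule int_pow_cong) (use ab in \<open>simp_all add: cong_def\<close>)
    finally have cj: "conjugate (b [^] j) a = a [^] (2::nat)" by (simp only: int_pow_int)
    have sum: "(\<Sum>l<2. 2 ^ l) = (3::nat)" by (simp add: numeral_2_eq_2)
    have "(a [^] i \<otimes> b [^] j) [^] (2::nat) = a [^] (i * 3) \<otimes> (b [^] j) [^] (2::nat)"
      using mult_power_conjugate[OF ab(1) _ cj, of i 2] ab(2) sum by simp
    also have "a [^] (i * 3) = \<one>" using pow_eq_id[OF ab(1), of "i * 3"] ab(3) by simp
    finally show ?thesis using ab(2) by (simp add: nat_pow_pow mult.commute)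
  qed
  have prod1: "a [^] i \<otimes> b [^] j = \<one> \<longleftrightarrow> 3 dvd i \<and> 6 dvd j" for i j :: nat
  proof
    assume "a [^] i \<otimes> b [^] j = \<one>"
    then have "a [^] int i \<otimes> b [^] int j = a [^] (0::int) \<otimes> b [^] (0::int)" by (simp add: int_pow_int)
    from metacyclic_product_eq[OF ab(1,2,6) this] show "3 dvd i \<and> 6 dvd j"
      using ab(3,4) by (simp add: cong_0_iff int_dvd_int_iff[of 3, simplified] int_dvd_int_iff[of 6, simplified])
  next
    assume "3 dvd i \<and> 6 dvd j"
    then have "a [^] i = \<one>" "b [^] j = \<one>" using pow_eq_id[OF ab(1)] pow_eq_id[OF ab(2)] ab(3,4) by simp_all
    then show "a [^] i \<otimes> b [^] j = \<one>" by simp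
  qed
  have xc: "a [^] i \<otimes> b [^] j \<in> carrier G" for i j :: nat using ab by simp
  have oddn: "(a [^] i \<otimes> b [^] j) [^] (2 * n) = b [^] (2 * j * n)" if "odd j" for i j n :: nat
    using odd[OF that, of i] ab(2) by (simp flip: nat_pow_pow[OF xc] add: nat_pow_pow)
  have c2: "(a [^] i \<otimes> b [^] j) [^] (2::nat) = \<one> \<longleftrightarrow> j = 3 \<or> (i = 0 \<and> j = 0)" if "i < 3" "j < 6" for i j :: nat
  proof (cases "even j")
    case True
    then have "(a [^] i \<otimes> b [^] j) [^] (2::nat) = \<one> \<longleftrightarrow> 3 dvd i * 2 \<and> 6 dvd j * 2" using even prod1 by simp
    then show ?thesis using that True by presburger
  next
    case False
    then have "(a [^] i \<otimes> b [^] j) [^] (2::nat) = \<one> \<longleftrightarrow> 6 dvd 2 * j" using odd pow_eq_id[OF ab(2)] ab(4) by simp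
    then show ?thesis using that False by presburger
  qed
  have c3: "(a [^] i \<otimes> b [^] j) [^] (3::nat) = \<one> \<longleftrightarrow> even j" for i j :: nat
  proof (cases "even j")
    case True
    then have "(a [^] i \<otimes> b [^] j) [^] (3::nat) = \<one> \<longleftrightarrow> 3 dvd i * 3 \<and> 6 dvd j * 3" using even prod1 by simp
    then show ?thesis using True by presburger
  next
    case False
    have "(a [^] i \<otimes> b [^] j) [^] (3::nat) = (a [^] i \<otimes> b [^] j) [^] (2::nat) \<otimes> (a [^] i \<otimes> b [^] j)"
      by (simp add: numeral_3_eq_3 numeral_2_eq_2)
    also have "\<dots> = (b [^] (2 * j) \<otimes> a [^] i) \<otimes> b [^] j" using odd[OF False] ab by (simp add: m_assoc)
    also have "b [^] (2 * j) \<otimes> a [^] i = a [^] i \<otimes> b [^] (2 * j)"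
    proof -
      have "conjugate (b [^] (2 * j)) (a [^] int i) = a [^] int i"
        using conjugate_pow_int_pow[OF ab(1,2,5), of "2 * j" "int i"] by simp
      then show ?thesis using ab by (simp add: conjugate_eq_iff_commute int_pow_int)
    qed
    also have "(a [^] i \<otimes> b [^] (2 * j)) \<otimes> b [^] j = a [^] i \<otimes> b [^] (3 * j)"
      using ab by (simp add: m_assoc nat_pow_mult)
    finally have "(a [^] i \<otimes> b [^] j) [^] (3::nat) = \<one> \<longleftrightarrow> 3 dvd i \<and> 6 dvd 3 * j" using prod1 by simp
    then show ?thesis using False by presburger
  qed
  have c6: "(a [^] i \<otimes> b [^] j) [^] (6::nat) = \<one>" for i j :: nat
  proof (cases "even j")
    case True
    then have "(a [^] i \<otimes> b [^] j) [^] (6::nat) = \<one> \<longleftrightarrow> 3 dvd i * 6 \<and> 6 dvd j * 6" using even prod1 by simp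
    then show ?thesis by simp
  next
    case False
    then show ?thesis using oddn[OF False, of i 3] pow_eq_id[OF ab(2), of "2 * j * 3"] ab(4) by simp
  qed
  have n2: "card {x \<in> carrier G. x [^] (2::nat) = \<one>} = 4"
  proof -
    have "card {x \<in> carrier G. x [^] (2::nat) = \<one>} = card {(i :: nat, j :: nat). i < 3 \<and> j < 6 \<and> (j = 3 \<or> (i = 0 \<and> j = 0))}"
      by (rule card_metacyclic_solutions[OF ab(1-4,6,7)]) (rule c2)
    also have "{(i :: nat, j :: nat). i < 3 \<and> j < 6 \<and> (j = 3 \<or> (i = 0 \<and> j = 0))} = {(0, 3), (1, 3), (2, 3), (0, 0)}"
      by auto
    finally show ?thesis by simp
  qed
  have n3: "card {x \<in> carrier G. x [^] (3::nat) = \<one>} = 9"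
  proof -
    have "card {x \<in> carrier G. x [^] (3::nat) = \<one>} = card {(i :: nat, j :: nat). i < 3 \<and> j < 6 \<and> even j}"
      by (rule card_metacyclic_solutions[OF ab(1-4,6,7)]) (rule c3)
    also have "{(i :: nat, j :: nat). i < 3 \<and> j < 6 \<and> even j} = {..<3} \<times> {0, 2, 4}"
    proof -
      have "j < 6 \<and> even j \<longleftrightarrow> j = 0 \<or> j = 2 \<or> j = 4" for j :: nat by presburger
      then show ?thesis by auto
    qed
    finally show ?thesis by simp
  qed
  have n6: "card {x \<in> carrier G. x [^] (6::nat) = \<one>} = 18"
  proof -
    have "card {x \<in> carrier G. x [^] (6::nat) = \<one>} = card {(i :: nat, j :: nat). i < 3 \<and> j < 6 \<and> True}"
      by (rule card_metacyclic_solutions[OF ab(1-4,6,7)]) (simp add: c6)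
    also have "{(i :: nat, j :: nat). i < 3 \<and> j < 6 \<and> True} = {..<3} \<times> {..<6}" by auto
    finally show ?thesis by simp
  qed
  have dv: "ord x dvd d \<longleftrightarrow> x [^] d = \<one>" if "x \<in> carrier G" for x d using pow_eq_id[OF that] by simp
  have ord: "ord x \<in> {1, 2, 3, 6}" if x: "x \<in> carrier G" for x
  proof -
    have "{x \<in> carrier G. x [^] (6::nat) = \<one>} = carrier G"
      by (rule card_seteq) (use n6 ab(7) in \<open>auto simp: order_def\<close>)
    then have d: "ord x dvd 6" using x dv by blast
    then have "ord x \<le> 6" by (rule dvd_imp_le) simp
    then have "ord x \<in> {0, 1, 2, 3, 4, 5, 6}" by auto
    then show ?thesis using d ord_pos[OF x] by auto
  qed
  have i1: "{x \<in> carrier G. ord x = 1} = {\<one>}" using ord_eq_1 by auto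
  have i2: "{x \<in> carrier G. ord x = 2} = {x \<in> carrier G. x [^] (2::nat) = \<one>} - {\<one>}"
    using ord ord_eq_1 by (fastforce simp flip: dv)
  have i3: "{x \<in> carrier G. ord x = 3} = {x \<in> carrier G. x [^] (3::nat) = \<one>} - {\<one>}"
    using ord ord_eq_1 by (fastforce simp flip: dv)
  have o2: "card {x \<in> carrier G. ord x = 2} = 3" unfolding i2 using n2 by simp
  have o3: "card {x \<in> carrier G. ord x = 3} = 8" unfolding i3 using n3 by simp
  have o1: "card {x \<in> carrier G. ord x = 1} = 1" unfolding i1 by simp
  have i6: "{x \<in> carrier G. ord x = 6} = carrier G - ({x \<in> carrier G. ord x = 1} \<union> {x \<in> carrier G. ord x = 2} \<union> {x \<in> carrier G. ord x = 3})"
    using ord by fastforce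
  have "card ({x \<in> carrier G. ord x = 1} \<union> {x \<in> carrier G. ord x = 2} \<union> {x \<in> carrier G. ord x = 3}) = 1 + 3 + 8"
    using o1 o2 o3 by (subst card_Un_disjoint; (subst card_Un_disjoint)?) auto
  then have o6: "card {x \<in> carrier G. ord x = 6} = 6"
    unfolding i6 using ab(7) by (subst card_Diff_subset) (auto simp: order_def)
  have t6: "totient 6 = 2"
    using totient_mult_coprime[of 2 3] totient_prime[of 2] totient_prime[of 3] by simp
  have t3: "totient 3 = 2" "totient 2 = 1" using totient_prime[of 3] totient_prime[of 2] by simp_all
  have "card (cyc (carrier G)) = (\<Sum>d\<in>{1, 2, 3, 6}. card {x \<in> carrier G. ord x = d} div totient d)"
    by (rule card_cyc_by_order) (use ord in auto)
  then show ?thesis using o1 o2 o3 o6 t3 t6 by simp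
qed

end

section \<open>The groups of the list\<close>

context group
begin

lemma ord_eq_primeI:
  assumes "x \<in> carrier G" "Factorial_Ring.prime p" "x [^] (p::nat) = \<one>" "x \<noteq> \<one>"
  shows "ord x = p"
proof -
  have "ord x dvd p" using assms pow_eq_id by simp
  moreover have "ord x \<noteq> 1" using assms ord_eq_1 by simp
  ultimately show ?thesis using assms(2) prime_nat_iff by metis
qed

lemma pow_3: "x \<in> carrier G \<Longrightarrow> x [^] (3::nat) = x \<otimes> x \<otimes> x"
  by (simp add: numeral_3_eq_3)

lemma ord_eq_6I:
  assumes "x \<in> carrier G" "x [^] (6::nat) = \<one>" "x [^] (2::nat) \<noteq> \<one>" "x [^] (3::nat) \<noteq> \<one>"
  shows "ord x = 6"
proof -
  have d: "ord x dvd 6" "\<not> ord x dvd 2" "\<not> ord x dvd 3" using assms pow_eq_id by simp_all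
  then have "ord x \<le> 6" using dvd_imp_le by simp
  then have "ord x \<in> {0, 1, 2, 3, 4, 5, 6}" by auto
  then show ?thesis using d by auto
qed

lemma split_metacyclicI:
  assumes "a \<in> carrier G" "b \<in> carrier G" "ord a = m" "ord b = k" "conjugate b a = a [^] r"
    "generate G {a} \<inter> generate G {b} = {\<one>}" "order G = m * k"
  shows "split_metacyclic m k r"
  using assms unfolding split_metacyclic_def by blast

end

lemma finite_group_cyclic_semidirect:
  assumes "m > 0" "k > 0" "r ^ k mod int m = 1 mod int m"
  shows "finite_group (cyclic_semidirect m k r)"
  using group_cyclic_semidirect[OF assms] assms(1,2)
  by (simp add: finite_group_def finite_group_axioms_def cyclic_semidirect_def semidirect_product_def
      carrier_integer_mod_group)

lemma split_metacyclic_cyclic_semidirect: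
  assumes m: "m > 1" and k: "k > 1" and r: "r ^ k mod int m = 1 mod int m"
  shows "group.split_metacyclic (cyclic_semidirect m k r) m k r"
proof -
  let ?S = "cyclic_semidirect m k r"
  interpret S: finite_group ?S using finite_group_cyclic_semidirect m k r by simp
  have carr: "carrier ?S = {0..<int m} \<times> {0..<int k}"
    using m k by (simp add: cyclic_semidirect_def semidirect_product_def carrier_integer_mod_group)
  have mult: "(i, j) \<otimes>\<^bsub>?S\<^esub> (i', j') = ((i + (r ^ nat j * i') mod int m) mod int m, (j + j') mod int k)"
    if "0 \<le> i'" "i' < int m" for i j i' j'
    using that m by (simp add: cyclic_semidirect_def semidirect_product_def cyclic_action_def carrier_integer_mod_group)
  have one: "\<one>\<^bsub>?S\<^esub> = (0, 0)" by (simp add: cyclic_semidirect_def semidirect_product_def)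
  \<comment> \<open>This is where \<open>m\<close> and \<open>k\<close> must exceed 1: the carrier
    consists of least residues.\<close>
  have ac: "(1, 0) \<in> carrier ?S" and bc: "(0, 1) \<in> carrier ?S" using m k by (simp_all add: carr)
  have an: "(1, 0) [^]\<^bsub>?S\<^esub> n = (int n mod int m, 0)" for n :: nat
    by (induction n) (use m in \<open>simp_all add: one mult mod_simps add.commute\<close>)
  have bn: "(0, 1) [^]\<^bsub>?S\<^esub> n = (0, int n mod int k)" for n :: nat
    by (induction n) (use m k in \<open>simp_all add: one mult mod_simps add.commute\<close>)
  show ?thesis
  proof (rule S.split_metacyclicI[OF ac bc])
    show "S.ord (1, 0) = m" using m by (simp add: S.ord_unique[OF ac] an one mod_eq_0_iff_dvd)
    show "S.ord (0, 1) = k" using k by (simp add: S.ord_unique[OF bc] bn one mod_eq_0_iff_dvd)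
    define s where "s = nat (r mod int m)"
    have s: "int s = r mod int m" using m by (simp add: s_def)
    have "(1, 0) [^]\<^bsub>?S\<^esub> r = (1, 0) [^]\<^bsub>?S\<^esub> int s"
      by (rule S.int_pow_cong[OF ac]) (simp add: \<open>S.ord (1, 0) = m\<close> s cong_def)
    also have "\<dots> = (r mod int m, 0)" unfolding int_pow_int an by (simp add: s)
    finally have ar: "(1, 0) [^]\<^bsub>?S\<^esub> r = (r mod int m, 0)" .
    have "(0, 1) \<otimes>\<^bsub>?S\<^esub> (1, 0) = ((1, 0) [^]\<^bsub>?S\<^esub> r) \<otimes>\<^bsub>?S\<^esub> (0, 1)"
      unfolding ar using m k by (simp add: mult)
    then show "S.conjugate (0, 1) (1, 0) = (1, 0) [^]\<^bsub>?S\<^esub> r"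
      using S.conjugate_eq_mult_iff[OF bc ac] ac by simp
    show "generate ?S {(1, 0)} \<inter> generate ?S {(0, 1)} = {\<one>\<^bsub>?S\<^esub>}"
      by (auto simp: S.generate_singleton_iff[OF ac] S.generate_singleton_iff[OF bc] an bn one) (rule exI[of _ 0], simp)+
    show "order ?S = m * k" by (simp add: order_def carr)
  qed
qed

lemma finite_group_DirProd_27_3: "finite_group (integer_mod_group 27 \<times>\<times> integer_mod_group 3)"
  by (simp add: finite_group_def finite_group_axioms_def DirProd_group carrier_integer_mod_group)

lemma finite_group_DirProd_3_sym_3: "finite_group (integer_mod_group 3 \<times>\<times> sym_group 3)"
  by (simp add: finite_group_def finite_group_axioms_def DirProd_group carrier_integer_mod_group sym_group_is_group)
    (simp add: sym_group_def finite_permutations)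

lemma split_metacyclic_27_3_DirProd:
  "group.split_metacyclic (integer_mod_group 27 \<times>\<times> integer_mod_group 3) 27 3 1"
proof -
  let ?S = "integer_mod_group 27 \<times>\<times> integer_mod_group 3"
  interpret S: finite_group ?S by (rule finite_group_DirProd_27_3)
  have ac: "(1, 0) \<in> carrier ?S" and bc: "(0, 1) \<in> carrier ?S" by (simp_all add: carrier_integer_mod_group)
  have an: "(1, 0) [^]\<^bsub>?S\<^esub> n = (int n mod 27, 0)" for n :: nat
    by (induction n) (simp_all add: mod_simps add.commute)
  have bn: "(0, 1) [^]\<^bsub>?S\<^esub> n = (0, int n mod 3)" for n :: nat
    by (induction n) (simp_all add: mod_simps add.commute)
  show ?thesis
  proof (rule S.split_metacyclicI[OF ac bc])
    show "S.ord (1, 0) = 27" by (simp add: S.ord_unique[OF ac] an) presburger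
    show "S.ord (0, 1) = 3" by (simp add: S.ord_unique[OF bc] bn) presburger
    show "S.conjugate (0, 1) (1, 0) = (1, 0) [^]\<^bsub>?S\<^esub> (1::int)"
      using S.conjugate_eq_mult_iff[OF bc ac] ac by simp
    show "generate ?S {(1, 0)} \<inter> generate ?S {(0, 1)} = {\<one>\<^bsub>?S\<^esub>}"
      by (auto simp: S.generate_singleton_iff[OF ac] S.generate_singleton_iff[OF bc] an bn)
        (rule exI[of _ "0::nat"], simp)+
    show "order ?S = 27 * 3" by (simp add: order_def carrier_integer_mod_group)
  qed
qed

lemma split_metacyclic_3_6_DirProd:
  "group.split_metacyclic (integer_mod_group 3 \<times>\<times> sym_group 3) 3 6 (- 1)"
proof -
  let ?S = "integer_mod_group 3 \<times>\<times> sym_group 3"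
  interpret S: finite_group ?S by (rule finite_group_DirProd_3_sym_3)
  define s where "s = Transposition.transpose (1::nat) 2"
  define t where "t = Transposition.transpose (2::nat) 3"
  have sc: "s \<in> carrier (sym_group 3)" and tc: "t \<in> carrier (sym_group 3)"
    by (auto simp: s_def t_def sym_group_carrier intro!: permutes_swap_id)
  have stc: "s \<circ> t \<in> carrier (sym_group 3)" using sc tc by (simp add: sym_group_carrier permutes_compose)
  have mult: "x \<otimes>\<^bsub>?S\<^esub> y = ((fst x + fst y) mod 3, snd x \<circ> snd y)" for x y
    by (simp add: mult_DirProd' sym_group_mult)
  have one: "\<one>\<^bsub>?S\<^esub> = (0, id)" by (simp add: sym_group_one)
  have ss: "s \<circ> s = id" and tt: "t \<circ> t = id" by (simp_all add: s_def t_def)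
  have s3: "(s \<circ> t) \<circ> (s \<circ> t) \<circ> (s \<circ> t) = id"
    by (auto simp: s_def t_def transpose_def fun_eq_iff)
  have sne: "s 1 = 2" and stne: "(s \<circ> t) 3 = 1" by (simp_all add: s_def t_def transpose_def)
  \<comment> \<open>\<open>a\<close> is a 3-cycle in the symmetric group. \<open>b\<close> combines
    a generator of the cyclic factor with a transposition, so it has order 6 and inverts
    \<open>a\<close>.\<close>
  define a where "a = (0::int, s \<circ> t)"
  define b where "b = (1::int, s)"
  have ac: "a \<in> carrier ?S" and bc: "b \<in> carrier ?S"
    using sc stc by (simp_all add: a_def b_def carrier_integer_mod_group)
  have a3: "a [^]\<^bsub>?S\<^esub> (3::nat) = \<one>\<^bsub>?S\<^esub>"
    unfolding S.pow_3[OF ac] mult one using s3 by (simp add: a_def)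
  have "a \<noteq> \<one>\<^bsub>?S\<^esub>" using stne unfolding a_def one by (auto simp del: comp_apply)
  then have oa: "S.ord a = 3" using S.ord_eq_primeI[OF ac _ a3] by simp
  have b2: "b [^]\<^bsub>?S\<^esub> (2::nat) = (2, id)"
    using bc by (simp add: numeral_2_eq_2 mult sym_group_one) (simp add: b_def ss)
  have b3: "b [^]\<^bsub>?S\<^esub> (3::nat) = (0, s)"
  proof -
    have "b [^]\<^bsub>?S\<^esub> (3::nat) = b [^]\<^bsub>?S\<^esub> (2::nat) \<otimes>\<^bsub>?S\<^esub> b" using S.nat_pow_Suc[of b 2] by (simp del: mult_DirProd')
    then show ?thesis unfolding b2 mult by (simp add: b_def)
  qed
  have b6: "b [^]\<^bsub>?S\<^esub> (6::nat) = \<one>\<^bsub>?S\<^esub>"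
    using S.nat_pow_mult[OF bc, of 3 3] b3 by (simp add: sym_group_mult sym_group_one ss)
  have ob: "S.ord b = 6"
    by (rule S.ord_eq_6I[OF bc b6]) (use sne in \<open>auto simp: b2 b3 sym_group_one\<close>)
  have "a \<otimes>\<^bsub>?S\<^esub> (b \<otimes>\<^bsub>?S\<^esub> a) = b"
  proof -
    have "(s \<circ> t) \<circ> (s \<circ> (s \<circ> t)) = s \<circ> (t \<circ> (s \<circ> s) \<circ> t)" by (simp add: o_assoc)
    also have "\<dots> = s" by (simp add: ss tt)
    finally show ?thesis by (simp add: mult) (simp add: a_def b_def)
  qed
  then have "b \<otimes>\<^bsub>?S\<^esub> a = inv\<^bsub>?S\<^esub> a \<otimes>\<^bsub>?S\<^esub> b" 
    by (metis S.inv_solve_left S.m_closed ac bc)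
  then have cj: "S.conjugate b a = inv\<^bsub>?S\<^esub> a" using S.conjugate_eq_mult_iff[OF bc ac S.inv_closed[OF ac]] by simp
  have "S.conjugate b a \<noteq> a"
  proof
    assume "S.conjugate b a = a"
    then have "a [^]\<^bsub>?S\<^esub> (2::nat) = \<one>\<^bsub>?S\<^esub>" using cj ac by (metis S.pow_2 S.r_inv)
    then show False using S.pow_eq_id[OF ac, of 2] oa by simp
  qed
  then have int: "generate ?S {a} \<inter> generate ?S {b} = {\<one>\<^bsub>?S\<^esub>}"
    by (intro S.prime_metacyclic_Int_trivial ac bc) (simp_all add: oa)
  have ord: "order ?S = 3 * 6"
  proof -
    have "card (carrier (sym_group 3)) = fact 3" by (rule sym_group_card_carrier)
    then show ?thesis by (simp add: order_def carrier_integer_mod_group card_cartesian_product fact_numeral)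
  qed
  show ?thesis
    by (rule S.split_metacyclicI[OF ac bc oa ob _ int ord]) (use ac cj in \<open>simp add: S.int_pow_neg\<close>)
qed

section \<open>Homomorphisms from presented groups and the dicyclic group\<close>

context group
begin

definition word_eval :: "('g \<Rightarrow> 'a) \<Rightarrow> 'g word \<Rightarrow> 'a" where
  "word_eval v w = foldr (\<lambda>(x, s) y. (if s then v x else inv (v x)) \<otimes> y) w \<one>"

lemma word_eval_Nil [simp]: "word_eval v [] = \<one>"
  and word_eval_Cons [simp]: "word_eval v ((x, s) # w) = (if s then v x else inv (v x)) \<otimes> word_eval v w"
  by (simp_all add: word_eval_def)

context
  fixes v :: "'g \<Rightarrow> 'a"
  assumes v [simp]: "\<And>x. v x \<in> carrier G"
begin

lemma word_eval_closed [simp]: "word_eval v w \<in> carrier G"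
  by (induction w) auto

lemma word_eval_append: "word_eval v (u @ w) = word_eval v u \<otimes> word_eval v w"
  by (induction u) (auto simp: m_assoc)

lemma word_eval_replicate: "word_eval v (replicate n (x, True)) = v x [^] n"
  using nat_pow_Suc2[OF v] by (induction n) (simp_all del: nat_pow_Suc)

lemma word_eval_eq:
  assumes "word_eq R u w" "\<And>l r. (l, r) \<in> R \<Longrightarrow> word_eval v l = word_eval v r"
  shows "word_eval v u = word_eval v w"
  using assms
  by (induction rule: word_eq.induct) (auto simp: word_eval_append group_simps)

text \<open>Von Dyck's theorem. The map evaluates an arbitrarily chosen word of the class; by
  \<open>word_eval_eq\<close> the choice does not matter.\<close>

lemma word_class_hom:
  assumes "\<And>l r. (l, r) \<in> R \<Longrightarrow> word_eval v l = word_eval v r"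
  obtains f where "f \<in> hom (presented_group R) G" "\<And>w. f (word_class R w) = word_eval v w"
proof
  define f where "f A = word_eval v (SOME w. w \<in> A)" for A
  show f: "f (word_class R w) = word_eval v w" for w
  proof -
    have "w \<in> word_class R w" by (simp add: word_class_def word_eq_refl)
    then have "(SOME u. u \<in> word_class R w) \<in> word_class R w" by (rule someI)
    then have "word_eq R w (SOME u. u \<in> word_class R w)" by (simp add: word_class_def)
    then show ?thesis unfolding f_def using word_eval_eq assms by metis
  qed
  show "f \<in> hom (presented_group R) G"
  proof (rule homI)
    fix A B assume "A \<in> carrier (presented_group R)" "B \<in> carrier (presented_group R)"
    then obtain u w where "A = word_class R u" "B = word_class R w" by (auto simp: presented_group_def)
    then show "f (A \<otimes>\<^bsub>presented_group R\<^esub> B) = f A \<otimes> f B"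
      by (simp add: mult_presented_group f word_eval_append)
  qed (auto simp: presented_group_def f)
qed

end

end

lemma word_class_replicate:
  "word_class R (replicate n (x, True)) = word_class R [(x, True)] [^]\<^bsub>presented_group R\<^esub> n"
proof (induction n)
  case 0
  show ?case by (simp add: presented_group_def)
next
  case (Suc n)
  then show ?case
    using mult_presented_group[of R "replicate n (x, True)" "[(x, True)]"] by (simp add: replicate_append_same)
qed

lemma word_class_inverse:
  "word_class R [(x, False)] = inv\<^bsub>presented_group R\<^esub> word_class R [(x, True)]"
proof -
  interpret P: group "presented_group R" by (rule group_presented_group)
  have "word_eq R ([] @ [(x, False), (x, \<not> False)] @ []) ([] @ [])" by (rule word_eq_cancel)
  then have "word_class R [(x, False)] \<otimes>\<^bsub>presented_group R\<^esub> word_class R [(x, True)] = \<one>\<^bsub>presented_group R\<^esub>"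
    by (simp add: mult_presented_group word_class_eq_iff) (simp add: presented_group_def word_class_eq_iff)
  then show ?thesis by (intro P.inv_equality[symmetric]) (auto simp: presented_group_def)
qed

text \<open>Every element is x^i y^j with 0 <= i < 2 n and j = 0 or 1. Generation by
  \<open>x\<close> and \<open>y\<close> is expressed in \<open>gen\<close> as an induction
  principle, the form in which words provide it.\<close>

lemma (in group) card_dicyclic_le:
  assumes [simp]: "x \<in> carrier G" "y \<in> carrier G"
    and x2n: "x [^] (2 * int n) = \<one>" and y2: "y [^] (2::int) = x [^] int n" and cj: "conjugate y x = inv x"
    and n: "n > 0"
    and gen: "\<And>T. \<one> \<in> T \<Longrightarrow> (\<And>z. z \<in> T \<Longrightarrow> {x \<otimes> z, inv x \<otimes> z, y \<otimes> z, inv y \<otimes> z} \<subseteq> T) \<Longrightarrow> carrier G \<subseteq> T"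
  shows "finite (carrier G)" "card (carrier G) \<le> 4 * n"
proof -
  let ?f = "\<lambda>(i, j). x [^] (i::int) \<otimes> y [^] (j::int)"
  have yx: "y \<otimes> x [^] i = x [^] (- i) \<otimes> y" for i :: int
  proof -
    have "conjugate y (x [^] i) = x [^] (- i)" by (simp add: conjugate_int_pow cj int_pow_neg int_pow_inv)
    then show ?thesis using conjugate_eq_mult_iff[of y "x [^] i"] by simp
  qed
  have yx': "inv y \<otimes> x [^] i = x [^] (- i) \<otimes> inv y" for i :: int
  proof -
    have "inv y \<otimes> x [^] i = inv y \<otimes> (x [^] i \<otimes> y) \<otimes> inv y" by (simp add: m_assoc)
    also have "x [^] i \<otimes> y = y \<otimes> x [^] (- i)" using yx[of "- i"] by simp
    finally show ?thesis by (simp flip: m_assoc)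
  qed
  have "carrier G \<subseteq> range ?f"
  proof (rule gen)
    show "\<one> \<in> range ?f" by (rule image_eqI[where x = "(0, 0)"]) auto
  next
    fix z assume "z \<in> range ?f"
    then obtain i j :: int where z: "z = x [^] i \<otimes> y [^] j" by auto
    have "x \<otimes> z = x [^] (1 + i) \<otimes> y [^] j" "inv x \<otimes> z = x [^] (- 1 + i) \<otimes> y [^] j"
      unfolding z by (subst int_pow_mult; simp add: m_assoc int_pow_neg)+
    moreover have "y \<otimes> z = (y \<otimes> x [^] i) \<otimes> y [^] j" "inv y \<otimes> z = (inv y \<otimes> x [^] i) \<otimes> y [^] j"
      unfolding z by (simp_all add: m_assoc)
    then have "y \<otimes> z = x [^] (- i) \<otimes> y [^] (1 + j)" "inv y \<otimes> z = x [^] (- i) \<otimes> y [^] (- 1 + j)"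
      unfolding yx yx' by (subst int_pow_mult; simp add: m_assoc int_pow_neg)+
    ultimately show "{x \<otimes> z, inv x \<otimes> z, y \<otimes> z, inv y \<otimes> z} \<subseteq> range ?f"
      by (metis (mono_tags, lifting) case_prod_conv empty_subsetI insert_subset rangeI)
  qed
  also have "range ?f \<subseteq> ?f ` ({0..<2 * int n} \<times> {0..<2})"
  proof
    fix z assume "z \<in> range ?f"
    then obtain i j :: int where z: "z = x [^] i \<otimes> y [^] j" by auto
    \<comment> \<open>The even part of the exponent of \<open>y\<close> is traded for powers of
      \<open>x\<close> through y^2 = x^n.\<close>
    define l where "l = i + int n * (j div 2)"
    have "y [^] j = (y [^] (2::int)) [^] (j div 2) \<otimes> y [^] (j mod 2)"
      by (simp add: int_pow_pow flip: int_pow_mult)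
    then have "z = x [^] l \<otimes> y [^] (j mod 2)"
      unfolding z y2 l_def by (simp add: int_pow_pow int_pow_mult m_assoc)
    also have "x [^] l = (x [^] (2 * int n)) [^] (l div (2 * int n)) \<otimes> x [^] (l mod (2 * int n))"
      by (simp add: int_pow_pow flip: int_pow_mult)
    finally have "z = ?f (l mod (2 * int n), j mod 2)" by (simp add: x2n)
    moreover have "(l mod (2 * int n), j mod 2) \<in> {0..<2 * int n} \<times> {0..<2}" using n by simp
    ultimately show "z \<in> ?f ` ({0..<2 * int n} \<times> {0..<2})" by (rule image_eqI)
  qed
  finally have sub: "carrier G \<subseteq> ?f ` ({0..<2 * int n} \<times> {0..<2})" .
  then show "finite (carrier G)" by (rule finite_surj[rotated]) simp
  have "card (carrier G) \<le> card ({0..<2 * int n} \<times> {0..<2::int})" by (rule surj_card_le[OF _ sub]) simp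
  then show "card (carrier G) \<le> 4 * n" by (simp add: nat_mult_distrib)
qed

text \<open>An upper bound only. That the relations do not collapse the group further is seen, for n
  = 7, from the surjection in \<open>split_metacyclic_7_4_dicyclic\<close>.\<close>

lemma card_dicyclic_group_le:
  assumes "n > 0"
  shows "finite (carrier (dicyclic_group n))" "card (carrier (dicyclic_group n)) \<le> 4 * n"
proof -
  define R where "R = {(replicate (2 * n) (dic_x, True), []),
     ([(dic_y, True), (dic_y, True)], replicate n (dic_x, True)),
     ([(dic_y, True), (dic_x, True), (dic_y, False)], [(dic_x, False)])}"
  define D where "D = presented_group R"
  interpret D: group D unfolding D_def by (rule group_presented_group)
  define c where "c = word_class R"
  have cc [simp]: "c w \<in> carrier D" for w by (simp add: c_def D_def presented_group_def)
  have cm: "c u \<otimes>\<^bsub>D\<^esub> c w = c (u @ w)" for u w by (simp add: c_def D_def mult_presented_group)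
  have c1: "c [] = \<one>\<^bsub>D\<^esub>" by (simp add: c_def D_def presented_group_def)
  have crep: "c (replicate k (g, True)) = c [(g, True)] [^]\<^bsub>D\<^esub> k" for k g
    by (simp add: c_def D_def word_class_replicate)
  have cinv: "c [(g, False)] = inv\<^bsub>D\<^esub> c [(g, True)]" for g
    by (simp add: c_def D_def word_class_inverse)
  have rel: "c l = c r" if "(l, r) \<in> R" for l r
    using word_eq_rel[OF that, of "[]" "[]"] by (simp add: c_def word_class_eq_iff)
  define x where "x = c [(dic_x, True)]"
  define y where "y = c [(dic_y, True)]"
  have xc: "x \<in> carrier D" and yc: "y \<in> carrier D" by (simp_all add: x_def y_def)
  have "x [^]\<^bsub>D\<^esub> (2 * n) = \<one>\<^bsub>D\<^esub>"
    using rel[of "replicate (2 * n) (dic_x, True)" "[]"] c1 crep by (simp add: x_def R_def)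
  then have x2n: "x [^]\<^bsub>D\<^esub> (2 * int n) = \<one>\<^bsub>D\<^esub>" by (simp flip: int_pow_int)
  have "y \<otimes>\<^bsub>D\<^esub> y = x [^]\<^bsub>D\<^esub> n"
    using rel[of "[(dic_y, True), (dic_y, True)]" "replicate n (dic_x, True)"] crep by (simp add: x_def y_def R_def cm)
  then have y2: "y [^]\<^bsub>D\<^esub> (2::int) = x [^]\<^bsub>D\<^esub> int n"
    using int_pow_int[of D y 2] D.pow_2[OF yc] by (simp add: int_pow_int)
  have "y \<otimes>\<^bsub>D\<^esub> x \<otimes>\<^bsub>D\<^esub> inv\<^bsub>D\<^esub> y = inv\<^bsub>D\<^esub> x"
    using rel[of "[(dic_y, True), (dic_x, True), (dic_y, False)]" "[(dic_x, False)]"]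
    by (simp add: x_def y_def R_def cm flip: cinv)
  then have cj: "D.conjugate y x = inv\<^bsub>D\<^esub> x" by (simp add: D.conjugate_def)
  have gen: "carrier D \<subseteq> T" if one: "\<one>\<^bsub>D\<^esub> \<in> T"
    and cl: "\<And>z. z \<in> T \<Longrightarrow> {x \<otimes>\<^bsub>D\<^esub> z, inv\<^bsub>D\<^esub> x \<otimes>\<^bsub>D\<^esub> z, y \<otimes>\<^bsub>D\<^esub> z, inv\<^bsub>D\<^esub> y \<otimes>\<^bsub>D\<^esub> z} \<subseteq> T" for T
  proof -
    have "c w \<in> T" for w
    proof (induction w)
      case (Cons u w)
      obtain g s where u: "u = (g, s)" by (cases u)
      have "c (u # w) = c [u] \<otimes>\<^bsub>D\<^esub> c w" by (simp add: cm)
      moreover have "c [u] \<in> {x, inv\<^bsub>D\<^esub> x, y, inv\<^bsub>D\<^esub> y}"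
        by (cases g; cases s) (simp_all add: u x_def y_def cinv)
      ultimately show ?case using cl[OF Cons] by auto
    qed (use one c1 in simp)
    then show ?thesis by (auto simp: D_def presented_group_def c_def)
  qed
  have "dicyclic_group n = D" by (simp add: dicyclic_group_def D_def R_def)
  then show "finite (carrier (dicyclic_group n))" "card (carrier (dicyclic_group n)) \<le> 4 * n"
    using D.card_dicyclic_le[OF xc yc x2n y2 cj assms gen] by simp_all
qed

text \<open>The generator of order 14 is a z with the central involution z = b^2, and (a z)^7 = z =
  b^2. Since \<open>a\<close> is recovered as (a z)^8, the induced homomorphism is onto, and the
  bound 28 makes it injective.\<close>

lemma (in finite_group) split_metacyclic_7_4_dicyclic:
  assumes "split_metacyclic 7 4 (- 1)"
  shows "G \<cong> dicyclic_group 7"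
proof -
  obtain a b where ab: "a \<in> carrier G" "b \<in> carrier G" "ord a = 7" "ord b = 4"
    "conjugate b a = a [^] (- 1 :: int)" "generate G {a} \<inter> generate G {b} = {\<one>}" "order G = 7 * 4"
    using assms by (auto simp: split_metacyclic_def)
  let ?R = "{(replicate (2 * 7) (dic_x, True), []),
     ([(dic_y, True), (dic_y, True)], replicate 7 (dic_x, True)),
     ([(dic_y, True), (dic_x, True), (dic_y, False)], [(dic_x, False)])}"
  define z where "z = b \<otimes> b"
  have zc: "z \<in> carrier G" using ab by (simp add: z_def)
  have "conjugate (b [^] (2::nat)) (a [^] (1::int)) = a [^] (1::int)"
    using conjugate_pow_int_pow[OF ab(1,2,5), of 2 1] by simp
  then have com: "z \<otimes> a = a \<otimes> z"
    using ab zc conjugate_eq_iff_commute[of z a] by (simp add: pow_2 z_def)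
  have b4: "b [^] (4::nat) = \<one>" and a7: "a [^] (7::nat) = \<one>" using ab pow_ord_eq_1 by metis+
  have zz: "z \<otimes> z = \<one>" using b4 ab(2) by (simp add: z_def numeral_eq_Suc m_assoc)
  have powz: "(a \<otimes> z) [^] n = a [^] n \<otimes> z [^] n" for n :: nat
    using pow_mult_distrib[OF com[symmetric] ab(1) zc] .
  have z7: "z [^] (7::nat) = z" "z [^] (14::nat) = \<one>" "z [^] (8::nat) = \<one>"
  proof -
    have "ord z dvd 2" using zz pow_eq_id[OF zc, of 2] zc by (simp add: pow_2)
    then have d: "z [^] n = \<one>" if "even n" for n :: nat using that pow_eq_id[OF zc] dvd_trans by blast
    then show "z [^] (14::nat) = \<one>" "z [^] (8::nat) = \<one>" by simp_all
    show "z [^] (7::nat) = z" using nat_pow_Suc[of z 6] d[of 6] zc by simp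
  qed
  define v where "v g = (case g of dic_x \<Rightarrow> a \<otimes> z | dic_y \<Rightarrow> b)" for g
  have vx: "v dic_x = a \<otimes> z" and vy: "v dic_y = b" by (simp_all add: v_def)
  have vc: "v g \<in> carrier G" for g using ab zc by (cases g) (simp_all add: v_def)
  have rel: "word_eval v l = word_eval v r" if "(l, r) \<in> ?R" for l r
  proof -
    have "a [^] (14::nat) = \<one>" using ab pow_eq_id[OF ab(1)] by simp
    then have r1: "word_eval v (replicate (2 * 7) (dic_x, True)) = word_eval v []"
      by (simp add: word_eval_replicate vc vx powz z7)
    have r2: "word_eval v [(dic_y, True), (dic_y, True)] = word_eval v (replicate 7 (dic_x, True))"
      using ab zc unfolding word_eval_replicate[of v, OF vc] vx powz by (simp add: vy a7 z7 flip: z_def)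
    have "conjugate b (a \<otimes> z) = inv a \<otimes> z"
    proof -
      have "conjugate b z = z" using ab by (simp add: conjugate_eq_iff_commute z_def m_assoc)
      then show ?thesis using ab zc by (simp add: conjugate_mult int_pow_neg)
    qed
    moreover have "inv (a \<otimes> z) = inv a \<otimes> z"
      by (rule inv_equality) (use ab zc com zz in \<open>simp_all add: m_assoc\<close>, metis com inv_closed inv_solve_left l_one m_assoc one_closed r_one zz)
    ultimately have r3: "word_eval v [(dic_y, True), (dic_x, True), (dic_y, False)] = word_eval v [(dic_x, False)]"
      using ab zc by (simp add: vx vy conjugate_def m_assoc)
    show ?thesis using that r1 r2 r3 by auto
  qed
  obtain f where f: "f \<in> hom (presented_group ?R) G" "\<And>w. f (word_class ?R w) = word_eval v w"
    using word_class_hom[of v ?R, OF vc rel] by blast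
  have fim: "f ` carrier (presented_group ?R) = carrier G"
  proof (rule antisym)
    show "f ` carrier (presented_group ?R) \<subseteq> carrier G" using f(1) by (auto simp: hom_def)
    have "generate G {a} <#> generate G {b} = carrier G"
    proof (rule card_seteq)
      have s: "subgroup (generate G {a}) G" "subgroup (generate G {b}) G"
        using ab by (simp_all add: generate_singleton_subgroup)
      show "generate G {a} <#> generate G {b} \<subseteq> carrier G" using s by (simp add: setmult_subset_G subgroup.subset)
      show "card (carrier G) \<le> card (generate G {a} <#> generate G {b})"
        using card_set_mult[OF s] ab by (simp add: card_generate_singleton order_def)
    qed simp
    moreover have "g \<otimes> h \<in> f ` carrier (presented_group ?R)"
      if gh: "g \<in> generate G {a}" "h \<in> generate G {b}" for g h
    proof -
      obtain i j :: nat where ij: "g = a [^] i" "h = b [^] j"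
        using gh generate_singleton_iff[OF ab(1)] generate_singleton_iff[OF ab(2)] by auto
      have a8: "(a \<otimes> z) [^] (8::nat) = a" using powz[of 8] z7 nat_pow_Suc[of a 7] a7 ab(1) by simp
      have "word_eval v (replicate (8 * i) (dic_x, True) @ replicate j (dic_y, True)) = (a \<otimes> z) [^] (8 * i) \<otimes> b [^] j"
        by (simp add: word_eval_append word_eval_replicate vc vx vy)
      also have "(a \<otimes> z) [^] (8 * i) = a [^] i"
        using a8 nat_pow_pow[of "a \<otimes> z" 8 i] ab(1) zc by simp
      finally have "f (word_class ?R (replicate (8 * i) (dic_x, True) @ replicate j (dic_y, True))) = g \<otimes> h"
        using f(2) ij by simp
      moreover have "word_class ?R w \<in> carrier (presented_group ?R)" for w by (simp add: presented_group_def)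
      ultimately show ?thesis by (metis image_eqI)
    qed
    ultimately show "carrier G \<subseteq> f ` carrier (presented_group ?R)" by (metis set_multE subsetI)
  qed
  have D: "finite (carrier (presented_group ?R))" "card (carrier (presented_group ?R)) \<le> 28"
    using card_dicyclic_group_le[of 7] by (simp_all add: dicyclic_group_def)
  have "card (carrier G) = 28" using ab(7) by (simp add: order_def)
  then have "card (carrier (presented_group ?R)) = card (f ` carrier (presented_group ?R))"
    using D card_image_le[OF D(1), of f] fim by simp
  then have "inj_on f (carrier (presented_group ?R))" using D(1) by (metis eq_card_imp_inj_on)
  then have "f \<in> iso (presented_group ?R) G" using f(1) fim by (simp add: iso_def bij_betw_def)
  then have "presented_group ?R \<cong> G" by (rule is_isoI)
  then have "G \<cong> presented_group ?R" using group.iso_sym group_presented_group by blast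
  then show ?thesis by (simp add: dicyclic_group_def)
qed

section \<open>Cyclic groups\<close>

lemma (in group) cyclic_iso_integer_mod_group:
  assumes x: "x \<in> carrier G" and ord: "ord x = n" "n > 0" and gen: "generate G {x} = carrier G"
  shows "G \<cong> integer_mod_group n"
proof -
  define f where "f i = x [^] (i::int)" for i
  have inj: "inj_on f (carrier (integer_mod_group n))"
  proof (rule inj_onI)
    fix i j assume ij: "i \<in> carrier (integer_mod_group n)" "j \<in> carrier (integer_mod_group n)" "f i = f j"
    then have "int n dvd j - i" using int_pow_eq[OF x] ord(1) by (simp add: f_def)
    then have "i mod int n = j mod int n" by (metis mod_eq_dvd_iff)
    then show "i = j" using ij ord(2) by (simp add: carrier_integer_mod_group)
  qed
  have "f \<in> iso (integer_mod_group n) G"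
  proof (rule isoI)
    show "f \<in> hom (integer_mod_group n) G"
    proof (rule homI)
      fix i j
      have "x [^] ((i + j) mod int n) = x [^] (i + j)" by (rule int_pow_cong[OF x]) (simp add: ord(1) cong_def)
      then show "f (i \<otimes>\<^bsub>integer_mod_group n\<^esub> j) = f i \<otimes> f j" using x by (simp add: f_def int_pow_mult)
    qed (use x in \<open>simp add: f_def\<close>)
    have "carrier G \<subseteq> f ` carrier (integer_mod_group n)"
    proof
      fix y assume "y \<in> carrier G"
      then obtain i :: int where i: "y = x [^] i" using gen x by (auto simp: generate_pow)
      have "y = f (i mod int n)" unfolding i f_def by (rule int_pow_cong[OF x]) (simp add: ord(1) cong_def)
      then show "y \<in> f ` carrier (integer_mod_group n)" using ord(2) by (simp add: carrier_integer_mod_group)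
    qed
    moreover have "f ` carrier (integer_mod_group n) \<subseteq> carrier G" using x by (auto simp: f_def)
    ultimately show "bij_betw f (carrier (integer_mod_group n)) (carrier G)" using inj by (auto simp: bij_betw_def)
  qed
  then have "integer_mod_group n \<cong> G" by (rule is_isoI)
  then show ?thesis using group.iso_sym group_integer_mod_group by blast
qed

lemma card_cyclic_subgroups_integer_mod_group_prime_power:
  assumes p: "Factorial_Ring.prime (p::nat)" and k: "k > 0"
  shows "card (cyclic_subgroups (integer_mod_group (p ^ k))) = k + 1"
proof -
  let ?Z = "integer_mod_group (p ^ k)"
  have n: "p ^ k > 1" using p k prime_gt_1_nat one_less_power by blast
  interpret Z: finite_group ?Z
    using p by (simp add: finite_group_def finite_group_axioms_def) (simp add: carrier_integer_mod_group prime_gt_0_nat)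
  have one: "1 \<in> carrier ?Z" unfolding integer_mod_group_1 using n by linarith
  have pw: "1 [^]\<^bsub>?Z\<^esub> j = int j mod int (p ^ k)" for j :: nat
    by (simp only: pow_integer_mod_group mult_1_right)
  have ord: "Z.ord 1 = p ^ k"
    unfolding Z.ord_unique[OF one] pw one_integer_mod_group by (metis mod_0_imp_dvd dvd_imp_mod_0 int_dvd_int_iff)
  have "generate ?Z {1} = carrier ?Z"
  proof (rule card_seteq)
    show "generate ?Z {1} \<subseteq> carrier ?Z" using Z.generate_incl one by simp
    show "card (carrier ?Z) \<le> card (generate ?Z {1})"
      unfolding Z.card_generate_singleton[OF one] ord using n by (simp add: carrier_integer_mod_group del: of_nat_power)
  qed simp
  then show ?thesis using Z.card_cyc_prime_power[OF p one ord] by (simp add: Z.cyclic_subgroups_eq_cyc)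
qed

section \<open>The classification\<close>

context finite_group
begin

lemma split_metacyclic_cong:
  assumes "split_metacyclic m k r" "[r = s] (mod int m)"
  shows "split_metacyclic m k s"
proof -
  obtain a b where ab: "a \<in> carrier G" "b \<in> carrier G" "ord a = m" "ord b = k"
    "conjugate b a = a [^] r" "generate G {a} \<inter> generate G {b} = {\<one>}" "order G = m * k"
    using assms(1) by (auto simp: split_metacyclic_def)
  have "a [^] r = a [^] s" using int_pow_cong[OF ab(1)] assms(2) ab(3) by simp
  then show ?thesis using split_metacyclicI[OF ab(1-4) _ ab(6,7)] ab(5) by simp
qed

text \<open>Replaces \<open>b\<close> by another generator of <b>. This identifies the two exponents
  of order 3: 19^2 = 10 (mod 27) and 4^2 = 2 (mod 7).\<close>

lemma split_metacyclic_power: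
  assumes "split_metacyclic m k r" "coprime j k"
  shows "split_metacyclic m k (r ^ j)"
proof -
  obtain a b where ab: "a \<in> carrier G" "b \<in> carrier G" "ord a = m" "ord b = k"
    "conjugate b a = a [^] r" "generate G {a} \<inter> generate G {b} = {\<one>}" "order G = m * k"
    using assms(1) by (auto simp: split_metacyclic_def)
  have bj: "b [^] j \<in> carrier G" using ab by simp
  have gen: "generate G {b [^] j} = generate G {b}" using generate_pow_eq_iff[OF ab(2)] ab(4) assms(2) by simp
  then have "ord (b [^] j) = k" using card_generate_singleton ab(2,4) bj by metis
  moreover have "conjugate (b [^] j) a = a [^] (r ^ j)"
    using conjugate_pow_int_pow[OF ab(1,2,5), of j 1] ab(1) by simp
  ultimately show ?thesis using split_metacyclicI[OF ab(1) bj ab(3) _ _ _ ab(7)] gen ab(6) by simp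
qed

text \<open>\<open><a>\<close> has index 3 and turns out to be normal. For a suitable
  \<open>w\<close> outside it, w^3 = a^s with 3 dividing \<open>s\<close>, as otherwise <w> would be
  everything. \<open>odd_prime_order_complement\<close> then supplies a complement of order 3, and
  r^3 = 1 (mod 27) leaves three exponents.\<close>

lemma order_81_split_metacyclic:
  assumes G: "order G = 81" and a: "a \<in> carrier G" "ord a = 27"
    and nc: "\<And>x. x \<in> carrier G \<Longrightarrow> generate G {x} \<noteq> carrier G"
  shows "split_metacyclic 27 3 1 \<or> split_metacyclic 27 3 10"
proof -
  define A where "A = generate G {a}"
  have sA: "subgroup A G" and cA: "card A = 27"
    using a by (simp_all add: A_def generate_singleton_subgroup card_generate_singleton)
  interpret A: subgroup A G by (rule sA)
  have aA: "a \<in> A" by (simp add: A_def generate_singleton_self)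
  have p3: "Factorial_Ring.prime (3::nat)" by simp
  have idx: "card (rcosets A) = 3" using lagrange[OF sA] G cA by simp
  have AA: "A \<in> rcosets A" using rcosetsI[OF A.subset one_closed] coset_mult_one[OF A.subset] by simp
  interpret act: subgroup_action G A "rcosets A" "\<lambda>h C. C #> inv h"
    by (rule rcosets_subgroup_action[OF sA sA])
  \<comment> \<open>\<open>A\<close> acts on its three cosets and fixes \<open>A\<close>. The number
    of fixed cosets is divisible by 3, so some \<open>w\<close> outside \<open>A\<close> normalizes
    \<open>A\<close>.\<close>
  define F where "F = {C \<in> rcosets A. \<forall>g\<in>A. C #> inv g = C}"
  have AF: "A \<in> F" using AA coset_join2[OF _ sA] by (simp add: F_def)
  have "[3 = card F] (mod 3)" unfolding F_def using act.fixed_points_cong[OF p3, of 3] cA idx by simp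
  then have "3 dvd card F" by (simp add: cong_def mod_eq_0_iff_dvd)
  moreover have "card F > 0" using AF by (auto simp: F_def card_gt_0_iff)
  ultimately have "card F \<noteq> card {A}" by auto
  then have "F \<noteq> {A}" by metis
  then obtain C where C: "C \<in> F" "C \<noteq> A" using AF by blast
  then obtain w where w: "w \<in> carrier G" "C = A #> w" by (auto simp: F_def RCOSETS_def)
  have wA: "w \<notin> A" using coset_join2[OF w(1) sA] C w by auto
  have conjw: "conjugate w h \<in> A" if "h \<in> A" for h
    by (rule fixed_rcoset_conjugate[OF sA w(1)]) (use that C w in \<open>auto simp: F_def\<close>)
  have "conjugate (w [^] n) h \<in> A" if "h \<in> A" for n :: nat and h
    using that
    by (induction n arbitrary: h) (use w conjw in \<open>auto simp flip: conjugate_conjugate\<close>)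
  then have conjgw: "conjugate g h \<in> A" if "g \<in> generate G {w}" "h \<in> A" for g h
    using that w(1) by (auto simp: generate_singleton_iff)
  have sW: "subgroup (generate G {w}) G" using w by (simp add: generate_singleton_subgroup)
  have AW: "A <#> generate G {w} = carrier G"
  proof -
    have s: "subgroup (A <#> generate G {w}) G" using subgroup_set_mult_normalized[OF sA sW conjgw] .
    have "card (A <#> generate G {w}) dvd 3 ^ 4" using card_subgroup_dvd_order[OF s] G by simp
    then obtain i where i: "i \<le> 4" "card (A <#> generate G {w}) = 3 ^ i" using divides_primepow_nat[OF p3] by blast
    have "A \<subset> A <#> generate G {w}"
      using subset_set_mult[OF sA sW] generate_singleton_self[of w] wA by blast
    then have "card A < card (A <#> generate G {w})" by (rule psubset_card_mono[OF finite_subgroup[OF s]])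
    then have "(3::nat) ^ 3 < 3 ^ i" using i cA by simp
    then have "i = 4" using i(1) power_less_imp_less_exp[of "3::nat" 3 i] by simp
    then show ?thesis
      using i(2) G subgroup_eqI[OF s subgroup_self subgroup.subset[OF s]] by (simp add: order_def)
  qed
  have "A \<lhd> G"
    unfolding A_def
  proof (rule generate_singleton_normalI[OF a(1)])
    fix g assume "g \<in> carrier G"
    then obtain x h where xh: "x \<in> A" "h \<in> generate G {w}" "g = x \<otimes> h" using AW by (metis set_multE)
    have hc: "h \<in> carrier G" using generate_singleton_in_carrier[OF w(1) xh(2)] .
    have "conjugate g a = conjugate x (conjugate h a)" using xh hc a by (simp add: conjugate_conjugate)
    then show "conjugate g a \<in> generate G {a}"
      using subgroup_conjugate_closed[OF sA xh(1) conjgw[OF xh(2) aA]] by (simp add: A_def)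
  qed
  then have "w [^] (3::nat) \<in> A" using normal_pow_index[of A w] w idx by simp
  then obtain s :: nat where s: "w [^] (3::nat) = a [^] s" using a by (auto simp: A_def generate_singleton_iff)
  have "3 dvd s"
  proof (rule ccontr)
    assume "\<not> 3 dvd s"
    then have "coprime s (3 ^ 3)" using p3 by (metis coprime_commute coprime_power_right_iff prime_imp_coprime_nat)
    then have "generate G {w [^] (3::nat)} = A" using generate_pow_eq_iff[OF a(1)] a(2) s by (simp add: A_def)
    moreover have "w [^] (3::nat) \<in> generate G {w}"
      using subgroup_nat_pow_closed[OF sW generate_singleton_self] .
    ultimately have "A \<subseteq> generate G {w}" using generate_singleton_subset[OF sW] by metis
    then have "x \<otimes> h \<in> generate G {w}" if "x \<in> A" "h \<in> generate G {w}" for x h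
      using subgroup.m_closed[OF sW] that by blast
    then have "carrier G \<subseteq> generate G {w}" unfolding AW[symmetric] by (metis set_multE subsetI)
    then show False using nc[OF w(1)] subgroup.subset[OF sW] by blast
  qed
  then obtain s' where s': "s = 3 * s'" by blast
  have "ord a = 3 ^ Suc 2" using a(2) by simp
  moreover have "conjugate w a \<in> generate G {a}" using conjw[OF aA] by (simp add: A_def)
  moreover have "w [^] (3::nat) = a [^] (3 * s')" using s s' by simp
  ultimately obtain i :: nat where i: "(a [^] i \<otimes> w) [^] (3::nat) = \<one>"
    by (rule odd_prime_order_complement[OF p3 odd_numeral a(1) w(1)])
  define b where "b = a [^] i \<otimes> w"
  have aiA: "a [^] i \<in> A" using subgroup_nat_pow_closed[OF sA aA] .
  have bc: "b \<in> carrier G" using a w by (simp add: b_def)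
  have bA: "b \<notin> A"
  proof
    assume "b \<in> A"
    then have "inv (a [^] i) \<otimes> b \<in> A" using aiA by simp
    then show False using wA a w by (simp add: b_def group_simps)
  qed
  have ob: "ord b = 3" using ord_eq_primeI[OF bc p3] i bA A.one_closed unfolding b_def by metis
  have "conjugate b a = conjugate (a [^] i) (conjugate w a)" using a w by (simp add: b_def conjugate_conjugate)
  then have "conjugate b a \<in> A" using subgroup_conjugate_closed[OF sA aiA] conjw[OF aA] by simp
  then obtain r where r: "conjugate b a = a [^] (r::nat)" using a by (auto simp: A_def generate_singleton_iff)
  have int: "generate G {a} \<inter> generate G {b} = {\<one>}"
    using prime_ord_Int_trivial[OF bc _ sA bA] ob by (auto simp: A_def)
  have sm: "split_metacyclic 27 3 (int r)"
    by (rule split_metacyclicI[OF a(1) bc a(2) ob _ int]) (use r G in \<open>simp_all add: int_pow_int\<close>)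
  have "a [^] (int r ^ 3 * 1) = conjugate (b [^] (3::nat)) (a [^] (1::int))"
    using conjugate_pow_int_pow[OF a(1) bc, of "int r" 3 1] r by (simp add: int_pow_int)
  also have "\<dots> = a [^] (1::int)" using pow_ord_eq_1[OF bc] ob a(1) by simp
  finally have "27 dvd 1 - int r ^ 3"
    using int_pow_eq[OF a(1), of "int r ^ 3" 1] a(2) by simp
  then have "[int r ^ 3 = 1] (mod 27)" by (simp add: cong_iff_dvd_diff dvd_diff_commute)
  then have cube: "(r mod 27) ^ 3 mod 27 = 1"
    using cong_int_iff[of "r ^ 3" 1 27] by (simp add: cong_def power_mod)
  have "\<forall>x\<in>{..<27::nat}. x ^ 3 mod 27 = 1 \<longrightarrow> x \<in> {1, 10, 19}" by (simp add: lessThan_nat_numeral lessThan_Suc)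
  then have "r mod 27 \<in> {1, 10, 19}" using cube by simp
  then consider "r mod 27 = 1" | "r mod 27 = 10" | "r mod 27 = 19" by blast
  then show ?thesis
  proof cases
    case 1
    then have "[int r = 1] (mod int 27)" using zmod_int[of r 27] by (simp add: cong_def)
    then show ?thesis using split_metacyclic_cong[OF sm] by blast
  next
    case 2
    then have "[int r = 10] (mod int 27)" using zmod_int[of r 27] by (simp add: cong_def)
    then show ?thesis using split_metacyclic_cong[OF sm] by blast
  next
    case 3
    then have "int r mod 27 = 19" using zmod_int[of r 27] by simp
    then have "(int r)\<^sup>2 mod 27 = 19\<^sup>2 mod 27" by (metis power_mod)
    then have "[(int r)\<^sup>2 = 10] (mod int 27)" by (simp add: cong_def)
    moreover have "split_metacyclic 27 3 ((int r)\<^sup>2)" by (rule split_metacyclic_power[OF sm]) simp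
    ultimately show ?thesis using split_metacyclic_cong by blast
  qed
qed

end

section \<open>Cyclic subgroups acting nontrivially on N\<close>

context p_complement
begin

text \<open>The estimates behind the case analysis: outside \<open>core\<close> the index of
  \<open>cent Y\<close> in \<open>N\<close> differs from 1 but is 1 modulo \<open>p\<close>, and
  \<open>cent Y\<close>, being proper, misses a cyclic subgroup of \<open>N\<close>.\<close>

lemma not_core_cent:
  assumes Y: "Y \<in> cyc P - cyc core"
  shows "p + 1 \<le> card (conjs Y)" "[card (conjs Y) = 1] (mod p)" "cent Y \<subset> N" "subgroup (cent Y) G"
    and "card (cyc (cent Y)) < card (cyc N)"
proof -
  have YP: "Y \<in> cyc P" using Y by blast
  show sub: "subgroup (cent Y) G" by (rule subgroup_cent[OF cyc_P_subset(2)[OF YP]])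
  have "cent Y \<subseteq> N" by (auto simp: cent_def)
  then show strict: "cent Y \<subset> N" using cent_eq_N_iff[OF YP] Y by blast
  then have "card (cent Y) < card N" using psubset_card_mono[OF finite_subgroup[OF N.subgroup_axioms]] by blast
  then have "card (conjs Y) \<noteq> 1" using card_conjs[OF YP] by auto
  moreover have "card (conjs Y) \<noteq> 0"
    using card_conjs[OF YP] card_subgroup_pos[OF N.subgroup_axioms] by (metis less_not_refl mult_0)
  moreover show cg: "[card (conjs Y) = 1] (mod p)" by (rule card_conjs_cong[OF YP])
  ultimately show "p + 1 \<le> card (conjs Y)"
  proof -
    assume m: "card (conjs Y) \<noteq> 1" "card (conjs Y) \<noteq> 0"
    then have "p dvd card (conjs Y) - 1" using cg cong_to_1_nat by blast
    then have "p \<le> card (conjs Y) - 1" using m by (intro dvd_imp_le) simp_all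
    then show ?thesis using m by simp
  qed
  obtain x where x: "x \<in> N" "x \<notin> cent Y" using strict by blast
  then have "generate G {x} \<in> cyc N - cyc (cent Y)"
    using generate_mem_cyc[OF x(1)] generate_mem_cyc_iff[OF sub] by simp
  then have "cyc (cent Y) \<subset> cyc N" using cyc_mono strict by blast
  then show "card (cyc (cent Y)) < card (cyc N)"
    using psubset_card_mono finite_cyc(1)[OF N.subgroup_axioms] by blast
qed

text \<open><y> is a p-group whose only fixed point on \<open>N\<close> is 1, and conjugation
  preserves orders.\<close>

lemma card_order_elements_dvd:
  assumes y: "y \<in> P" and triv: "cent (generate G {y}) = {\<one>}" and d: "d \<noteq> 1"
  shows "p dvd card {x \<in> N. ord x = d}"
proof -
  have yc: "y \<in> carrier G" using y by simp
  have sY: "subgroup (generate G {y}) G" using yc by (simp add: generate_singleton_subgroup)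
  interpret Y: subgroup "generate G {y}" G by (rule sY)
  interpret act: subgroup_action G "generate G {y}" "{x \<in> N. ord x = d}" conjugate
  proof
    show "finite {x \<in> N. ord x = d}" using finite_subgroup[OF N.subgroup_axioms] by simp
    fix x assume x: "x \<in> {x \<in> N. ord x = d}"
    show "conjugate g x \<in> {x \<in> N. ord x = d}" if "g \<in> generate G {y}" for g
      using that x normal_conjugate_closed[OF normal_N] by (simp add: ord_conjugate)
    show "conjugate \<one> x = x" using x by simp
    show "conjugate (g \<otimes> h) x = conjugate g (conjugate h x)" if "g \<in> generate G {y}" "h \<in> generate G {y}" for g h
      using that x by (simp add: conjugate_conjugate)
  qed
  obtain k where "card P = p ^ k" using card_P by blast
  then obtain i where "card (generate G {y}) = p ^ i"
    using card_subgroup_dvd[OF sY subgroup_P generate_singleton_subset[OF subgroup_P y]] divides_primepow_nat[OF prime_p] by metis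
  from act.fixed_points_cong[OF prime_p this]
  have "[card {x \<in> N. ord x = d} = card {x \<in> {x \<in> N. ord x = d}. \<forall>g\<in>generate G {y}. conjugate g x = x}] (mod p)" .
  also have "{x \<in> {x \<in> N. ord x = d}. \<forall>g\<in>generate G {y}. conjugate g x = x} = {}"
  proof -
    have "{x \<in> {x \<in> N. ord x = d}. \<forall>g\<in>generate G {y}. conjugate g x = x} \<subseteq> {x \<in> cent (generate G {y}). ord x = d}"
      by (auto simp: cent_def)
    also have "\<dots> = {}" using triv d ord_eq_1[OF one_closed] by auto
    finally show ?thesis by blast
  qed
  finally show ?thesis by (simp add: cong_0_iff)
qed

text \<open>\<open>P\<close> is the union of \<open>core\<close> and the one remaining cyclic
  subgroup, so it equals the latter, and \<open>core\<close> is its maximal subgroup. The order of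
  \<open>y\<close> is read off from \<open>card (cyc P) = card (cyc core) + 1\<close>.\<close>

lemma unique_noncore_cyclic:
  assumes D: "card (cyc P - cyc core) = 1"
  obtains y where "y \<in> P" "generate G {y} = P" "y \<notin> core" "y [^] p \<in> core" "ord y = p ^ card (cyc core)" "0 < card (cyc core)"
proof -
  obtain Y where Y: "cyc P - cyc core = {Y}" using D card_1_singletonE by blast
  then obtain y where y: "y \<in> P" "Y = generate G {y}" by (metis Diff_iff cycE singletonI)
  have yc: "y \<in> carrier G" using y by simp
  have sY: "subgroup (generate G {y}) G" using yc by (simp add: generate_singleton_subgroup)
  have ycore: "y \<notin> core" using Y y generate_mem_cyc by blast
  have cov: "g \<in> core \<or> g \<in> generate G {y}" if "g \<in> P" for g
  proof -
    have "generate G {g} \<in> cyc P" using that by (rule generate_mem_cyc)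
    then have "generate G {g} \<in> cyc core \<or> generate G {g} = generate G {y}" using Y y by blast
    then show ?thesis using generate_mem_cyc_iff[OF subgroup_core] that generate_singleton_self[of g] by auto
  qed
  then have "P \<subseteq> core \<union> generate G {y}" by blast
  then have "P \<subseteq> generate G {y}" using subgroup_subset_Un[OF subgroup_P subgroup_core sY] ycore y by blast
  then have gen: "generate G {y} = P" using generate_singleton_subset[OF subgroup_P y(1)] by blast
  obtain k where "card P = p ^ k" using card_P by blast
  then have ord: "ord y = p ^ k" using gen card_generate_singleton[OF yc] by simp
  have "card (cyc P) = card (cyc core) + 1"
    using card_Diff_subset[OF finite_cyc(1)[OF subgroup_core] cyc_mono[OF core_subset]] D
      card_mono[OF finite_cyc(1)[OF subgroup_P] cyc_mono[OF core_subset]] by linarith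
  then have k: "k = card (cyc core)" using card_cyc_prime_power[OF prime_p yc ord] gen by simp
  have pos: "0 < card (cyc core)"
    using trivial_mem_cyc[OF subgroup_core] finite_cyc(1)[OF subgroup_core] card_gt_0_iff by blast
  have "\<not> coprime p (ord y)" using ord k pos prime_p by (auto simp: prime_gt_1_nat)
  then have "generate G {y [^] p} \<noteq> Y" using generate_pow_eq_iff[OF yc] y(2) by simp
  moreover have yp: "y [^] p \<in> P" using subgroup_nat_pow_closed[OF subgroup_P y(1)] .
  ultimately have "generate G {y [^] p} \<in> cyc core" using Y generate_mem_cyc by blast
  then have "y [^] p \<in> core" using generate_mem_cyc_iff[OF subgroup_core] yp by simp
  then show thesis using that[OF y(1) gen ycore] ord k pos by simp
qed

text \<open>The generator \<open>y\<close> of \<open>P\<close> acts nontrivially on the cyclic group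
  \<open>N\<close>, while y^p acts trivially, so \<open>r\<close> has multiplicative order
  \<open>p\<close> modulo \<open>card N\<close>.\<close>

lemma prime_complement_split_metacyclic:
  assumes q: "Factorial_Ring.prime (card N)" and D: "card (cyc P - cyc core) = 1"
  obtains r :: nat where "split_metacyclic (card N) (p ^ card (cyc core)) (int r)"
    "[r ^ p = 1] (mod card N)" "\<not> [r = 1] (mod card N)"
proof -
  obtain y where y: "y \<in> P" "generate G {y} = P" "y \<notin> core" "y [^] p \<in> core" "ord y = p ^ card (cyc core)"
    using unique_noncore_cyclic[OF D] by metis
  have yc: "y \<in> carrier G" using y by simp
  obtain a where a: "a \<in> N" "ord a = card N" using cauchy[OF q N.subgroup_axioms] by auto
  have ac: "a \<in> carrier G" using a by simp
  have gen: "generate G {a} = N"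
    by (rule subgroup_eqI[OF generate_singleton_subgroup[OF ac] N.subgroup_axioms
          generate_singleton_subset[OF N.subgroup_axioms a(1)]])
      (simp add: card_generate_singleton[OF ac] a)
  obtain r :: nat where r: "conjugate y a = a [^] r"
    using normal_conjugate_closed[OF normal_N yc a(1)] gen generate_singleton_iff[OF ac] by auto
  have moved: "conjugate y a \<noteq> a"
  proof
    assume fixed: "conjugate y a = a"
    have "conjugate y n = n" if n: "n \<in> N" for n
    proof -
      have "n \<in> generate G {a}" using n gen by simp
      then obtain i :: nat where "n = a [^] i" using generate_singleton_iff[OF ac] by blast
      then show ?thesis using fixed yc ac by (simp add: conjugate_pow)
    qed
    then show False using y(1,3) by (auto simp: core_def)
  qed
  have "order G = card N * p ^ card (cyc core)" using order_eq y(2,5) card_generate_singleton[OF yc] by simp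
  moreover have "generate G {a} \<inter> generate G {y} = {\<one>}"
    using prime_metacyclic_Int_trivial[OF ac yc] a q moved by simp
  ultimately have sm: "split_metacyclic (card N) (p ^ card (cyc core)) (int r)"
    using split_metacyclicI[OF ac yc a(2) y(5)] r by (simp add: int_pow_int)
  have "a [^] (r ^ p) = conjugate (y [^] p) a"
    using conjugate_pow_int_pow[OF ac yc, of "int r" p 1] r ac by (simp add: int_pow_int flip: of_nat_power)
  also have "\<dots> = a [^] (1::nat)" using y(4) a(1) by (simp add: core_def)
  finally have "[r ^ p = 1] (mod card N)" unfolding pow_eq_iff[OF ac] a(2) .
  moreover have "\<not> [r = 1] (mod card N)" using moved r pow_eq_iff[OF ac, of r 1] a(2) ac by simp
  ultimately show thesis using that[OF sm] by blast
qed

end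

section \<open>Small groups that occur as N\<close>

context finite_group
begin

text \<open>Cauchy's theorem gives a subgroup of prime order. Being the only nontrivial cyclic
  subgroup, it contains every element.\<close>

lemma card_cyc_2_prime:
  assumes H: "subgroup H G" and c: "card (cyc H) = 2"
  obtains x where "x \<in> H" "generate G {x} = H" "Factorial_Ring.prime (ord x)" "ord x = card H"
proof -
  have "card H \<noteq> 1"
  proof
    assume "card H = 1"
    then have "H = {\<one>}" by (rule card_1_subgroup[OF H])
    then show False using c by (simp add: cyc_def)
  qed
  then obtain l where l: "Factorial_Ring.prime l" "l dvd card H" using prime_factor_nat by blast
  then obtain x where x: "x \<in> H" "ord x = l" using cauchy[OF l(1) H] by blast
  have xc: "x \<in> carrier G" using x H subgroup.mem_carrier by metis
  have ne: "generate G {x} \<noteq> {\<one>}"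
    using card_generate_singleton[OF xc] x l by auto
  have two: "cyc H = {{\<one>}, generate G {x}}"
    by (rule sym, rule card_seteq)
      (use H c ne trivial_mem_cyc[OF H] generate_mem_cyc[OF x(1)] in auto)
  have "z \<in> generate G {x}" if "z \<in> H" for z
  proof -
    have "generate G {z} \<in> {{\<one>}, generate G {x}}" using generate_mem_cyc[OF that] two by simp
    then show ?thesis using generate_singleton_self[of z] generate.one[of G "{x}"] by auto
  qed
  then have gen: "generate G {x} = H" using generate_singleton_subset[OF H x(1)] by blast
  then show thesis using that x l card_generate_singleton[OF xc] by simp
qed

text \<open>The four subgroups are those of orders 1, 2, 4 and 4 l.\<close>

lemma cyc_generate_4:
  assumes x: "x \<in> carrier G" "ord x = 4 * l" and l: "l > 1"
  shows "4 \<le> card (cyc (generate G {x}))"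
proof -
  define H where "H = generate G {x}"
  have sH: "subgroup H G" using x by (simp add: H_def generate_singleton_subgroup)
  have xH: "x \<in> H" by (simp add: H_def generate_singleton_self)
  have mem: "ord x div k \<in> card ` cyc H" if "k dvd ord x" "k \<noteq> 0" for k
  proof -
    have "card (generate G {x [^] k}) = ord x div k"
      using card_generate_singleton[of "x [^] k"] ord_pow[OF x(1) that] x(1) by simp
    then show ?thesis using generate_mem_cyc[OF subgroup_nat_pow_closed[OF sH xH]] by (metis image_eqI)
  qed
  have "{1, 2, 4, 4 * l} \<subseteq> card ` cyc H"
    using mem[of "4 * l"] mem[of "2 * l"] mem[of l] mem[of 1] x(2) l by simp
  moreover have "card {1, 2, 4, 4 * l} = 4" using l by simp
  ultimately show ?thesis
    unfolding H_def[symmetric] using surj_card_le[OF finite_cyc(1)[OF sH]] by metis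
qed

lemma card_cyc_subgroup_le: "subgroup H G \<Longrightarrow> card (cyc H) \<le> card H"
  unfolding cyc_def by (rule card_image_le) (rule finite_subgroup)

lemma set_mult_subset_subgroup:
  "subgroup H G \<Longrightarrow> A \<subseteq> H \<Longrightarrow> B \<subseteq> H \<Longrightarrow> A <#> B \<subseteq> H"
  by (auto simp: set_mult_def intro: subgroup.m_closed)

lemma card_9_central_element:
  assumes N: "subgroup N G" and c9: "card N = 9"
  obtains z where "z \<in> N" "z \<noteq> \<one>" "\<And>g. g \<in> N \<Longrightarrow> conjugate g z = z"
proof -
  interpret N: subgroup N G by (rule N)
  interpret act: subgroup_action G N N conjugate
    by unfold_locales (use subgroup_conjugate_closed[OF N] finite_subgroup[OF N] in \<open>simp_all add: conjugate_conjugate\<close>)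
  define F where "F = {x \<in> N. \<forall>g\<in>N. conjugate g x = x}"
  have "[9 = card F] (mod 3)"
    unfolding F_def using act.fixed_points_cong[of 3 2] c9 by simp
  then have "3 dvd card F" by (simp add: cong_def mod_eq_0_iff_dvd)
  moreover have "\<one> \<in> F" by (simp add: F_def)
  moreover have "finite F" using finite_subgroup[OF N] by (simp add: F_def)
  ultimately have "card F > 0" using card_gt_0_iff by blast
  with \<open>3 dvd card F\<close>
  have "card F \<noteq> card {\<one>}" by auto
  then have "F \<noteq> {\<one>}" by metis
  then obtain z where "z \<in> F" "z \<noteq> \<one>" using \<open>\<one> \<in> F\<close> by blast
  then show thesis using that by (auto simp: F_def)
qed

text \<open>If \<open>x\<close> is not a power of a central element z of order 3, then N = <z> <x>,
  and z commutes with \<open>x\<close>.\<close>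

lemma exponent_3_card_9_commute:
  assumes N: "subgroup N G" and c9: "card N = 9" and exp: "\<And>x. x \<in> N \<Longrightarrow> x [^] (3::nat) = \<one>"
    and g: "g \<in> N" and x: "x \<in> N"
  shows "conjugate g x = x"
proof (cases "x = \<one>")
  case False
  interpret N: subgroup N G by (rule N)
  have p3: "Factorial_Ring.prime (3::nat)" by simp
  have ord: "ord u = 3" if "u \<in> N" "u \<noteq> \<one>" for u using ord_eq_primeI[OF _ p3 exp] that by simp
  obtain z where z: "z \<in> N" "z \<noteq> \<one>" "\<And>g. g \<in> N \<Longrightarrow> conjugate g z = z"
    using card_9_central_element[OF N c9] by metis
  have zc: "z \<in> carrier G" and xc: "x \<in> carrier G" using z x by simp_all
  have sz: "subgroup (generate G {z}) G" and sx: "subgroup (generate G {x}) G"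
    using zc xc by (simp_all add: generate_singleton_subgroup)
  show ?thesis
  proof (cases "x \<in> generate G {z}")
    case True
    then obtain i :: nat where "x = z [^] i" using generate_singleton_iff[OF zc] by blast
    then show ?thesis using z(3)[OF g] g zc by (simp add: conjugate_pow)
  next
    case nin: False
    have "generate G {z} \<inter> generate G {x} = {\<one>}"
      using prime_ord_Int_trivial[OF xc _ sz nin] ord[OF x False] by auto
    then have "card (generate G {z} <#> generate G {x}) = 9"
      using card_set_mult[OF sz sx] card_generate_singleton zc xc ord[OF x False] ord[OF z(1,2)] by simp
    moreover have "generate G {z} <#> generate G {x} \<subseteq> N"
      by (rule set_mult_subset_subgroup[OF N generate_singleton_subset[OF N z(1)] generate_singleton_subset[OF N x]])
    ultimately have "generate G {z} <#> generate G {x} = N"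
      using card_subset_eq[OF finite_subgroup[OF N]] c9 by simp
    then obtain u v where uv: "u \<in> generate G {z}" "v \<in> generate G {x}" "g = u \<otimes> v" using g by (metis set_multE)
    obtain i j :: nat where ij: "u = z [^] i" "v = x [^] j"
      using uv generate_singleton_iff[OF zc] generate_singleton_iff[OF xc] by blast
    have "conjugate x z = z" using z(3)[OF x] .
    then have "x \<otimes> z = z \<otimes> x" using conjugate_eq_iff_commute[OF xc zc] by simp
    then have "conjugate z x = x" using conjugate_eq_iff_commute[OF zc xc] by simp
    then have "conjugate (z [^] i) x = x"
      by (induction i) (use zc xc in \<open>simp_all flip: conjugate_conjugate\<close>)
    moreover have "conjugate (x [^] j) x = x"
      using xc nat_pow_comm[OF xc, of j 1] by (simp add: conjugate_eq_iff_commute)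
    ultimately show ?thesis using uv(3) ij zc xc by (simp flip: conjugate_conjugate)
  qed
qed (use assms in \<open>simp add: subgroup.mem_carrier[OF N]\<close>)

text \<open>Suppose l > 3. The three cyclic subgroups besides {1} and \<open>C\<close> have order 3
  or 3 l, since a second one of order \<open>l\<close> would produce l^2 elements. Their totients
  are 2 or 2 (l - 1) and must add up to 2 l; but three summands 2 give less, and one summand 2 (l -
  1) already gives at least 2 l + 2.\<close>

lemma card_3_prime_5_cyc:
  assumes N: "subgroup N G" and C: "subgroup C G" "C \<subseteq> N" "C \<in> cyc N" and l: "Factorial_Ring.prime l" "odd l"
    and cC: "card C = l" and cN: "card N = 3 * l" and c5: "card (cyc N) = 5"
  shows "l = 3"
proof (rule ccontr)
  assume "l \<noteq> 3"
  then have l5: "l > 3" using l by (metis nat_neq_iff numeral_3_eq_3 even_numeral less_Suc_eq prime_gt_1_nat numeral_2_eq_2 Suc_1 One_nat_def less_Suc_eq_le not_less)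
  define B where "B = cyc N - {{\<one>}, C}"
  have Cne: "C \<noteq> {\<one>}" using cC l by auto
  have mem: "{{\<one>}, C} \<subseteq> cyc N" using C(3) trivial_mem_cyc[OF N] by simp
  have fin: "finite (cyc N)" using N by simp
  have cB: "card B = 3"
    unfolding B_def using card_Diff_subset[OF _ mem] Cne c5 by simp
  have finB: "finite B" using fin by (simp add: B_def)
  have "3 * l = (\<Sum>E\<in>cyc N. totient (card E))" using card_subgroup_eq_sum_totient[OF N] cN by simp
  also have "\<dots> = (\<Sum>E\<in>B. totient (card E)) + (\<Sum>E\<in>{{\<one>}, C}. totient (card E))"
    unfolding B_def by (rule sum.subset_diff[OF mem fin])
  also have "(\<Sum>E\<in>{{\<one>}, C}. totient (card E)) = 1 + (l - 1)"
    using Cne cC totient_prime[OF l(1)] by simp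
  finally have sum: "(\<Sum>E\<in>B. totient (card E)) = 2 * l" using l5 by simp
  have cop: "coprime 3 l" using primes_coprime[of 3 l] l(1) l5 by simp
  have t3: "totient 3 = 2" using totient_prime[of 3] by simp
  have t: "totient (card E) \<in> {2, 2 * (l - 1)}" if E: "E \<in> B" for E
  proof -
    have sE: "subgroup E G" "E \<subseteq> N" using cyc_subgroup[OF N] E by (auto simp: B_def)
    have "card E dvd 3 * l" using card_subgroup_dvd[OF sE(1) N sE(2)] cN by simp
    then obtain d e where de: "card E = d * e" "d dvd 3" "e dvd l" using division_decomp by metis
    have "d \<in> {1, 3}" using de(2) prime_nat_iff[of 3] by auto
    moreover have "e \<in> {1, l}" using de(3) l(1) prime_nat_iff[of l] by auto
    moreover have "card E \<noteq> 1" using card_1_subgroup[OF sE(1)] E by (auto simp: B_def)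
    moreover have "card E \<noteq> l"
    proof
      assume cE: "card E = l"
      have sI: "subgroup (E \<inter> C) G" using subgroups_Inter_pair[OF sE(1) C(1)] .
      have "card (E \<inter> C) \<noteq> l"
      proof
        assume cI: "card (E \<inter> C) = l"
        have "E \<inter> C = E" by (rule card_subset_eq[OF finite_subgroup[OF sE(1)]]) (use cI cE in auto)
        moreover have "E \<inter> C = C" by (rule card_subset_eq[OF finite_subgroup[OF C(1)]]) (use cI cC in auto)
        ultimately show False using E by (auto simp: B_def)
      qed
      moreover have "card (E \<inter> C) dvd l" using card_subgroup_dvd[OF sI sE(1)] cE by auto
      ultimately have "card (E \<inter> C) = 1" using l(1) prime_nat_iff by metis
      then have "card (E <#> C) = l * l" using card_set_mult[OF sE(1) C(1)] cE cC by simp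
      moreover have "E <#> C \<subseteq> N" by (rule set_mult_subset_subgroup[OF N sE(2) C(2)])
      ultimately have "l * l \<le> 3 * l" using card_mono[OF finite_subgroup[OF N]] cN by metis
      then show False using l5 by simp
    qed
    ultimately have "card E = 3 \<or> card E = 3 * l" using de(1) by auto
    then show ?thesis
      using t3 totient_mult_coprime[OF cop] totient_prime[OF l(1)] by auto
  qed
  show False
  proof (cases "\<exists>E\<in>B. totient (card E) = 2 * (l - 1)")
    case True
    then obtain E where E: "E \<in> B" "totient (card E) = 2 * (l - 1)" by blast
    have "2 \<le> totient (card F)" if "F \<in> B - {E}" for F
    proof -
      have "totient (card F) = 2 \<or> totient (card F) = 2 * (l - 1)" using t[of F] that by blast
      then show ?thesis using l5 by linarith
    qed
    from sum_bounded_below[of "B - {E}" 2 "\<lambda>E. totient (card E)", OF this]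
    have "card (B - {E}) * 2 \<le> (\<Sum>E\<in>B - {E}. totient (card E))" by simp
    moreover have "card (B - {E}) = 2" using E finB cB by simp
    ultimately show False
      using sum sum.remove[OF finB E(1), of "\<lambda>E. totient (card E)"] E(2) l5 by linarith
  next
    case False
    then have "(\<Sum>E\<in>B. totient (card E)) = (\<Sum>E\<in>B. 2)" using t by (intro sum.cong) auto
    then show False using sum cB l5 by simp
  qed
qed

end

section \<open>Solving the count when the action is nontrivial\<close>

context p_complement
begin

lemma card_cyc_N_ge_2: "card N \<noteq> 1 \<Longrightarrow> 2 \<le> card (cyc N)"
  using card_cyc_ge_2[OF N.subgroup_axioms] .

lemma card_cyc_core_pos: "1 \<le> card (cyc core)"
proof -
  have "card (cyc core) \<noteq> 0"
    using trivial_mem_cyc[OF subgroup_core] finite_cyc(1)[OF subgroup_core] by auto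
  then show ?thesis by simp
qed

lemma card_cyc_ge_subset:
  assumes "E \<subseteq> cyc P - cyc core"
  shows "card (cyc core) * card (cyc N) + (\<Sum>Y\<in>E. card (conjs Y) * card (cyc (cent Y))) \<le> card (cyc (carrier G))"
proof -
  have "finite (cyc P - cyc core)" using finite_cyc(1)[OF subgroup_P] by simp
  from sum_mono2[OF this assms, of "\<lambda>Y. card (conjs Y) * card (cyc (cent Y))"]
  show ?thesis unfolding card_cyc_eq by simp
qed

lemma p_dvd_card_conjs_minus:
  assumes "Y \<in> cyc P - cyc core"
  shows "p dvd card (conjs Y) - 1"
  using not_core_cent(2)[OF assms] cong_to_1_nat by blast

text \<open>Here the index of \<open>cent Y\<close> is m = |N| itself, so n + m is at most 11 and m
  = 1 (mod p). The elements of \<open>N\<close> of a given prime order come in multiples of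
  \<open>p\<close>, which excludes m = 6 and m = 8. For m = 4 every term of the count is divisible
  by 4, and m = 9 would need a group of order 9 with two cyclic subgroups.\<close>

lemma trivial_cent_card_N:
  assumes c: "card (cyc (carrier G)) = 11" and Y: "Y \<in> cyc P - cyc core" and triv: "cent Y = {\<one>}"
  shows "card N \<in> {3, 5, 7}"
proof -
  define n where "n = card (cyc N)"
  define m where "m = card N"
  have YP: "Y \<in> cyc P" using Y by blast
  then obtain y where y: "y \<in> P" "Y = generate G {y}" by (rule cycE)
  have mY: "card (conjs Y) = m" using card_conjs[OF YP] triv by (simp add: m_def)
  have pm: "p dvd m - 1" "p + 1 \<le> m" using p_dvd_card_conjs_minus[OF Y] not_core_cent(1)[OF Y] mY by simp_all
  have p2: "2 \<le> p" using prime_p by (rule prime_ge_2_nat)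
  have "card (cyc {\<one>}) = 1" by (simp add: cyc_def)
  then have b: "card (cyc core) * n + m \<le> 11" using card_cyc_ge_subset[of "{Y}"] Y mY triv c by (simp add: n_def)
  have n2: "2 \<le> n" unfolding n_def by (rule card_cyc_N_ge_2) (use pm p2 in \<open>simp add: m_def\<close>)
  have "n \<le> card (cyc core) * n" using card_cyc_core_pos by simp
  then have nm: "n + m \<le> 11" using b by linarith
  have elts: "p dvd card {x \<in> N. ord x = d}" "card {x \<in> N. ord x = d} \<noteq> 0"
    if "Factorial_Ring.prime d" "d dvd m" for d
  proof -
    show "p dvd card {x \<in> N. ord x = d}"
      by (rule card_order_elements_dvd[OF y(1)]) (use triv y(2) that in auto)
    show "card {x \<in> N. ord x = d} \<noteq> 0"
      using cauchy[OF that(1) N.subgroup_axioms] that(2) finite_subgroup[OF N.subgroup_axioms] by (auto simp: m_def)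
  qed
  have elts_le: "p \<le> card {x \<in> N. ord x = d}" if "Factorial_Ring.prime d" "d dvd m" for d
    using dvd_imp_le[OF elts(1)[OF that]] elts(2)[OF that] by simp
  have inv_le: "p + 1 \<le> n" if "even m"
  proof -
    have "p \<le> card {C \<in> cyc N. card C = 2}"
      using elts_le[of 2] that card_elements_of_order[OF N.subgroup_axioms, of 2] by simp
    also have "\<dots> \<le> card (cyc N - {{\<one>}})" by (rule card_mono) (use finite_cyc(1)[OF N.subgroup_axioms] in auto)
    also have "\<dots> = n - 1" using trivial_mem_cyc[OF N.subgroup_axioms] by (simp add: n_def)
    finally show ?thesis using n2 by linarith
  qed
  have "m \<in> {3, 4, 5, 6, 7, 8, 9}" using nm n2 pm(2) p2 by auto
  moreover have "m \<noteq> 4"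
  proof
    assume m4: "m = 4"
    then have "p dvd 3" using pm by simp
    then have p3: "p = 3" using prime_p primes_dvd_imp_eq[of p 3] by simp
    have n4: "n = 4" using inv_le m4 p3 card_cyc_subgroup_le[OF N.subgroup_axioms] by (simp add: n_def m_def)
    have "card (conjs Z) * card (cyc (cent Z)) = 4" if Z: "Z \<in> cyc P - cyc core" for Z
    proof -
      have mZ: "card (conjs Z) * card (cent Z) = 4" using card_conjs[of Z] Z m4 by (simp add: m_def)
      then have "card (conjs Z) = 4" using not_core_cent(1)[OF Z] p3 dvd_imp_le[of "card (conjs Z)" 4] by (metis dvd_triv_left le_antisym add_numeral_left numeral_eq_iff zero_less_numeral eval_nat_numeral(2) numeral_plus_one semiring_norm(2) semiring_norm(8))
      then show ?thesis using mZ card_1_subgroup[OF not_core_cent(4)[OF Z]] \<open>card (cyc {\<one>}) = 1\<close> by simp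
    qed
    then have "11 = card (cyc core) * 4 + (\<Sum>Z\<in>cyc P - cyc core. 4)" using card_cyc_eq c n4 by (simp add: n_def)
    then have "11 = 4 * (card (cyc core) + card (cyc P - cyc core))" by simp
    then show False by presburger
  qed
  moreover have "m \<noteq> 6"
  proof
    assume m6: "m = 6"
    then have "p dvd 5" using pm by simp
    then have p5: "p = 5" using prime_p primes_dvd_imp_eq[of p 5] by simp
    have "card ({x \<in> N. ord x = 2} \<union> {x \<in> N. ord x = 3}) \<le> m"
      unfolding m_def by (rule card_mono) (use finite_subgroup[OF N.subgroup_axioms] in auto)
    moreover have "card ({x \<in> N. ord x = 2} \<union> {x \<in> N. ord x = 3}) = card {x \<in> N. ord x = 2} + card {x \<in> N. ord x = 3}"
    proof (rule card_Un_disjoint)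
      show "finite {x \<in> N. ord x = 2}" "finite {x \<in> N. ord x = 3}"
        using finite_subgroup[OF N.subgroup_axioms] by simp_all
    qed auto
    moreover have "5 \<le> card {x \<in> N. ord x = 2}" "5 \<le> card {x \<in> N. ord x = 3}"
      using elts_le[of 2] elts_le[of 3] m6 p5 by simp_all
    ultimately show False using m6 by linarith
  qed
  moreover have "m \<noteq> 8"
  proof
    assume m8: "m = 8"
    then have "p dvd 7" using pm by simp
    then have "p = 7" using prime_p primes_dvd_imp_eq[of p 7] by simp
    then show False using inv_le m8 nm by simp
  qed
  moreover have "m \<noteq> 9"
  proof
    assume m9: "m = 9"
    then have "n = 2" using nm n2 by simp
    then show False using p_subgroup_card_cyc_2[of 3 N 2] N.subgroup_axioms m9 by (simp add: n_def m_def)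
  qed
  ultimately show ?thesis by (auto simp: m_def)
qed

text \<open>With q = |N| and \<open>D\<close> the cyclic subgroups of \<open>P\<close> outside
  \<open>core\<close>, the count reads 11 = 2 c(core) + q |D|. Once |D| = 1, it gives c(core) = 4,
  3, 2 for q = 3, 5, 7, and \<open>P\<close> is cyclic of order p^c(core).\<close>

lemma prime_N_11:
  assumes c: "card (cyc (carrier G)) = 11" and q: "card N \<in> {3, 5, 7}" and ne: "cyc P - cyc core \<noteq> {}"
  shows "split_metacyclic 3 16 (- 1) \<or> split_metacyclic 5 8 (- 1) \<or> split_metacyclic 7 4 (- 1) \<or> split_metacyclic 7 9 2"
proof -
  define D where "D = cyc P - cyc core"
  have finD: "finite D" using finite_cyc(1)[OF subgroup_P] by (simp add: D_def)
  have qp: "Factorial_Ring.prime (card N)" using q by auto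
  have "card (cyc N) = 2"
  proof -
    obtain a where a: "a \<in> N" "ord a = card N" using cauchy[OF qp N.subgroup_axioms] by auto
    have "generate G {a} = N"
      by (rule subgroup_eqI[OF generate_singleton_subgroup N.subgroup_axioms generate_singleton_subset[OF N.subgroup_axioms a(1)]])
        (use a in \<open>simp_all add: card_generate_singleton\<close>)
    then show ?thesis using card_cyc_prime_power[OF qp, of a 1] a by simp
  qed
  moreover have cs: "card (conjs Y) = card N \<and> card (cyc (cent Y)) = 1" if Y: "Y \<in> D" for Y
  proof -
    have Y': "Y \<in> cyc P - cyc core" using Y by (simp add: D_def)
    have "card (cent Y) < card N"
      using psubset_card_mono[OF finite_subgroup[OF N.subgroup_axioms] not_core_cent(3)[OF Y']] .
    moreover have m: "card (conjs Y) * card (cent Y) = card N" using card_conjs[of Y] Y' by blast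
    then have "card (cent Y) dvd card N" by (metis dvd_triv_right)
    ultimately have "card (cent Y) = 1" using qp by (metis less_irrefl prime_nat_iff)
    then have "cent Y = {\<one>}" by (rule card_1_subgroup[OF not_core_cent(4)[OF Y']])
    then show ?thesis using m by (simp add: cyc_def)
  qed
  ultimately have eq: "11 = card (cyc core) * 2 + card D * card N"
    using card_cyc_eq c by (simp add: D_def)
  have c0: "1 \<le> card (cyc core)" by (rule card_cyc_core_pos)
  have u: "card D \<noteq> 0" using ne finD by (simp add: D_def)
  obtain Y where Y: "Y \<in> cyc P - cyc core" using ne by blast
  have pq: "p dvd card N - 1" using p_dvd_card_conjs_minus[OF Y] cs[of Y] Y by (simp add: D_def)
  have p2: "2 \<le> p" using prime_p by (rule prime_ge_2_nat)
  \<comment> \<open>Otherwise q = 3, p = 2, and \<open>core\<close> is trivial. All elements of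
    \<open>P\<close> outside \<open>core\<close> invert \<open>N\<close>, so the product of any two
    of them acts trivially and is 1. They are therefore inverse to each other and generate a single
    subgroup.\<close>
  have D1: "card D = 1"
  proof (rule ccontr)
    assume "card D \<noteq> 1"
    then have D2: "2 \<le> card D" using u by simp
    then have "2 * card N \<le> card D * card N" by simp
    then have "card N \<le> 4" using eq c0 by linarith
    then have q3: "card N = 3" using q by auto
    then have "p = 2" using pq p2 by (auto dest: dvd_imp_le)
    have "card (cyc core) = 1" using eq c0 D2 unfolding q3 by presburger
    obtain a where a: "a \<in> N" "ord a = card N" using cauchy[OF qp N.subgroup_axioms] by auto
    have ac: "a \<in> carrier G" using a by simp
    have gen: "generate G {a} = N"
      by (rule subgroup_eqI[OF generate_singleton_subgroup[OF ac] N.subgroup_axioms generate_singleton_subset[OF N.subgroup_axioms a(1)]])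
        (use a ac in \<open>simp add: card_generate_singleton\<close>)
    have core_iff: "g \<in> core \<longleftrightarrow> conjugate g a = a" if g: "g \<in> P" for g
    proof
      assume fixed: "conjugate g a = a"
      have "conjugate g n = n" if n: "n \<in> N" for n
      proof -
        have "n \<in> generate G {a}" using n gen by simp
        then obtain i :: nat where "n = a [^] i" using generate_singleton_iff[OF ac] by blast
        then show ?thesis using fixed g ac by (simp add: conjugate_pow)
      qed
      then show "g \<in> core" using g by (simp add: core_def)
    qed (use a in \<open>simp add: core_def\<close>)
    have sq: "conjugate g a = a [^] (2::nat)" if g: "g \<in> P" "g \<notin> core" for g
    proof -
      have gc: "g \<in> carrier G" using g by simp
      obtain r :: nat where r: "conjugate g a = a [^] r"
        using normal_conjugate_closed[OF normal_N gc a(1)] gen generate_singleton_iff[OF ac] by auto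
      then have r3: "conjugate g a = a [^] (r mod 3)" using pow_mod_ord[OF ac, of r] a(2) q3 by simp
      have "conjugate g a \<noteq> \<one>" using ord_conjugate[OF gc ac] a(2) q3 by auto
      then have "r mod 3 \<noteq> 0" using r3 by (metis nat_pow_0)
      moreover have "r mod 3 \<noteq> 1" using core_iff[OF g(1)] g(2) r3 ac by (metis nat_pow_eone)
      ultimately have "r mod 3 = 2" by presburger
      then show ?thesis using r3 by simp
    qed
    have "core = {\<one>}"
    proof -
      have "cyc core = {{\<one>}}" using \<open>card (cyc core) = 1\<close> trivial_mem_cyc[OF subgroup_core] by (metis card_1_singletonE singletonD)
      then have "z = \<one>" if "z \<in> core" for z using generate_mem_cyc[OF that] generate_singleton_self[of z] by auto
      then show ?thesis using subgroup.one_closed[OF subgroup_core] by blast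
    qed
    have same: "Z = Y" if Z: "Z \<in> D" for Z
    proof -
      obtain g h where g: "g \<in> P" "Y = generate G {g}" and h: "h \<in> P" "Z = generate G {h}"
        using Y Z by (auto simp: D_def elim!: cycE)
      have gc: "g \<notin> core" and hc: "h \<notin> core" using g h Y Z generate_mem_cyc by (auto simp: D_def)
      have "conjugate (g \<otimes> h) a = conjugate g (conjugate h a)" using g h ac by (simp add: conjugate_conjugate)
      also have "\<dots> = a [^] (4::nat)" using sq[OF g(1) gc] sq[OF h(1) hc] g ac by (simp add: conjugate_pow nat_pow_pow)
      also have "\<dots> = a [^] (1::nat)" unfolding pow_eq_iff[OF ac] using a(2) q3 by (simp add: cong_def)
      finally have "g \<otimes> h \<in> core" using core_iff g(1) h(1) ac by simp
      then have "g \<otimes> h = \<one>" using \<open>core = {\<one>}\<close> by simp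
      then have "h = inv g" using g(1) h(1) by (metis P.mem_carrier inv_equality inv_inv inv_closed)
      then have "g \<in> generate G {h}" "h \<in> generate G {g}"
        using generate.inv[of h "{h}" G] generate.inv[of g "{g}" G] g(1) by auto
      then show ?thesis using g h generate_singleton_eq_iff P.mem_carrier by metis
    qed
    then have "D \<subseteq> {Y}" by blast
    then have "card D \<le> 1" using card_mono[of "{Y}" D] by simp
    then show False using D2 by simp
  qed
  obtain r :: nat where r: "split_metacyclic (card N) (p ^ card (cyc core)) (int r)"
    "[r ^ p = 1] (mod card N)" "\<not> [r = 1] (mod card N)"
    using prime_complement_split_metacyclic[OF qp] D1 by (metis D_def)
  \<comment> \<open>Modulo a prime, r^2 = 1 and r not 1 leave r = -1.\<close>
  have even: "split_metacyclic (card N) (2 ^ card (cyc core)) (- 1)" if "p = 2"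
  proof (rule split_metacyclic_cong)
    show "split_metacyclic (card N) (2 ^ card (cyc core)) (int r)" using r(1) that by simp
    have "[int r ^ 2 = 1] (mod int (card N))" using r(2) that by (metis cong_int_iff of_nat_1 of_nat_power)
    then have "int (card N) dvd (int r - 1) * (int r + 1)"
      by (simp add: cong_iff_dvd_diff algebra_simps power2_eq_square)
    moreover have "\<not> int (card N) dvd int r - 1"
      using r(3) cong_int_iff[of r 1 "card N"] by (simp add: cong_iff_dvd_diff)
    ultimately have "int (card N) dvd int r + 1" using qp prime_dvd_mult_iff[of "int (card N)"] by simp
    then show "[int r = - 1] (mod int (card N))" by (simp add: cong_iff_dvd_diff)
  qed
  consider "card N = 3" "card (cyc core) = 4" | "card N = 5" "card (cyc core) = 3" | "card N = 7" "card (cyc core) = 2"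
    using q eq D1 by auto
  then show ?thesis
  proof cases
    case 1
    then have "p = 2" using pq p2 by (auto dest: dvd_imp_le)
    then show ?thesis using even 1 by simp
  next
    case 2
    then have "p dvd 2 ^ 2" using pq by simp
    then have "p = 2" using prime_p by (metis prime_dvd_power primes_dvd_imp_eq two_is_prime_nat)
    then show ?thesis using even 2 by simp
  next
    case 3
    then have "p dvd 2 * 3" using pq by simp
    then have "p dvd 2 \<or> p dvd 3" by (subst (asm) prime_dvd_mult_iff[OF prime_p])
    then have "p = 2 \<or> p = 3" using prime_p primes_dvd_imp_eq[of p 2] primes_dvd_imp_eq[of p 3] by auto
    then show ?thesis
    proof
      assume "p = 2"
      then show ?thesis using even 3 by simp
    next
      assume p3: "p = 3"
      have sm: "split_metacyclic 7 9 (int r)" using r(1) 3 p3 by simp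
      have "(r mod 7) ^ 3 mod 7 = 1" using r(2) 3 p3 by (simp add: cong_def power_mod)
      moreover have "\<forall>x\<in>{..<7::nat}. x ^ 3 mod 7 = 1 \<longrightarrow> x \<in> {1, 2, 4}" by (simp add: lessThan_nat_numeral lessThan_Suc)
      ultimately have "r mod 7 \<in> {1, 2, 4}" by simp
      moreover have "r mod 7 \<noteq> 1" using r(3) 3 by (simp add: cong_def)
      ultimately consider "r mod 7 = 2" | "r mod 7 = 4" by blast
      then show ?thesis
      proof cases
        case 1
        then have "[int r = 2] (mod int 7)" using zmod_int[of r 7] by (simp add: cong_def)
        then show ?thesis using split_metacyclic_cong[OF sm] by blast
      next
        case 2
        then have "int r mod 7 = 4" using zmod_int[of r 7] by simp
        then have "(int r)\<^sup>2 mod 7 = 4\<^sup>2 mod 7" by (metis power_mod)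
        then have "[(int r)\<^sup>2 = 2] (mod int 7)" by (simp add: cong_def)
        moreover have "split_metacyclic 7 9 ((int r)\<^sup>2)" by (rule split_metacyclic_power[OF sm]) simp
        ultimately show ?thesis using split_metacyclic_cong by blast
      qed
    qed
  qed
qed

text \<open>\<open>C = cent Y\<close> has prime order \<open>l\<close>, and the count leaves index 3
  or 4. Index 4 would make \<open>N\<close> cyclic of order 4 l, which has too many subgroups. Index
  3 forces p = 2, a trivial \<open>core\<close> and c(N) = 5, whence l = 3 and |N| = 9.\<close>

lemma prime_cent_11:
  assumes c: "card (cyc (carrier G)) = 11" and Y: "Y \<in> cyc P - cyc core" and c2: "card (cyc (cent Y)) = 2"
  shows "split_metacyclic 3 6 (- 1)"
proof -
  define n where "n = card (cyc N)"
  define m where "m = card (conjs Y)"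
  define C where "C = cent Y"
  have YP: "Y \<in> cyc P" using Y by blast
  have sN: "subgroup N G" by (rule N.subgroup_axioms)
  have sC: "subgroup C G" "C \<subset> N" using not_core_cent(3,4)[OF Y] by (simp_all add: C_def)
  obtain x where x: "x \<in> C" "generate G {x} = C" "Factorial_Ring.prime (ord x)" "ord x = card C"
    using card_cyc_2_prime[OF sC(1)] c2 by (auto simp: C_def)
  define l where "l = card C"
  have lp: "Factorial_Ring.prime l" using x by (simp add: l_def)
  have xN: "x \<in> N" using x sC by blast
  have CN: "C \<in> cyc N" using generate_mem_cyc[OF xN] x(2) by simp
  have cN: "card N = m * l" using card_conjs[OF YP] by (simp add: m_def l_def C_def)
  have pm: "p dvd m - 1" "p + 1 \<le> m" using p_dvd_card_conjs_minus[OF Y] not_core_cent(1)[OF Y] by (simp_all add: m_def)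
  have p2: "2 \<le> p" using prime_p by (rule prime_ge_2_nat)
  have n3: "3 \<le> n" using not_core_cent(5)[OF Y] c2 by (simp add: n_def)
  have "card (cyc core) * n + m * 2 \<le> 11"
    using card_cyc_ge_subset[of "{Y}"] Y c2 c by (simp add: n_def m_def)
  moreover have c0n: "n \<le> card (cyc core) * n" using card_cyc_core_pos by simp
  ultimately have b: "n + 2 * m \<le> 11" by linarith
  then have "m = 3 \<or> m = 4" using pm(2) p2 n3 by linarith
  moreover have "m \<noteq> 4"
  proof
    assume m4: "m = 4"
    then have "n = 3" using b n3 by simp
    have mem: "{{\<one>}, C} \<subseteq> cyc N" using CN trivial_mem_cyc[OF sN] by simp
    have Cne: "C \<noteq> {\<one>}" using lp by (auto simp: l_def)
    have "card (cyc N - {{\<one>}, C}) = 1"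
      using card_Diff_subset[OF _ mem] Cne \<open>n = 3\<close> by (simp add: n_def)
    then obtain E where E: "cyc N - {{\<one>}, C} = {E}" using card_1_singletonE by blast
    then have EN: "E \<in> cyc N" by blast
    then obtain d where d: "d \<in> N" "E = generate G {d}" by (rule cycE)
    have sE: "subgroup E G" using cyc_subgroup[OF sN EN] by blast
    have "g \<in> C \<union> E" if "g \<in> N" for g
    proof -
      have "generate G {g} \<in> {{\<one>}, C, E}" using generate_mem_cyc[OF that] E by blast
      then show ?thesis using generate_singleton_self[of g] subgroup.one_closed[OF sE] by auto
    qed
    then have "N \<subseteq> E" using subgroup_subset_Un[OF sN sC(1) sE] sC(2) by blast
    then have "E = N" using cyc_subgroup[OF sN EN] by blast
    then have "ord d = 4 * l" using card_generate_singleton[of d] d cN m4 by simp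
    then have "4 \<le> n" using cyc_generate_4[of d l] d \<open>E = N\<close> prime_gt_1_nat[OF lp] by (simp add: n_def)
    then show False using \<open>n = 3\<close> by simp
  qed
  ultimately have m3: "m = 3" by blast
  then have p: "p = 2" using pm p2 by (auto dest: dvd_imp_le)
  have Dsub: "cyc P - cyc core \<subseteq> {Y}"
  proof
    fix Z assume Z: "Z \<in> cyc P - cyc core"
    show "Z \<in> {Y}"
    proof (rule ccontr)
      assume ne: "Z \<notin> {Y}"
      have "card (cyc core) * n + (\<Sum>W\<in>{Y, Z}. card (conjs W) * card (cyc (cent W))) \<le> 11"
        using card_cyc_ge_subset[of "{Y, Z}"] Y Z c by (simp add: n_def)
      moreover have "(\<Sum>W\<in>{Y, Z}. card (conjs W) * card (cyc (cent W))) = 6 + card (conjs Z) * card (cyc (cent Z))"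
        using ne m3 c2 by (simp add: m_def)
      ultimately have "n + (6 + card (conjs Z) * card (cyc (cent Z))) \<le> 11"
        using c0n by linarith
      moreover have "3 * 1 \<le> card (conjs Z) * card (cyc (cent Z))"
      proof (rule mult_le_mono)
        show "3 \<le> card (conjs Z)" using not_core_cent(1)[OF Z] p by simp
        have "cyc (cent Z) \<noteq> {}" using trivial_mem_cyc[OF not_core_cent(4)[OF Z]] by blast
        then have "card (cyc (cent Z)) \<noteq> 0" using finite_cyc(1)[OF not_core_cent(4)[OF Z]] by simp
        then show "1 \<le> card (cyc (cent Z))" by simp
      qed
      ultimately show False using n3 by simp
    qed
  qed
  then have D: "cyc P - cyc core = {Y}" using Y by blast
  then have "card (cyc core) * n = 5"
    using card_cyc_eq c m3 c2 by (simp add: n_def m_def)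
  moreover from this have "n dvd 5" by (metis dvd_triv_right)
  then have n5: "n = 5" using n3 primes_dvd_imp_eq[of n 5] prime_nat_iff[of 5] by auto
  ultimately have c0: "card (cyc core) = 1" by simp
  obtain y where y: "y \<in> P" "generate G {y} = P" "y \<notin> core" "ord y = p ^ card (cyc core)"
    using unique_noncore_cyclic D by (metis is_singletonI is_singleton_altdef)
  have yc: "y \<in> carrier G" using y by simp
  have oy: "ord y = 2" using y(4) c0 p by simp
  have yne: "y \<noteq> \<one>" using oy by auto
  have yy: "y \<otimes> y = \<one>" using pow_ord_eq_1[OF yc] oy pow_2[OF yc] by simp
  have Yy: "Y = generate G {y}"
    using generate_mem_cyc[OF y(1)] generate_mem_cyc_iff[OF subgroup_core yc] y(3) D by blast
  have Ciff: "g \<in> C \<longleftrightarrow> g \<in> N \<and> conjugate y g = g" for g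
    unfolding C_def Yy cent_generate[OF yc] by blast
  have "odd l" using not_dvd p cN by (metis dvd_mult)
  from card_3_prime_5_cyc[OF sN sC(1) psubset_imp_subset[OF sC(2)] CN lp this l_def[symmetric]]
  have l3: "l = 3" using cN m3 n5 unfolding n_def by blast
  then have c9: "card N = 9" using cN m3 by simp
  have p3: "Factorial_Ring.prime (3::nat)" by simp
  have exp: "g [^] (3::nat) = \<one>" if g: "g \<in> N" for g
  proof -
    have gc: "g \<in> carrier G" using g by simp
    have "ord g dvd 3 ^ 2" using ord_dvd_card_subgroup[OF sN g] c9 by simp
    then obtain i where i: "i \<le> 2" "ord g = 3 ^ i" using divides_primepow_nat[OF p3] by blast
    have "i \<noteq> 2"
    proof
      assume i2: "i = 2"
      have "generate G {g} = N"
        by (rule subgroup_eqI[OF generate_singleton_subgroup[OF gc] sN generate_singleton_subset[OF sN g]])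
          (use i i2 c9 in \<open>simp add: card_generate_singleton[OF gc]\<close>)
      then show False using card_cyc_prime_power[OF p3 gc i(2)] i2 n5 by (simp add: n_def)
    qed
    then have "i = 0 \<or> i = 1" using i(1) by auto
    then have "ord g dvd 3" using i(2) by auto
    then show ?thesis using pow_eq_id[OF gc] by simp
  qed
  obtain g where g: "g \<in> N" "g \<notin> C" using sC(2) by blast
  \<comment> \<open>The involution \<open>y\<close> inverts its commutator with \<open>g\<close>,
    which is nontrivial because \<open>g\<close> is outside the centralizer
    \<open>C\<close>.\<close>
  define d where "d = inv g \<otimes> conjugate y g"
  have gc: "g \<in> carrier G" using g by simp
  have yg: "conjugate y g \<in> N" using normal_conjugate_closed[OF normal_N yc g(1)] .
  have dN: "d \<in> N" using g yg by (simp add: d_def)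
  have dc: "d \<in> carrier G" using dN by simp
  have dne: "d \<noteq> \<one>"
  proof
    assume "d = \<one>"
    then have "conjugate y g = g" using gc yc by (metis conjugate_closed d_def inv_closed inv_equality inv_inv)
    then show False using g Ciff by blast
  qed
  have od: "ord d = 3" using ord_eq_primeI[OF dc p3 exp[OF dN] dne] .
  have yd: "conjugate y d = inv d"
  proof -
    have "conjugate y (conjugate y g) = g" using yc gc yy by (simp add: conjugate_conjugate)
    then have "conjugate y d = inv (conjugate y g) \<otimes> g"
      using yc gc by (simp add: d_def conjugate_mult conjugate_inv)
    then show ?thesis using yc gc by (simp add: d_def inv_mult_group)
  qed
  have xc: "x \<in> carrier G" using xN by simp
  have ox: "ord x = 3" using x(4) l3 by (simp add: l_def)
  have "x \<otimes> y = y \<otimes> x"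
    using Ciff[of x] x(1) conjugate_eq_iff_commute[OF yc xc] by simp
  then have pw: "(x \<otimes> y) [^] k = x [^] k \<otimes> y [^] k" for k :: nat using pow_mult_distrib xc yc by blast
  \<comment> \<open>\<open>x\<close> lies in \<open>C\<close>, so it commutes with \<open>y\<close>,
    and with \<open>d\<close> because \<open>N\<close> is abelian. Hence \<open>b\<close> has order
    6 and inverts \<open>d\<close>.\<close>
  define b where "b = x \<otimes> y"
  have bc: "b \<in> carrier G" using xc yc by (simp add: b_def)
  have px: "x [^] k = \<one> \<longleftrightarrow> 3 dvd k" and py: "y [^] k = \<one> \<longleftrightarrow> 2 dvd k" for k :: nat
    using pow_eq_id[OF xc] pow_eq_id[OF yc] ox oy by simp_all
  have ob: "ord b = 6"
  proof (rule ord_eq_6I[OF bc])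
    have "x [^] (6::nat) = \<one>" "y [^] (6::nat) = \<one>" using px py by simp_all
    then show "b [^] (6::nat) = \<one>" by (simp add: b_def pw)
    have "x [^] (2::nat) \<noteq> \<one>" "y [^] (2::nat) = \<one>" using px py by simp_all
    then show "b [^] (2::nat) \<noteq> \<one>" using xc by (simp add: b_def pw)
    have "x [^] (3::nat) = \<one>" "y [^] (3::nat) \<noteq> \<one>" using px py by simp_all
    then show "b [^] (3::nat) \<noteq> \<one>" using yc by (simp add: b_def pw)
  qed
  have "conjugate x d = d"
    using exponent_3_card_9_commute[OF sN c9 exp xN dN] .
  then have bd: "conjugate b d = inv d"
    using xc yc dc yd by (simp add: b_def conjugate_inv flip: conjugate_conjugate)
  have "conjugate b d \<noteq> d"
  proof
    assume "conjugate b d = d"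
    then have "d [^] (2::nat) = \<one>" using bd dc by (metis pow_2 r_inv)
    then show False using pow_eq_id[OF dc, of 2] od by simp
  qed
  then have "generate G {d} \<inter> generate G {b} = {\<one>}"
    using prime_metacyclic_Int_trivial[OF dc bc] od by simp
  moreover have "card P = 2" using y(2) card_generate_singleton[OF yc] oy by simp
  ultimately show ?thesis
    using split_metacyclicI[OF dc bc od ob] bd dc order_eq c9 by (simp add: int_pow_neg)
qed

text \<open>Since c(N) exceeds c(cent Y) and the index is at least 3, a centralizer with three or
  more cyclic subgroups would already give at least 4 + 9. The values 1 and 2 are the two preceding
  analyses.\<close>

lemma complement_11:
  assumes c: "card (cyc (carrier G)) = 11" and N1: "card N \<noteq> 1" and P1: "card P \<noteq> 1"
  shows "split_metacyclic 3 16 (- 1) \<or> split_metacyclic 5 8 (- 1) \<or> split_metacyclic 7 4 (- 1) \<or>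
    split_metacyclic 7 9 2 \<or> split_metacyclic 3 6 (- 1)"
proof -
  have ne: "cyc P - cyc core \<noteq> {}"
  proof
    assume "cyc P - cyc core = {}"
    then have "cyc core = cyc P" using cyc_mono[OF core_subset] by blast
    then have eq: "11 = card (cyc P) * card (cyc N)" using card_cyc_eq c by simp
    have "2 \<le> card (cyc P)" "2 \<le> card (cyc N)"
      using card_cyc_ge_2[OF subgroup_P P1] card_cyc_ge_2[OF N.subgroup_axioms N1] by simp_all
    moreover have "Factorial_Ring.prime (11::nat)" by simp
    ultimately show False using eq by (metis prime_product numeral_le_one_iff semiring_norm(69))
  qed
  then obtain Y where Y: "Y \<in> cyc P - cyc core" by blast
  have b: "card (cyc core) * card (cyc N) + card (conjs Y) * card (cyc (cent Y)) \<le> 11"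
    using card_cyc_ge_subset[of "{Y}"] Y c by simp
  have "card (cyc N) \<le> card (cyc core) * card (cyc N)" using card_cyc_core_pos by simp
  moreover have "3 * card (cyc (cent Y)) \<le> card (conjs Y) * card (cyc (cent Y))"
    using not_core_cent(1)[OF Y] prime_ge_2_nat[OF prime_p] by (intro mult_le_mono1) simp
  ultimately have "card (cyc (cent Y)) < 3" using b not_core_cent(5)[OF Y] by linarith
  moreover have "card (cyc (cent Y)) \<noteq> 0"
    using trivial_mem_cyc[OF not_core_cent(4)[OF Y]] finite_cyc(1)[OF not_core_cent(4)[OF Y]] by auto
  ultimately consider "card (cyc (cent Y)) = 1" | "card (cyc (cent Y)) = 2" by linarith
  then show ?thesis
  proof cases
    case 1
    then have "card (cent Y) = 1" using card_cyc_ge_2[OF not_core_cent(4)[OF Y]] by fastforce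
    then have "cent Y = {\<one>}" by (rule card_1_subgroup[OF not_core_cent(4)[OF Y]])
    then show ?thesis using prime_N_11[OF c trivial_cent_card_N[OF c Y] ne] by blast
  next
    case 2
    then show ?thesis using prime_cent_11[OF c Y] by blast
  qed
qed

end

theorem (in finite_group) card_cyc_11_cases:
  assumes c: "card (cyc (carrier G)) = 11"
  shows "(\<exists>p. Factorial_Ring.prime p \<and> (\<exists>x\<in>carrier G. generate G {x} = carrier G \<and> ord x = p ^ 10)) \<or>
    split_metacyclic 27 3 1 \<or> split_metacyclic 27 3 10 \<or> split_metacyclic 3 16 (- 1) \<or>
    split_metacyclic 5 8 (- 1) \<or> split_metacyclic 7 4 (- 1) \<or> split_metacyclic 7 9 2 \<or> split_metacyclic 3 6 (- 1)"
proof -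
  have "order G \<noteq> 1" using card_cyc_le c by linarith
  then obtain p where p: "Factorial_Ring.prime p" "p dvd order G"
    and nrm: "\<And>q. Factorial_Ring.prime q \<Longrightarrow> q \<noteq> p \<Longrightarrow> card (syl q) = 1"
  \<comment> \<open>\<open>p\<close> is the prime with non-normal Sylow subgroups, or any prime
    divisor of the order if there is none.\<close>
  proof (cases "\<exists>p. Factorial_Ring.prime p \<and> card (syl p) \<noteq> 1")
    case True
    then obtain p where "Factorial_Ring.prime p" "card (syl p) \<noteq> 1" by blast
    then show thesis using that[of p] multiplicity_pos_if_syl_ne_1 at_most_one_nonnormal_syl[OF c] by metis
  next
    case False
    obtain p where "Factorial_Ring.prime p" "p dvd order G" using \<open>order G \<noteq> 1\<close> prime_factor_nat by blast
    then show thesis using that[of p] False by blast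
  qed
  obtain N P where NP: "p_complement G p N P" using p_complement_exists[OF p(1) nrm] by metis
  interpret p_complement G p N P by (rule NP)
  have "card P \<noteq> 1" using order_eq not_dvd p(2) by auto
  show ?thesis
  proof (cases "card N = 1")
    case True
    then obtain k where "order G = p ^ k" using order_eq card_P by auto
    from p_group_11[OF p(1) this c] show ?thesis using order_81_split_metacyclic p(1) by blast
  next
    case False
    then show ?thesis using complement_11[OF c False \<open>card P \<noteq> 1\<close>] by blast
  qed
qed

section \<open>The listed groups have eleven cyclic subgroups\<close>

lemma card_cyclic_subgroups_semidirect_prime:
  assumes p: "Factorial_Ring.prime p" and q: "Factorial_Ring.prime q" and "p \<noteq> q" and k: "k > 0"
    and r: "[r ^ p = 1] (mod int q)" "\<not> [r = 1] (mod int q)"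
  shows "card (cyclic_subgroups (cyclic_semidirect q (p ^ k) r)) = 2 * k + q"
proof -
  have "[(r ^ p) ^ p ^ (k - 1) = 1 ^ p ^ (k - 1)] (mod int q)" using r(1) by (rule cong_pow)
  moreover have "p * p ^ (k - 1) = p ^ k" using k by (simp add: power_eq_if)
  ultimately have rk: "r ^ p ^ k mod int q = 1 mod int q" by (simp add: cong_def flip: power_mult)
  have pk: "p ^ k > 1" using one_less_power[OF prime_gt_1_nat[OF p] k] .
  have q1: "q > 1" using q by (rule prime_gt_1_nat)
  interpret S: finite_group "cyclic_semidirect q (p ^ k) r"
    by (rule finite_group_cyclic_semidirect) (use p q rk in \<open>simp_all add: prime_gt_0_nat\<close>)
  show ?thesis
    using S.metacyclic_prime_card[OF split_metacyclic_cyclic_semidirect[OF q1 pk rk] q p assms(3) k r(2,1)]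
    by (simp add: S.cyclic_subgroups_eq_cyc)
qed

lemma card_cyclic_subgroups_semidirect_27_3_10: "card (cyclic_subgroups (cyclic_semidirect 27 3 10)) = 11"
proof -
  interpret S: finite_group "cyclic_semidirect 27 3 10" by (rule finite_group_cyclic_semidirect) simp_all
  have "S.split_metacyclic 27 3 10" by (rule split_metacyclic_cyclic_semidirect) simp_all
  from S.metacyclic_27_3_card[OF this] show ?thesis by (simp add: S.cyclic_subgroups_eq_cyc cong_def)
qed

lemma card_cyclic_subgroups_DirProd_27_3: "card (cyclic_subgroups (integer_mod_group 27 \<times>\<times> integer_mod_group 3)) = 11"
proof -
  interpret S: finite_group "integer_mod_group 27 \<times>\<times> integer_mod_group 3" by (rule finite_group_DirProd_27_3)
  from S.metacyclic_27_3_card[OF split_metacyclic_27_3_DirProd]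
  show ?thesis by (simp add: S.cyclic_subgroups_eq_cyc)
qed

lemma card_cyclic_subgroups_DirProd_3_sym_3: "card (cyclic_subgroups (integer_mod_group 3 \<times>\<times> sym_group 3)) = 11"
proof -
  interpret S: finite_group "integer_mod_group 3 \<times>\<times> sym_group 3" by (rule finite_group_DirProd_3_sym_3)
  from S.metacyclic_3_6_card[OF split_metacyclic_3_6_DirProd] show ?thesis by (simp add: S.cyclic_subgroups_eq_cyc)
qed

text \<open>As a split extension of Z_7 by Z_4 acting by inversion, the group falls under the
  formula 2 k + q with k = 2 and q = 7.\<close>

lemma card_cyclic_subgroups_dicyclic_7: "card (cyclic_subgroups (dicyclic_group 7)) = 11"
proof -
  interpret S: finite_group "cyclic_semidirect 7 4 (- 1)" by (rule finite_group_cyclic_semidirect) simp_all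
  have "S.split_metacyclic 7 4 (- 1)" by (rule split_metacyclic_cyclic_semidirect) simp_all
  then have "cyclic_semidirect 7 4 (- 1) \<cong> dicyclic_group 7" by (rule S.split_metacyclic_7_4_dicyclic)
  moreover have "group (dicyclic_group 7)" by (simp add: dicyclic_group_def group_presented_group)
  moreover have "card (cyclic_subgroups (cyclic_semidirect 7 (2 ^ 2) (- 1))) = 2 * 2 + 7"
    by (rule card_cyclic_subgroups_semidirect_prime) (simp_all add: cong_def)
  ultimately show ?thesis using card_cyclic_subgroups_iso[OF S.is_group] by simp
qed

lemma (in finite_group) split_metacyclic_imp_iso:
  assumes "split_metacyclic m k r" "finite_group H" "group.split_metacyclic H m k r"
  shows "G \<cong> H"
proof -
  interpret H: finite_group H by fact
  have "cyclic_semidirect m k r \<cong> H" using H.iso_sym H.split_metacyclic_iso[OF assms(3)] group.iso_sym by blast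
  then show ?thesis using split_metacyclic_iso[OF assms(1)] iso_trans by blast
qed

theorem theorem1p1:
  fixes G :: "('a, 'b) monoid_scheme"
  assumes "group G" and "finite (carrier G)"
  shows "card (cyclic_subgroups G) = 11 \<longleftrightarrow>
    (\<exists>p::nat. Factorial_Ring.prime p \<and> G \<cong> integer_mod_group (p ^ 10)) \<or>
    G \<cong> integer_mod_group 27 \<times>\<times> integer_mod_group 3 \<or>
    G \<cong> cyclic_semidirect 27 3 10 \<or>
    G \<cong> dicyclic_group 7 \<or>
    G \<cong> cyclic_semidirect 7 9 2 \<or>
    G \<cong> integer_mod_group 3 \<times>\<times> sym_group 3 \<or>
    G \<cong> cyclic_semidirect 5 8 (- 1) \<or>
    G \<cong> cyclic_semidirect 3 16 (- 1)"
proof -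
  interpret finite_group G using assms by (simp add: finite_group_def finite_group_axioms_def)
  note transfer = card_cyclic_subgroups_iso[OF assms(1)]
  show ?thesis
  proof (intro iffI)
    assume "card (cyclic_subgroups G) = 11"
    then have "card (cyc (carrier G)) = 11" by (simp add: cyclic_subgroups_eq_cyc)
    from card_cyc_11_cases[OF this] show "(\<exists>p::nat. Factorial_Ring.prime p \<and> G \<cong> integer_mod_group (p ^ 10)) \<or>
      G \<cong> integer_mod_group 27 \<times>\<times> integer_mod_group 3 \<or> G \<cong> cyclic_semidirect 27 3 10 \<or>
      G \<cong> dicyclic_group 7 \<or> G \<cong> cyclic_semidirect 7 9 2 \<or> G \<cong> integer_mod_group 3 \<times>\<times> sym_group 3 \<or>
      G \<cong> cyclic_semidirect 5 8 (- 1) \<or> G \<cong> cyclic_semidirect 3 16 (- 1)"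
    proof (elim disjE exE conjE bexE)
      fix p x
      assume "Factorial_Ring.prime (p::nat)" "x \<in> carrier G" "generate G {x} = carrier G" "ord x = p ^ 10"
      then show ?thesis using cyclic_iso_integer_mod_group[of x "p ^ 10"] by (auto simp: prime_gt_0_nat)
    qed (use split_metacyclic_iso split_metacyclic_7_4_dicyclic
        split_metacyclic_imp_iso[OF _ finite_group_DirProd_27_3 split_metacyclic_27_3_DirProd]
        split_metacyclic_imp_iso[OF _ finite_group_DirProd_3_sym_3 split_metacyclic_3_6_DirProd] in blast)+
  next
    \<comment> \<open>The orders 9 = 3^2, 8 = 2^3 and 16 = 2^4 are written as prime powers, so that
      the formula 2 k + q applies; its value is 11 each time.\<close>
    have c7: "card (cyclic_subgroups (cyclic_semidirect 7 (3 ^ 2) 2)) = 2 * 2 + 7"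
      and c5: "card (cyclic_subgroups (cyclic_semidirect 5 (2 ^ 3) (- 1))) = 2 * 3 + 5"
      and c3: "card (cyclic_subgroups (cyclic_semidirect 3 (2 ^ 4) (- 1))) = 2 * 4 + 3"
      by (rule card_cyclic_subgroups_semidirect_prime; simp add: cong_def)+
    assume "(\<exists>p::nat. Factorial_Ring.prime p \<and> G \<cong> integer_mod_group (p ^ 10)) \<or>
      G \<cong> integer_mod_group 27 \<times>\<times> integer_mod_group 3 \<or> G \<cong> cyclic_semidirect 27 3 10 \<or>
      G \<cong> dicyclic_group 7 \<or> G \<cong> cyclic_semidirect 7 9 2 \<or> G \<cong> integer_mod_group 3 \<times>\<times> sym_group 3 \<or>
      G \<cong> cyclic_semidirect 5 8 (- 1) \<or> G \<cong> cyclic_semidirect 3 16 (- 1)"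
    then show "card (cyclic_subgroups G) = 11"
    proof (elim disjE exE conjE)
      fix p :: nat
      assume "Factorial_Ring.prime p" "G \<cong> integer_mod_group (p ^ 10)"
      then show ?thesis
        using transfer[OF group_integer_mod_group] card_cyclic_subgroups_integer_mod_group_prime_power[of p 10] by simp
    next
      assume "G \<cong> integer_mod_group 27 \<times>\<times> integer_mod_group 3"
      then show ?thesis
        using transfer[OF finite_group.axioms(1)[OF finite_group_DirProd_27_3]] card_cyclic_subgroups_DirProd_27_3 by simp
    next
      assume "G \<cong> integer_mod_group 3 \<times>\<times> sym_group 3"
      then show ?thesis
        using transfer[OF finite_group.axioms(1)[OF finite_group_DirProd_3_sym_3]] card_cyclic_subgroups_DirProd_3_sym_3 by simp
    next
      assume "G \<cong> dicyclic_group 7"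
      moreover have "group (dicyclic_group 7)" by (simp add: dicyclic_group_def group_presented_group)
      ultimately show ?thesis using transfer[of "dicyclic_group 7"] card_cyclic_subgroups_dicyclic_7 by simp
    next
      assume "G \<cong> cyclic_semidirect 27 3 10"
      then show ?thesis
        using transfer[OF group_cyclic_semidirect[of 27 3 10]] card_cyclic_subgroups_semidirect_27_3_10 by simp
    next
      assume "G \<cong> cyclic_semidirect 7 9 2"
      then show ?thesis using transfer[OF group_cyclic_semidirect[of 7 9 2]] c7 by simp
    next
      assume "G \<cong> cyclic_semidirect 5 8 (- 1)"
      then show ?thesis using transfer[OF group_cyclic_semidirect[of 5 8 "- 1"]] c5 by simp
    next
      assume "G \<cong> cyclic_semidirect 3 16 (- 1)"
      then show ?thesis using transfer[OF group_cyclic_semidirect[of 3 16 "- 1"]] c3 by simp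
    qed
  qed
qed

end
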